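(* Let $q\ge3$ and let $t:(\mathbb Z/q\mathbb Z)^\times\to\mathbb C$ be a non-zero function with $\langle t,\chi_0\rangle=0$. Assume the Generalized Riemann Hypothesis for $L(s,\chi)$ for all Dirichlet characters $\chi$ modulo $q$ with $\langle t,\chi\rangle\ne0$. Then there exists a (unique) constant $C=C(t)\in\mathbb C$ such that for all $\varepsilon>0$ the natural density of the set \[\left\{x\ge 2\, :\, \left| \pi_{1/2}(x;t) +\mathrm{M}(t)\log \log x-C\right|\le \frac{(\log \log x)^{3+\varepsilon}}{\log x}\right\}\] exists and equals $1$. Furthermore, there exists $K=K(t)>1$ such that the logarithmic density of the set \[\left\{x\ge 2\, :\, \left| \pi_{1/2}(x;t) +\mathrm{M}(t)\log \log x-C\right|\le \frac{K\log \log x}{\log x}\right\}\] exists and equals $1$.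
   Context: $\chi_0$ is the principal character mod $q$ and $\langle f,g\rangle=\frac1{\varphi(q)}\sum_{a\in(\mathbb Z/q\mathbb Z)^\times}f(a)\overline{g(a)}$. For $x\ge2$, $\pi_{1/2}(x;t)=\sum_{p\le x,\,p\nmid q}t(p)p^{-1/2}$ (sum over primes, $t(p)$ meaning $t$ of the class of $p$). For a non-principal character $\chi$, $m_\chi=\mathrm{ord}_{s=1/2}L(s,\chi)$; $r(a)=\#\{x\in(\mathbb Z/q\mathbb Z)^\times:x^2=a\}$; $\mathrm{M}(t)=\frac12\bigl(\langle t,r\rangle+2\sum_{\chi\ne\chi_0}\langle t,\chi\rangle m_\chi\bigr)$. The natural density of a Borel set $A\subset[2,\infty)$ is $\lim_{X\to\infty}\frac1X\mathrm{meas}\{2\le x\le X: x\in A\}$ (Lebesgue measure), and its logarithmic density is $\lim_{X\to\infty}\frac{1}{\log X}\int_2^X \mathbf 1_A(u)\frac{du}{u}$, when these limits exist. *)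

theory Defs
  imports "HOL-Complex_Analysis.Complex_Analysis" "HOL-Number_Theory.Number_Theory"
begin

definition units_mod :: "nat \<Rightarrow> nat set" where
  "units_mod q = {a. a < q \<and> coprime a q}"

definition dirichlet_char :: "nat \<Rightarrow> (nat \<Rightarrow> complex) \<Rightarrow> bool" where
  "dirichlet_char q chi \<longleftrightarrow>
     chi 1 = 1 \<and> (\<forall>m n. chi (m * n) = chi m * chi n) \<and> (\<forall>n. chi (n + q) = chi n) \<and>
     (\<forall>n. chi n = 0 \<longleftrightarrow> \<not> coprime n q)"

definition principal_char :: "nat \<Rightarrow> nat \<Rightarrow> complex" where
  "principal_char q n = (if coprime n q then 1 else 0)"

definition char_inner :: "nat \<Rightarrow> (nat \<Rightarrow> complex) \<Rightarrow> (nat \<Rightarrow> complex) \<Rightarrow> complex" where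
  "char_inner q f g = (\<Sum>a\<in>units_mod q. f a * cnj (g a)) / of_nat (totient q)"

text \<open>Dirichlet L-function given by its Dirichlet series (convergent for Re s > 0 when
  the character is non-principal).\<close>
definition Lfun :: "(nat \<Rightarrow> complex) \<Rightarrow> complex \<Rightarrow> complex" where
  "Lfun chi s = (\<Sum>n. chi (Suc n) / (of_nat (Suc n)) powr s)"

definition GRH_for :: "(nat \<Rightarrow> complex) \<Rightarrow> bool" where
  "GRH_for chi \<longleftrightarrow> (\<forall>s. 0 < Re s \<and> Re s < 1 \<and> Lfun chi s = 0 \<longrightarrow> Re s = 1/2)"

definition m_char :: "(nat \<Rightarrow> complex) \<Rightarrow> int" where
  "m_char chi = zorder (Lfun chi) (1/2)"

definition r_sq :: "nat \<Rightarrow> nat \<Rightarrow> complex" where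
  "r_sq q a = of_nat (card {x \<in> units_mod q. x ^ 2 mod q = a mod q})"

definition M_const :: "nat \<Rightarrow> (nat \<Rightarrow> complex) \<Rightarrow> complex" where
  "M_const q t = (char_inner q t (r_sq q)
     + 2 * (\<Sum>chi\<in>{chi. dirichlet_char q chi \<and> chi \<noteq> principal_char q}.
              char_inner q t chi * of_int (m_char chi))) / 2"

definition pi_half :: "nat \<Rightarrow> (nat \<Rightarrow> complex) \<Rightarrow> real \<Rightarrow> complex" where
  "pi_half q t x = (\<Sum>p\<in>{p. prime p \<and> real p \<le> x \<and> \<not> p dvd q}.
                       t (p mod q) / of_real (sqrt (real p)))"

definition has_natural_density :: "real set \<Rightarrow> real \<Rightarrow> bool" where
  "has_natural_density A d \<longleftrightarrow> A \<in> sets lborel \<and>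
     ((\<lambda>X. measure lborel (A \<inter> {2..X}) / X) \<longlongrightarrow> d) at_top"

definition has_log_density :: "real set \<Rightarrow> real \<Rightarrow> bool" where
  "has_log_density A d \<longleftrightarrow> A \<in> sets lborel \<and>
     ((\<lambda>X. (integral\<^sup>L lborel (\<lambda>u. indicator (A \<inter> {2..X}) u / u)) / ln X) \<longlongrightarrow> d) at_top"

end

(* For each nonprincipal character chi with GRH, put
   E(v) = e^(-v/2) sum_{n <= e^v} Lambda(n) chi(n) + 2 m_chi. No explicit formula is needed: the Laplace
   transform f of E is -L'/L(1/2+s)/(1/2+s) + 2 m_chi/s, which is regular at 0, and a Gaussian-smoothed Laplace
   inversion on the line Re s = 1/Y, together with Plancherel-type kernel bounds, turns the local
   bound |L'/L| <= C log(|t|+2) + sum over nearby zeros of 1/|s-rho| into the mean squares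
   int_0^Y e^(y-Y) |E(y)|^2 dy << (log Y)^2 and int_0^Y |E(y)|^2 dy << Y, and into
   int_0^Y E << log Y.  Partial summation then gives, for y = log x,
     sum_{p <= x} chi(p)/sqrt p = -(m_chi + [chi^2 = chi_0]/2) log y + c + E(y)/y + O(log y / y),
   where the squares of primes are handled by Mertens' theorem for chi^2. Summing against the Fourier
   coefficients of t, Chebyshev's inequality in x and in log x yields the two density statements. *)
theory Submission
  imports Defs "HOL-Probability.Probability" "HOL-Real_Asymp.Real_Asymp"
begin

text \<open>The zeros are known only through a local count of logarithmic order, so sums over zeros
  are never formed: the singularities \<open>1/(s - \<rho>)\<close> stay inside the integrand on
  \<open>Re s = 1/Y\<close>. This abscissa costs only a constant, since \<open>exp (y/Y)\<close> is
  bounded for \<open>y \<le> Y\<close>. On it a unit window sees the singularities with size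
  \<open>log Y\<close> in mean and \<open>Y\<close> in mean square; the first bound, used twice,
  gives the mean square at scale 1, the second that at scale \<open>Y\<close>. Apart from nearby
  zeros the transform decays like \<open>log |t| / |t|\<close>, and extracting
  \<open>(1 + |t|)^(3/4)\<close> leaves a weight whose square is integrable. For the constant in the
  expansion a mean square is too weak, because partial summation leaves \<open>E(v)/(2v)\<close>
  under an integral to infinity; hence the separate bound for the primitive of \<open>E\<close>,
  whose transform has one more factor \<open>1/s\<close>. Non-vanishing on \<open>Re s = 1\<close>
  enters twice: the GRH predicate speaks of the open strip only, and the squares of primes call for
  Mertens' theorem for \<open>chi^2\<close>.\<close>

section \<open>Dirichlet characters: values, finiteness, sums over units\<close>

lemma dirichlet_charD:
 assumes "dirichlet_char q chi"
 shows "chi 1 = 1" "chi (Suc 0) = 1" "chi (m * n) = chi m * chi n" "chi (n + q) = chi n"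
  "chi n = 0 \<longleftrightarrow> \<not> coprime n q"
 using assms by (auto simp: dirichlet_char_def)

lemma dirichlet_char_mod:
 assumes "dirichlet_char q chi"
 shows "chi (n mod q) = chi n"
proof -
 have "chi (m + k * q) = chi m" for m k
 proof (induction k)
  case (Suc k)
  then show ?case using dirichlet_charD(4)[OF assms, of "m + k * q"] by (simp add: algebra_simps)
 qed simp
 from this[of "n mod q" "n div q"] show ?thesis by simp
qed

lemma dirichlet_char_cong:
 assumes "dirichlet_char q chi" "[m = n] (mod q)"
 shows "chi m = chi n"
 using dirichlet_char_mod[OF assms(1), of m] dirichlet_char_mod[OF assms(1), of n] assms(2)
 by (simp add: cong_def)

lemma dirichlet_char_power:
 assumes "dirichlet_char q chi"
 shows "chi (n ^ k) = chi n ^ k"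
 by (induction k) (use dirichlet_charD[OF assms] in auto)

lemma dirichlet_char_power_totient:
 assumes "dirichlet_char q chi" "coprime n q"
 shows "chi n ^ totient q = 1"
 using dirichlet_char_cong[OF assms(1) euler_theorem[OF assms(2)]]
 by (simp add: dirichlet_char_power[OF assms(1)] dirichlet_charD[OF assms(1)])

lemma norm_dirichlet_char:
 assumes "dirichlet_char q chi" "coprime n q" "q > 0"
 shows "norm (chi n) = 1"
proof -
 have "norm (chi n) ^ totient q = 1 ^ totient q"
  using dirichlet_char_power_totient[OF assms(1,2)] by (metis norm_one norm_power power_one)
 then show ?thesis
  by (rule power_eq_imp_eq_base) (use assms(3) in auto)
qed

lemma norm_dirichlet_char_le:
 assumes "dirichlet_char q chi" "q > 0"
 shows "norm (chi n) \<le> 1"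
 using norm_dirichlet_char[OF assms(1) _ assms(2), of n] dirichlet_charD(5)[OF assms(1), of n]
 by (cases "coprime n q") auto

lemma dirichlet_char_principal: "dirichlet_char q (principal_char q)"
proof -
 have "coprime (n + q) q \<longleftrightarrow> coprime n q" for n
  unfolding coprime_iff_gcd_eq_1 by simp
 then show ?thesis unfolding dirichlet_char_def principal_char_def by simp
qed

lemma dirichlet_char_mult:
 assumes "dirichlet_char q chi" "dirichlet_char q \<psi>"
 shows "dirichlet_char q (\<lambda>n. chi n * \<psi> n)"
 using assms by (auto simp: dirichlet_char_def)

lemma finite_units_mod [simp]: "finite (units_mod q)"
 by (rule finite_subset[of _ "{..<q}"]) (auto simp: units_mod_def)

lemma card_units_mod: "q > 1 \<Longrightarrow> card (units_mod q) = totient q"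
 unfolding totient_def
 by (rule arg_cong[where f = card])
  (auto simp: units_mod_def totatives_def intro: Nat.gr0I le_neq_implies_less)

text \<open>A character is determined by its restriction to the residues below \<open>q\<close>, and
  by Euler's theorem each value there is 0 or a \<open>totient q\<close>-th root of unity.
  Restriction therefore embeds the characters into a finite product.\<close>

lemma finite_dirichlet_chars:
 assumes "q > 0"
 shows "finite {chi. dirichlet_char q chi}"
proof -
 define R where "R = insert 0 {z :: complex. z ^ totient q = 1}"
 have "finite R" unfolding R_def using finite_roots_unity[of "totient q"] assms by (auto simp: Suc_leI)
 then have fin: "finite (PiE {..<q} (\<lambda>_. R))" by (intro finite_PiE) auto
 show ?thesis
 proof (rule inj_on_finite[OF _ _ fin])
  show "inj_on (\<lambda>chi. restrict chi {..<q}) {chi. dirichlet_char q chi}"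
  proof (rule inj_onI)
   fix chi \<psi> :: "nat \<Rightarrow> complex"
   assume *: "chi \<in> {chi. dirichlet_char q chi}" "\<psi> \<in> {chi. dirichlet_char q chi}" "restrict chi {..<q} = restrict \<psi> {..<q}"
   show "chi = \<psi>"
   proof
    fix n
    have "chi (n mod q) = \<psi> (n mod q)" using fun_cong[OF *(3), of "n mod q"] assms by simp
    then show "chi n = \<psi> n" using * by (simp add: dirichlet_char_mod)
   qed
  qed
  show "(\<lambda>chi. restrict chi {..<q}) ` {chi. dirichlet_char q chi} \<subseteq> PiE {..<q} (\<lambda>_. R)"
  proof clarify
   fix chi assume chi: "dirichlet_char q chi"
   have "chi n \<in> R" for n
    using dirichlet_char_power_totient[OF chi, of n] dirichlet_charD(5)[OF chi, of n]
    by (cases "coprime n q") (auto simp: R_def)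
   then show "restrict chi {..<q} \<in> PiE {..<q} (\<lambda>_. R)" by simp
  qed
 qed
qed

lemma bij_betw_units_mod_mult:
 assumes "coprime b q" "q > 0"
 shows "bij_betw (\<lambda>a. a * b mod q) (units_mod q) (units_mod q)"
proof -
 have inj: "inj_on (\<lambda>a. a * b mod q) (units_mod q)"
 proof (rule inj_onI)
  fix x y assume xy: "x \<in> units_mod q" "y \<in> units_mod q" "x * b mod q = y * b mod q"
  then have "[x = y] (mod q)" using cong_mult_rcancel_nat[of b q x y] assms by (auto simp: cong_def)
  then show "x = y" using xy by (simp add: units_mod_def cong_def)
 qed
 moreover have "(\<lambda>a. a * b mod q) ` units_mod q \<subseteq> units_mod q"
  using assms by (auto simp: units_mod_def)
 ultimately show ?thesis
  using endo_inj_surj[OF finite_units_mod] by (auto simp: bij_betw_def)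
qed

text \<open>Choose a unit \<open>b\<close> with \<open>chi b \<noteq> 1\<close>. Multiplication by
  \<open>b\<close> permutes the units and multiplies the sum by \<open>chi b\<close>.\<close>

lemma sum_dirichlet_char_units:
 assumes "dirichlet_char q chi" "chi \<noteq> principal_char q" "q > 0"
 shows "(\<Sum>a\<in>units_mod q. chi a) = 0"
proof -
 obtain b where "chi b \<noteq> principal_char q b" using assms(2) by blast
 with dirichlet_charD(5)[OF assms(1), of b] have b: "coprime b q" "chi b \<noteq> 1"
  by (auto simp: principal_char_def split: if_splits)
 have "(\<Sum>a\<in>units_mod q. chi a) = (\<Sum>a\<in>units_mod q. chi (a * b mod q))"
  by (rule sum.reindex_bij_betw[OF bij_betw_units_mod_mult[OF b(1) assms(3)], symmetric])
 also have "\<dots> = (\<Sum>a\<in>units_mod q. chi a) * chi b"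
  by (simp add: dirichlet_char_mod[OF assms(1)] dirichlet_charD(3)[OF assms(1)] sum_distrib_right)
 finally have "(\<Sum>a\<in>units_mod q. chi a) * (1 - chi b) = 0" by (simp add: algebra_simps)
 with b show ?thesis by simp
qed

section \<open>Extension of characters from subgroups, and orthogonality\<close>

text \<open>A character of a subgroup of the unit group, where \<open>H\<close> is the set of all
  natural numbers whose residue classes lie in the subgroup. Closure under congruence replaces the
  passage to residue classes.\<close>

definition partial_char :: "nat \<Rightarrow> nat set \<Rightarrow> (nat \<Rightarrow> complex) \<Rightarrow> bool" where
 "partial_char q H \<eta> \<longleftrightarrow> (\<forall>n\<in>H. coprime n q) \<and> 1 \<in> H \<and> \<eta> 1 = 1 \<and>
  (\<forall>m\<in>H. \<forall>n\<in>H. m * n \<in> H \<and> \<eta> (m * n) = \<eta> m * \<eta> n) \<and>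
  (\<forall>m\<in>H. \<forall>n. [m = n] (mod q) \<longrightarrow> n \<in> H \<and> \<eta> m = \<eta> n)"

lemma partial_char_power:
 assumes "partial_char q H \<eta>" "m \<in> H"
 shows "m ^ k \<in> H" "\<eta> (m ^ k) = \<eta> m ^ k"
proof -
 have "m ^ k \<in> H \<and> \<eta> (m ^ k) = \<eta> m ^ k"
  by (induction k) (use assms in \<open>auto simp: partial_char_def\<close>)
 then show "m ^ k \<in> H" "\<eta> (m ^ k) = \<eta> m ^ k" by auto
qed

text \<open>Division inside \<open>H\<close>: by Euler's theorem \<open>h ^ (totient q - 1)\<close>
  inverts \<open>h\<close> modulo \<open>q\<close>, so \<open>m\<close> is congruent to a product of
  elements of \<open>H\<close>.\<close>

lemma partial_char_cancel:
 assumes "partial_char q H \<eta>" "h \<in> H" "[h * m = h'] (mod q)" "h' \<in> H" "q > 0"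
 shows "m \<in> H" "\<eta> h * \<eta> m = \<eta> h'"
proof -
 define i where "i = h ^ (totient q - 1)"
 have i: "i \<in> H" unfolding i_def by (rule partial_char_power[OF assms(1,2)])
 have "totient q > 0" using assms by simp
 then have "h * i = h ^ totient q" unfolding i_def by (metis Suc_diff_1 power_Suc)
 moreover have "coprime h q" using assms by (auto simp: partial_char_def)
 ultimately have hi: "[h * i = 1] (mod q)" using euler_theorem by simp
 have "[i * (h * m) = i * h'] (mod q)" using assms(3) by (rule cong_scalar_left)
 moreover have "[i * (h * m) = m] (mod q)"
  using cong_scalar_right[OF hi, of m] by (simp add: mult_ac)
 ultimately have m: "[i * h' = m] (mod q)" by (meson cong_sym cong_trans)
 have "i * h' \<in> H" using i assms by (auto simp: partial_char_def)
 then show mH: "m \<in> H" using m assms(1) by (auto simp: partial_char_def)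
 have "h * m \<in> H" "\<eta> (h * m) = \<eta> h * \<eta> m" using mH assms unfolding partial_char_def by blast+
 moreover have "\<eta> (h * m) = \<eta> h'" using \<open>h * m \<in> H\<close> assms(1,3) unfolding partial_char_def by blast
 ultimately show "\<eta> h * \<eta> m = \<eta> h'" by simp
qed

lemma partial_char_nonzero:
 assumes "partial_char q H \<eta>" "h \<in> H" "q > 0"
 shows "\<eta> h \<noteq> 0"
proof -
 have "\<eta> h ^ totient q = \<eta> (h ^ totient q)" using partial_char_power[OF assms(1,2)] by simp
 also have "\<dots> = \<eta> 1"
  using assms euler_theorem[of h q] partial_char_power(1)[OF assms(1,2)]
  unfolding partial_char_def by metis
 also have "\<dots> = 1" using assms by (simp add: partial_char_def)
 finally show ?thesis using assms(3) by (auto simp: power_0_left)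
qed

text \<open>The subgroup generated by \<open>H\<close> and \<open>a\<close> consists of the products
  \<open>h * a ^ j\<close>, and \<open>k\<close> is the order of \<open>a\<close> modulo
  \<open>H\<close>. The one constraint on the value \<open>z\<close> at \<open>a\<close> is
  \<open>z ^ k = \<eta> (a ^ k)\<close>. Leaving \<open>z\<close> free serves two ends: any root
  continues the character, and a root other than 1 separates \<open>a\<close> from 1.\<close>

lemma partial_char_extend:
 assumes pc: "partial_char q H \<eta>" and q: "q > 0" and a: "coprime a q"
  and k: "k > 0" "a ^ k \<in> H" "\<And>j. 0 < j \<Longrightarrow> j < k \<Longrightarrow> a ^ j \<notin> H" and z: "z ^ k = \<eta> (a ^ k)"
 shows "\<exists>H' \<eta>'. partial_char q H' \<eta>' \<and> H \<subseteq> H' \<and> (\<forall>h\<in>H. \<eta>' h = \<eta> h) \<and> a \<in> H' \<and> \<eta>' a = z"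
proof -
 note pcD = pc[unfolded partial_char_def]
 \<comment> \<open>By minimality of \<open>k\<close>, the exponents \<open>d\<close> with
   \<open>a ^ d\<close> in \<open>H\<close> are multiples of \<open>k\<close>: dividing by a power
   of \<open>a ^ k\<close> shows that the remainder \<open>d mod k\<close> is such an exponent as
   well.\<close>
 have pow: "\<eta> (a ^ d) = z ^ d" if "a ^ d \<in> H" for d
 proof -
  have akd: "(a ^ k) ^ (d div k) \<in> H" "\<eta> ((a ^ k) ^ (d div k)) = \<eta> (a ^ k) ^ (d div k)"
   using partial_char_power[OF pc k(2)] by auto
  have "(a ^ k) ^ (d div k) * a ^ (d mod k) = a ^ d"
   by (simp flip: power_mult power_add)
  then have "a ^ (d mod k) \<in> H"
   using partial_char_cancel(1)[OF pc akd(1) _ that q, of "a ^ (d mod k)"] by simp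
  then have "d mod k = 0" using k(3)[of "d mod k"] k(1) by (cases "d mod k = 0") auto
  then have "k * (d div k) = d" by auto
  then show ?thesis using akd(2) z by (metis power_mult)
 qed
 have wd1: "\<eta> h * z ^ i = \<eta> h' * z ^ j" if "h \<in> H" "h' \<in> H" "[h * a ^ i = h' * a ^ j] (mod q)" "j \<le> i" for h h' i j
 proof -
  have "[h * a ^ (i - j) * a ^ j = h' * a ^ j] (mod q)"
   using that(3,4) by (simp add: mult.assoc flip: power_add)
  then have c: "[h * a ^ (i - j) = h'] (mod q)"
   using cong_mult_rcancel_nat[of "a ^ j" q "h * a ^ (i - j)" h'] a by simp
  have "a ^ (i - j) \<in> H" "\<eta> h * \<eta> (a ^ (i - j)) = \<eta> h'"
   using partial_char_cancel[OF pc that(1) c that(2) q] by auto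
  then have "\<eta> h' = \<eta> h * z ^ (i - j)" using pow by simp
  then show ?thesis using that(4) by (simp add: mult.assoc flip: power_add)
 qed
 have wd: "\<eta> h * z ^ i = \<eta> h' * z ^ j" if "h \<in> H" "h' \<in> H" "[h * a ^ i = h' * a ^ j] (mod q)" for h h' i j
  using wd1[OF that] wd1[OF that(2,1) cong_sym[OF that(3)]] by (cases "j \<le> i") auto
 define H' where "H' = {n. \<exists>h\<in>H. \<exists>j. [n = h * a ^ j] (mod q)}"
 \<comment> \<open>The representation \<open>h * a ^ j\<close> is not unique; the value is read off
   from an arbitrary one, and \<open>wd\<close> shows that all of them agree.\<close>
 define \<eta>' where "\<eta>' n = (SOME w. \<exists>h\<in>H. \<exists>j. [n = h * a ^ j] (mod q) \<and> w = \<eta> h * z ^ j)" for n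
 have eta': "\<eta>' n = \<eta> h * z ^ j" if "h \<in> H" "[n = h * a ^ j] (mod q)" for n h j
  unfolding \<eta>'_def
 proof (rule some_equality)
  show "\<exists>ha\<in>H. \<exists>ja. [n = ha * a ^ ja] (mod q) \<and> \<eta> h * z ^ j = \<eta> ha * z ^ ja" using that by blast
 next
  fix w assume "\<exists>h\<in>H. \<exists>j. [n = h * a ^ j] (mod q) \<and> w = \<eta> h * z ^ j"
  then obtain h' i where "h' \<in> H" "[n = h' * a ^ i] (mod q)" "w = \<eta> h' * z ^ i" by blast
  then show "w = \<eta> h * z ^ j" using wd[of h' h i j] that by (meson cong_sym cong_trans)
 qed
 have "partial_char q H' \<eta>'"
  unfolding partial_char_def
 proof (intro conjI ballI allI impI)
  fix n assume "n \<in> H'"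
  then obtain h j where "h \<in> H" "[n = h * a ^ j] (mod q)" by (auto simp: H'_def)
  moreover have "coprime (h * a ^ j) q" using \<open>h \<in> H\<close> a pcD by simp
  ultimately show "coprime n q" using cong_imp_coprime cong_sym by blast
 next
  show "1 \<in> H'" using pcD by (auto simp: H'_def intro!: bexI[of _ 1] exI[of _ 0])
  show "\<eta>' 1 = 1" using eta'[of 1 1 0] pcD by simp
 next
  fix m n assume "m \<in> H'" "n \<in> H'"
  then obtain h i h' j where hh: "h \<in> H" "[m = h * a ^ i] (mod q)" "h' \<in> H" "[n = h' * a ^ j] (mod q)"
   by (auto simp: H'_def)
  have c: "[m * n = (h * h') * a ^ (i + j)] (mod q)"
   using cong_mult[OF hh(2,4)] by (simp add: power_add mult_ac)
  have hH: "h * h' \<in> H" "\<eta> (h * h') = \<eta> h * \<eta> h'" using hh pcD by auto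
  show "m * n \<in> H'" using c hH by (auto simp: H'_def)
  show "\<eta>' (m * n) = \<eta>' m * \<eta>' n"
   using eta'[OF hH(1) c] eta'[OF hh(1,2)] eta'[OF hh(3,4)] hH(2) by (simp add: power_add)
 next
  fix m n assume "m \<in> H'" "[m = n] (mod q)"
  then obtain h i where "h \<in> H" "[m = h * a ^ i] (mod q)" by (auto simp: H'_def)
  moreover from this \<open>[m = n] (mod q)\<close> have "[n = h * a ^ i] (mod q)" by (meson cong_sym cong_trans)
  ultimately show "n \<in> H'" "\<eta>' m = \<eta>' n" using eta' by (auto simp: H'_def)
 qed
 moreover have "h \<in> H' \<and> \<eta>' h = \<eta> h" if "h \<in> H" for h
  using that eta'[OF that, of h 0] by (auto simp: H'_def intro!: bexI[of _ h] exI[of _ 0])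
 moreover have "a \<in> H'" "\<eta>' a = z"
  using pcD eta'[of 1 a 1] by (auto simp: H'_def intro!: bexI[of _ 1] exI[of _ 1])
 ultimately show ?thesis by (intro exI[of _ H'] exI[of _ \<eta>']) auto
qed

lemma least_power_in:
 assumes "partial_char q H \<eta>" "coprime a q" "q > 0"
 obtains k where "k > 0" "a ^ k \<in> H" "\<And>j. 0 < j \<Longrightarrow> j < k \<Longrightarrow> a ^ j \<notin> H"
proof -
 have "[1 = a ^ totient q] (mod q)" using euler_theorem[OF assms(2)] by (rule cong_sym)
 then have "a ^ totient q \<in> H" using assms(1) unfolding partial_char_def by blast
 then have ex: "\<exists>k. 0 < k \<and> a ^ k \<in> H" using assms(3) by (intro exI[of _ "totient q"]) auto
 show ?thesis
  by (rule that[of "LEAST k. 0 < k \<and> a ^ k \<in> H"])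
   (use LeastI_ex[OF ex] not_less_Least in blast)+
qed

text \<open>Adjoin one unit after another until \<open>H\<close> contains all of them. The induction
  is on the number of residues below \<open>q\<close> outside \<open>H\<close>; a value at the new
  unit exists because a non-zero complex number has a \<open>k\<close>-th root.\<close>

lemma partial_char_imp_dirichlet_char:
 assumes "partial_char q H \<eta>" "q > 1"
 shows "\<exists>chi. dirichlet_char q chi \<and> (\<forall>h\<in>H. chi h = \<eta> h)"
 using assms
proof (induction "card ({..<q} - H)" arbitrary: H \<eta> rule: less_induct)
 case less
 show ?case
 proof (cases "\<forall>n. coprime n q \<longrightarrow> n \<in> H")
  case True
  then have H: "n \<in> H \<longleftrightarrow> coprime n q" for n using less.prems(1) unfolding partial_char_def by blast
  have cong: "\<eta> m = \<eta> n" if "coprime m q" "[m = n] (mod q)" for m n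
   using less.prems(1) that H unfolding partial_char_def by blast
  have mult: "\<eta> (m * n) = \<eta> m * \<eta> n" if "coprime m q" "coprime n q" for m n
   using less.prems(1) that H unfolding partial_char_def by blast
  have "dirichlet_char q (\<lambda>n. if coprime n q then \<eta> n else 0)"
   unfolding dirichlet_char_def
  proof (intro conjI allI)
   show "(if coprime (n + q) q then \<eta> (n + q) else 0) = (if coprime n q then \<eta> n else 0)" for n
   proof -
    have "[n + q = n] (mod q)" by (simp add: cong_def)
    moreover from this have "coprime (n + q) q \<longleftrightarrow> coprime n q" by (meson cong_imp_coprime cong_sym)
    ultimately show ?thesis using cong[of "n + q" n] by simp
   qed
   show "(if coprime n q then \<eta> n else 0) = 0 \<longleftrightarrow> \<not> coprime n q" for n
    using partial_char_nonzero[OF less.prems(1), of n] H[of n] less.prems(2) by simp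
   show "(if coprime 1 q then \<eta> 1 else 0) = 1"
    using less.prems(1) unfolding partial_char_def by simp
   show "(if coprime (m * n) q then \<eta> (m * n) else 0)
    = (if coprime m q then \<eta> m else 0) * (if coprime n q then \<eta> n else 0)" for m n
    using mult by simp
  qed
  then show ?thesis using H by (intro exI[of _ "\<lambda>n. if coprime n q then \<eta> n else 0"]) simp
 next
  case False
  then obtain b where b: "coprime b q" "b \<notin> H" by blast
  \<comment> \<open>The induction counts residues below \<open>q\<close>, so the adjoined unit has
    to be one of them.\<close>
  define a where "a = b mod q"
  have a: "coprime a q" "a < q" using b less.prems by (auto simp: a_def)
  have aH: "a \<notin> H"
  proof
   assume "a \<in> H"
   moreover have "[a = b] (mod q)" by (simp add: a_def cong_def)
   ultimately show False using b less.prems(1) unfolding partial_char_def by blast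
  qed
  have q: "q > 0" using less.prems by simp
  obtain k where k: "k > 0" "a ^ k \<in> H" "\<And>j. 0 < j \<Longrightarrow> j < k \<Longrightarrow> a ^ j \<notin> H"
   using least_power_in[OF less.prems(1) a(1) q] by blast
  have "\<eta> (a ^ k) \<noteq> 0" using partial_char_nonzero[OF less.prems(1) k(2) q] .
  then have "exp (ln (\<eta> (a ^ k)) / k) ^ k = \<eta> (a ^ k)"
   using k(1) by (simp flip: exp_of_nat_mult)
  from partial_char_extend[OF less.prems(1) q a(1) k this]
  obtain H' \<eta>' where H': "partial_char q H' \<eta>'" "H \<subseteq> H'" "\<forall>h\<in>H. \<eta>' h = \<eta> h" "a \<in> H'"
   by blast
  have "card ({..<q} - H') < card ({..<q} - H)"
   by (rule psubset_card_mono) (use H' a aH in auto)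
  from less.hyps[OF this H'(1) less.prems(2)] H' show ?thesis by (metis subsetD)
 qed
qed

text \<open>Start from the trivial character on the class of 1. Modulo this subgroup
  \<open>a\<close> has order \<open>k \<ge> 2\<close>, so a primitive \<open>k\<close>-th root of
  unity is an admissible value at \<open>a\<close>, and this partial character extends to all
  units.\<close>

lemma dirichlet_char_separates:
 assumes "coprime a q" "\<not> [a = 1] (mod q)" "q > 1"
 shows "\<exists>chi. dirichlet_char q chi \<and> chi a \<noteq> 1"
proof -
 define H where "H = {n. [n = 1] (mod q)}"
 have pc: "partial_char q H (\<lambda>_. 1)"
  unfolding partial_char_def H_def
 proof (intro conjI ballI allI impI; (simp; fail)?)
  show "coprime n q" if "n \<in> {n. [n = 1] (mod q)}" for n
   using that cong_imp_coprime[of 1 n q] by (simp add: cong_sym)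
  show "m * n \<in> {n. [n = 1] (mod q)}" if "m \<in> {n. [n = 1] (mod q)}" "n \<in> {n. [n = 1] (mod q)}" for m n
   using cong_mult[of m 1 q n 1] that by simp
  show "n \<in> {n. [n = 1] (mod q)}" if "m \<in> {n. [n = 1] (mod q)}" "[m = n] (mod q)" for m n
   using that by (auto intro: cong_trans cong_sym)
 qed
 have q: "q > 0" using assms by simp
 obtain k where k: "k > 0" "a ^ k \<in> H" "\<And>j. 0 < j \<Longrightarrow> j < k \<Longrightarrow> a ^ j \<notin> H"
  using least_power_in[OF pc assms(1) q] by blast
 have "k \<noteq> 1" using k(2) assms(2) by (auto simp: H_def)
 then have k2: "k \<ge> 2" using k(1) by simp
 define z where "z = exp (2 * of_real pi * \<i> / k)"
 have "z ^ k = 1" using k(1) by (simp add: z_def flip: exp_of_nat_mult)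
 have "z \<noteq> 1"
 proof
  assume "z = 1"
  then obtain n :: int where "Im (2 * of_real pi * \<i> / k) = of_int (2 * n) * pi"
   unfolding z_def exp_eq_1 by auto
  then have "1 / real k * (2 * pi) = of_int n * (2 * pi)" by (simp add: mult_ac)
  then have "1 / real k = of_int n" by (simp only: mult_cancel_right) simp
  moreover have "0 < 1 / real k" "1 / real k < 1" using k2 by auto
  ultimately show False by simp
 qed
 note z = this
 have zk: "z ^ k = (\<lambda>_. 1) (a ^ k)" using \<open>z ^ k = 1\<close> .
 obtain H' \<eta>' where H': "partial_char q H' \<eta>'" "a \<in> H'" "\<eta>' a = z"
  using partial_char_extend[OF pc q assms(1) k zk] by metis
 from partial_char_imp_dirichlet_char[OF H'(1) assms(3)]
 obtain chi where "dirichlet_char q chi" "\<forall>h\<in>H'. chi h = \<eta>' h" by blast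
 have "chi a = z" using \<open>\<forall>h\<in>H'. chi h = \<eta>' h\<close> H'(2,3) by (metis)
 then have "chi a \<noteq> 1" using z by simp
 then have "dirichlet_char q chi \<and> chi a \<noteq> 1" using \<open>dirichlet_char q chi\<close> by (rule conjI[rotated])
 then show ?thesis by (rule exI[of _ chi])
qed

text \<open>Dual to the sum over units: multiplication by a character with
  \<open>\<psi> a \<noteq> 1\<close> permutes the characters and multiplies the sum by
  \<open>\<psi> a\<close>.\<close>

lemma sum_over_dirichlet_chars:
 assumes "coprime a q" "\<not> [a = 1] (mod q)" "q > 1"
 shows "(\<Sum>chi | dirichlet_char q chi. chi a) = 0"
proof -
 obtain \<psi> where \<psi>: "dirichlet_char q \<psi>" "\<psi> a \<noteq> 1" using dirichlet_char_separates[OF assms] by (elim exE conjE)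
 let ?D = "{chi. dirichlet_char q chi}"
 have fin: "finite ?D" using finite_dirichlet_chars[of q] assms by simp
 have inj: "inj_on (\<lambda>chi n. \<psi> n * chi n) ?D"
 proof (rule inj_onI, rule ext)
  fix chi chi' and n :: nat
  assume *: "chi \<in> ?D" "chi' \<in> ?D" "(\<lambda>n. \<psi> n * chi n) = (\<lambda>n. \<psi> n * chi' n)"
  from fun_cong[OF *(3), of n] have "\<psi> n = 0 \<or> chi n = chi' n" by simp
  moreover have "\<psi> n = 0 \<Longrightarrow> chi n = chi' n" 
   using *(1,2) dirichlet_charD(5)[OF \<psi>(1), of n] dirichlet_charD(5)[of q chi n]
    dirichlet_charD(5)[of q chi' n] by simp
  ultimately show "chi n = chi' n" by blast
 qed
 have "(\<lambda>chi n. \<psi> n * chi n) ` ?D \<subseteq> ?D" using dirichlet_char_mult[OF \<psi>(1)] by blast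
 with inj fin have bij: "bij_betw (\<lambda>chi n. \<psi> n * chi n) ?D ?D"
  by (simp add: bij_betw_def endo_inj_surj)
 have "(\<Sum>chi\<in>?D. chi a) = (\<Sum>chi\<in>?D. \<psi> a * chi a)"
  by (rule sum.reindex_bij_betw[OF bij, of "\<lambda>chi. chi a", symmetric])
 also have "\<dots> = \<psi> a * (\<Sum>chi\<in>?D. chi a)" by (simp add: sum_distrib_left)
 finally have "(1 - \<psi> a) * (\<Sum>chi\<in>?D. chi a) = 0" by (simp only: left_diff_distrib mult_1 diff_self)
 with \<psi> show ?thesis by simp
qed

text \<open>Count the sum of \<open>chi a\<close> over all characters and units twice. Summing over
  units first leaves the principal character with \<open>totient q\<close>; summing over characters
  first leaves \<open>a = 1\<close> with the number of characters.\<close>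

lemma card_dirichlet_chars:
 assumes "q > 1"
 shows "card {chi. dirichlet_char q chi} = totient q"
proof -
 let ?D = "{chi. dirichlet_char q chi}"
 have fin: "finite ?D" using finite_dirichlet_chars[of q] assms by simp
 have one: "1 \<in> units_mod q" using assms by (simp add: units_mod_def)
 have "(\<Sum>chi\<in>?D. \<Sum>a\<in>units_mod q. chi a) = (\<Sum>chi\<in>?D. if chi = principal_char q then of_nat (totient q) else 0)"
 proof (rule sum.cong[OF refl])
  fix chi assume chi: "chi \<in> ?D"
  have "(\<Sum>a\<in>units_mod q. principal_char q a) = of_nat (totient q)"
   using card_units_mod[OF assms] by (simp add: principal_char_def units_mod_def)
  then show "(\<Sum>a\<in>units_mod q. chi a) = (if chi = principal_char q then of_nat (totient q) else 0)"
   using sum_dirichlet_char_units[of q chi] chi assms by auto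
 qed
 also have "\<dots> = of_nat (totient q)"
  using fin dirichlet_char_principal[of q] by simp
 finally have "of_nat (totient q) = (\<Sum>a\<in>units_mod q. \<Sum>chi\<in>?D. chi a)"
  using sum.swap[of "\<lambda>chi a. chi a" "units_mod q" ?D] by simp
 also have "\<dots> = (\<Sum>a\<in>units_mod q. if a = 1 then of_nat (card ?D) else 0)"
 proof (rule sum.cong[OF refl])
  fix a assume a: "a \<in> units_mod q"
  have "a \<noteq> 1 \<Longrightarrow> \<not> [a = 1] (mod q)" using a assms by (auto simp: units_mod_def cong_def)
  then show "(\<Sum>chi\<in>?D. chi a) = (if a = 1 then of_nat (card ?D) else 0)"
   using sum_over_dirichlet_chars[of a q] a assms by (auto simp: units_mod_def dirichlet_charD simp del: One_nat_def)
 qed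
 also have "\<dots> = of_nat (card ?D)" using one by simp
 finally show ?thesis by (metis of_nat_eq_iff)
qed

lemma dirichlet_char_orthogonal:
 assumes "a \<in> units_mod q" "b \<in> units_mod q" "q > 1"
 shows "(\<Sum>chi | dirichlet_char q chi. cnj (chi a) * chi b) = (if a = b then of_nat (totient q) else 0)"
proof -
 \<comment> \<open>A representative of \<open>b / a\<close>, which reduces the pairing of two units
   to a character sum at one unit.\<close>
 define c where "c = a ^ (totient q - 1) * b"
 have t: "totient q > 0" using assms by simp
 have co: "coprime a q" "coprime b q" using assms by (auto simp: units_mod_def)
 have eq: "cnj (chi a) * chi b = chi c" if "dirichlet_char q chi" for chi
 proof -
  have "chi a * chi a ^ (totient q - 1) = 1"
   using dirichlet_char_power_totient[OF that co(1)] t by (metis Suc_diff_1 power_Suc)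
  moreover have "chi a * cnj (chi a) = 1"
   using norm_dirichlet_char[OF that co(1)] assms complex_norm_square[of "chi a"] by simp
  ultimately have "cnj (chi a) = chi a ^ (totient q - 1)"
   by (metis mult.assoc mult.commute mult_1)
  then show ?thesis by (simp add: c_def dirichlet_charD[OF that] dirichlet_char_power[OF that])
 qed
 have ac: "[a * c = b] (mod q)"
 proof -
  have "a * c = a ^ totient q * b" using t unfolding c_def by (metis Suc_diff_1 mult.assoc power_Suc)
  then show ?thesis using cong_scalar_right[OF euler_theorem[OF co(1)], of b] by simp
 qed
 have "[c = 1] (mod q) \<longleftrightarrow> a = b"
 proof
  assume "[c = 1] (mod q)"
  then have "[a * c = a * 1] (mod q)" by (rule cong_scalar_left)
  with ac have "[a = b] (mod q)" by (metis cong_sym cong_trans mult.right_neutral)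
  then show "a = b" using assms by (simp add: units_mod_def cong_def)
 next
  assume "a = b"
  with ac have "[a * c = a * 1] (mod q)" by simp
  then show "[c = 1] (mod q)" using cong_mult_lcancel_nat[of a q c 1] co by simp
 qed
 moreover have "coprime c q" using co by (simp add: c_def)
 moreover have "[c = 1] (mod q) \<Longrightarrow> (\<Sum>chi | dirichlet_char q chi. chi c) = of_nat (totient q)"
 proof -
  assume c1: "[c = 1] (mod q)"
  have "chi c = 1" if "dirichlet_char q chi" for chi
   using dirichlet_char_cong[OF that c1] dirichlet_charD(1)[OF that] by simp
  then have "(\<Sum>chi | dirichlet_char q chi. chi c) = (\<Sum>chi | dirichlet_char q chi. 1)"
   by (intro sum.cong) auto
  then show ?thesis using card_dirichlet_chars[OF assms(3)] by simp
 qed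
 ultimately show ?thesis using eq sum_over_dirichlet_chars[of c q] assms by simp
qed

lemma char_expansion:
 assumes "b \<in> units_mod q" "q > 1"
 shows "t b = (\<Sum>chi | dirichlet_char q chi. char_inner q t chi * chi b)"
proof -
 have "(\<Sum>chi | dirichlet_char q chi. char_inner q t chi * chi b)
  = (\<Sum>chi | dirichlet_char q chi. \<Sum>a\<in>units_mod q. t a / of_nat (totient q) * (cnj (chi a) * chi b))"
  unfolding char_inner_def sum_divide_distrib sum_distrib_right by (simp add: mult_ac)
 also have "\<dots> = (\<Sum>a\<in>units_mod q. t a / of_nat (totient q) * (\<Sum>chi | dirichlet_char q chi. cnj (chi a) * chi b))"
  by (subst sum.swap) (simp add: sum_distrib_left)
 also have "\<dots> = (\<Sum>a\<in>units_mod q. if a = b then t a else 0)"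
  using assms by (intro sum.cong) (auto simp: dirichlet_char_orthogonal)
 also have "\<dots> = t b" using assms by simp
 finally show ?thesis by simp
qed

text \<open>Up to normalisation, pairing with \<open>r_sq\<close> sums \<open>t\<close> over the
  squares of the units. Expanding \<open>t\<close> in characters leaves the mean of
  \<open>chi^2\<close>, which vanishes unless \<open>chi^2\<close> is principal. This is the
  counterpart of the term that the squares of primes contribute later.\<close>

lemma char_inner_r_sq:
 assumes "q > 1"
 shows "char_inner q t (r_sq q)
  = (\<Sum>chi | dirichlet_char q chi. if (\<lambda>n. chi n ^ 2) = principal_char q then char_inner q t chi else 0)"
proof -
 let ?D = "{chi. dirichlet_char q chi}" and ?U = "units_mod q"
 have sq: "b ^ 2 mod q \<in> ?U" if "b \<in> ?U" for b using that assms by (auto simp: units_mod_def)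
 have "(\<Sum>a\<in>?U. t a * cnj (r_sq q a)) = (\<Sum>a\<in>?U. \<Sum>b\<in>?U. if b ^ 2 mod q = a then t a else 0)"
 proof (rule sum.cong[OF refl])
  fix a assume "a \<in> ?U"
  then have "a mod q = a" by (simp add: units_mod_def)
  then have "{x \<in> ?U. x ^ 2 mod q = a mod q} = {x \<in> ?U. x ^ 2 mod q = a}" by simp
  then show "t a * cnj (r_sq q a) = (\<Sum>b\<in>?U. if b ^ 2 mod q = a then t a else 0)"
   by (simp add: r_sq_def sum.If_cases Int_def mult.commute)
 qed
 also have "\<dots> = (\<Sum>b\<in>?U. \<Sum>a\<in>?U. if a = b ^ 2 mod q then t a else 0)"
  by (subst sum.swap) (simp add: eq_commute)
 also have "\<dots> = (\<Sum>b\<in>?U. t (b ^ 2 mod q))" using sq by simp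
 also have "\<dots> = (\<Sum>b\<in>?U. \<Sum>chi\<in>?D. char_inner q t chi * chi b ^ 2)"
  using char_expansion[OF sq assms, of _ t]
  by (intro sum.cong) (simp_all add: dirichlet_char_mod dirichlet_char_power)
 also have "\<dots> = (\<Sum>chi\<in>?D. char_inner q t chi * (\<Sum>b\<in>?U. chi b ^ 2))"
  by (subst sum.swap) (simp add: sum_distrib_left)
 also have "\<dots> = (\<Sum>chi\<in>?D. (if (\<lambda>n. chi n ^ 2) = principal_char q then char_inner q t chi else 0) * of_nat (totient q))"
 proof (rule sum.cong[OF refl])
  fix chi assume "chi \<in> ?D"
  then have d: "dirichlet_char q (\<lambda>n. chi n ^ 2)"
   using dirichlet_char_mult[of q chi chi] by (simp add: power2_eq_square)
  have "(\<Sum>b\<in>?U. principal_char q b) = of_nat (totient q)"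
   using card_units_mod[OF assms] by (simp add: principal_char_def units_mod_def)
  moreover have "(\<Sum>b\<in>?U. chi b ^ 2) = 0" if "(\<lambda>n. chi n ^ 2) \<noteq> principal_char q"
   using sum_dirichlet_char_units[OF d that] assms by simp
  moreover have "(\<Sum>b\<in>?U. chi b ^ 2) = (\<Sum>b\<in>?U. principal_char q b)" if "(\<lambda>n. chi n ^ 2) = principal_char q"
   using fun_cong[OF that] by simp
  ultimately show "char_inner q t chi * (\<Sum>b\<in>?U. chi b ^ 2) =
   (if (\<lambda>n. chi n ^ 2) = principal_char q then char_inner q t chi else 0) * of_nat (totient q)" by auto
 qed
 also have "\<dots> = (\<Sum>chi\<in>?D. if (\<lambda>n. chi n ^ 2) = principal_char q then char_inner q t chi else 0) * of_nat (totient q)"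
  by (rule sum_distrib_right[symmetric])
 finally have "char_inner q t (r_sq q) * of_nat (totient q) = \<dots>"
  using assms by (simp add: char_inner_def[of q t "r_sq q"])
 then show ?thesis using assms by simp
qed

section \<open>Dirichlet series with bounded partial sums of the coefficients\<close>

lemma norm_of_nat_powr [simp]: "n > 0 \<Longrightarrow> norm (of_nat n powr s :: complex) = real n powr Re s"
 by (simp add: norm_powr_real_powr)

text \<open>Mean value bound along the segment from \<open>x\<close> to \<open>y\<close>. The gain
  of one power of \<open>x\<close> is what makes summation by parts converge in the whole half-plane
  \<open>Re s > 0\<close>.\<close>

lemma norm_powr_diff_le:
 fixes s :: complex
 assumes "0 < x" "x \<le> y" "Re s > 0"
 shows "norm (of_real x powr (-s) - of_real y powr (-s)) \<le> norm s * x powr (-Re s - 1) * (y - x)"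
proof -
 have "norm ((of_real x :: complex) powr (-s) - of_real y powr (-s))
   \<le> (norm s * x powr (-Re s - 1)) * norm ((of_real x :: complex) - of_real y)"
 proof (rule field_differentiable_bound[where S = "closed_segment (of_real x) (of_real y)"
    and f' = "\<lambda>w. -s * w powr (-s - 1)"])
  fix w :: complex assume "w \<in> closed_segment (of_real x) (of_real y)"
  then obtain u where u: "w = of_real u" "x \<le> u"
   using assms by (auto simp: closed_segment_of_real closed_segment_eq_real_ivl)
  show "((\<lambda>w. w powr (-s)) has_field_derivative -s * w powr (-s - 1)) (at w within closed_segment (of_real x) (of_real y))"
   by (rule has_field_derivative_at_within[OF has_field_derivative_powr]) (use u assms in auto)
  have "norm (w powr (-s - 1)) = u powr (-Re s - 1)"
   using u assms by (simp add: norm_powr_real_powr)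
  also have "\<dots> \<le> x powr (-Re s - 1)"
   using u assms by (intro powr_mono2') auto
  finally show "norm (-s * w powr (-s - 1)) \<le> norm s * x powr (-Re s - 1)"
   by (simp add: norm_mult mult_left_mono)
 qed auto
 also have "norm ((of_real x :: complex) - of_real y) = y - x"
  using assms by (metis abs_minus_commute abs_of_nonneg diff_ge_0_iff_ge norm_of_real of_real_diff)
 finally show ?thesis .
qed

lemma summable_Suc_powr: "a > 1 \<Longrightarrow> summable (\<lambda>n. real (Suc n) powr (-a))"
 using summable_Suc_iff[of "\<lambda>n. real n powr (-a)"] summable_real_powr_iff[of "-a"] by simp

text \<open>Summation by parts: \<open>Lfun f\<close> is the sum of \<open>S(k+1)((k+1)\<^sup>-\<^sup>s - (k+2)\<^sup>-\<^sup>s)\<close>,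
 where \<open>S\<close> denotes the partial sums of the coefficients.\<close>

definition Abel_term :: "(nat \<Rightarrow> complex) \<Rightarrow> nat \<Rightarrow> complex \<Rightarrow> complex" where
 "Abel_term f k s = (\<Sum>i<Suc k. f (Suc i)) * (of_nat (Suc k) powr (-s) - of_nat (Suc (Suc k)) powr (-s))"

lemma norm_Abel_term_le:
 assumes "\<And>N. norm (\<Sum>i<N. f (Suc i)) \<le> B" "Re s > 0"
 shows "norm (Abel_term f k s) \<le> B * norm s * real (Suc k) powr (-Re s - 1)"
proof -
 have B: "B \<ge> 0" using assms(1)[of 0] by simp
 have "norm (of_real (Suc k) powr (-s) - of_real (Suc (Suc k)) powr (-s))
   \<le> norm s * real (Suc k) powr (-Re s - 1) * (real (Suc (Suc k)) - real (Suc k))"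
  by (rule norm_powr_diff_le) (use assms in auto)
 then have "norm (Abel_term f k s) \<le> B * (norm s * real (Suc k) powr (-Re s - 1))"
  unfolding Abel_term_def norm_mult using assms(1)[of "Suc k"] B by (intro mult_mono) simp_all
 then show ?thesis by (simp add: mult.assoc)
qed

lemma Lfun_Abel:
 assumes B: "\<And>N. norm (\<Sum>i<N. f (Suc i)) \<le> B" and s: "Re s > 0"
 shows "summable (\<lambda>k. norm (Abel_term f k s))" "(\<lambda>k. f (Suc k) / of_nat (Suc k) powr s) sums (\<Sum>k. Abel_term f k s)"
proof -
 show sm: "summable (\<lambda>k. norm (Abel_term f k s))"
 proof (rule summable_comparison_test')
  show "summable (\<lambda>k. B * norm s * real (Suc k) powr (-Re s - 1))"
   using summable_Suc_powr[of "Re s + 1"] s by (intro summable_mult) simp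
 qed (use norm_Abel_term_le[OF B s] in auto)
 have eq: "(\<Sum>k<N. f (Suc k) / of_nat (Suc k) powr s)
   = (\<Sum>i<N. f (Suc i)) * of_nat (Suc N) powr (-s) + (\<Sum>k<N. Abel_term f k s)" for N
  by (induction N) (simp_all add: Abel_term_def powr_minus divide_inverse algebra_simps del: of_nat_Suc)
 have "(\<lambda>N. (\<Sum>i<N. f (Suc i)) * of_nat (Suc N) powr (-s)) \<longlonglongrightarrow> 0"
 proof (rule Lim_null_comparison)
  show "\<forall>\<^sub>F N in sequentially. norm ((\<Sum>i<N. f (Suc i)) * of_nat (Suc N) powr (-s)) \<le> B * real (Suc N) powr (-Re s)"
   using B by (intro always_eventually allI) (auto simp: norm_mult intro!: mult_right_mono simp del: of_nat_Suc)
  have "filterlim (\<lambda>N. real (Suc N)) at_top sequentially"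
   by (rule filterlim_compose[OF filterlim_real_sequentially filterlim_Suc])
  then have "(\<lambda>N. real (Suc N) powr (-Re s)) \<longlonglongrightarrow> 0"
   by (intro tendsto_neg_powr) (use s in auto)
  then show "(\<lambda>N. B * real (Suc N) powr (-Re s)) \<longlonglongrightarrow> 0" by (rule tendsto_mult_right_zero)
 qed
 moreover have "(\<lambda>N. \<Sum>k<N. Abel_term f k s) \<longlonglongrightarrow> (\<Sum>k. Abel_term f k s)"
  using summable_LIMSEQ[OF summable_norm_cancel[OF sm]] .
 ultimately have "(\<lambda>N. \<Sum>k<N. f (Suc k) / of_nat (Suc k) powr s) \<longlonglongrightarrow> 0 + (\<Sum>k. Abel_term f k s)"
  unfolding eq by (rule tendsto_add)
 then show "(\<lambda>k. f (Suc k) / of_nat (Suc k) powr s) sums (\<Sum>k. Abel_term f k s)"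
  by (simp add: sums_def)
qed

lemma Lfun_eq_Abel:
 assumes "\<And>N. norm (\<Sum>i<N. f (Suc i)) \<le> B" "Re s > 0"
 shows "Lfun f s = (\<Sum>k. Abel_term f k s)"
 using Lfun_Abel(2)[OF assms] unfolding Lfun_def by (simp add: sums_iff)

text \<open>Linear growth in \<open>norm s\<close> is good enough because only its logarithm enters
  when zeros are counted.\<close>

lemma Lfun_bound:
 assumes B: "\<And>N. norm (\<Sum>i<N. f (Suc i)) \<le> B" and s0: "s0 > 0"
 shows "\<exists>C>0. \<forall>s. Re s \<ge> s0 \<longrightarrow> norm (Lfun f s) \<le> C * norm s"
proof -
 have B0: "B \<ge> 0" using B[of 0] by simp
 define C where "C = (\<Sum>k. real (Suc k) powr (-s0 - 1))"
 have sm: "summable (\<lambda>k. real (Suc k) powr (-s0 - 1))"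
  using summable_Suc_powr[of "s0 + 1"] s0 by simp
 have C: "C \<ge> 0" unfolding C_def by (intro suminf_nonneg sm) auto
 have "norm (Lfun f s) \<le> (B * C + 1) * norm s" if s: "Re s \<ge> s0" for s
 proof -
  have s': "Re s > 0" using s s0 by simp
  have "norm (Lfun f s) \<le> (\<Sum>k. norm (Abel_term f k s))"
   unfolding Lfun_eq_Abel[OF B s'] by (rule summable_norm[OF Lfun_Abel(1)[OF B s']])
  also have "\<dots> \<le> (\<Sum>k. B * norm s * real (Suc k) powr (-s0 - 1))"
  proof (rule suminf_le)
   show "norm (Abel_term f k s) \<le> B * norm s * real (Suc k) powr (-s0 - 1)" for k
    by (rule order_trans[OF norm_Abel_term_le[OF B s']])
     (use s B0 in \<open>auto intro!: mult_left_mono powr_mono\<close>)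
  qed (use Lfun_Abel(1)[OF B s'] sm in \<open>auto intro: summable_mult\<close>)
  also have "\<dots> = B * norm s * C" unfolding C_def by (rule suminf_mult[OF sm])
  also have "\<dots> \<le> (B * C + 1) * norm s" by (simp add: algebra_simps)
  finally show ?thesis .
 qed
 then show ?thesis using B0 C by (intro exI[of _ "B * C + 1"]) (auto intro: add_nonneg_pos)
qed

lemma has_field_derivative_nat_powr:
 "((\<lambda>s::complex. of_nat (Suc k) powr (-s)) has_field_derivative - of_real (ln (Suc k)) * of_nat (Suc k) powr (-s)) (at s)"
proof -
 have "((\<lambda>s::complex. of_nat (Suc k) powr (-s)) has_field_derivative
   (Ln (of_nat (Suc k)) * of_nat (Suc k) powr (-s)) * (-1)) (at s)"
  by (rule DERIV_chain2[OF has_field_derivative_powr_right]) (auto intro!: derivative_eq_intros simp del: of_nat_Suc)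
 then show ?thesis by (simp add: Ln_of_nat del: of_nat_Suc)
qed

lemma Lfun_holomorphic:
 assumes B: "\<And>N. norm (\<Sum>i<N. f (Suc i)) \<le> B"
 shows "Lfun f holomorphic_on {s. Re s > 0}"
proof -
 have B0: "B \<ge> 0" using B[of 0] by simp
 have "\<exists>g g'. \<forall>s\<in>{s. Re s > 0}. ((\<lambda>k. Abel_term f k s) sums g s) \<and>
   ((\<lambda>k. (\<Sum>i<Suc k. f (Suc i)) * (- of_real (ln (Suc k)) * of_nat (Suc k) powr (-s)
    - (- of_real (ln (Suc (Suc k))) * of_nat (Suc (Suc k)) powr (-s)))) sums g' s) \<and> (g has_field_derivative g' s) (at s)"
 proof (rule series_and_derivative_comparison_local)
  show "open {s. Re s > 0}" by (rule open_halfspace_Re_gt)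
  show "((\<lambda>s. Abel_term f k s) has_field_derivative (\<Sum>i<Suc k. f (Suc i)) * (- of_real (ln (Suc k)) * of_nat (Suc k) powr (-s)
    - (- of_real (ln (Suc (Suc k))) * of_nat (Suc (Suc k)) powr (-s)))) (at s)" for k s
   unfolding Abel_term_def
   by (intro DERIV_cmult DERIV_diff has_field_derivative_nat_powr)
  show "\<exists>d h. 0 < d \<and> summable h \<and> (\<forall>\<^sub>F n in sequentially. \<forall>y\<in>ball s d \<inter> {s. Re s > 0}. norm (Abel_term f n y) \<le> h n)"
   if "s \<in> {s. Re s > 0}" for s
  proof (intro exI conjI)
   define d where "d = Re s / 2"
   show "0 < d" using that by (simp add: d_def)
   show "summable (\<lambda>k. B * (norm s + d) * real (Suc k) powr (-d - 1))"
    using summable_Suc_powr[of "d + 1"] \<open>0 < d\<close> by (intro summable_mult) simp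
   have "norm (Abel_term f n y) \<le> B * (norm s + d) * real (Suc n) powr (-d - 1)"
    if y: "y \<in> ball s d" "Re y > 0" for n y
   proof -
    have yd: "norm (y - s) < d" using y by (simp add: dist_norm norm_minus_commute)
    have "\<bar>Re y - Re s\<bar> < d" using yd abs_Re_le_cmod[of "y - s"] by simp
    then have "Re y \<ge> d" unfolding d_def by linarith
    moreover have "norm y \<le> norm s + d" using yd norm_triangle_sub[of y s] by simp
    ultimately show ?thesis
     using B0 \<open>0 < d\<close> by (intro order_trans[OF norm_Abel_term_le[OF B y(2)]] mult_mono powr_mono) auto
   qed
   then show "\<forall>\<^sub>F n in sequentially. \<forall>y\<in>ball s d \<inter> {s. Re s > 0}. norm (Abel_term f n y) \<le> B * (norm s + d) * real (Suc n) powr (-d - 1)"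
    by (intro always_eventually) auto
  qed
 qed
 then obtain g g' where g: "\<And>s. Re s > 0 \<Longrightarrow> (\<lambda>k. Abel_term f k s) sums g s \<and> (g has_field_derivative g' s) (at s)"
  by auto
 have "g holomorphic_on {s. Re s > 0}"
  unfolding holomorphic_on_def field_differentiable_def using g by (blast intro: has_field_derivative_at_within)
 then show ?thesis
  by (rule holomorphic_transform) (use g Lfun_eq_Abel[OF B] in \<open>auto simp: sums_iff\<close>)
qed

text \<open>Over any \<open>q\<close> consecutive integers the sum is zero, so whole periods drop
  out and fewer than \<open>q\<close> terms of modulus at most 1 remain.\<close>

lemma periodic_partial_sums_bounded:
 fixes f :: "nat \<Rightarrow> complex"
 assumes per: "\<And>n. f (n + q) = f n" and q: "q > 0" and zero: "(\<Sum>n<q. f n) = 0" and bd: "\<And>n. norm (f n) \<le> 1"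
 shows "norm (\<Sum>i<N. f (Suc i)) \<le> real q"
proof -
 \<comment> \<open>The partial sums begin at 1 and not at 0, so the vanishing over a period is shown
   for shifted periods.\<close>
 have zero': "(\<Sum>i<q. f (Suc i + m)) = 0" for m
 proof (induction m)
  case 0
  have "(\<Sum>i<Suc q. f i) = f 0 + (\<Sum>i<q. f (Suc i))" by (rule sum.lessThan_Suc_shift)
  then show ?case using zero per[of 0] by simp
 next
  case (Suc m)
  have "(\<Sum>i<Suc q. f (Suc i + m)) = f (Suc m) + (\<Sum>i<q. f (Suc (Suc i) + m))"
   by (subst sum.lessThan_Suc_shift) simp
  then show ?case using Suc per[of "Suc m"] by (simp add: add_ac)
 qed
 have "(\<Sum>i<k * q + r. f (Suc i)) = (\<Sum>i<r. f (Suc i))" for k r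
 proof (induction k)
  case (Suc k)
  have "(\<Sum>i<a + b. f (Suc i)) = (\<Sum>i<a. f (Suc i)) + (\<Sum>i<b. f (Suc i + a))" for a b
   by (induction b) (simp_all add: add_ac)
  from this[of "k * q + r" q] Suc zero'[of "r + k * q"] show ?case by (simp add: add_ac)
 qed simp
 from this[of "N div q" "N mod q"] have "(\<Sum>i<N. f (Suc i)) = (\<Sum>i<N mod q. f (Suc i))" by simp
 also have "norm \<dots> \<le> (\<Sum>i<N mod q. 1)" using bd by (intro sum_norm_le) auto
 also have "\<dots> \<le> real q" using q by (simp add: less_imp_le)
 finally show ?thesis .
qed

subsection \<open>Absolutely convergent Dirichlet series\<close>

lemma Lfun_abs_convergent:
 assumes f: "\<And>n. n > 0 \<Longrightarrow> norm (f n) \<le> C * real n powr e" and s: "Re s > 1 + e"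
 shows "summable (\<lambda>n. norm (f (Suc n) / of_nat (Suc n) powr s))"
  "(\<lambda>n. f (Suc n) / of_nat (Suc n) powr s) sums Lfun f s"
proof -
 show sm: "summable (\<lambda>n. norm (f (Suc n) / of_nat (Suc n) powr s))"
 proof (rule summable_comparison_test')
  show "summable (\<lambda>n. C * real (Suc n) powr (-(Re s - e)))"
   using s by (intro summable_mult summable_Suc_powr) simp
  show "norm (norm (f (Suc n) / of_nat (Suc n) powr s)) \<le> C * real (Suc n) powr (-(Re s - e))" for n
   using f[of "Suc n"] by (simp add: norm_divide powr_diff powr_minus divide_simps del: of_nat_Suc)
 qed
 show "(\<lambda>n. f (Suc n) / of_nat (Suc n) powr s) sums Lfun f s"
  unfolding Lfun_def by (rule summable_sums[OF summable_norm_cancel[OF sm]])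
qed

lemma Lfun_has_derivative:
 assumes f: "\<And>n. n > 0 \<Longrightarrow> norm (f n) \<le> C * real n powr e" and s: "Re s > 1 + e"
 shows "(Lfun f has_field_derivative - Lfun (\<lambda>n. of_real (ln n) * f n) s) (at s)"
proof -
 let ?S = "{s. Re s > 1 + e}"
 have "C * real 1 powr e \<ge> 0" by (rule order_trans[OF norm_ge_zero f[of 1]]) simp
 then have C: "C \<ge> 0" by simp
 have "\<exists>g g'. \<forall>s\<in>?S. ((\<lambda>k. f (Suc k) * of_nat (Suc k) powr (-s)) sums g s) \<and>
   ((\<lambda>k. f (Suc k) * (- of_real (ln (Suc k)) * of_nat (Suc k) powr (-s))) sums g' s) \<and> (g has_field_derivative g' s) (at s)"
 proof (rule series_and_derivative_comparison_local)
  show "open ?S" by (rule open_halfspace_Re_gt)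
  show "((\<lambda>s. f (Suc k) * of_nat (Suc k) powr (-s)) has_field_derivative f (Suc k) * (- of_real (ln (Suc k)) * of_nat (Suc k) powr (-s))) (at s)" for k s
   by (intro DERIV_cmult has_field_derivative_nat_powr)
  show "\<exists>d h. 0 < d \<and> summable h \<and> (\<forall>\<^sub>F n in sequentially. \<forall>y\<in>ball s d \<inter> ?S. norm (f (Suc n) * of_nat (Suc n) powr (-y)) \<le> h n)"
   if "s \<in> ?S" for s
  proof (intro exI conjI)
   define d where "d = (Re s - 1 - e) / 2"
   show "0 < d" using that by (simp add: d_def)
   show "summable (\<lambda>k. C * real (Suc k) powr (-(d + 1)))"
    using \<open>0 < d\<close> by (intro summable_mult summable_Suc_powr) simp
   have "norm (f (Suc n) * of_nat (Suc n) powr (-y)) \<le> C * real (Suc n) powr (-(d + 1))"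
    if y: "y \<in> ball s d" for n y
   proof -
    have yd: "norm (y - s) < d" using y by (simp add: dist_norm norm_minus_commute)
    have "\<bar>Re y - Re s\<bar> < d" using yd abs_Re_le_cmod[of "y - s"] by simp
    moreover have "2 * d = Re s - 1 - e" by (simp add: d_def)
    ultimately have "e - Re y \<le> -(d + 1)" by linarith
    then have p: "real (Suc n) powr (e - Re y) \<le> real (Suc n) powr (-(d + 1))" by (intro powr_mono) auto
    have "norm (f (Suc n) * of_nat (Suc n) powr (-y)) \<le> C * real (Suc n) powr e * real (Suc n) powr (-Re y)"
     unfolding norm_mult using f[of "Suc n"] C by (intro mult_mono) (auto simp del: of_nat_Suc)
    also have "\<dots> = C * real (Suc n) powr (e - Re y)" by (simp add: powr_diff powr_minus field_simps)
    also have "\<dots> \<le> C * real (Suc n) powr (-(d + 1))" using p C by (rule mult_left_mono)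
    finally show ?thesis .
   qed
   then show "\<forall>\<^sub>F n in sequentially. \<forall>y\<in>ball s d \<inter> ?S. norm (f (Suc n) * of_nat (Suc n) powr (-y)) \<le> C * real (Suc n) powr (-(d + 1))"
    by (intro always_eventually) auto
  qed
 qed
 then obtain g g' where g: "\<And>s. s \<in> ?S \<Longrightarrow> (\<lambda>k. f (Suc k) * of_nat (Suc k) powr (-s)) sums g s \<and>
   (\<lambda>k. f (Suc k) * (- of_real (ln (Suc k)) * of_nat (Suc k) powr (-s))) sums g' s \<and> (g has_field_derivative g' s) (at s)"
  by blast
 have sS: "s \<in> ?S" using s by simp
 have "g' s = - Lfun (\<lambda>n. of_real (ln n) * f n) s"
 proof -
  have "(\<lambda>k. - (f (Suc k) * (- of_real (ln (Suc k)) * of_nat (Suc k) powr (-s)))) sums (- g' s)"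
   using g[OF sS] by (intro sums_minus) blast
  then have "(\<lambda>k. of_real (ln (Suc k)) * f (Suc k) / of_nat (Suc k) powr s) sums (- g' s)"
   by (simp add: powr_minus divide_inverse mult_ac)
  then have "Lfun (\<lambda>n. of_real (ln n) * f n) s = - g' s" unfolding Lfun_def by (simp add: sums_iff)
  then show ?thesis by simp
 qed
 moreover have "Lfun f w = g w" if "w \<in> ?S" for w
  using g[OF that] unfolding Lfun_def by (simp add: sums_iff powr_minus divide_inverse)
 ultimately show ?thesis
  using has_field_derivative_transform_within_open[of g "g' s" s ?S "Lfun f"] g[OF sS] sS open_halfspace_Re_gt
  by auto
qed

section \<open>Dirichlet convolution and the logarithmic derivative\<close>

text \<open>Bridge between series indexed from 0, the form in which \<open>Lfun\<close> is defined,
  and unordered sums over the positive integers, which may be rearranged.\<close>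

lemma infsum_pos_nat:
 fixes A :: "nat \<Rightarrow> 'a :: banach"
 assumes "summable (\<lambda>n. norm (A (Suc n)))"
 shows "(\<lambda>n. norm (A n)) summable_on {0<..}" "infsum A {0<..} = (\<Sum>n. A (Suc n))"
proof -
 have im: "{0<..} = range Suc" by (auto simp: image_iff gr0_conv_Suc)
 have "(\<lambda>n. norm (A (Suc n))) summable_on UNIV"
  by (rule norm_summable_imp_summable_on) (use assms in simp)
 then show "(\<lambda>n. norm (A n)) summable_on {0<..}"
  unfolding im using summable_on_reindex[of Suc UNIV "\<lambda>n. norm (A n)"] by (simp add: o_def)
 have "((\<lambda>n. A (Suc n)) has_sum (\<Sum>n. A (Suc n))) UNIV"
  by (rule norm_summable_imp_has_sum[OF assms summable_sums[OF summable_norm_cancel[OF assms]]])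
 then have "(A has_sum (\<Sum>n. A (Suc n))) {0<..}"
  unfolding im using has_sum_reindex[of Suc UNIV A] by (simp add: o_def)
 then show "infsum A {0<..} = (\<Sum>n. A (Suc n))" by (rule infsumI)
qed

text \<open>Sort the pairs \<open>(d, m)\<close> by their product: sending \<open>(d, m)\<close> to
  \<open>(d * m, d)\<close> is a bijection onto the pairs of a positive integer and one of its
  divisors.\<close>

lemma infsum_divisors:
 fixes h :: "nat \<Rightarrow> nat \<Rightarrow> 'a :: banach"
 assumes sm: "(\<lambda>(d, m). h d m) summable_on {0<..} \<times> {0<..}"
 shows "(\<Sum>\<^sub>\<infinity>d\<in>{0<..}. \<Sum>\<^sub>\<infinity>m\<in>{0<..}. h d m) = (\<Sum>\<^sub>\<infinity>n\<in>{0<..}. \<Sum>d | d dvd n. h d (n div d))"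
  "(\<lambda>n. \<Sum>d | d dvd n. h d (n div d)) summable_on {0<..}"
proof -
 let ?P = "{0::nat<..}" and ?D = "\<lambda>n::nat. {d. d dvd n}"
 have bij: "bij_betw (\<lambda>(d, m). (d * m, d)) (?P \<times> ?P) (Sigma ?P ?D)"
  by (rule bij_betwI[where g = "\<lambda>(n, d). (d, n div d)"]) (auto elim!: dvdE intro: Nat.gr0I)
 have "(\<lambda>p. (\<lambda>(n, d). h d (n div d)) ((\<lambda>(d, m). (d * m, d)) p)) summable_on (?P \<times> ?P)"
  using sm by (rule summable_on_cong[THEN iffD1, rotated]) auto
 then have sm2: "(\<lambda>(n, d). h d (n div d)) summable_on Sigma ?P ?D"
  using summable_on_reindex_bij_betw[OF bij] by blast
 have fin: "infsum (\<lambda>d. h d (n div d)) (?D n) = (\<Sum>d | d dvd n. h d (n div d))" if "n \<in> ?P" for n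
  using that by simp
 have "(\<Sum>\<^sub>\<infinity>d\<in>?P. \<Sum>\<^sub>\<infinity>m\<in>?P. h d m) = infsum (\<lambda>(d, m). h d m) (?P \<times> ?P)"
  by (rule infsum_Sigma'_banach[OF sm])
 also have "\<dots> = infsum (\<lambda>p. (\<lambda>(n, d). h d (n div d)) ((\<lambda>(d, m). (d * m, d)) p)) (?P \<times> ?P)"
  by (rule infsum_cong) auto
 also have "\<dots> = infsum (\<lambda>(n, d). h d (n div d)) (Sigma ?P ?D)"
  by (rule infsum_reindex_bij_betw[OF bij])
 also have "\<dots> = (\<Sum>\<^sub>\<infinity>n\<in>?P. \<Sum>\<^sub>\<infinity>d\<in>?D n. h d (n div d))"
  by (rule infsum_Sigma'_banach[OF sm2, symmetric])
 also have "\<dots> = (\<Sum>\<^sub>\<infinity>n\<in>?P. \<Sum>d | d dvd n. h d (n div d))"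
  by (rule infsum_cong[OF fin])
 finally show "(\<Sum>\<^sub>\<infinity>d\<in>?P. \<Sum>\<^sub>\<infinity>m\<in>?P. h d m) = (\<Sum>\<^sub>\<infinity>n\<in>?P. \<Sum>d | d dvd n. h d (n div d))" .
 show "(\<lambda>n. \<Sum>d | d dvd n. h d (n div d)) summable_on ?P"
  using summable_on_Sigma_banach[OF sm2] by (rule summable_on_cong[THEN iffD1, rotated]) (rule fin)
qed

lemma Dirichlet_convolution:
 fixes A B :: "nat \<Rightarrow> complex"
 assumes A: "summable (\<lambda>n. norm (A (Suc n)))" and B: "summable (\<lambda>n. norm (B (Suc n)))"
  and C: "summable (\<lambda>n. norm (C (Suc n)))" "\<And>n. n > 0 \<Longrightarrow> C n = (\<Sum>d | d dvd n. B d * A (n div d))"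
 shows "(\<Sum>n. B (Suc n)) * (\<Sum>n. A (Suc n)) = (\<Sum>n. C (Suc n))"
proof -
 let ?P = "{0::nat<..}"
 note a = infsum_pos_nat[of A, OF A] and b = infsum_pos_nat[of B, OF B] and c = infsum_pos_nat[of C, OF C(1)]
 have "(\<lambda>p. norm (B (fst p) * A (snd p))) summable_on ?P \<times> ?P"
 proof (rule iffD2[OF Infinite_Sum.abs_summable_on_Sigma_iff[of "\<lambda>p. B (fst p) * A (snd p)" ?P "\<lambda>_. ?P"]], intro conjI ballI)
  show "(\<lambda>y. norm (B (fst (x, y)) * A (snd (x, y)))) summable_on ?P" for x
   using a(1) by (simp add: norm_mult summable_on_cmult_right)
  show "(\<lambda>x. norm (infsum (\<lambda>y. norm (B (fst (x, y)) * A (snd (x, y)))) ?P)) summable_on ?P"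
  proof -
   have "0 \<le> infsum (\<lambda>y. norm (A y)) ?P" by (rule infsum_nonneg) simp
   then show ?thesis
    using b(1) by (simp add: norm_mult infsum_cmult_right' abs_mult summable_on_cmult_left)
  qed
 qed
 then have sm: "(\<lambda>(d, m). B d * A m) summable_on ?P \<times> ?P"
  using abs_summable_summable[of "\<lambda>p. B (fst p) * A (snd p)"] by (simp add: case_prod_unfold)
 have "(\<Sum>n. B (Suc n)) * (\<Sum>n. A (Suc n)) = infsum (\<lambda>d. infsum (\<lambda>m. B d * A m) ?P) ?P"
  unfolding a(2)[symmetric] b(2)[symmetric] by (simp add: infsum_cmult_left' infsum_cmult_right')
 also have "\<dots> = (\<Sum>\<^sub>\<infinity>n\<in>?P. \<Sum>d | d dvd n. B d * A (n div d))"
  by (rule infsum_divisors(1)[OF sm])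
 also have "\<dots> = infsum C ?P" by (rule infsum_cong) (simp add: C(2))
 finally show ?thesis unfolding c(2) .
qed

lemma norm_completely_mult_bounds:
 fixes f :: "nat \<Rightarrow> complex"
 assumes "\<And>n. norm (f n) \<le> 1" "e > 0" "n > 0"
 shows "norm (mangoldt n * f n) \<le> 1 / e * real n powr e" "norm (of_real (ln n) * f n) \<le> 1 / e * real n powr e"
proof -
 have l: "ln (real n) \<le> 1 / e * real n powr e" using ln_powr_bound[of "real n" e] assms by simp
 have l0: "0 \<le> ln (real n)" using assms by simp
 have m: "mangoldt n \<le> ln (real n)" by (rule mangoldt_le[OF assms(3)])
 have "norm (mangoldt n * f n) \<le> mangoldt n * 1"
  unfolding norm_mult using assms(1) by (intro mult_mono) (auto simp: mangoldt_nonneg)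
 then show "norm (mangoldt n * f n) \<le> 1 / e * real n powr e" using l m by simp
 have "norm (of_real (ln n) * f n) \<le> ln (real n) * 1"
  unfolding norm_mult using assms(1) l0 by (intro mult_mono) auto
 then show "norm (of_real (ln n) * f n) \<le> 1 / e * real n powr e" using l by simp
qed

text \<open>Complete multiplicativity lets \<open>f\<close> be multiplied into every term of the
  identity that sums \<open>mangoldt\<close> over the divisors of \<open>n\<close> to
  \<open>ln n\<close>.\<close>

lemma Lfun_mangoldt_mult:
 fixes f :: "nat \<Rightarrow> complex"
 assumes f: "\<And>n. norm (f n) \<le> 1" "\<And>m n. f (m * n) = f m * f n" and s: "Re s > 1"
 shows "Lfun (\<lambda>n. mangoldt n * f n) s * Lfun f s = Lfun (\<lambda>n. of_real (ln n) * f n) s"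
proof -
 \<comment> \<open>Half of the room between \<open>Re s\<close> and 1 absorbs the logarithmic
   coefficients, by \<open>ln n \<le> n^e / e\<close>.\<close>
 define e where "e = (Re s - 1) / 2"
 have e: "e > 0" "Re s > 1 + e" using s by (auto simp: e_def field_simps)
 show ?thesis
  unfolding Lfun_def
 proof (rule Dirichlet_convolution[of "\<lambda>n. f n / of_nat n powr s" "\<lambda>n. mangoldt n * f n / of_nat n powr s"
    "\<lambda>n. of_real (ln n) * f n / of_nat n powr s"])
  show "summable (\<lambda>n. norm (f (Suc n) / of_nat (Suc n) powr s))"
   using Lfun_abs_convergent(1)[of f 1 0 s] f(1) s by simp
  show "summable (\<lambda>n. norm (mangoldt (Suc n) * f (Suc n) / of_nat (Suc n) powr s))"
   using Lfun_abs_convergent(1)[of "\<lambda>n. mangoldt n * f n", OF norm_completely_mult_bounds(1)[of f e, OF f(1) e(1)] e(2)] .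
  show "summable (\<lambda>n. norm (of_real (ln (real (Suc n))) * f (Suc n) / of_nat (Suc n) powr s))"
   using Lfun_abs_convergent(1)[of "\<lambda>n. of_real (ln n) * f n", OF norm_completely_mult_bounds(2)[of f e, OF f(1) e(1)] e(2)] .
  fix n :: nat assume n: "n > 0"
  have "(\<Sum>d | d dvd n. mangoldt d * f d / of_nat d powr s * (f (n div d) / of_nat (n div d) powr s))
   = (\<Sum>d | d dvd n. mangoldt d * (f n / of_nat n powr s))"
  proof (rule sum.cong[OF refl])
   fix d assume "d \<in> {d. d dvd n}"
   then obtain m where m: "n = d * m" by auto
   then have "m > 0" "d > 0" using n by auto
   have "of_nat n powr s = of_nat d powr s * (of_nat m powr s :: complex)"
    unfolding m of_nat_mult by (rule powr_times_real) auto
   then show "mangoldt d * f d / of_nat d powr s * (f (n div d) / of_nat (n div d) powr s) = mangoldt d * (f n / of_nat n powr s)"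
    using m \<open>d > 0\<close> f(2)[of d m] by simp
  qed
  also have "\<dots> = of_real (ln n) * (f n / of_nat n powr s)"
   using mangoldt_sum[of n, where 'a = complex] n by (simp only: sum_distrib_right[symmetric])
  finally show "of_real (ln (real n)) * f n / of_nat n powr s =
   (\<Sum>d | d dvd n. mangoldt d * f d / of_nat d powr s * (f (n div d) / of_nat (n div d) powr s))" by simp
 qed
qed

text \<open>The term 1/4 is kept and the rest is compared with a telescoping sum of value 1/2. What
  counts is a total below 1.\<close>

lemma sum_inverse_squares_from_2: "summable (\<lambda>n. 1 / (real (n + 2))^2)" "(\<Sum>n. 1 / (real (n + 2))^2) \<le> 3 / 4"
proof -
 have tel: "(\<lambda>n. 1 / real (n + 2) - 1 / real (Suc n + 2)) sums (1 / real (0 + 2) - 0)"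
  by (rule telescope_sums') (intro tendsto_divide_0[OF tendsto_const]
    filterlim_at_top_imp_at_infinity filterlim_compose[OF filterlim_real_sequentially] filterlim_add_const_nat_at_top)
 have le: "1 / (real (n + 3))^2 \<le> 1 / real (n + 2) - 1 / real (Suc n + 2)" for n
  by (simp add: divide_simps power2_eq_square) (simp add: algebra_simps)?
 have sm: "summable (\<lambda>n. 1 / (real (n + 3))^2)"
  by (rule summable_comparison_test'[OF sums_summable[OF tel], of 0]) (use le in simp)
 then have sm': "summable (\<lambda>n. 1 / (real (Suc n + 2))^2)" by (simp add: numeral_3_eq_3)
 then show sm2: "summable (\<lambda>n. 1 / (real (n + 2))^2)" using summable_Suc_iff[of "\<lambda>n. 1 / (real (n + 2))^2"] by simp
 have "(\<Sum>n. 1 / (real (n + 2))^2) = (\<Sum>n. 1 / (real (Suc n + 2))^2) + 1 / 4"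
  using suminf_split_head[OF sm2] by simp
 also have "(\<Sum>n. 1 / (real (Suc n + 2))^2) = (\<Sum>n. 1 / (real (n + 3))^2)" by (simp add: numeral_3_eq_3)
 also have "\<dots> \<le> 1 / real (0 + 2) - 0"
  using suminf_le[OF le sm sums_summable[OF tel]] sums_unique[OF tel] by simp
 finally show "(\<Sum>n. 1 / (real (n + 2))^2) \<le> 3 / 4" by simp
qed

text \<open>The first term of the series is 1 and the others add up to at most 3/4. This supplies
  the centres on \<open>Re s = 2\<close> of the discs in which zeros are counted.\<close>

lemma Lfun_lower_bound:
 assumes f: "\<And>n. norm (f n) \<le> 1" "f 1 = 1" and s: "Re s \<ge> 2"
 shows "norm (Lfun f s) \<ge> 1 / 4"
proof -
 have sm: "summable (\<lambda>n. norm (f (Suc n) / of_nat (Suc n) powr s))"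
  and su: "(\<lambda>n. f (Suc n) / of_nat (Suc n) powr s) sums Lfun f s"
  using Lfun_abs_convergent[of f 1 0 s] f(1) s by auto
 have "Lfun f s = (\<Sum>n. f (Suc (Suc n)) / of_nat (Suc (Suc n)) powr s) + f (Suc 0) / of_nat (Suc 0) powr s"
  unfolding sums_unique[OF su] using suminf_split_head[OF sums_summable[OF su]] by simp
 then have eq: "Lfun f s = 1 + (\<Sum>n. f (Suc (Suc n)) / of_nat (Suc (Suc n)) powr s)" using f(2) by simp
 have sm1: "summable (\<lambda>n. norm (f (Suc (Suc n)) / of_nat (Suc (Suc n)) powr s))"
  using summable_Suc_iff[of "\<lambda>n. norm (f (Suc n) / of_nat (Suc n) powr s)"] sm by simp
 have "norm (\<Sum>n. f (Suc (Suc n)) / of_nat (Suc (Suc n)) powr s) \<le> (\<Sum>n. norm (f (Suc (Suc n)) / of_nat (Suc (Suc n)) powr s))"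
  by (rule summable_norm[OF sm1])
 also have "\<dots> \<le> (\<Sum>n. 1 / (real (n + 2))^2)"
 proof (rule suminf_le[OF _ sm1 sum_inverse_squares_from_2(1)])
  fix n
  have "real (n + 2) powr 2 \<le> real (n + 2) powr Re s" using s by (intro powr_mono) auto
  then have "real (n + 2) ^ 2 \<le> real (n + 2) powr Re s" by (simp add: powr_numeral)
  then show "norm (f (Suc (Suc n)) / of_nat (Suc (Suc n)) powr s) \<le> 1 / (real (n + 2))^2"
   unfolding norm_divide using f(1)[of "Suc (Suc n)"] by (intro frac_le) (auto simp del: of_nat_Suc)
 qed
 also note sum_inverse_squares_from_2(2)
 finally show ?thesis unfolding eq
  using norm_diff_ineq[of 1 "\<Sum>n. f (Suc (Suc n)) / of_nat (Suc (Suc n)) powr s"] by simp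
qed

text \<open>With a primitive \<open>P\<close> of the series with coefficients
  \<open>mangoldt n * f n\<close>, the product of \<open>Lfun f\<close> and \<open>exp P\<close> has
  derivative zero. It is a constant, non-zero at 2, so \<open>Lfun f\<close> has no zero. The
  argument stands in for the Euler product.\<close>

lemma Lfun_Re_gt_1:
 fixes f :: "nat \<Rightarrow> complex"
 assumes f: "\<And>n. norm (f n) \<le> 1" "\<And>m n. f (m * n) = f m * f n" "f 1 = 1" and s: "Re s > 1"
 shows "Lfun f s \<noteq> 0" "deriv (Lfun f) s = - Lfun (\<lambda>n. mangoldt n * f n) s * Lfun f s"
proof -
 let ?S = "{s. Re s > 1}" and ?D = "Lfun (\<lambda>n. mangoldt n * f n)"
 have d: "(Lfun f has_field_derivative - ?D w * Lfun f w) (at w)" if "Re w > 1" for w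
  using Lfun_has_derivative[of f 1 0 w] f(1) that Lfun_mangoldt_mult[OF f(1,2) that] by simp
 have holD: "?D holomorphic_on ?S"
  unfolding holomorphic_on_def
 proof
  fix w assume "w \<in> ?S"
  define e where "e = (Re w - 1) / 2"
  have e: "e > 0" "Re w > 1 + e" using \<open>w \<in> ?S\<close> by (auto simp: e_def field_simps)
  from Lfun_has_derivative[of "\<lambda>n. mangoldt n * f n", OF norm_completely_mult_bounds(1)[of f e, OF f(1) e(1)] e(2)]
  show "?D field_differentiable at w within ?S"
   unfolding field_differentiable_def using has_field_derivative_at_within by blast
 qed
 have cv: "convex ?S" "open ?S" by (auto simp: convex_halfspace_Re_gt open_halfspace_Re_gt)
 obtain P where P: "\<And>w. w \<in> ?S \<Longrightarrow> (P has_field_derivative ?D w) (at w within ?S)"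
  using holomorphic_convex_primitive'[OF cv holD] by blast
 have "\<exists>c. \<forall>w\<in>?S. Lfun f w * exp (P w) = c"
 proof (rule has_field_derivative_zero_constant[OF cv(1)])
  fix w assume w: "w \<in> ?S"
  have "((\<lambda>w. Lfun f w * exp (P w)) has_field_derivative
   (- ?D w * Lfun f w) * exp (P w) + exp (P w) * ?D w * Lfun f w) (at w within ?S)"
   by (rule has_field_derivative_at_within, rule DERIV_mult[OF d DERIV_fun_exp])
    (use w P[OF w] at_within_open[OF w cv(2)] in simp_all)
  then show "((\<lambda>w. Lfun f w * exp (P w)) has_field_derivative 0) (at w within ?S)" by (simp add: mult_ac)
 qed
 then obtain c where c: "\<And>w. Re w > 1 \<Longrightarrow> Lfun f w * exp (P w) = c" by auto
 have "Lfun f 2 \<noteq> 0" using Lfun_lower_bound[of f 2, OF f(1,3)] by auto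
 with c[of 2] have "c \<noteq> 0" by auto
 with c[OF s] show "Lfun f s \<noteq> 0" by auto
 show "deriv (Lfun f) s = - ?D s * Lfun f s" using d[OF s] by (rule DERIV_imp_deriv)
qed

section \<open>Continuation of the zeta function to \<open>Re s > 0\<close>\<close>

text \<open>With \<open>n = Suc k\<close>, the quantity is the integral of
  \<open>(s - 1) * (n powr (-s) - w powr (-s))\<close> over \<open>n \<le> w \<le> n + 1\<close>,
  and the difference of powers gains a factor \<open>1 / n\<close>. The proof bounds the derivative
  of the corresponding \<open>g\<close>.\<close>

lemma zeta_term_bound:
 fixes s :: complex
 assumes "Re s > 0"
 shows "norm ((s - 1) * of_nat (Suc k) powr (-s) - of_nat (Suc k) powr (1 - s) + of_nat (Suc (Suc k)) powr (1 - s))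
  \<le> norm (s - 1) * norm s * real (Suc k) powr (-Re s - 1)"
proof -
 define x where "x = real (Suc k)"
 have x: "x > 0" by (simp add: x_def)
 define g where "g = (\<lambda>w::complex. (s - 1) * of_real x powr (-s) * w + w powr (1 - s))"
 have "norm (g (of_real x) - g (of_real (x + 1)))
   \<le> (norm (s - 1) * (norm s * x powr (-Re s - 1))) * norm ((of_real x :: complex) - of_real (x + 1))"
 proof (rule field_differentiable_bound[where S = "closed_segment (of_real x) (of_real (x + 1))"
    and f' = "\<lambda>w. (s - 1) * (of_real x powr (-s) - w powr (-s))"])
  fix w :: complex assume "w \<in> closed_segment (of_real x) (of_real (x + 1))"
  then obtain u where u: "w = of_real u" "x \<le> u" "u \<le> x + 1"
   unfolding closed_segment_of_real by (auto simp: closed_segment_eq_real_ivl)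
  have "(g has_field_derivative (s - 1) * of_real x powr (-s) * 1 + (1 - s) * w powr (1 - s - 1)) (at w)"
   unfolding g_def by (intro DERIV_add DERIV_cmult DERIV_ident has_field_derivative_powr) (use u x in auto)
  then show "(g has_field_derivative (s - 1) * (of_real x powr (-s) - w powr (-s))) (at w within closed_segment (of_real x) (of_real (x + 1)))"
   using has_field_derivative_at_within by (simp add: algebra_simps)
  have "norm (of_real x powr (-s) - w powr (-s)) \<le> norm s * x powr (-Re s - 1) * (u - x)"
   unfolding u(1) by (rule norm_powr_diff_le) (use u x assms in auto)
  also have "\<dots> \<le> norm s * x powr (-Re s - 1) * 1"
   using u by (intro mult_left_mono) auto
  finally show "norm ((s - 1) * (of_real x powr (-s) - w powr (-s))) \<le> norm (s - 1) * (norm s * x powr (-Re s - 1))"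
   unfolding norm_mult by (intro mult_left_mono) auto
 qed auto
 also have "norm ((of_real x :: complex) - of_real (x + 1)) = 1" by (simp add: norm_minus_commute)
 also have "norm (g (of_real x) - g (of_real (x + 1))) = norm (g (of_real (x + 1)) - g (of_real x))"
  by (rule norm_minus_commute)
 also have "g (of_real (x + 1)) - g (of_real x) = (s - 1) * of_real x powr (-s) - of_real x powr (1 - s) + of_real (x + 1) powr (1 - s)"
  by (simp add: g_def algebra_simps)
 finally show ?thesis by (simp add: x_def add_ac)
qed

text \<open>\<open>(s - 1)\<close> times the zeta series is 1 plus the series of the terms just
  bounded, because for \<open>Re s > 1\<close> their telescoping parts add up to 1. That series
  converges for \<open>Re s > 0\<close> and vanishes at 1, which records a simple pole of residue
  1.\<close>

lemma zeta_continuation: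
 "\<exists>N. N holomorphic_on {s. Re s > 0} \<and> N 1 = 1 \<and> (\<forall>s. Re s > 1 \<longrightarrow> N s = (s - 1) * Lfun (\<lambda>_. 1) s)"
proof -
 define T where "T k s = (s - 1) * of_nat (Suc k) powr (-s) - of_nat (Suc k) powr (1 - s) + of_nat (Suc (Suc k)) powr (1 - s)"
  for k and s :: complex
 have Tb: "norm (T k s) \<le> norm (s - 1) * norm s * real (Suc k) powr (-Re s - 1)" if "Re s > 0" for k s
  unfolding T_def by (rule zeta_term_bound[OF that])
 let ?S = "{s. Re s > 0}"
 have op: "open ?S" by (rule open_halfspace_Re_gt)
 have Thol: "T k holomorphic_on ?S" for k
  unfolding T_def by (intro holomorphic_intros)
 have "\<exists>g g'. \<forall>s\<in>?S. ((\<lambda>k. T k s) sums g s) \<and> ((\<lambda>k. deriv (T k) s) sums g' s) \<and> (g has_field_derivative g' s) (at s)"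
 proof (rule series_and_derivative_comparison_local[OF op])
  show "(T k has_field_derivative deriv (T k) s) (at s)" if "s \<in> ?S" for k s
   by (rule holomorphic_derivI[OF Thol op that])
  show "\<exists>d h. 0 < d \<and> summable h \<and> (\<forall>\<^sub>F n in sequentially. \<forall>y\<in>ball s d \<inter> ?S. norm (T n y) \<le> h n)"
   if "s \<in> ?S" for s
  proof (intro exI conjI)
   define d where "d = Re s / 2"
   show "0 < d" using that by (simp add: d_def)
   show "summable (\<lambda>k. ((norm s + d + 1) * (norm s + d)) * real (Suc k) powr (-(d + 1)))"
    using \<open>0 < d\<close> by (intro summable_mult summable_Suc_powr) simp
   have "norm (T n y) \<le> ((norm s + d + 1) * (norm s + d)) * real (Suc n) powr (-(d + 1))"
    if y: "y \<in> ball s d" "Re y > 0" for n y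
   proof -
    have yd: "norm (y - s) < d" using y by (simp add: dist_norm norm_minus_commute)
    have "\<bar>Re y - Re s\<bar> < d" using yd abs_Re_le_cmod[of "y - s"] by simp
    then have "- Re y - 1 \<le> -(d + 1)" unfolding d_def by linarith
    then have p: "real (Suc n) powr (- Re y - 1) \<le> real (Suc n) powr (-(d + 1))" by (intro powr_mono) auto
    have 1: "norm y \<le> norm s + d" using yd norm_triangle_sub[of y s] by simp
    then have 2: "norm (y - 1) \<le> norm s + d + 1" using norm_triangle_ineq4[of y 1] by simp
    show ?thesis
     by (rule order_trans[OF Tb[OF y(2)]]) (use p 1 2 \<open>0 < d\<close> in \<open>intro mult_mono; simp\<close>)
   qed
   then show "\<forall>\<^sub>F n in sequentially. \<forall>y\<in>ball s d \<inter> ?S. norm (T n y) \<le> ((norm s + d + 1) * (norm s + d)) * real (Suc n) powr (-(d + 1))"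
    by (intro always_eventually) auto
  qed
 qed
 then obtain g g' where g: "\<And>s. Re s > 0 \<Longrightarrow> (\<lambda>k. T k s) sums g s \<and> (g has_field_derivative g' s) (at s)"
  by auto
 have ghol: "g holomorphic_on ?S"
  unfolding holomorphic_on_def field_differentiable_def using g by (blast intro: has_field_derivative_at_within)
 have "g 1 = 0"
 proof -
  have "T k 1 = 0" for k by (simp add: T_def del: of_nat_Suc)
  then show ?thesis using g[of 1] by (simp add: sums_iff)
 qed
 moreover have "1 + g s = (s - 1) * Lfun (\<lambda>_. 1) s" if s: "Re s > 1" for s
 proof -
  have L: "(\<lambda>k. 1 / of_nat (Suc k) powr s) sums Lfun (\<lambda>_. 1) s"
   using Lfun_abs_convergent(2)[of "\<lambda>_. 1" 1 0 s] s by simp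
  have "(\<lambda>k. of_nat (Suc k) powr (1 - s) :: complex) \<longlonglongrightarrow> 0"
  proof (rule Lim_null_comparison)
   show "\<forall>\<^sub>F N in sequentially. norm (of_nat (Suc N) powr (1 - s) :: complex) \<le> real (Suc N) powr (-(Re s - 1))"
    by (intro always_eventually allI) (simp del: of_nat_Suc)
   have "filterlim (\<lambda>N. real (Suc N)) at_top sequentially"
    by (rule filterlim_compose[OF filterlim_real_sequentially filterlim_Suc])
   then show "(\<lambda>N. real (Suc N) powr (-(Re s - 1))) \<longlonglongrightarrow> 0"
    by (intro tendsto_neg_powr) (use s in auto)
  qed
  then have "(\<lambda>k. (of_nat (Suc k) powr (1 - s) :: complex) - of_nat (Suc (Suc k)) powr (1 - s)) sums (of_nat (Suc 0) powr (1 - s) - 0)"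
   by (rule telescope_sums')
  moreover have one: "(of_nat (Suc 0) :: complex) powr (1 - s) = 1" by simp
  ultimately have tel: "(\<lambda>k. (of_nat (Suc k) powr (1 - s) :: complex) - of_nat (Suc (Suc k)) powr (1 - s)) sums 1"
   unfolding one by simp
  from sums_diff[OF sums_mult[OF L, of "s - 1"] tel]
  have "(\<lambda>k. T k s) sums ((s - 1) * Lfun (\<lambda>_. 1) s - 1)"
   by (simp add: T_def powr_minus divide_inverse algebra_simps del: of_nat_Suc)
  moreover have "(\<lambda>k. T k s) sums g s" using g[of s] s by simp
  ultimately have "(s - 1) * Lfun (\<lambda>_. 1) s - 1 = g s" by (rule sums_unique2)
  then show ?thesis by (simp add: algebra_simps)
 qed
 ultimately show ?thesis
  using ghol by (intro exI[of _ "\<lambda>s. 1 + g s"]) (auto intro!: holomorphic_intros)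
qed

section \<open>Blaschke products and Landau's lemma\<close>

text \<open>The Blaschke factor of the disc of radius \<open>R\<close> has modulus 1 on the
  boundary. Dividing by it keeps the bound \<open>M\<close>, by the maximum principle, while the
  value at 0 grows by \<open>R / norm a\<close>, hence at least by \<open>R / r\<close>.\<close>

lemma Blaschke_factor_out:
 fixes f :: "complex \<Rightarrow> complex"
 assumes hol: "f holomorphic_on ball 0 R'" and r: "0 < r" "r < R" "R < R'" "R' \<le> R^2 / r"
  and a: "norm a \<le> r" "f a = 0" and M: "\<And>z::complex. norm z \<le> R \<Longrightarrow> norm (f z) \<le> M"
 obtains g where "g holomorphic_on ball 0 R'"
  "\<And>z::complex. norm z < R' \<Longrightarrow> f z = of_real R * (z - a) / ((of_real R)^2 - cnj a * z) * g z"
  "\<And>z::complex. norm z \<le> R \<Longrightarrow> norm (g z) \<le> M" "norm (f 0) * (R / r) \<le> norm (g 0)"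
proof -
 have R0: "R > 0" using r by simp
 define k where "k z = (if z = a then deriv f a else (f z - f a) / (z - a))" for z
 have k: "k holomorphic_on ball 0 R'"
  unfolding k_def by (rule pole_lemma_open[OF hol]) simp
 have fk: "f z = (z - a) * k z" for z
  using a by (simp add: k_def)
 define g where "g z = k z * ((of_real R)^2 - cnj a * z) / R" for z
 \<comment> \<open>The pole of the factor lies at \<open>R^2 / cnj a\<close>; the assumption
   \<open>R' \<le> R^2 / r\<close> keeps it outside the ball of radius \<open>R'\<close>.\<close>
 have nz: "(of_real R)^2 - cnj a * z \<noteq> 0" if "norm z < R'" for z
 proof
  assume "(of_real R)^2 - cnj a * z = 0"
  then have eq: "R^2 = norm a * norm z"
   by (metis R0 complex_mod_cnj eq_iff_diff_eq_0 norm_mult norm_of_real power2_eq_square abs_of_pos zero_less_power mult_pos_pos)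
  have "norm a * norm z \<le> r * norm z" using a by (simp add: mult_right_mono)
  also have "\<dots> < r * R'" using that r by simp
  also have "\<dots> \<le> R^2" using r by (simp add: field_simps)
  finally show False using eq by simp
 qed
 have g: "g holomorphic_on ball 0 R'"
  unfolding g_def using R0 by (intro holomorphic_intros k) auto
 have fg: "f z = of_real R * (z - a) / ((of_real R)^2 - cnj a * z) * g z" if "norm z < R'" for z
  using nz[OF that] R0 by (simp add: fk g_def)
 have gM: "norm (g z) \<le> M" if z: "norm z \<le> R" for z
 proof (rule maximum_modulus_frontier[of g "cball 0 R"])
  show "g holomorphic_on interior (cball 0 R)"
   by (rule holomorphic_on_subset[OF g]) (use r in auto)
  show "continuous_on (closure (cball 0 R)) g"
   by (rule continuous_on_subset[OF holomorphic_on_imp_continuous_on[OF g]]) (use r in auto)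
  show "norm (g w) \<le> M" if "w \<in> frontier (cball 0 R)" for w
  proof -
   have w: "norm w = R" using that R0 by simp
   have "(of_real R)^2 = w * cnj w" using w complex_norm_square[of w] by simp
   then have "(of_real R)^2 - cnj a * w = w * cnj (w - a)" by (simp add: algebra_simps)
   then have n1: "norm ((of_real R)^2 - cnj a * w) = R * norm (w - a)"
    by (metis complex_mod_cnj norm_mult w)
   have wa: "w \<noteq> a" using w a r by auto
   have "norm (of_real R * (w - a) / ((of_real R)^2 - cnj a * w)) = 1"
    using n1 wa R0 by (simp add: norm_mult norm_divide)
   moreover have "norm (f w) = norm (of_real R * (w - a) / ((of_real R)^2 - cnj a * w)) * norm (g w)"
    using fg[of w] w r by (simp only: norm_mult[symmetric])
   ultimately have "norm (g w) = norm (f w)" by simp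
   then show ?thesis using M[of w] w by simp
  qed
 qed (use z in auto)
 have "norm (f 0) = norm a / R * norm (g 0)"
  using fg[of 0] r R0 by (simp add: norm_mult norm_divide power2_eq_square)
 also have "\<dots> \<le> r / R * norm (g 0)"
  using a R0 by (intro mult_right_mono divide_right_mono) auto
 finally have "norm (f 0) * (R / r) \<le> norm (g 0)"
  using R0 r by (simp add: field_simps)
 then show ?thesis using that g fg gM by blast
qed

text \<open>Each division raises the value at 0 by at least \<open>R / r\<close> under the fixed
  bound \<open>M\<close>, so \<open>M < norm (f 0) * (R / r) ^ n\<close> admits at most
  \<open>n\<close> of them. This is Jensen's bound for the number of zeros; the list repeats a zero
  according to its multiplicity.\<close>

lemma Blaschke_factorization:
 fixes f :: "complex \<Rightarrow> complex"
 assumes "f holomorphic_on ball 0 R'" and r: "0 < r" "r < R" "R < R'" "R' \<le> R^2 / r"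
  and "\<And>z::complex. norm z \<le> R \<Longrightarrow> norm (f z) \<le> M" "M < norm (f 0) * (R / r) ^ n"
 shows "\<exists>as g. length as \<le> n \<and> (\<forall>a\<in>set as. norm a \<le> r \<and> f a = 0) \<and> g holomorphic_on ball 0 R' \<and>
  (\<forall>z. norm z < R' \<longrightarrow> f z = (\<Prod>a\<leftarrow>as. of_real R * (z - a) / ((of_real R)^2 - cnj a * z)) * g z) \<and>
  (\<forall>z. norm z \<le> r \<longrightarrow> g z \<noteq> 0) \<and> (\<forall>z. norm z \<le> R \<longrightarrow> norm (g z) \<le> M) \<and> norm (f 0) \<le> norm (g 0)"
 using assms
proof (induction n arbitrary: f)
 case 0
 from 0(6)[of 0] 0(7) r show ?case by auto
next
 case (Suc n)
 show ?case
 proof (cases "\<exists>a. norm a \<le> r \<and> f a = 0")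
  case False
  then show ?thesis using Suc.prems by (intro exI[of _ "[]"] exI[of _ f]) auto
 next
  case True
  then obtain a where a: "norm a \<le> r" "f a = 0" by blast
  obtain g where g: "g holomorphic_on ball 0 R'"
   "\<And>z::complex. norm z < R' \<Longrightarrow> f z = of_real R * (z - a) / ((of_real R)^2 - cnj a * z) * g z"
   "\<And>z::complex. norm z \<le> R \<Longrightarrow> norm (g z) \<le> M" "norm (f 0) * (R / r) \<le> norm (g 0)"
   using Blaschke_factor_out[OF Suc.prems(1) r a Suc.prems(6)] by metis
  have "M < norm (f 0) * (R / r) * (R / r) ^ n" using Suc.prems(7) by (simp add: mult_ac)
  also have "\<dots> \<le> norm (g 0) * (R / r) ^ n"
   using g(4) r by (intro mult_right_mono) auto
  finally have "M < norm (g 0) * (R / r) ^ n" .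
  from Suc.IH[OF g(1) r g(3) this] obtain as h where h:
   "length as \<le> n" "\<And>a. a \<in> set as \<Longrightarrow> norm a \<le> r \<and> g a = 0" "h holomorphic_on ball 0 R'"
   "\<And>z::complex. norm z < R' \<Longrightarrow> g z = (\<Prod>a\<leftarrow>as. of_real R * (z - a) / ((of_real R)^2 - cnj a * z)) * h z"
   "\<And>z::complex. norm z \<le> r \<Longrightarrow> h z \<noteq> 0" "\<And>z::complex. norm z \<le> R \<Longrightarrow> norm (h z) \<le> M" "norm (g 0) \<le> norm (h 0)"
   by blast
  have "norm (f 0) * 1 \<le> norm (f 0) * (R / r)"
   using r by (intro mult_left_mono) auto
  then have "norm (f 0) \<le> norm (h 0)" using g(4) h(7) by linarith
  moreover have "f b = 0" if "b \<in> set as" for b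
   using h(2)[OF that] g(2)[of b] r by auto
  ultimately show ?thesis using h g(2) a
   by (intro exI[of _ "a # as"] exI[of _ h]) (auto simp: mult.assoc)
 qed
qed

text \<open>A logarithm \<open>G\<close> of \<open>g / g 0\<close> has real part below
  \<open>A\<close>, and \<open>w / (2 * A - w)\<close> maps this half-plane into the unit disc.
  Schwarz's lemma bounds \<open>G\<close>, and Cauchy's inequality on circles of radius
  \<open>(r1 - r2) / 2\<close> bounds its derivative \<open>g' / g\<close>.\<close>

lemma Borel_Caratheodory_logderiv:
 fixes g :: "complex \<Rightarrow> complex"
 assumes hol: "g holomorphic_on ball 0 r1" and nz: "\<And>z::complex. norm z < r1 \<Longrightarrow> g z \<noteq> 0"
  and A: "\<And>z::complex. norm z < r1 \<Longrightarrow> norm (g z) < norm (g 0) * exp A" and r: "0 < r2" "r2 < r1"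
  and z: "norm z \<le> r2"
 shows "norm (deriv g z / g z) \<le> 8 * A * r1 / (r1 - r2)^2"
proof -
 have A0: "A > 0" using A[of 0] nz[of 0] r by simp
 obtain G0 where G0: "G0 holomorphic_on ball 0 r1" "\<And>z. z \<in> ball 0 r1 \<Longrightarrow> exp (G0 z) = g z"
  using holomorphic_logarithm_exists[of "ball 0 r1" g 0] hol nz r by auto
 define G where "G z = G0 z - G0 0" for z
 have G: "G holomorphic_on ball 0 r1" unfolding G_def by (intro holomorphic_intros G0)
 have ReG: "Re (G z) < A" if "norm z < r1" for z
 proof -
  have "norm (g z) = exp (Re (G0 z))" "norm (g 0) = exp (Re (G0 0))"
   using G0(2)[of z] G0(2)[of 0] that r by (auto simp flip: norm_exp_eq_Re)
  with A[OF that] have "exp (Re (G0 z)) < exp (Re (G0 0) + A)" by (simp add: exp_add)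
  then show ?thesis by (simp add: G_def)
 qed
 have lt: "norm (G z) < norm (2 * A - G z)" if "norm z < r1" for z
 proof -
  have "(norm (G z))^2 < (norm (2 * A - G z))^2"
   unfolding cmod_power2 using mult_pos_pos[OF A0, of "A - Re (G z)"] ReG[OF that]
   by (simp add: power2_eq_square algebra_simps)
  then show ?thesis by (rule power2_less_imp_less) simp
 qed
 define \<phi> :: "complex \<Rightarrow> complex" where "\<phi> = (\<lambda>z. G (of_real r1 * z) / (2 * A - G (of_real r1 * z)))"
 have in': "r1 * z \<in> ball 0 r1" if "norm z < 1" for z :: complex
  using that r by (auto simp: norm_mult)
 have nz2: "2 * of_real A - G w \<noteq> 0" if "norm w < r1" for w using lt[OF that] by auto
 have "(G \<circ> (\<lambda>z. r1 * z)) holomorphic_on ball 0 1"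
  by (rule holomorphic_on_compose_gen[OF _ G]) (use in' in \<open>auto intro!: holomorphic_intros\<close>)
 then have "\<phi> holomorphic_on ball 0 1"
  unfolding \<phi>_def o_def using in' nz2 by (intro holomorphic_intros) auto
 moreover have "\<phi> 0 = 0" by (simp add: \<phi>_def G_def)
 moreover have "norm (\<phi> w) < 1" if "norm w < 1" for w
  using lt[of "r1 * w"] in'[OF that] nz2[of "r1 * w"] by (auto simp: \<phi>_def norm_divide divide_simps)
 ultimately have Sch: "norm (\<phi> w) \<le> norm w" if "norm w < 1" for w
  using Schwarz_Lemma(1)[of \<phi> w] that by blast
 \<comment> \<open>The circle about \<open>z\<close> in Cauchy's inequality reaches up to the
   midpoint \<open>r3\<close>, where the bound for \<open>G\<close> is still finite.\<close>
 define r3 where "r3 = (r1 + r2) / 2"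
 have bound: "norm (G w) \<le> 2 * A * r1 / (r1 - r3)" if w: "norm w \<le> r3" for w
 proof -
  have w1: "norm w < r1" using w r by (simp add: r3_def)
  have "norm (\<phi> (w / r1)) \<le> norm w / r1"
   using Sch[of "w / r1"] w1 r by (simp add: norm_divide)
  then have "norm (G w) \<le> norm w / r1 * norm (2 * A - G w)"
   using r nz2[OF w1] by (simp add: \<phi>_def norm_divide divide_simps mult_ac)
  also have "\<dots> \<le> r3 / r1 * (2 * A + norm (G w))"
   using w r A0 norm_triangle_ineq4[of "2 * of_real A" "G w"]
   by (intro mult_mono divide_right_mono) (auto simp: r3_def norm_mult)
  finally have "r1 * norm (G w) \<le> r1 * (r3 / r1 * (2 * A + norm (G w)))" using r by (intro mult_left_mono) auto
  also have "\<dots> = r3 * (2 * A + norm (G w))" using r by simp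
  finally have "norm (G w) * (r1 - r3) \<le> r3 * (2 * A)" by (simp add: algebra_simps)
  also have "\<dots> \<le> r1 * (2 * A)" using r A0 by (simp add: r3_def)
  finally show ?thesis using r by (simp add: r3_def field_simps)
 qed
 have sub: "cball z ((r1 - r2) / 2) \<subseteq> cball 0 r3"
 proof
  fix w assume "w \<in> cball z ((r1 - r2) / 2)"
  then have "norm (w - z) \<le> (r1 - r2) / 2"
   by (simp add: dist_norm norm_minus_commute)
  moreover have "norm w \<le> norm z + norm (w - z)"
   by (rule norm_triangle_sub)
  ultimately have "norm w \<le> norm z + (r1 - r2) / 2" by linarith
  then show "w \<in> cball 0 r3" using z by (simp add: r3_def field_simps)
 qed
 have sub3: "cball 0 r3 \<subseteq> ball 0 r1" using r by (auto simp: r3_def)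
 have "norm ((deriv ^^ 1) G z) \<le> fact 1 * (2 * A * r1 / (r1 - r3)) / ((r1 - r2) / 2) ^ 1"
 proof (rule Cauchy_inequality)
  show "G holomorphic_on ball z ((r1 - r2) / 2)"
   using holomorphic_on_subset[OF G] sub sub3 by (meson ball_subset_cball order_trans)
  show "continuous_on (cball z ((r1 - r2) / 2)) G"
   using holomorphic_on_imp_continuous_on[OF G] sub sub3 by (meson continuous_on_subset order_trans)
  show "norm (G x) \<le> 2 * A * r1 / (r1 - r3)" if "norm (z - x) = (r1 - r2) / 2" for x
   by (rule bound) (use that sub in \<open>auto simp: dist_norm subset_iff\<close>)
 qed (use r in auto)
 also have "fact 1 * (2 * A * r1 / (r1 - r3)) / ((r1 - r2) / 2) ^ 1 = 8 * A * r1 / (r1 - r2)^2"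
  using r by (simp add: r3_def field_simps power2_eq_square)
 also have "(deriv ^^ 1) G z = deriv g z / g z"
 proof -
  have zb: "z \<in> ball 0 r1" using z r by simp
  have "(G0 has_field_derivative deriv G0 z) (at z)"
   using G0(1) zb by (meson holomorphic_derivI open_ball)
  then have 1: "(G has_field_derivative deriv G0 z) (at z)"
   unfolding G_def by (auto intro!: derivative_eq_intros)
  have "((\<lambda>w. exp (G0 w)) has_field_derivative exp (G0 z) * deriv G0 z) (at z)"
   using \<open>(G0 has_field_derivative deriv G0 z) (at z)\<close> by (auto intro!: derivative_eq_intros)
  then have "(g has_field_derivative exp (G0 z) * deriv G0 z) (at z)"
   by (rule has_field_derivative_transform_within_open[of _ _ _ "ball 0 r1"]) (use zb G0 in auto)
  then have "deriv g z = g z * deriv G0 z" using G0(2)[OF zb] by (simp add: DERIV_imp_deriv)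
  then show ?thesis using DERIV_imp_deriv[OF 1] nz[of z] zb by simp
 qed
 finally show ?thesis .
qed

lemma has_field_derivative_prod_list:
 fixes b :: "'a \<Rightarrow> complex \<Rightarrow> complex"
 assumes "\<And>a. a \<in> set as \<Longrightarrow> b a z \<noteq> 0"
  "\<And>a. a \<in> set as \<Longrightarrow> (b a has_field_derivative b a z * d a) (at z)"
 shows "((\<lambda>z. \<Prod>a\<leftarrow>as. b a z) has_field_derivative (\<Prod>a\<leftarrow>as. b a z) * (\<Sum>a\<leftarrow>as. d a)) (at z)"
 using assms
proof (induction as)
 case (Cons a as)
 have "((\<lambda>z. b a z * (\<Prod>a\<leftarrow>as. b a z)) has_field_derivative
   b a z * d a * (\<Prod>a\<leftarrow>as. b a z) + (\<Prod>a\<leftarrow>as. b a z) * (\<Sum>a\<leftarrow>as. d a) * b a z) (at z)"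
  by (rule DERIV_mult) (use Cons in auto)
 then show ?case by (simp add: algebra_simps)
qed auto

text \<open>Landau's lemma: near a point where \<open>f\<close> is not too small, \<open>f'/f\<close> is a sum over the nearby zeros.\<close>

lemma logderiv_near_zeros:
 fixes r2 r1 R R' :: real
 assumes r: "0 < r2" "r2 < r1" "r1 < R" "R < R'" "R' \<le> R^2 / r1"
 shows "\<exists>K>0. \<forall>f M. f holomorphic_on ball 0 R' \<longrightarrow> f 0 \<noteq> 0 \<longrightarrow>
  (\<forall>z. norm z \<le> R \<longrightarrow> norm (f z) \<le> M) \<longrightarrow>
  (\<exists>as. real (length as) \<le> K * (ln (M / norm (f 0)) + 1) \<and> (\<forall>a\<in>set as. norm a \<le> r1 \<and> f a = 0) \<and>
   (\<forall>z. norm z \<le> r2 \<longrightarrow> f z \<noteq> 0 \<longrightarrow>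
    norm (deriv f z / f z) \<le> K * (ln (M / norm (f 0)) + 1) + (\<Sum>a\<leftarrow>as. 1 / norm (z - a))))"
proof -
 define K1 where "K1 = 1 / ln (R / r1) + 1"
 define c where "c = r1 / (R^2 - r1 * r2)"
 define K where "K = K1 + K1 * c + 8 * r1 / (r1 - r2)^2"
 have lnpos: "ln (R / r1) > 0" using r by simp
 have R2: "R^2 - r1 * r2 > 0"
  unfolding power2_eq_square using r by (smt (verit) mult_strict_mono)
 have c0: "c > 0" using r R2 by (simp add: c_def)
 have K1: "K1 \<ge> 1" using lnpos by (simp add: K1_def)
 have K: "K \<ge> K1" using r c0 K1 by (simp add: K_def)
 show ?thesis
 proof (intro exI[of _ K] conjI allI impI)
  show "0 < K" using K K1 by simp
 next
  fix f :: "complex \<Rightarrow> complex" and M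
  assume f: "f holomorphic_on ball 0 R'" "f 0 \<noteq> 0" and M: "\<forall>z. norm z \<le> R \<longrightarrow> norm (f z) \<le> M"
  have f0: "norm (f 0) \<le> M" "norm (f 0) > 0" using M f r by auto
  define B where "B = ln (M / norm (f 0))"
  have B0: "B \<ge> 0" using f0 by (simp add: B_def)
  \<comment> \<open>The least integer above \<open>B / ln (R / r1)\<close>, so that
    \<open>(R / r1) ^ n\<close> exceeds \<open>M / norm (f 0) = exp B\<close>.\<close>
  define n where "n = nat \<lfloor>B / ln (R / r1)\<rfloor> + 1"
  have n1: "real n \<ge> B / ln (R / r1)" "real n \<le> B / ln (R / r1) + 1" "real n > B / ln (R / r1)"
   using B0 lnpos by (auto simp: n_def of_nat_nat le_floor_iff) linarith+
  have "B < real n * ln (R / r1)" using n1(3) lnpos by (simp add: field_simps)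
  then have "exp B < exp (real n * ln (R / r1))" by simp
  also have "\<dots> = (R / r1) ^ n" using r by (simp add: exp_of_nat_mult)
  finally have "exp B < (R / r1) ^ n" .
  moreover have "M / norm (f 0) > 0" using f0 by (intro divide_pos_pos) linarith+
  then have "exp B = M / norm (f 0)" unfolding B_def by (rule exp_ln)
  note expB = this
  ultimately have Mn: "M < norm (f 0) * (R / r1) ^ n"
   using pos_divide_less_eq[OF f0(2)] by (simp only: mult.commute)
  have "0 < r1" "\<And>z::complex. norm z \<le> R \<Longrightarrow> norm (f z) \<le> M" using r M by auto
  from Blaschke_factorization[of f, OF f(1) this(1) r(3-5) this(2) Mn] obtain as :: "complex list" and g where g:
   "length as \<le> n" "\<And>a. a\<in>set as \<Longrightarrow> norm a \<le> r1 \<and> f a = 0" "g holomorphic_on ball 0 R'"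
   "\<And>z::complex. norm z < R' \<Longrightarrow> f z = (\<Prod>a\<leftarrow>as. of_real R * (z - a) / ((of_real R)^2 - cnj a * z)) * g z"
   "\<And>z::complex. norm z \<le> r1 \<Longrightarrow> g z \<noteq> 0" "\<And>z::complex. norm z \<le> R \<Longrightarrow> norm (g z) \<le> M" "norm (f 0) \<le> norm (g 0)"
   by blast
  have len: "real (length as) \<le> K1 * (B + 1)"
  proof -
   have "real (length as) \<le> B / ln (R / r1) + 1" using g(1) n1(2) by linarith
   also have "\<dots> \<le> K1 * (B + 1)" using lnpos B0 by (simp add: K1_def field_simps)
   finally show ?thesis .
  qed
  \<comment> \<open>The additional 1 in the exponent gives the strict inequality that
    \<open>Borel_Caratheodory_logderiv\<close> asks for.\<close>
  have gb: "norm (g z) < norm (g 0) * exp (B + 1)" if "norm z < r1" for z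
  proof -
   have "norm (f 0) * exp B = M" using expB f0 by simp
   then have "norm (g z) \<le> norm (f 0) * exp B" using g(6)[of z] that r by simp
   also have "\<dots> < norm (f 0) * exp (B + 1)" using f0 by simp
   also have "\<dots> \<le> norm (g 0) * exp (B + 1)" using g(7) by simp
   finally show ?thesis .
  qed
  have main: "norm (deriv f z / f z) \<le> K * (B + 1) + (\<Sum>a\<leftarrow>as. 1 / norm (z - a))"
   if z: "norm z \<le> r2" and fz: "f z \<noteq> 0" for z
  proof -
   define b where "b a z = of_real R * (z - a) / ((of_real R)^2 - cnj a * z)" for a z
   \<comment> \<open>The logarithmic derivative of a Blaschke factor: the first summand is the
     singular part at the zero, the second has modulus at most \<open>c\<close>.\<close>
   define d where "d a = 1 / (z - a) + cnj a / ((of_real R)^2 - cnj a * z)" for a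
   have nrm: "norm ((of_real R)^2 - cnj a * z) \<ge> R^2 - r1 * r2" if "a \<in> set as" for a
   proof -
    have "norm (cnj a * z) \<le> r1 * r2"
     using g(2)[OF that] z r by (simp add: norm_mult mult_mono)
    then show ?thesis
     using norm_triangle_ineq2[of "(of_real R)^2" "cnj a * z"] by (simp add: norm_power)
   qed
   have nz: "(of_real R)^2 - cnj a * z \<noteq> 0" "z \<noteq> a" if "a \<in> set as" for a
    using nrm[OF that] R2 g(2)[OF that] fz by auto
   have db: "(b a has_field_derivative b a z * d a) (at z)" if "a \<in> set as" for a
    unfolding b_def d_def using nz[OF that] r
    by (auto intro!: derivative_eq_intros simp: divide_simps) (simp add: algebra_simps)
   have bnz: "b a z \<noteq> 0" if "a \<in> set as" for a
    using nz[OF that] r by (simp add: b_def)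
   have zR: "z \<in> ball 0 R'" using z r by simp
   have gd: "(g has_field_derivative deriv g z) (at z)"
    using g(3) zR by (meson holomorphic_derivI open_ball)
   have "((\<lambda>w. (\<Prod>a\<leftarrow>as. b a w) * g w) has_field_derivative
     (\<Prod>a\<leftarrow>as. b a z) * (\<Sum>a\<leftarrow>as. d a) * g z + deriv g z * (\<Prod>a\<leftarrow>as. b a z)) (at z)"
    by (intro DERIV_mult has_field_derivative_prod_list gd bnz db)
   then have "(f has_field_derivative
     (\<Prod>a\<leftarrow>as. b a z) * (\<Sum>a\<leftarrow>as. d a) * g z + deriv g z * (\<Prod>a\<leftarrow>as. b a z)) (at z)"
    by (rule has_field_derivative_transform_within_open[of _ _ _ "ball 0 R'"])
     (use zR g(4) in \<open>auto simp: b_def\<close>)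
   then have df: "deriv f z = (\<Prod>a\<leftarrow>as. b a z) * (\<Sum>a\<leftarrow>as. d a) * g z + deriv g z * (\<Prod>a\<leftarrow>as. b a z)"
    by (rule DERIV_imp_deriv)
   have fz2: "f z = (\<Prod>a\<leftarrow>as. b a z) * g z" using g(4) zR by (simp add: b_def)
   have pnz: "(\<Prod>a\<leftarrow>as. b a z) \<noteq> 0" "g z \<noteq> 0" using fz fz2 by auto
   have "deriv f z / f z = (\<Sum>a\<leftarrow>as. d a) + deriv g z / g z"
    unfolding df fz2 using pnz by (simp add: field_simps)
   also have "norm \<dots> \<le> norm (\<Sum>a\<leftarrow>as. d a) + norm (deriv g z / g z)" by (rule norm_triangle_ineq)
   also have "norm (\<Sum>a\<leftarrow>as. d a) \<le> (\<Sum>a\<leftarrow>as. norm (d a))" by (induction as) (auto intro: norm_triangle_le)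
   also have "\<dots> \<le> (\<Sum>a\<leftarrow>as. 1 / norm (z - a) + c)"
   proof (rule sum_list_mono)
    fix a assume a: "a \<in> set as"
    have "norm (cnj a / ((of_real R)^2 - cnj a * z)) \<le> r1 / (R^2 - r1 * r2)"
     unfolding norm_divide using nrm[OF a] g(2)[OF a] R2 r by (intro frac_le) auto
    then show "norm (d a) \<le> 1 / norm (z - a) + c"
     unfolding d_def c_def using norm_triangle_ineq[of "1 / (z - a)" "cnj a / ((of_real R)^2 - cnj a * z)"]
     by (simp add: norm_divide)
   qed
   also have "\<dots> = (\<Sum>a\<leftarrow>as. 1 / norm (z - a)) + length as * c"
    by (simp add: sum_list_addf sum_list_triv)
   also have "length as * c \<le> K1 * (B + 1) * c" using len c0 by (intro mult_right_mono) auto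
   also have "norm (deriv g z / g z) \<le> 8 * (B + 1) * r1 / (r1 - r2)^2"
    by (rule Borel_Caratheodory_logderiv[where ?r2.0 = r2])
     (use gb g r z in \<open>auto intro: holomorphic_on_subset\<close>)
   finally have "norm (deriv f z / f z) \<le> (\<Sum>a\<leftarrow>as. 1 / norm (z - a)) + K1 * (B + 1) * c + 8 * (B + 1) * r1 / (r1 - r2)^2"
    by simp
   moreover have "K1 * (B + 1) * c + 8 * (B + 1) * r1 / (r1 - r2)^2 = (K - K1) * (B + 1)"
    by (simp add: K_def algebra_simps)
   moreover have "(K - K1) * (B + 1) \<le> K * (B + 1)" using K1 B0 by (intro mult_right_mono) auto
   ultimately show ?thesis by linarith
  qed
  have "K1 * (B + 1) \<le> K * (B + 1)" using K B0 by (intro mult_right_mono) auto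
  then show "\<exists>as. real (length as) \<le> K * (ln (M / norm (f 0)) + 1) \<and> (\<forall>a\<in>set as. norm a \<le> r1 \<and> f a = 0) \<and>
   (\<forall>z. norm z \<le> r2 \<longrightarrow> f z \<noteq> 0 \<longrightarrow>
    norm (deriv f z / f z) \<le> K * (ln (M / norm (f 0)) + 1) + (\<Sum>a\<leftarrow>as. 1 / norm (z - a)))"
   using len g(2) main unfolding B_def[symmetric] by (intro exI[of _ as]) auto
 qed
qed

subsection \<open>Non-vanishing on the line Re s = 1\<close>

lemma dirichlet_char_partial_sums:
 assumes "dirichlet_char q chi" "chi \<noteq> principal_char q" "q > 1"
 shows "norm (\<Sum>i<N. chi (Suc i)) \<le> real q"
proof (rule periodic_partial_sums_bounded)
 have "(\<Sum>n<q. chi n) = (\<Sum>n\<in>units_mod q. chi n)"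
  by (rule sum.mono_neutral_right) (use dirichlet_charD(5)[OF assms(1)] in \<open>auto simp: units_mod_def\<close>)
 then show "(\<Sum>n<q. chi n) = 0" using sum_dirichlet_char_units[of q chi] assms by simp
qed (use assms dirichlet_charD(4)[OF assms(1)] norm_dirichlet_char_le[OF assms(1)] in auto)

text \<open>Subtract from the principal character its mean \<open>totient q / q\<close>. The
  difference sums to zero over a period, so its series is holomorphic on \<open>Re s > 0\<close>,
  and the pole comes from the multiple \<open>c\<close> of the zeta function alone.\<close>

lemma principal_continuation:
 assumes "q > 1"
 shows "\<exists>N. N holomorphic_on {s. Re s > 0} \<and> N 1 \<noteq> 0 \<and> (\<forall>s. Re s > 1 \<longrightarrow> N s = (s - 1) * Lfun (principal_char q) s)"
proof -
 define c where "c = (of_nat (totient q) / of_nat q :: complex)"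
 define f where "f n = principal_char q n - c" for n
 have c: "c \<noteq> 0" "c = of_real (totient q / q)" using assms by (auto simp: c_def)
 have c1: "0 \<le> totient q / q" "totient q / q \<le> 1" using assms totient_le[of q] by auto
 have nf: "norm (f n) \<le> 1" for n
 proof -
  have "f n = of_real ((if coprime n q then 1 else 0) - totient q / q)"
   by (simp add: f_def c(2) principal_char_def)
  then have "norm (f n) = \<bar>(if coprime n q then 1 else 0) - totient q / q\<bar>" by (simp only: norm_of_real)
  also have "\<dots> \<le> 1" using c1 by (cases "coprime n q"; simp only: if_True if_False; linarith)
  finally show ?thesis .
 qed
 have "(\<Sum>n<q. principal_char q n) = (\<Sum>n\<in>units_mod q. principal_char q n)"
  by (rule sum.mono_neutral_right) (auto simp: units_mod_def principal_char_def)
 also have "\<dots> = of_nat (totient q)"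
  using card_units_mod[OF assms] by (simp add: principal_char_def units_mod_def)
 finally have fz: "(\<Sum>n<q. f n) = 0" using assms by (simp add: f_def sum_subtractf c_def)
 have B: "norm (\<Sum>i<N. f (Suc i)) \<le> real q" for N
  using periodic_partial_sums_bounded[of f q, OF _ _ fz nf] assms
   dirichlet_charD(4)[OF dirichlet_char_principal] by (simp add: f_def)
 obtain N where N: "N holomorphic_on {s. Re s > 0}" "N 1 = 1" "\<And>s. Re s > 1 \<Longrightarrow> N s = (s - 1) * Lfun (\<lambda>_. 1) s"
  using zeta_continuation by blast
 define M where "M s = c * N s + (s - 1) * Lfun f s" for s
 have "M holomorphic_on {s. Re s > 0}"
  unfolding M_def by (intro holomorphic_intros N Lfun_holomorphic[OF B])
 moreover have "M 1 \<noteq> 0" using N(2) c by (simp add: M_def)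
 moreover have "M s = (s - 1) * Lfun (principal_char q) s" if s: "Re s > 1" for s
 proof -
  have "(\<lambda>n. f (Suc n) / of_nat (Suc n) powr s) sums Lfun f s"
   using Lfun_Abel(2)[OF B, of s] Lfun_eq_Abel[OF B, of s] s by simp
  moreover have "(\<lambda>n. 1 / of_nat (Suc n) powr s) sums Lfun (\<lambda>_. 1) s"
   using Lfun_abs_convergent(2)[of "\<lambda>_. 1" 1 0 s] s by simp
  ultimately have "(\<lambda>n. f (Suc n) / of_nat (Suc n) powr s + c * (1 / of_nat (Suc n) powr s)) sums (Lfun f s + c * Lfun (\<lambda>_. 1) s)"
   by (intro sums_add sums_mult)
  then have "(\<lambda>n. principal_char q (Suc n) / of_nat (Suc n) powr s) sums (Lfun f s + c * Lfun (\<lambda>_. 1) s)"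
   by (simp add: f_def diff_divide_distrib)
  then have "Lfun (principal_char q) s = Lfun f s + c * Lfun (\<lambda>_. 1) s" unfolding Lfun_def by (simp add: sums_iff)
  then show ?thesis unfolding M_def N(3)[OF s] by (simp add: algebra_simps)
 qed
 ultimately show ?thesis by blast
qed

text \<open>Writing \<open>F w = g w * (w - z) ^ n\<close> with \<open>g\<close> free of zeros near
  \<open>z\<close>, the logarithmic derivative is \<open>n / s\<close> plus the bounded
  \<open>g' / g\<close>. The applications are points on \<open>Re s = 1\<close> and the point
  1/2.\<close>

lemma logderiv_near_point:
 assumes hol: "F holomorphic_on S" and S: "open S" "connected S" "z \<in> S" and nz: "\<exists>w\<in>S. F w \<noteq> 0"
 shows "\<exists>r C. r > 0 \<and> zorder F z \<ge> 0 \<and> (zorder F z = 0 \<longleftrightarrow> F z \<noteq> 0) \<and>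
  (\<forall>s. s \<noteq> 0 \<longrightarrow> norm s \<le> r \<longrightarrow> norm (deriv F (z + s) / F (z + s) - of_int (zorder F z) / s) \<le> C)"
proof -
 define n where "n = nat (zorder F z)"
 define g where "g = zor_poly F z"
 have "(if F z = 0 then zorder F z > 0 else zorder F z = 0) \<and> (\<exists>r. r > 0 \<and> cball z r \<subseteq> S \<and> g holomorphic_on cball z r
   \<and> (\<forall>w\<in>cball z r. F w = g w * (w - z) ^ n \<and> g w \<noteq> 0))"
  unfolding n_def g_def by (rule zorder_exist_zero[OF hol S nz])
 then have zo: "zorder F z \<ge> 0" "zorder F z = 0 \<longleftrightarrow> F z \<noteq> 0" and ex: "\<exists>r. r > 0 \<and> cball z r \<subseteq> S \<and> g holomorphic_on cball z r
   \<and> (\<forall>w\<in>cball z r. F w = g w * (w - z) ^ n \<and> g w \<noteq> 0)" by (metis less_imp_le order_refl, metis less_irrefl, blast)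
 from ex obtain r where r: "r > 0" "g holomorphic_on cball z r" "\<And>w. w \<in> cball z r \<Longrightarrow> F w = g w * (w - z) ^ n \<and> g w \<noteq> 0" by blast
 have zn: "zorder F z = int n" using zo(1) by (simp add: n_def)
 have gb: "g holomorphic_on ball z r" by (rule holomorphic_on_subset[OF r(2)]) auto
 have "continuous_on (cball z (r / 2)) (\<lambda>w. deriv g w / g w)"
 proof (rule continuous_on_subset)
  show "continuous_on (ball z r) (\<lambda>w. deriv g w / g w)"
   by (intro holomorphic_on_imp_continuous_on holomorphic_intros gb) (use r(3) in auto)
 qed (use r(1) in auto)
 then have "compact ((\<lambda>w. deriv g w / g w) ` cball z (r / 2))" by (rule compact_continuous_image) simp
 then obtain C where C: "\<And>w. w \<in> cball z (r / 2) \<Longrightarrow> norm (deriv g w / g w) \<le> C"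
  unfolding compact_eq_bounded_closed bounded_iff by blast
 have "norm (deriv F (z + s) / F (z + s) - of_int (zorder F z) / s) \<le> C" if s: "s \<noteq> 0" "norm s \<le> r / 2" for s
 proof -
  define w where "w = z + s"
  have ws: "w - z = s" by (simp add: w_def)
  have wb: "w \<in> ball z r" "w \<in> cball z (r / 2)" using s r(1) by (auto simp: w_def dist_norm)
  have gd: "(g has_field_derivative deriv g w) (at w)" by (rule holomorphic_derivI[OF gb _ wb(1)]) simp
  have "((\<lambda>w. g w * (w - z) ^ n) has_field_derivative deriv g w * (w - z) ^ n + (of_nat n * (w - z) ^ (n - 1)) * g w) (at w)"
   by (rule DERIV_mult[OF gd]) (auto intro!: derivative_eq_intros)
  then have "(F has_field_derivative deriv g w * (w - z) ^ n + (of_nat n * (w - z) ^ (n - 1)) * g w) (at w)"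
   by (rule has_field_derivative_transform_within_open[of _ _ _ "ball z r"]) (use wb r(3) in auto)
  then have dF: "deriv F w = deriv g w * s ^ n + (of_nat n * s ^ (n - 1)) * g w"
   unfolding ws by (rule DERIV_imp_deriv)
  have Fw: "F w = g w * s ^ n" "g w \<noteq> 0" using r(3)[of w] wb ws by auto
  have pw: "s * (of_nat n * s ^ (n - 1)) = of_nat n * s ^ n" by (cases n) auto
  have "s * (deriv F w / F w - deriv g w / g w) = of_nat n"
  proof -
   have "s * deriv F w = s * deriv g w * s ^ n + of_nat n * s ^ n * g w"
    unfolding dF distrib_left pw[symmetric] by (simp only: mult.assoc)
   then have "s * deriv F w / F w = s * deriv g w * s ^ n / F w + of_nat n * s ^ n * g w / F w"
    by (simp add: add_divide_distrib)
   also have "\<dots> = s * (deriv g w / g w) + of_nat n" using Fw s by simp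
   finally show ?thesis by (simp add: right_diff_distrib)
  qed
  then have "deriv F w / F w - deriv g w / g w = of_nat n / s" using s(1) by (metis nonzero_mult_div_cancel_left)
  then have "deriv F w / F w - of_int (zorder F z) / s = deriv g w / g w" unfolding zn by (simp add: algebra_simps)
  then show ?thesis using C[OF wb(2)] by (simp add: w_def)
 qed
 then show ?thesis using zo r(1) by - (rule exI[of _ "r / 2"], rule exI[of _ C], auto)
qed

lemma logderiv_residue_limit:
 assumes "F holomorphic_on S" "open S" "connected S" "z \<in> S" "\<exists>w\<in>S. F w \<noteq> 0"
 shows "\<exists>k::nat. (F z = 0 \<longrightarrow> k \<ge> 1) \<and> (F z \<noteq> 0 \<longrightarrow> k = 0) \<and>
  ((\<lambda>x. of_real x * (deriv F (z + of_real x) / F (z + of_real x))) \<longlongrightarrow> of_nat k) (at_right 0)"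
proof -
 obtain r C where r: "r > 0" "zorder F z \<ge> 0" "zorder F z = 0 \<longleftrightarrow> F z \<noteq> 0"
  "\<And>s. s \<noteq> 0 \<Longrightarrow> norm s \<le> r \<Longrightarrow> norm (deriv F (z + s) / F (z + s) - of_int (zorder F z) / s) \<le> C"
  using logderiv_near_point[OF assms] by blast
 define k where "k = nat (zorder F z)"
 have "((\<lambda>x. of_real x * (deriv F (z + of_real x) / F (z + of_real x)) - of_nat k) \<longlongrightarrow> 0) (at_right (0::real))"
 proof (rule Lim_null_comparison)
  show "\<forall>\<^sub>F x in at_right (0::real). norm (of_real x * (deriv F (z + of_real x) / F (z + of_real x)) - of_nat k) \<le> x * C"
  proof (rule eventually_at_rightI[of 0 r])
   fix x assume x: "x \<in> {0<..<r}"
   have "of_real x * (deriv F (z + of_real x) / F (z + of_real x)) - of_nat k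
     = of_real x * (deriv F (z + of_real x) / F (z + of_real x) - of_int (zorder F z) / of_real x)"
    using x r(2) by (simp add: k_def right_diff_distrib)
   then show "norm (of_real x * (deriv F (z + of_real x) / F (z + of_real x)) - of_nat k) \<le> x * C"
    using x r(4)[of "of_real x"] by (simp add: norm_mult mult_left_mono)
  qed (rule r(1))
  show "((\<lambda>x. x * C) \<longlongrightarrow> 0) (at_right (0::real))" by (auto intro!: tendsto_eq_intros)
 qed
 then have lim: "((\<lambda>x. of_real x * (deriv F (z + of_real x) / F (z + of_real x))) \<longlongrightarrow> of_nat k) (at_right (0::real))"
  by (rule LIM_zero_cancel)
 have "F z = 0 \<longrightarrow> k \<ge> 1" "F z \<noteq> 0 \<longrightarrow> k = 0" using r(2,3) by (auto simp: k_def)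
 then show ?thesis using lim by blast
qed

text \<open>The identity \<open>3 + 4 cos u + cos (2 u) = 2 (1 + cos u)^2\<close>, with
  \<open>cos u\<close> the real part of \<open>chi n / n^(\<i> t)\<close>. At integers not coprime
  to \<open>q\<close> all three terms vanish.\<close>

lemma three_four_one:
 assumes chi: "dirichlet_char q chi" and q: "q > 1" and x: "x > 1"
 shows "0 \<le> 3 * Re (Lfun (\<lambda>n. mangoldt n * principal_char q n) (of_real x))
  + 4 * Re (Lfun (\<lambda>n. mangoldt n * chi n) (Complex x t))
  + Re (Lfun (\<lambda>n. mangoldt n * (chi n)^2) (Complex x (2 * t)))"
proof -
 define e where "e = (x - 1) / 2"
 have e: "e > 0" "x > 1 + e" using x by (auto simp: e_def field_simps)
 have sums: "(\<lambda>n. mangoldt (Suc n) * f (Suc n) / of_nat (Suc n) powr s) sums Lfun (\<lambda>n. mangoldt n * f n) s"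
  if "\<And>n. norm (f n) \<le> 1" "Re s = x" for f :: "nat \<Rightarrow> complex" and s
  using Lfun_abs_convergent(2)[of "\<lambda>n. mangoldt n * f n", OF norm_completely_mult_bounds(1)[of f e, OF that(1) e(1)]] that(2) e(2) by simp
 have n1: "norm (principal_char q n) \<le> 1" "norm (chi n) \<le> 1" "norm ((chi n)^2) \<le> 1" for n
  using norm_dirichlet_char_le[OF chi, of n] norm_dirichlet_char_le[OF dirichlet_char_principal, of q n] q
  by (auto simp: norm_power power_le_one)
 have "(\<lambda>n. 3 * Re (mangoldt (Suc n) * principal_char q (Suc n) / of_nat (Suc n) powr of_real x)
   + 4 * Re (mangoldt (Suc n) * chi (Suc n) / of_nat (Suc n) powr Complex x t)
   + Re (mangoldt (Suc n) * (chi (Suc n))^2 / of_nat (Suc n) powr Complex x (2 * t))) sums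
  (3 * Re (Lfun (\<lambda>n. mangoldt n * principal_char q n) (of_real x))
  + 4 * Re (Lfun (\<lambda>n. mangoldt n * chi n) (Complex x t))
  + Re (Lfun (\<lambda>n. mangoldt n * (chi n)^2) (Complex x (2 * t))))"
  by (intro sums_add sums_mult sums_Re sums n1) auto
 then show ?thesis
 proof (rule sums_le[OF _ sums_zero, rotated])
  fix n
  define m where "m = Suc n"
  define w where "w = chi m / of_nat m powr (\<i> * t)"
  have m0: "of_nat m \<noteq> (0::complex)" unfolding m_def by (rule of_nat_neq_0)
  have pw: "of_nat m powr Complex x u = of_real (real m powr x) * of_nat m powr (\<i> * u)" for u
  proof -
   have "of_nat m powr Complex x u = of_nat m powr of_real x * of_nat m powr (\<i> * u)"
    by (simp add: Complex_eq powr_add)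
   then show ?thesis using powr_of_real[of "real m" x] by (simp add: m_def)
  qed
  have pw2: "of_nat m powr (\<i> * (2 * t)) = (of_nat m powr (\<i> * t))^2"
   using m0 by (simp add: powr_def exp_double[symmetric] algebra_simps)
  have p1: "of_nat m powr of_real x = (of_real (real m powr x) :: complex)"
   using powr_of_real[of "real m" x] by (simp add: m_def)
  define c where "c = mangoldt m / (real m powr x)"
  have c0: "c \<ge> 0" by (simp add: c_def mangoldt_nonneg)
  have cc: "complex_of_real c = mangoldt m / of_real (real m powr x)" by (simp add: c_def)
  have a: "mangoldt m * principal_char q m / of_nat m powr of_real x = of_real c * principal_char q m"
   "mangoldt m * chi m / of_nat m powr Complex x t = of_real c * w"
   "mangoldt m * (chi m)^2 / of_nat m powr Complex x (2 * t) = of_real c * w^2"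
   unfolding pw p1 w_def cc using pw2 by (simp_all add: power_divide)
  have "3 * Re (mangoldt m * principal_char q m / of_nat m powr of_real x)
   + 4 * Re (mangoldt m * chi m / of_nat m powr Complex x t)
   + Re (mangoldt m * (chi m)^2 / of_nat m powr Complex x (2 * t))
   = Re (of_real c * (3 * principal_char q m + 4 * w + w^2))"
   unfolding a by (simp add: algebra_simps)
  also have "\<dots> = c * Re (3 * principal_char q m + 4 * w + w^2)" by simp
  also have "\<dots> \<ge> 0"
  proof (rule mult_nonneg_nonneg[OF c0])
   show "0 \<le> Re (3 * principal_char q m + 4 * w + w^2)"
   proof (cases "coprime m q")
    case True
    have "norm w = 1" unfolding w_def using norm_dirichlet_char[OF chi True] q
     by (simp add: norm_divide m_def del: of_nat_Suc)
    then have "(Re w)^2 + (Im w)^2 = 1" by (metis cmod_power2 one_power2)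
    then have "Re (3 * principal_char q m + 4 * w + w^2) = 2 * (1 + Re w)^2"
     using True by (simp add: principal_char_def Re_power2) (simp add: power2_eq_square algebra_simps)
    then show ?thesis by simp
   next
    case False
    then show ?thesis using dirichlet_charD(5)[OF chi, of m] by (simp add: principal_char_def w_def)
   qed
  qed
  finally show "0 \<le> 3 * Re (mangoldt (Suc n) * principal_char q (Suc n) / of_nat (Suc n) powr of_real x)
   + 4 * Re (mangoldt (Suc n) * chi (Suc n) / of_nat (Suc n) powr Complex x t)
   + Re (mangoldt (Suc n) * (chi (Suc n))^2 / of_nat (Suc n) powr Complex x (2 * t))"
   unfolding m_def by simp
 qed
qed

lemma Lfun_char_holomorphic:
 assumes "dirichlet_char q chi" "chi \<noteq> principal_char q" "q > 1"
 shows "Lfun chi holomorphic_on {s. Re s > 0}"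
 by (rule Lfun_holomorphic[OF dirichlet_char_partial_sums[OF assms]])

lemma Lfun_char_Re_gt_1:
 assumes "dirichlet_char q chi" "q > 1" "Re s > 1"
 shows "Lfun chi s \<noteq> 0" "deriv (Lfun chi) s = - Lfun (\<lambda>n. mangoldt n * chi n) s * Lfun chi s"
 using Lfun_Re_gt_1[of chi s] norm_dirichlet_char_le[OF assms(1)] dirichlet_charD[OF assms(1)] assms by auto

lemma Lfun_char_logderiv_limit:
 assumes "dirichlet_char q chi" "chi \<noteq> principal_char q" "q > 1"
 shows "\<exists>k::nat. (Lfun chi (Complex 1 t) = 0 \<longrightarrow> k \<ge> 1) \<and>
  ((\<lambda>x. x * Re (Lfun (\<lambda>n. mangoldt n * chi n) (Complex (1 + x) t))) \<longlongrightarrow> - real k) (at_right 0)"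
proof -
 have ex: "\<exists>w\<in>{s. Re s > 0}. Lfun chi w \<noteq> 0"
  using Lfun_char_Re_gt_1(1)[OF assms(1,3), of 2] by (intro bexI[of _ 2]) auto
 have "Complex 1 t \<in> {s. Re s > 0}" by simp
 from logderiv_residue_limit[OF Lfun_char_holomorphic[OF assms] open_halfspace_Re_gt
   convex_connected[OF convex_halfspace_Re_gt] this ex]
 obtain k :: nat where k: "Lfun chi (Complex 1 t) = 0 \<longrightarrow> k \<ge> 1"
  "((\<lambda>x. of_real x * (deriv (Lfun chi) (Complex 1 t + of_real x) / Lfun chi (Complex 1 t + of_real x))) \<longlongrightarrow> of_nat k) (at_right 0)"
  by blast
 have "((\<lambda>x. - Re (of_real x * (deriv (Lfun chi) (Complex 1 t + of_real x) / Lfun chi (Complex 1 t + of_real x)))) \<longlongrightarrow> - real k) (at_right 0)"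
  by (rule tendsto_eq_rhs[OF tendsto_minus[OF tendsto_Re[OF k(2)]]]) simp
 moreover have "\<forall>\<^sub>F x in at_right 0. - Re (of_real x * (deriv (Lfun chi) (Complex 1 t + of_real x) / Lfun chi (Complex 1 t + of_real x)))
   = x * Re (Lfun (\<lambda>n. mangoldt n * chi n) (Complex (1 + x) t))"
 proof (rule eventually_at_rightI[of 0 1])
  fix x :: real assume "x \<in> {0<..<1}"
  then have "Re (Complex 1 t + of_real x) > 1" by simp
  moreover have "Complex 1 t + of_real x = Complex (1 + x) t" by (simp add: complex_eq_iff)
  ultimately show "- Re (of_real x * (deriv (Lfun chi) (Complex 1 t + of_real x) / Lfun chi (Complex 1 t + of_real x)))
   = x * Re (Lfun (\<lambda>n. mangoldt n * chi n) (Complex (1 + x) t))"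
   using Lfun_char_Re_gt_1[OF assms(1,3), of "Complex (1 + x) t"] by simp
 qed simp
 ultimately have "((\<lambda>x. x * Re (Lfun (\<lambda>n. mangoldt n * chi n) (Complex (1 + x) t))) \<longlongrightarrow> - real k) (at_right 0)"
  by (rule Lim_transform_eventually)
 then show ?thesis using k(1) by blast
qed

text \<open>With \<open>N\<close> equal to \<open>s - 1\<close> times the series of the principal
  character, the coefficients \<open>mangoldt\<close> give \<open>1 / (w - 1) - N' / N\<close>. At
  \<open>t = 0\<close> the first part contributes the residue 1 and \<open>N\<close> has no zero;
  elsewhere only a possible zero of \<open>N\<close> counts, with negative sign.\<close>

lemma principal_logderiv_limit:
 assumes "q > 1"
 shows "\<exists>k::nat. (t = 0 \<longrightarrow> k = 0) \<and>
  ((\<lambda>x. x * Re (Lfun (\<lambda>n. mangoldt n * principal_char q n) (Complex (1 + x) t))) \<longlongrightarrow> (if t = 0 then 1 else 0) - real k) (at_right 0)"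
proof -
 let ?Z = "Lfun (principal_char q)" and ?D = "Lfun (\<lambda>n. mangoldt n * principal_char q n)"
 obtain N where N: "N holomorphic_on {s. Re s > 0}" "N 1 \<noteq> 0" "\<And>s. Re s > 1 \<Longrightarrow> N s = (s - 1) * ?Z s"
  using principal_continuation[OF assms] by blast
 define z where "z = Complex 1 t"
 have ex: "\<exists>w\<in>{s. Re s > 0}. N w \<noteq> 0"
  using N(2) by (intro bexI[of _ 1]) auto
 have "z \<in> {s. Re s > 0}" by (simp add: z_def)
 from logderiv_residue_limit[OF N(1) open_halfspace_Re_gt convex_connected[OF convex_halfspace_Re_gt] this ex]
 obtain k :: nat where k: "N z \<noteq> 0 \<longrightarrow> k = 0"
  and lim: "((\<lambda>x. of_real x * (deriv N (z + of_real x) / N (z + of_real x))) \<longlongrightarrow> of_nat k) (at_right 0)"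
  by blast
 have k0: "k = 0" if "t = 0"
 proof -
  have "z = 1" using that by (simp add: z_def complex_eq_iff)
  then show ?thesis using k N(2) by simp
 qed
 have eq: "?D w = 1 / (w - 1) - deriv N w / N w" if w: "Re w > 1" for w
 proof -
  have nz: "?Z w \<noteq> 0" "deriv ?Z w = - ?D w * ?Z w"
   using Lfun_char_Re_gt_1[OF dirichlet_char_principal assms w] by auto
  have w1: "w \<noteq> 1" using w by auto
  have "(?Z has_field_derivative - Lfun (\<lambda>n. of_real (ln n) * principal_char q n) w) (at w)"
   by (rule Lfun_has_derivative[of _ 1 0]) (use w in \<open>auto simp: principal_char_def\<close>)
  then have "(?Z has_field_derivative deriv ?Z w) (at w)" using DERIV_imp_deriv by metis
  then have "((\<lambda>w. (w - 1) * ?Z w) has_field_derivative (1 - 0) * ?Z w + deriv ?Z w * (w - 1)) (at w)"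
   by (intro DERIV_mult DERIV_diff DERIV_ident DERIV_const)
  then have "(N has_field_derivative (1 - 0) * ?Z w + deriv ?Z w * (w - 1)) (at w)"
   by (rule has_field_derivative_transform_within_open[of _ _ _ "{s. Re s > 1}"])
    (use w N(3) open_halfspace_Re_gt in auto)
  then have "deriv N w = (1 - 0) * ?Z w + deriv ?Z w * (w - 1)" by (rule DERIV_imp_deriv)
  then have "deriv N w / N w = (?Z w - ?D w * ?Z w * (w - 1)) / ((w - 1) * ?Z w)"
   unfolding nz(2) N(3)[OF w] by simp
  also have "\<dots> = 1 / (w - 1) - ?D w" using nz(1) w1 by (simp add: diff_divide_distrib)
  finally show ?thesis by simp
 qed
 have "((\<lambda>x. Re (of_real x / (z + of_real x - 1))) \<longlongrightarrow> (if t = 0 then 1 else 0)) (at_right 0)"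
 proof (cases "t = 0")
  case True
  then have z1: "z = 1" by (simp add: z_def complex_eq_iff)
  have "\<forall>\<^sub>F x in at_right (0::real). 1 = Re (of_real x / (z + of_real x - 1))"
   by (rule eventually_at_rightI[of 0 1]) (auto simp: z1)
  then show ?thesis using True by (simp add: tendsto_eventually eventually_mono)
 next
  case False
  then have "z \<noteq> 1" by (auto simp: z_def complex_eq_iff)
  then have "((\<lambda>x. of_real x / (z + of_real x - 1)) \<longlongrightarrow> of_real 0 / (z + of_real 0 - 1)) (at_right 0)"
   by (intro tendsto_intros) auto
  then have "((\<lambda>x. Re (of_real x / (z + of_real x - 1))) \<longlongrightarrow> Re (of_real 0 / (z + of_real 0 - 1))) (at_right 0)"
   by (rule tendsto_Re)
  then show ?thesis using False by simp
 qed
 from tendsto_diff[OF this tendsto_Re[OF lim]]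
 have "((\<lambda>x. Re (of_real x / (z + of_real x - 1)) - Re (of_real x * (deriv N (z + of_real x) / N (z + of_real x))))
  \<longlongrightarrow> (if t = 0 then 1 else 0) - real k) (at_right 0)" by simp
 moreover have "\<forall>\<^sub>F x in at_right 0. Re (of_real x / (z + of_real x - 1)) - Re (of_real x * (deriv N (z + of_real x) / N (z + of_real x)))
   = x * Re (?D (Complex (1 + x) t))"
 proof (rule eventually_at_rightI[of 0 1])
  fix x :: real assume x: "x \<in> {0<..<1}"
  have zx: "z + of_real x = Complex (1 + x) t" by (simp add: complex_eq_iff z_def)
  have "?D (Complex (1 + x) t) = 1 / (Complex (1 + x) t - 1) - deriv N (Complex (1 + x) t) / N (Complex (1 + x) t)"
   using eq[of "Complex (1 + x) t"] x by simp
  then have "of_real x * ?D (Complex (1 + x) t) = of_real x / (z + of_real x - 1) - of_real x * (deriv N (z + of_real x) / N (z + of_real x))"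
   unfolding zx by (simp add: right_diff_distrib)
  then show "Re (of_real x / (z + of_real x - 1)) - Re (of_real x * (deriv N (z + of_real x) / N (z + of_real x)))
   = x * Re (?D (Complex (1 + x) t))"
   by (metis Re_complex_of_real minus_complex.simps(1) mult_zero_left diff_zero times_complex.simps(1) Im_complex_of_real)
 qed simp
 ultimately have "((\<lambda>x. x * Re (?D (Complex (1 + x) t))) \<longlongrightarrow> (if t = 0 then 1 else 0) - real k) (at_right 0)"
  by (rule Lim_transform_eventually)
 then show ?thesis using k0 by (intro exI[of _ k]) simp
qed

text \<open>A zero of order \<open>k2 \<ge> 1\<close> at \<open>1 + \<i> t\<close> would turn the
  3-4-1 inequality into \<open>3 - 4 * k2 - k3 \<ge> 0\<close>. In the excluded case,
  \<open>t = 0\<close> with \<open>chi^2\<close> principal, the last term has a pole instead, and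
  for a simple zero the inequality reads \<open>3 - 4 + 1 \<ge> 0\<close>.\<close>

lemma Lfun_nonzero_Re_eq_1_complex:
 assumes chi: "dirichlet_char q chi" "chi \<noteq> principal_char q" and q: "q > 1"
  and nr: "t \<noteq> 0 \<or> (\<lambda>n. (chi n)^2) \<noteq> principal_char q"
 shows "Lfun chi (Complex 1 t) \<noteq> 0"
proof
 assume zero: "Lfun chi (Complex 1 t) = 0"
 let ?D = "\<lambda>f. Lfun (\<lambda>n. mangoldt n * f n)"
 obtain k1 :: nat where k1: "((\<lambda>x. x * Re (?D (principal_char q) (Complex (1 + x) 0))) \<longlongrightarrow> 1) (at_right 0)"
  using principal_logderiv_limit[OF q, of 0] by auto
 obtain k2 :: nat where k2: "k2 \<ge> 1" "((\<lambda>x. x * Re (?D chi (Complex (1 + x) t))) \<longlongrightarrow> - real k2) (at_right 0)"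
  using Lfun_char_logderiv_limit[OF chi q, of t] zero by auto
 have d2: "dirichlet_char q (\<lambda>n. (chi n)^2)"
  using dirichlet_char_mult[OF chi(1) chi(1)] by (simp add: power2_eq_square)
 obtain k3 :: nat where k3: "((\<lambda>x. x * Re (?D (\<lambda>n. (chi n)^2) (Complex (1 + x) (2 * t)))) \<longlongrightarrow> - real k3) (at_right 0)"
 proof (cases "(\<lambda>n. (chi n)^2) = principal_char q")
  case True
  with nr have "2 * t \<noteq> 0" by simp
  then show ?thesis using principal_logderiv_limit[OF q, of "2 * t"] fun_cong[OF True] that by auto
 next
  case False
  then show ?thesis using Lfun_char_logderiv_limit[OF d2 False q, of "2 * t"] that by auto
 qed
 have "((\<lambda>x. 3 * (x * Re (?D (principal_char q) (Complex (1 + x) 0))) + 4 * (x * Re (?D chi (Complex (1 + x) t)))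
   + x * Re (?D (\<lambda>n. (chi n)^2) (Complex (1 + x) (2 * t)))) \<longlongrightarrow> 3 * 1 + 4 * (- real k2) + (- real k3)) (at_right 0)"
  by (intro tendsto_intros k1 k2(2) k3)
 moreover have "\<forall>\<^sub>F x in at_right 0. 0 \<le> 3 * (x * Re (?D (principal_char q) (Complex (1 + x) 0))) + 4 * (x * Re (?D chi (Complex (1 + x) t)))
   + x * Re (?D (\<lambda>n. (chi n)^2) (Complex (1 + x) (2 * t)))"
 proof (rule eventually_at_rightI[of 0 1])
  fix x :: real assume x: "x \<in> {0<..<1}"
  have "complex_of_real (1 + x) = Complex (1 + x) 0" by (simp add: complex_eq_iff)
  then have "0 \<le> x * (3 * Re (?D (principal_char q) (Complex (1 + x) 0)) + 4 * Re (?D chi (Complex (1 + x) t))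
   + Re (?D (\<lambda>n. (chi n)^2) (Complex (1 + x) (2 * t))))"
   using three_four_one[OF chi(1) q, of "1 + x" t] x by (intro mult_nonneg_nonneg) auto
  then show "0 \<le> 3 * (x * Re (?D (principal_char q) (Complex (1 + x) 0))) + 4 * (x * Re (?D chi (Complex (1 + x) t)))
   + x * Re (?D (\<lambda>n. (chi n)^2) (Complex (1 + x) (2 * t)))" by (simp add: algebra_simps)
 qed simp
 ultimately have "0 \<le> 3 * 1 + 4 * (- real k2) + (- real k3)"
  by (rule tendsto_lowerbound) simp
 then show False using k2(1) by simp
qed

text \<open>The divisors of \<open>p ^ k * m\<close> are the products \<open>p ^ i * d\<close> with
  \<open>i \<le> k\<close> and \<open>d\<close> dividing \<open>m\<close>, each once. This is the
  one-prime case of multiplicativity of divisor sums.\<close>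

lemma divisor_sum_prime_power:
 fixes g :: "nat \<Rightarrow> real"
 assumes g: "\<And>m n. g (m * n) = g m * g n" "g 1 = 1" and p: "prime p" and m: "m > 0" "\<not> p dvd m"
 shows "(\<Sum>d | d dvd p ^ k * m. g d) = (\<Sum>i\<le>k. g p ^ i) * (\<Sum>d | d dvd m. g d)"
proof -
 have gp: "g (p ^ i) = g p ^ i" for i by (induction i) (use g in auto)
 have mult: "multiplicity p (p ^ i * d) = i" if "d dvd m" for i d
 proof -
  have "\<not> p dvd d" using that m dvd_trans by blast
  moreover have "d \<noteq> 0" using that m by auto
  ultimately show ?thesis using p
   by (simp add: prime_elem_multiplicity_mult_distrib not_dvd_imp_multiplicity_0 prime_gt_0_nat multiplicity_same_power)
 qed
 have bij: "bij_betw (\<lambda>(i, d). p ^ i * d) ({..k} \<times> {d. d dvd m}) {d. d dvd p ^ k * m}"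
  unfolding bij_betw_def
 proof
  show "inj_on (\<lambda>(i, d). p ^ i * d) ({..k} \<times> {d. d dvd m})"
  proof (rule inj_onI, clarify)
   fix i d j e assume *: "d dvd m" "e dvd m" "p ^ i * d = p ^ j * e"
   then have "i = j" using mult[of d i] mult[of e j] by simp
   then show "i = j \<and> d = e" using * p by (simp add: prime_gt_0_nat)
  qed
  show "(\<lambda>(i, d). p ^ i * d) ` ({..k} \<times> {d. d dvd m}) = {d. d dvd p ^ k * m}"
  proof (intro equalityI subsetI)
   fix x assume "x \<in> (\<lambda>(i, d). p ^ i * d) ` ({..k} \<times> {d. d dvd m})"
   then show "x \<in> {d. d dvd p ^ k * m}" by (auto intro!: mult_dvd_mono le_imp_power_dvd)
  next
   fix x assume "x \<in> {d. d dvd p ^ k * m}"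
   then have x: "x dvd p ^ k * m" by simp
   moreover have "p ^ k * m \<noteq> 0" using m prime_gt_0_nat[OF p] by simp
   ultimately have "x \<noteq> 0" by (metis dvd_0_left_iff)
   moreover have "\<not> is_unit p" using p not_prime_unit by blast
   ultimately obtain e where e: "x = p ^ multiplicity p x * e" "\<not> p dvd e"
    using multiplicity_decompose'[of x p] by metis
   define i where "i = multiplicity p x"
   have ce: "coprime e (p ^ k)" "coprime (p ^ i) m"
    using prime_imp_coprime[OF p e(2)] prime_imp_coprime[OF p m(2)]
    by (simp_all only: coprime_commute coprime_power_left_iff coprime_power_right_iff) auto
   have "e dvd p ^ k * m" "p ^ i dvd p ^ k * m" using x e(1) unfolding i_def by (metis dvd_mult_left dvd_mult_right)+
   then have "e dvd m" "p ^ i dvd p ^ k"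
    using ce by (simp_all add: coprime_dvd_mult_right_iff coprime_dvd_mult_left_iff)
   then have "i \<le> k" using p by (meson power_dvd_imp_le prime_gt_1_nat)
   with \<open>e dvd m\<close> show "x \<in> (\<lambda>(i, d). p ^ i * d) ` ({..k} \<times> {d. d dvd m})"
    using e(1) unfolding i_def[symmetric] by (intro image_eqI[of _ _ "(i, e)"]) auto
  qed
 qed
 have "(\<Sum>d | d dvd p ^ k * m. g d) = (\<Sum>(i, d)\<in>{..k} \<times> {d. d dvd m}. g (p ^ i * d))"
  using sum.reindex_bij_betw[OF bij, of g, symmetric] by (simp add: case_prod_unfold)
 also have "\<dots> = (\<Sum>i\<le>k. \<Sum>d | d dvd m. g (p ^ i) * g d)"
  by (simp add: sum.cartesian_product g(1))
 finally show ?thesis by (simp add: gp sum_product)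
qed

text \<open>The local factor at a prime is \<open>1 + e + ... + e ^ k\<close> with \<open>e\<close>
  in \<open>{0, 1, -1}\<close>. It is never negative, and for even \<open>k\<close> it is at least
  1.\<close>

lemma divisor_sum_quadratic:
 fixes g :: "nat \<Rightarrow> real"
 assumes g: "\<And>m n. g (m * n) = g m * g n" "g 1 = 1" "\<And>n. g n \<in> {0, 1, -1}"
 shows "n > 0 \<Longrightarrow> 0 \<le> (\<Sum>d | d dvd n. g d)" "n > 0 \<Longrightarrow> 1 \<le> (\<Sum>d | d dvd n^2. g d)"
proof -
 have geo: "(\<Sum>i\<le>k. g p ^ i) \<ge> 0 \<and> (\<Sum>i\<le>2 * k. g p ^ i) \<ge> 1" for k p
 proof -
  have "(\<Sum>i\<le>k. (-1::real) ^ i) = (if even k then 1 else 0)" for k by (induction k) auto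
  moreover have "(\<Sum>i\<le>k. (0::real) ^ i) = 1" for k by (induction k) auto
  ultimately show ?thesis using g(3)[of p] by auto
 qed
 have "n > 0 \<longrightarrow> 0 \<le> (\<Sum>d | d dvd n. g d) \<and> 1 \<le> (\<Sum>d | d dvd n^2. g d)"
 proof (induction n rule: less_induct)
  case (less n)
  show ?case
  proof (cases "n > 1")
   case False
   then show ?thesis using g(2) by (cases n) (auto simp: power2_eq_square)
  next
   case True
   then obtain p where p: "prime p" "p dvd n" using prime_factor_nat[of n] by auto
   then have "\<not> is_unit p" using not_prime_unit by blast
   then obtain m where m: "n = p ^ multiplicity p n * m" "\<not> p dvd m"
    using multiplicity_decompose'[of n p] True by (metis not_one_less_zero)
   define k where "k = multiplicity p n"
   have nk: "n = p ^ k * m" using m(1) by (simp add: k_def)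
   have "k > 0" using p True by (simp add: k_def prime_multiplicity_gt_zero_iff)
   have m0: "m > 0" using m True by (cases m) auto
   have "p ^ k > 1" using one_less_power[OF prime_gt_1_nat[OF p(1)] \<open>k > 0\<close>] .
   then have "m < n" using nk m0 by simp
   have sq: "n^2 = p ^ (2 * k) * m^2" by (simp add: nk power_mult_distrib power_mult mult.commute)
   have nd: "\<not> p dvd m^2" using m(2) p(1) by (simp add: prime_dvd_power_iff)
   have "0 \<le> (\<Sum>i\<le>k. g p ^ i) * (\<Sum>d | d dvd m. g d)"
    using geo less.IH[OF \<open>m < n\<close>] m0 by simp
   moreover have "1 * 1 \<le> (\<Sum>i\<le>2 * k. g p ^ i) * (\<Sum>d | d dvd m^2. g d)"
    using geo less.IH[OF \<open>m < n\<close>] m0 by (intro mult_mono) (auto intro: order_trans[OF zero_le_one])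
   moreover have "m^2 > 0" using m0 by simp
   ultimately show ?thesis
    using divisor_sum_prime_power[of g, OF g(1,2) p(1) m0 m(2), of k, folded nk]
     divisor_sum_prime_power[of g, OF g(1,2) p(1) _ nd, of "2 * k", folded sq] by simp
  qed
 qed
 then show "n > 0 \<Longrightarrow> 0 \<le> (\<Sum>d | d dvd n. g d)" "n > 0 \<Longrightarrow> 1 \<le> (\<Sum>d | d dvd n^2. g d)" by auto
qed

lemma norm_sum_by_parts_decreasing:
 fixes g :: "nat \<Rightarrow> 'a::real_normed_vector"
 assumes "\<And>N. norm (\<Sum>i<N. g i) \<le> B" "\<And>n. b (Suc n) \<le> b n" "\<And>n. 0 \<le> (b n :: real)"
 shows "norm (\<Sum>k<N. b k *\<^sub>R g k) \<le> B * b 0"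
proof -
 have eq: "(\<Sum>k<N. b k *\<^sub>R g k) = b N *\<^sub>R (\<Sum>i<N. g i) + (\<Sum>k<N. (b k - b (Suc k)) *\<^sub>R (\<Sum>i<Suc k. g i))"
  by (induction N) (simp_all add: algebra_simps)
 have "norm (\<Sum>k<N. b k *\<^sub>R g k) \<le> B * b N + (\<Sum>k<N. B * (b k - b (Suc k)))"
  unfolding eq
 proof (rule order_trans[OF norm_triangle_ineq add_mono])
  show "norm (b N *\<^sub>R (\<Sum>i<N. g i)) \<le> B * b N"
   using mult_left_mono[OF assms(1)[of N] assms(3)[of N]] assms(3)[of N] by (simp add: mult.commute)
  show "norm (\<Sum>k<N. (b k - b (Suc k)) *\<^sub>R (\<Sum>i<Suc k. g i)) \<le> (\<Sum>k<N. B * (b k - b (Suc k)))"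
  proof (rule sum_norm_le)
   fix k
   have "0 \<le> b k - b (Suc k)" using assms(2)[of k] by simp
   then show "norm ((b k - b (Suc k)) *\<^sub>R (\<Sum>i<Suc k. g i)) \<le> B * (b k - b (Suc k))"
    using mult_left_mono[OF assms(1)[of "Suc k"], of "b k - b (Suc k)"]
    by (simp add: mult.commute del: sum.lessThan_Suc)
  qed
 qed
 also have "(\<Sum>k<N. B * (b k - b (Suc k))) = B * (b 0 - b N)"
  by (simp only: sum_distrib_left[symmetric] sum_lessThan_telescope')
 finally show ?thesis by (simp add: algebra_simps)
qed

lemma sum_divisors_swap:
 fixes F :: "nat \<Rightarrow> nat \<Rightarrow> 'a::comm_monoid_add"
 shows "(\<Sum>n\<in>{1..N}. \<Sum>d | d dvd n. F d (n div d)) = (\<Sum>d\<in>{1..N}. \<Sum>m\<in>{1..N div d}. F d m)"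
proof -
 have "(\<Sum>n\<in>{1..N}. \<Sum>d | d dvd n. F d (n div d)) = (\<Sum>(n, d)\<in>Sigma {1..N} (\<lambda>n. {d. d dvd n}). F d (n div d))"
  by (rule sum.Sigma) auto
 also have "\<dots> = (\<Sum>(d, m)\<in>Sigma {1..N} (\<lambda>d. {1..N div d}). F d m)"
 proof (rule sum.reindex_bij_witness[of _ "\<lambda>(d, m). (d * m, d)" "\<lambda>(n, d). (d, n div d)"])
  fix p assume "p \<in> Sigma {1..N} (\<lambda>d. {1..N div d})"
  then obtain d m where p: "p = (d, m)" "1 \<le> d" "1 \<le> m" "m \<le> N div d" by auto
  then have "d * m \<le> N" by (metis div_times_less_eq_dividend le_trans mult.commute mult_le_mono1)
  then show "(case p of (d, m) \<Rightarrow> (d * m, d)) \<in> Sigma {1..N} (\<lambda>n. {d. d dvd n})" using p by auto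
  show "(case case p of (d, m) \<Rightarrow> (d * m, d) of (n, d) \<Rightarrow> (d, n div d)) = p" using p by auto
 next
  fix p assume "p \<in> Sigma {1..N} (\<lambda>n. {d. d dvd n})"
  then obtain n d where p: "p = (n, d)" "1 \<le> n" "n \<le> N" "d dvd n" by auto
  then obtain k where k: "n = d * k" by blast
  then have "1 \<le> d" "1 \<le> k" using p by auto
  moreover have "d \<le> N" using p dvd_imp_le[of d n] by auto
  moreover have "k \<le> N div d" using k p \<open>1 \<le> d\<close> by (simp add: less_eq_div_iff_mult_less_eq mult.commute)
  ultimately show "(case p of (n, d) \<Rightarrow> (d, n div d)) \<in> Sigma {1..N} (\<lambda>d. {1..N div d})" using p k by auto
  show "(case case p of (n, d) \<Rightarrow> (d, n div d) of (d, m) \<Rightarrow> (d * m, d)) = p" using p by auto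
  show "(case case p of (n, d) \<Rightarrow> (d, n div d) of (d, m) \<Rightarrow> F d m) = (case p of (n, d) \<Rightarrow> F d (n div d))" using p by auto
 qed
 also have "\<dots> = (\<Sum>d\<in>{1..N}. \<Sum>m\<in>{1..N div d}. F d m)" by (rule sum.Sigma[symmetric]) auto
 finally show ?thesis .
qed

text \<open>Pair the exponents \<open>i\<close> and \<open>n - 1 - i\<close> and apply the
  inequality of arithmetic and geometric means; the geometric mean of each pair is
  \<open>y ^ (n - 1)\<close>.\<close>

lemma geometric_sum_lower_bound:
 fixes x y :: real
 assumes x: "0 < y" "y < 1" "x = y^2"
 shows "real n * y ^ (n - 1) \<le> (\<Sum>i<n. x ^ i)"
proof -
 have "(\<Sum>i<n. x ^ i) = (\<Sum>i<n. x ^ (n - Suc i))"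
  by (rule sum.nat_diff_reindex[symmetric])
 then have "2 * (\<Sum>i<n. x ^ i) = (\<Sum>i<n. x ^ i + x ^ (n - Suc i))" by (simp add: sum.distrib)
 also have "\<dots> \<ge> (\<Sum>i<n. 2 * y ^ (n - 1))"
 proof (rule sum_mono)
  fix i assume "i \<in> {..<n}"
  then have "y ^ (n - 1) = y ^ i * y ^ (n - Suc i)" by (simp flip: power_add)
  then show "2 * y ^ (n - 1) \<le> x ^ i + x ^ (n - Suc i)"
   using sum_squares_bound[of "y ^ i" "y ^ (n - Suc i)"] by (simp add: x(3) power_mult[symmetric] mult_ac)
 qed
 finally show ?thesis by simp
qed

text \<open>Monsky's argument: if \<open>L(1, chi) = 0\<close>, then the Lambert series of \<open>chi\<close> stays bounded as
 \<open>x\<close> tends to \<open>1\<close>, although its coefficients \<open>\<Sum>d|n. chi(d)\<close> are non-negative and at least \<open>1\<close> at squares.\<close>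

lemma Lfun_nonzero_at_1_quadratic:
 assumes chi: "dirichlet_char q chi" "chi \<noteq> principal_char q" and q: "q > 1"
  and sq: "(\<lambda>n. (chi n)^2) = principal_char q"
 shows "Lfun chi 1 \<noteq> 0"
proof
 assume L0: "Lfun chi 1 = 0"
 define g where "g n = Re (chi n)" for n
 have chi3: "chi n \<in> {0, 1, -1}" for n
 proof -
  have "(chi n)^2 = 0 \<or> (chi n)^2 = 1" using fun_cong[OF sq, of n] by (auto simp: principal_char_def)
  then show ?thesis by (auto simp: power2_eq_1_iff)
 qed
 have cg: "chi n = of_real (g n)" for n using chi3[of n] by (auto simp: g_def)
 have g: "g (m * n) = g m * g n" "g 1 = 1" "g n \<in> {0, 1, -1}" for m n
 proof -
  have "complex_of_real (g (m * n)) = of_real (g m * g n)"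
   using dirichlet_charD(3)[OF chi(1), of m n] unfolding cg by simp
  then show "g (m * n) = g m * g n" by (simp only: of_real_eq_iff)
  show "g 1 = 1" "g n \<in> {0, 1, -1}"
   using dirichlet_charD(1)[OF chi(1)] chi3[of n] by (auto simp: g_def)
 qed
 have g1: "\<bar>g n\<bar> \<le> 1" for n using g(3)[of n] by auto
 define c where "c n = (\<Sum>d | d dvd n. g d)" for n
 have c: "n > 0 \<Longrightarrow> c n \<ge> 0" "n > 0 \<Longrightarrow> c (n^2) \<ge> 1" for n
  unfolding c_def using divisor_sum_quadratic[of g n] g by auto
 have bound: "(\<Sum>m\<in>{1..M}. x ^ m^2) \<le> real q" if x: "0 < x" "x < 1" for x M
 proof -
  have xn: "x ^ n < 1" if "n > 0" for n using x that by (simp add: power_less_one_iff)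
  \<comment> \<open>The singular part of a Lambert term at \<open>x = 1\<close> minus the term
    itself. The singular parts sum to \<open>L(1, chi) / (1 - x) = 0\<close>, and \<open>b\<close>
    decreases from the value 1, so summation by parts leaves at most the bound \<open>q\<close> for
    the partial sums of \<open>chi\<close>.\<close>
  define b where "b k = 1 / (real (Suc k) * (1 - x)) - x ^ Suc k / (1 - x ^ Suc k)" for k
  define y where "y = sqrt x"
  have y: "0 < y" "y < 1" "x = y^2" using x by (auto simp: y_def)
  have gs: "1 - x ^ n = (1 - x) * (\<Sum>i<n. x ^ i)" for n using one_diff_power_eq[of x n] by simp
  have ge: "real n * x ^ n \<le> (\<Sum>i<n. x ^ i)" for n
  proof -
   have "(\<Sum>i<n. x ^ n) \<le> (\<Sum>i<n. x ^ i)" using x by (intro sum_mono power_decreasing) auto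
   then show ?thesis by simp
  qed
  have b0: "b k \<ge> 0" for k
  proof -
   have "x ^ Suc k * (real (Suc k) * (1 - x)) \<le> 1 - x ^ Suc k"
    unfolding gs using ge[of "Suc k"] x by (simp add: mult.commute mult.assoc mult_left_mono del: of_nat_Suc sum.lessThan_Suc power_Suc)
   then show ?thesis unfolding b_def using x xn[of "Suc k"] by (simp add: divide_simps del: of_nat_Suc power_Suc)
  qed
  \<comment> \<open>In terms of the geometric sums \<open>S1\<close> and \<open>S2\<close>,
    monotonicity is the inequality \<open>n * (n + 1) * x ^ n \<le> S1 * S2\<close>, which follows
    from the lower bounds obtained by pairing.\<close>
  have bdec: "b (Suc k) \<le> b k" for k
  proof -
   define n where "n = Suc k"
   have n: "n > 0" "real n > 0" by (auto simp: n_def)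
   define S1 S2 where "S1 = (\<Sum>i<n. x ^ i)" and "S2 = (\<Sum>i<Suc n. x ^ i)"
   have S: "real n * y ^ (n - 1) \<le> S1" "real (Suc n) * y ^ n \<le> S2"
    using geometric_sum_lower_bound[OF y, of n] geometric_sum_lower_bound[OF y, of "Suc n"] by (auto simp: S1_def S2_def)
   have "x ^ n = y ^ (2 * n)" by (simp add: y(3) power_mult)
   also have "\<dots> \<le> y ^ (n - 1 + n)" using y by (intro power_decreasing) auto
   finally have "real n * real (Suc n) * x ^ n \<le> real n * real (Suc n) * y ^ (n - 1 + n)"
    by (intro mult_left_mono) auto
   also have "\<dots> = (real n * y ^ (n - 1)) * (real (Suc n) * y ^ n)" by (simp add: power_add)
   also have "\<dots> \<le> S1 * S2" using S y n by (intro mult_mono) (auto simp: S1_def intro!: sum_nonneg)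
   finally have key: "real n * real (Suc n) * x ^ n \<le> S1 * S2" .
   have Spos: "S1 > 0" "S2 > 0" using S y n by (auto intro: less_le_trans[OF _ S(1)] less_le_trans[OF _ S(2)])
   have e1: "x ^ n / (1 - x ^ n) - x ^ Suc n / (1 - x ^ Suc n) = x ^ n / ((1 - x) * (S1 * S2))"
   proof -
    have "x ^ n / (1 - x ^ n) - x ^ Suc n / (1 - x ^ Suc n) = x ^ n * (1 - x) / ((1 - x ^ n) * (1 - x ^ Suc n))"
     using xn[of n] xn[of "Suc n"] n by (simp add: diff_frac_eq) (simp add: algebra_simps)
    also have "\<dots> = x ^ n / ((1 - x) * (S1 * S2))"
     unfolding gs S1_def[symmetric] S2_def[symmetric] using x Spos by (simp add: divide_simps)
    finally show ?thesis .
   qed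
   have e2: "1 / (real n * (1 - x)) - 1 / (real (Suc n) * (1 - x)) = 1 / ((1 - x) * (real n * real (Suc n)))"
    using x n by (simp add: divide_simps)
   have "x ^ n / (S1 * S2) \<le> 1 / (real n * real (Suc n))"
    using key Spos n by (simp add: divide_simps mult_ac del: of_nat_Suc)
   then have "x ^ n / (S1 * S2) / (1 - x) \<le> 1 / (real n * real (Suc n)) / (1 - x)"
    using x by (intro divide_right_mono) auto
   then have "x ^ n / ((1 - x) * (S1 * S2)) \<le> 1 / ((1 - x) * (real n * real (Suc n)))"
    by (simp only: divide_divide_eq_left mult.commute[of "1 - x"])
   with e1 e2 have "x ^ n / (1 - x ^ n) - x ^ Suc n / (1 - x ^ Suc n) \<le> 1 / (real n * (1 - x)) - 1 / (real (Suc n) * (1 - x))"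
    by simp
   then show ?thesis unfolding b_def n_def by linarith
  qed
  have hb: "(\<Sum>d\<in>{1..N}. g d * (x ^ d / (1 - x ^ d))) = (\<Sum>k<N. g (Suc k) / real (Suc k)) / (1 - x) - (\<Sum>k<N. b k *\<^sub>R g (Suc k))" for N
  proof -
   have "(\<Sum>d\<in>{1..N}. g d * (x ^ d / (1 - x ^ d))) = (\<Sum>k<N. g (Suc k) * (x ^ Suc k / (1 - x ^ Suc k)))"
    by (rule sum.reindex_bij_witness[of _ Suc "\<lambda>n. n - 1"]) auto
   also have "\<dots> = (\<Sum>k<N. g (Suc k) / real (Suc k) / (1 - x) - b k *\<^sub>R g (Suc k))"
    by (intro sum.cong refl) (simp add: b_def algebra_simps del: of_nat_Suc power_Suc)
   finally show ?thesis by (simp only: sum_subtractf sum_divide_distrib)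
  qed
  \<comment> \<open>Truncation at \<open>N\<close> cuts the inner geometric series; each of the
    \<open>N\<close> tails is at most \<open>x ^ N / (1 - x)\<close>, and \<open>N * x ^ N\<close>
    tends to 0.\<close>
  have upper: "(\<Sum>n\<in>{1..N}. c n * x ^ n) \<le> (\<Sum>k<N. g (Suc k) / real (Suc k)) / (1 - x) + real q + real N * (x ^ N / (1 - x))" for N
  proof -
   have "(\<Sum>n\<in>{1..N}. c n * x ^ n) = (\<Sum>n\<in>{1..N}. \<Sum>d | d dvd n. g d * x ^ (d * (n div d)))"
    unfolding c_def sum_distrib_right by (intro sum.cong refl) auto
   also have "\<dots> = (\<Sum>d\<in>{1..N}. \<Sum>k\<in>{1..N div d}. g d * x ^ (d * k))" by (rule sum_divisors_swap)
   also have "\<dots> \<le> (\<Sum>d\<in>{1..N}. g d * (x ^ d / (1 - x ^ d)) + x ^ N / (1 - x))"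
   proof (rule sum_mono)
    fix d assume d: "d \<in> {1..N}"
    define K where "K = N div d"
    have xd: "x ^ d < 1" "x ^ d \<le> x" using xn[of d] power_decreasing[of 1 d x] d x by auto
    have "(\<Sum>k\<in>{1..K}. g d * x ^ (d * k)) = g d * (\<Sum>k\<in>{1..K}. (x ^ d) ^ k)"
     by (simp add: sum_distrib_left power_mult)
    also have "(\<Sum>k\<in>{1..K}. (x ^ d) ^ k) = x ^ d / (1 - x ^ d) - x ^ (d * Suc K) / (1 - x ^ d)"
    proof -
     have "(\<Sum>k\<in>{1..K}. y ^ k) * (1 - y) = y - y ^ Suc K" for y :: real
     proof (induction K)
      case (Suc K)
      have "(\<Sum>k\<in>{1..Suc K}. y ^ k) * (1 - y) = (\<Sum>k\<in>{1..K}. y ^ k) * (1 - y) + y ^ Suc K * (1 - y)" by (simp add: distrib_right)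
      also have "\<dots> = y - y ^ Suc (Suc K)" unfolding Suc by (simp add: algebra_simps)
      finally show ?case .
     qed simp
     from this[of "x ^ d"] show ?thesis
      unfolding power_mult[of x d "Suc K"] using xd by (simp add: eq_divide_eq diff_divide_distrib[symmetric] del: power_Suc)
    qed
    finally have "(\<Sum>k\<in>{1..K}. g d * x ^ (d * k)) = g d * (x ^ d / (1 - x ^ d)) - g d * (x ^ (d * Suc K) / (1 - x ^ d))"
     by (simp add: right_diff_distrib)
    moreover have "\<bar>g d * (x ^ (d * Suc K) / (1 - x ^ d))\<bar> \<le> 1 * (x ^ N / (1 - x))"
     unfolding abs_mult
    proof (intro mult_mono g1)
     have "x ^ (d * Suc K) \<le> x ^ N"
      using dividend_less_times_div[of d N] d x unfolding K_def by (intro power_decreasing) auto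
     then show "\<bar>x ^ (d * Suc K) / (1 - x ^ d)\<bar> \<le> x ^ N / (1 - x)"
      unfolding abs_divide using x xd by (intro frac_le) auto
    qed auto
    ultimately show "(\<Sum>k\<in>{1..N div d}. g d * x ^ (d * k)) \<le> g d * (x ^ d / (1 - x ^ d)) + x ^ N / (1 - x)"
     unfolding K_def by linarith
   qed
   also have "\<dots> = (\<Sum>d\<in>{1..N}. g d * (x ^ d / (1 - x ^ d))) + real N * (x ^ N / (1 - x))" by (simp add: sum.distrib)
   finally have "(\<Sum>n\<in>{1..N}. c n * x ^ n) \<le> \<dots>" .
   moreover have "\<bar>\<Sum>k<N. b k *\<^sub>R g (Suc k)\<bar> \<le> real q * 1"
   proof -
    have pg: "\<bar>\<Sum>i<N. g (Suc i)\<bar> \<le> real q" for N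
    proof -
     have "(\<Sum>i<N. chi (Suc i)) = of_real (\<Sum>i<N. g (Suc i))" by (simp add: cg)
     then show ?thesis using dirichlet_char_partial_sums[OF chi q, of N] by (simp only: norm_of_real)
    qed
    have "b 0 = 1" using x by (simp add: b_def field_simps)
    then show ?thesis using norm_sum_by_parts_decreasing[of "\<lambda>k. g (Suc k)" "real q" b N] pg bdec b0 by simp
   qed
   ultimately show ?thesis unfolding hb by linarith
  qed
  have "(\<lambda>k. chi (Suc k) / of_nat (Suc k) powr 1) sums 0"
   using Lfun_Abel(2)[OF dirichlet_char_partial_sums[OF chi q], of 1]
    Lfun_eq_Abel[OF dirichlet_char_partial_sums[OF chi q], of 1] L0 by simp
  then have "(\<lambda>k. Re (chi (Suc k) / of_nat (Suc k))) sums Re 0"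
   by (intro sums_Re) simp
  then have "(\<lambda>k. g (Suc k) / real (Suc k)) sums 0" by (simp add: g_def del: of_nat_Suc)
  then have g0: "(\<lambda>N. \<Sum>k<N. g (Suc k) / real (Suc k)) \<longlonglongrightarrow> 0" by (simp only: sums_def)
  have "(\<lambda>N. real N * x ^ N) \<longlonglongrightarrow> 0" by (rule powser_times_n_limit_0) (use x in simp)
  then have "(\<lambda>N. (\<Sum>k<N. g (Suc k) / real (Suc k)) / (1 - x) + real q + real N * x ^ N / (1 - x)) \<longlonglongrightarrow> 0 / (1 - x) + real q + 0 / (1 - x)"
   using x by (intro tendsto_intros g0) auto
  moreover have "\<forall>\<^sub>F N in sequentially. (\<Sum>m\<in>{1..M}. x ^ m^2)
    \<le> (\<Sum>k<N. g (Suc k) / real (Suc k)) / (1 - x) + real q + real N * x ^ N / (1 - x)"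
   using eventually_ge_at_top[of "M^2"]
  proof eventually_elim
   case (elim N)
   have "(\<Sum>m\<in>{1..M}. x ^ m^2) \<le> (\<Sum>m\<in>{1..M}. c (m^2) * x ^ m^2)"
    using c(2) x by (intro sum_mono) auto
   also have "\<dots> = (\<Sum>n\<in>(\<lambda>m. m^2) ` {1..M}. c n * x ^ n)"
    by (subst sum.reindex) (auto simp: inj_on_def)
   also have "\<dots> \<le> (\<Sum>n\<in>{1..N}. c n * x ^ n)"
   proof (rule sum_mono2)
    have "m^2 \<le> N" if "m \<le> M" for m using order_trans[OF power_mono[OF that] elim] by simp
    then show "(\<lambda>m. m^2) ` {1..M} \<subseteq> {1..N}" by auto
   qed (use c(1) x in auto)
   finally show ?case using upper[of N] by simp
  qed
  ultimately show ?thesis using tendsto_lowerbound[of _ _ sequentially] by force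
 qed
 \<comment> \<open>As \<open>x\<close> tends to 1, the sum over \<open>q + 1\<close> squares tends
   to \<open>q + 1\<close>, beyond the uniform bound \<open>q\<close>.\<close>
 have "((\<lambda>x::real. \<Sum>m\<in>{1..q+1}. x ^ m^2) \<longlongrightarrow> (\<Sum>m\<in>{1..q+1}. 1 ^ m^2)) (at_left 1)"
  by (intro tendsto_intros)
 moreover have "\<forall>\<^sub>F x in at_left (1::real). (\<Sum>m\<in>{1..q+1}. x ^ m^2) \<le> real q"
 proof (rule eventually_at_leftI[of 0])
  fix x :: real assume "x \<in> {0<..<1}"
  then show "(\<Sum>m\<in>{1..q+1}. x ^ m^2) \<le> real q" by (intro bound) auto
 qed simp
 ultimately have "(\<Sum>m\<in>{1..q+1}. (1::real) ^ m^2) \<le> real q"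
  by (rule tendsto_upperbound) simp
 then show False by simp
qed

theorem Lfun_nonzero_Re_eq_1:
 assumes chi: "dirichlet_char q chi" "chi \<noteq> principal_char q" and q: "q > 1" and s: "Re s \<ge> 1"
 shows "Lfun chi s \<noteq> 0"
proof (cases "Re s = 1")
 case False
 then show ?thesis using Lfun_char_Re_gt_1(1)[OF chi(1) q] s by simp
next
 case True
 then have s1: "s = Complex 1 (Im s)" by (simp add: complex_eq_iff)
 show ?thesis
 proof (cases "Im s \<noteq> 0 \<or> (\<lambda>n. (chi n)^2) \<noteq> principal_char q")
  case True
  then show ?thesis using Lfun_nonzero_Re_eq_1_complex[OF chi q, of "Im s"] s1 by simp
 next
  case False
  then have "s = 1" using s1 by (simp add: complex_eq_iff)
  then show ?thesis using Lfun_nonzero_at_1_quadratic[OF chi q] False by simp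
 qed
qed

subsection \<open>Laplace transforms and mean squares\<close>

lemma exp_decay_integral:
 fixes w :: complex
 assumes "Re w > 0"
 shows "integrable lborel (\<lambda>v. indicator {a..} v *\<^sub>R exp (- w * of_real v))"
  "(\<integral>v. indicator {a..} v *\<^sub>R exp (- w * of_real v) \<partial>lborel) = exp (- w * of_real a) / w"
proof -
 let ?f = "\<lambda>v. indicator {a..} v *\<^sub>R exp (- w * of_real v)"
 define r where "r = Re w"
 have r: "r > 0" using assms by (simp add: r_def)
 have lim0: "((\<lambda>x. exp (- r * x)) \<longlongrightarrow> 0) at_top"
  using r by real_asymp
 have limF: "((\<lambda>x. - exp (- r * x) / r) \<longlongrightarrow> 0) at_top"
  using r by real_asymp
 have "(\<integral>\<^sup>+x\<in>{a ..}. ennreal (exp (- r * x)) \<partial>lborel) = 0 - (- exp (- r * a) / r)"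
  by (rule nn_integral_FTC_atLeast[where F = "\<lambda>x. - exp (- r * x) / r"])
   (use r limF in \<open>auto intro!: derivative_eq_intros\<close>)
 moreover have "(\<integral>\<^sup>+x. norm (?f x) \<partial>lborel) = (\<integral>\<^sup>+x\<in>{a ..}. ennreal (exp (- r * x)) \<partial>lborel)"
  by (intro nn_integral_cong) (auto simp: r_def split: split_indicator)
 ultimately show int: "integrable lborel ?f"
  by (intro integrableI_bounded) auto
 have lim1: "((\<lambda>y. \<integral>x. indicator {..y} x *\<^sub>R ?f x \<partial>lborel) \<longlongrightarrow> (\<integral>x. ?f x \<partial>lborel)) at_top"
  by (rule tendsto_integral_at_top[OF _ int]) simp
 have ev: "\<forall>\<^sub>F y in at_top. exp (- w * of_real a) / w - exp (- w * of_real y) / w = (\<integral>x. indicator {..y} x *\<^sub>R ?f x \<partial>lborel)"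
 proof (rule eventually_at_top_linorderI[of a])
  fix y assume y: "a \<le> y"
  have "(\<integral>x. indicator {..y} x *\<^sub>R ?f x \<partial>lborel) = (\<integral>x. indicator {a..y} x *\<^sub>R exp (- w * of_real x) \<partial>lborel)"
   by (intro Bochner_Integration.integral_cong) (auto split: split_indicator)
  also have "\<dots> = (- exp (- w * of_real y) / w) - (- exp (- w * of_real a) / w)"
  proof (rule integral_FTC_atLeastAtMost[OF y])
   fix x
   have "((\<lambda>z. - exp (- w * z) / w) has_field_derivative exp (- w * of_real x)) (at (of_real x))"
    using assms by (auto intro!: derivative_eq_intros)
   then show "((\<lambda>x. - exp (- w * of_real x) / w) has_vector_derivative exp (- w * of_real x)) (at x within {a..y})"
    by (rule has_vector_derivative_real_field)
  qed (auto intro!: continuous_intros)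
  finally show "exp (- w * of_real a) / w - exp (- w * of_real y) / w = (\<integral>x. indicator {..y} x *\<^sub>R ?f x \<partial>lborel)" by simp
 qed
 have lim2: "((\<lambda>y. exp (- w * of_real a) / w - exp (- w * of_real y) / w) \<longlongrightarrow> exp (- w * of_real a) / w - 0 / w) at_top"
 proof (intro tendsto_intros)
  show "((\<lambda>y. exp (- w * of_real y)) \<longlongrightarrow> 0) at_top"
   by (rule Lim_null_comparison[OF _ lim0]) (auto simp: r_def)
 qed (use assms in auto)
 have "(\<integral>x. ?f x \<partial>lborel) = exp (- w * of_real a) / w - 0 / w"
  by (rule tendsto_unique[OF trivial_limit_at_top_linorder lim1 Lim_transform_eventually[OF lim2 ev]])
 then show "(\<integral>v. ?f v \<partial>lborel) = exp (- w * of_real a) / w" by simp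
qed

lemma Fubini_dominated:
 fixes h :: "real \<Rightarrow> real \<Rightarrow> complex"
 assumes h: "case_prod h \<in> borel_measurable (lborel \<Otimes>\<^sub>M lborel)"
  and a: "integrable lborel a" and b: "integrable lborel b" and le: "\<And>x y. norm (h x y) \<le> a x * b y"
 shows "(\<integral>y. \<integral>x. h x y \<partial>lborel \<partial>lborel) = (\<integral>x. \<integral>y. h x y \<partial>lborel \<partial>lborel)"
  "integrable lborel (\<lambda>x. \<integral>y. h x y \<partial>lborel)"
  "\<And>x. (\<lambda>y. h x y) \<in> borel_measurable borel \<Longrightarrow> integrable lborel (\<lambda>y. h x y)"
proof -
 have ab: "integrable (lborel \<Otimes>\<^sub>M lborel) (\<lambda>p. a (fst p) * b (snd p))"
 proof (rule lborel_pair.Fubini_integrable)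
  show "(\<lambda>p. a (fst p) * b (snd p)) \<in> borel_measurable (lborel \<Otimes>\<^sub>M lborel)"
   using borel_measurable_integrable[OF a] borel_measurable_integrable[OF b] by measurable
  show "integrable lborel (\<lambda>x. \<integral>y. norm (a (fst (x, y)) * b (snd (x, y))) \<partial>lborel)"
   using a b by (simp add: abs_mult)
  show "AE x in lborel. integrable lborel (\<lambda>y. a (fst (x, y)) * b (snd (x, y)))"
   using b by simp
 qed
 have int: "integrable (lborel \<Otimes>\<^sub>M lborel) (case_prod h)"
  by (rule Bochner_Integration.integrable_bound[OF ab h]) (use le in \<open>auto simp: case_prod_unfold intro!: AE_I2 order_trans[OF _ abs_ge_self]\<close>)
 show "(\<integral>y. \<integral>x. h x y \<partial>lborel \<partial>lborel) = (\<integral>x. \<integral>y. h x y \<partial>lborel \<partial>lborel)"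
  by (rule lborel_pair.Fubini_integral[OF int])
 show "integrable lborel (\<lambda>x. \<integral>y. h x y \<partial>lborel)"
  using lborel_pair.integrable_fst[OF int] by simp
 show "integrable lborel (\<lambda>y. h x y)" if "(\<lambda>y. h x y) \<in> borel_measurable borel" for x
  by (rule Bochner_Integration.integrable_bound[of _ "\<lambda>y. a x * b y"])
   (use b that le in \<open>auto intro!: AE_I2 order_trans[OF _ abs_ge_self]\<close>)
qed

section \<open>Inversion of the Laplace transform with Gaussian smoothing\<close>

text \<open>The characteristic function of the standard normal distribution, rescaled. A Gaussian
  damping with parameter \<open>d\<close> in \<open>t\<close> corresponds to a normal density of
  width \<open>d\<close> in \<open>u\<close>.\<close>

lemma gaussian_Fourier:
 fixes d u :: real
 assumes "d > 0"
 shows "integrable lborel (\<lambda>t. exp (\<i> * of_real (t * u)) * of_real (exp (- (d * t)\<^sup>2 / 2)))"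
  "(\<integral>t. exp (\<i> * of_real (t * u)) * of_real (exp (- (d * t)\<^sup>2 / 2)) \<partial>lborel) = of_real (2 * pi * normal_density 0 d u)"
proof -
 define c where "c = sqrt (2 * pi)"
 have c: "c > 0" "c^2 = 2 * pi" by (auto simp: c_def)
 let ?g = "\<lambda>x. std_normal_density x *\<^sub>R exp (\<i> * of_real (u / d * x))"
 have int: "integrable lborel ?g"
  by (rule Bochner_Integration.integrable_bound[OF integrable_normal_density[where \<mu> = 0 and \<sigma> = 1]]) auto
 have val: "(\<integral>x. ?g x \<partial>lborel) = of_real (exp (- (u / d)\<^sup>2 / 2))"
 proof -
  have "of_real (exp (- (u / d)\<^sup>2 / 2)) = char std_normal_distribution (u / d)"
   by (simp add: char_std_normal_distribution)
  also have "\<dots> = (\<integral>x. ?g x \<partial>lborel)"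
   unfolding char_def by (subst integral_density) auto
  finally show ?thesis by simp
 qed
 have eq: "exp (\<i> * of_real (t * u)) * of_real (exp (- (d * t)\<^sup>2 / 2)) = c *\<^sub>R ?g (0 + d * t)" for t
  using assms by (simp add: std_normal_density_def c_def scaleR_conv_of_real mult_ac)
 have "integrable lborel (\<lambda>t. ?g (0 + d * t))"
  by (rule lborel_integrable_real_affine[OF int]) (use assms in simp)
 then show "integrable lborel (\<lambda>t. exp (\<i> * of_real (t * u)) * of_real (exp (- (d * t)\<^sup>2 / 2)))"
  unfolding eq by (rule integrable_scaleR_right)
 have "(\<integral>x. ?g x \<partial>lborel) = \<bar>d\<bar> *\<^sub>R (\<integral>t. ?g (0 + d * t) \<partial>lborel)"
  by (rule lborel_integral_real_affine) (use assms in simp)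
 then have "(\<integral>t. ?g (0 + d * t) \<partial>lborel) = of_real (exp (- (u / d)\<^sup>2 / 2) / d)"
  using val assms by (simp add: scaleR_conv_of_real field_simps)
 then have "(\<integral>t. exp (\<i> * of_real (t * u)) * of_real (exp (- (d * t)\<^sup>2 / 2)) \<partial>lborel) = of_real (c * (exp (- (u / d)\<^sup>2 / 2) / d))"
  unfolding eq by (simp add: scaleR_conv_of_real)
 also have "c * (exp (- (u / d)\<^sup>2 / 2) / d) = 2 * pi * normal_density 0 d u"
  using assms c by (simp add: normal_density_def real_sqrt_mult c_def power_divide field_simps)
 finally show "(\<integral>t. exp (\<i> * of_real (t * u)) * of_real (exp (- (d * t)\<^sup>2 / 2)) \<partial>lborel) = of_real (2 * pi * normal_density 0 d u)" .
qed

text \<open>The term \<open>d^2 / 2 * s^2\<close> in the exponent makes the inversion integral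
  absolutely convergent, so that Fubini applies. Integrating over \<open>t\<close> first produces
  the convolution of \<open>A\<close> with a normal density in place of \<open>A\<close>.\<close>

lemma Laplace_inversion_smoothed:
 fixes A :: "real \<Rightarrow> complex"
 assumes A: "A \<in> borel_measurable borel" "integrable lborel (\<lambda>v. A v * of_real (exp (- c * v)))" and d: "d > 0"
 shows "(\<integral>t. (\<integral>v. A v * exp (- Complex c t * of_real v) \<partial>lborel) * exp (Complex c t * of_real y + of_real (d^2 / 2) * (Complex c t)^2) \<partial>lborel)
  = of_real (2 * pi) * (\<integral>v. A v * of_real (normal_density 0 d (y - v)) \<partial>lborel)"
proof -
 define G where "G t v = A v * exp (- Complex c t * of_real v) * exp (Complex c t * of_real y + of_real (d^2 / 2) * (Complex c t)^2)" for t v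
 define k where "k = exp (c * y + d^2 / 2 * c^2)"
 define a where "a t = k * exp (- (d * t)\<^sup>2 / 2)" for t
 define b where "b v = norm (A v) * exp (- c * v)" for v
 have Cm[measurable]: "(\<lambda>t. Complex c t) \<in> borel_measurable borel"
  by (simp add: Complex_eq)
 have G_meas: "case_prod G \<in> borel_measurable (lborel \<Otimes>\<^sub>M lborel)"
  unfolding G_def using A(1) by measurable
 have int_a: "integrable lborel a"
  using integrable_norm[OF gaussian_Fourier(1)[OF d, of 0]] unfolding a_def by (intro integrable_mult_right) (simp add: norm_mult)
 have int_b: "integrable lborel b"
  unfolding b_def using integrable_norm[OF A(2)] by (simp add: norm_mult)
 have Gb: "norm (G t v) \<le> a t * b v" for t v
 proof -
  have r: "Re (of_real r * w) = r * Re w" for r w by simp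
  have "Re (Complex c t * of_real y) = c * y" "Re ((Complex c t)^2) = c^2 - t^2"
   by (simp_all add: power2_eq_square)
  then have "Re (Complex c t * of_real y + of_real (d^2 / 2) * (Complex c t)^2) = (c * y + d^2 / 2 * c^2) + - (d * t)\<^sup>2 / 2"
   by (simp only: plus_complex.sel r) (simp add: power2_eq_square field_simps)
  then have "norm (exp (Complex c t * of_real y + of_real (d^2 / 2) * (Complex c t)^2)) = a t"
   unfolding norm_exp_eq_Re a_def k_def exp_add[symmetric] by (rule arg_cong[where f = exp])
  moreover have "norm (exp (- Complex c t * of_real v)) = exp (- c * v)" by simp
  ultimately show ?thesis unfolding G_def norm_mult b_def by (simp only: mult_ac)
 qed
 have inner: "(\<integral>t. G t v \<partial>lborel) = of_real (2 * pi) * (A v * of_real (normal_density 0 d (y - v)))" for v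
 proof -
  \<comment> \<open>Completing the square: the real part \<open>c\<close> of \<open>s\<close> shifts
    the argument by \<open>d^2 * c\<close>, and the factor produced by the shift restores the
    density at \<open>y - v\<close>.\<close>
  define u where "u = y - v + d^2 * c"
  have "G t v = (A v * of_real (exp (c * (y - v) + d^2 * c^2 / 2))) * (exp (\<i> * of_real (t * u)) * of_real (exp (- (d * t)\<^sup>2 / 2)))" for t
  proof -
   have "- Complex c t * of_real v + (Complex c t * of_real y + of_real (d^2 / 2) * (Complex c t)^2)
    = of_real (c * (y - v) + d^2 * c^2 / 2) + (\<i> * of_real (t * u) + of_real (- (d * t)\<^sup>2 / 2))"
    by (simp add: complex_eq_iff u_def power2_eq_square field_simps)
   then show ?thesis
    unfolding G_def by (simp only: mult.assoc exp_add[symmetric] exp_of_real[symmetric])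
  qed
  then have "(\<integral>t. G t v \<partial>lborel) = (A v * of_real (exp (c * (y - v) + d^2 * c^2 / 2))) * of_real (2 * pi * normal_density 0 d u)"
   using gaussian_Fourier[OF d, of u] by simp
  also have "exp (c * (y - v) + d^2 * c^2 / 2) * normal_density 0 d u = normal_density 0 d (y - v)"
  proof -
   have "c * (y - v) + d^2 * c^2 / 2 + - (u^2 / (2 * d^2)) = - ((y - v)^2 / (2 * d^2))"
    using d by (simp add: u_def power2_eq_square field_simps)
   then have "exp (c * (y - v) + d^2 * c^2 / 2) * exp (- (u^2 / (2 * d^2))) = exp (- ((y - v)^2 / (2 * d^2)))"
    by (simp only: exp_add[symmetric])
   then show ?thesis by (simp add: normal_density_def field_simps)
  qed
  then have "(A v * of_real (exp (c * (y - v) + d^2 * c^2 / 2))) * of_real (2 * pi * normal_density 0 d u)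
   = of_real (2 * pi) * (A v * of_real (normal_density 0 d (y - v)))"
   by (metis (no_types, opaque_lifting) mult.assoc mult.left_commute of_real_mult)
  finally show ?thesis .
 qed
 have "(\<integral>t. (\<integral>v. A v * exp (- Complex c t * of_real v) \<partial>lborel) * exp (Complex c t * of_real y + of_real (d^2 / 2) * (Complex c t)^2) \<partial>lborel)
  = (\<integral>t. \<integral>v. G t v \<partial>lborel \<partial>lborel)"
  unfolding G_def by (rule Bochner_Integration.integral_cong) (simp_all add: integral_mult_left_zero)
 also have "\<dots> = (\<integral>v. \<integral>t. G t v \<partial>lborel \<partial>lborel)"
  by (rule Fubini_dominated(1)[OF G_meas int_a int_b Gb, symmetric])
 also have "\<dots> = of_real (2 * pi) * (\<integral>v. A v * of_real (normal_density 0 d (y - v)) \<partial>lborel)"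
  unfolding inner by (rule integral_mult_right_zero)
 finally show ?thesis .
qed

lemma integrable_inverse_1_plus_square': "integrable lborel (\<lambda>t::real. 1 / (1 + t^2))"
 using integrable_inverse_1_plus_square by (simp add: set_integrable_def inverse_eq_divide)

lemma integral_inverse_1_plus_square': "integral\<^sup>L lborel (\<lambda>t::real. 1 / (1 + t^2)) = pi"
 using LBINT_inverse_1_plus_square
 by (simp add: interval_lebesgue_integral_def set_lebesgue_integral_def inverse_eq_divide)

text \<open>Cauchy's theorem for a rectangle in terms of a primitive: the vertical integrals are
  differences of its values, and the horizontal differences are \<open>O(1 / (1 + T^2))\<close> by
  the mean value bound.\<close>

lemma vertical_line_shift:
 fixes g :: "complex \<Rightarrow> complex"
 assumes hol: "g holomorphic_on {s. Re s > 0}" and ab: "0 < a" "a \<le> b"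
  and bd: "\<And>x t. a \<le> x \<Longrightarrow> x \<le> b \<Longrightarrow> norm (g (Complex x t)) \<le> B / (1 + t^2)"
 shows "(\<integral>t. g (Complex a t) \<partial>lborel) = (\<integral>t. g (Complex b t) \<partial>lborel)"
proof -
 let ?S = "{s. Re s > 0}"
 have cv: "convex ?S" "open ?S" by (auto simp: convex_halfspace_Re_gt open_halfspace_Re_gt)
 obtain \<Gamma> where \<Gamma>: "\<And>s. s \<in> ?S \<Longrightarrow> (\<Gamma> has_field_derivative g s) (at s)"
  using holomorphic_convex_primitive'[OF cv hol] at_within_open[OF _ cv(2)] by metis
 have contg: "continuous_on ?S g" by (rule holomorphic_on_imp_continuous_on[OF hol])
 have cont: "continuous_on UNIV (\<lambda>t. g (Complex x t))" if "x > 0" for x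
  by (rule continuous_on_compose2[OF contg]) (use that in \<open>auto simp: Complex_eq intro!: continuous_intros\<close>)
 have int: "integrable lborel (\<lambda>t. g (Complex x t))" if x: "a \<le> x" "x \<le> b" for x
 proof (rule Bochner_Integration.integrable_bound)
  show "integrable lborel (\<lambda>t. B * (1 / (1 + t^2)))" by (intro integrable_mult_right integrable_inverse_1_plus_square')
  show "(\<lambda>t. g (Complex x t)) \<in> borel_measurable lborel"
   using cont[of x] x ab by (simp add: borel_measurable_continuous_onI)
  show "AE t in lborel. norm (g (Complex x t)) \<le> norm (B * (1 / (1 + t^2)))"
   using bd[OF x] by (intro AE_I2 order_trans[OF _ abs_ge_self[of "B * (1 / (1 + _^2))", folded real_norm_def]]) simp
 qed
 have seg: "(\<integral>t. indicator {-T..T} t *\<^sub>R g (Complex x t) \<partial>lborel) = - \<i> * (\<Gamma> (Complex x T) - \<Gamma> (Complex x (-T)))"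
  if x: "x > 0" "T \<ge> 0" for x T
 proof -
  have "(\<integral>t. indicator {-T..T} t *\<^sub>R g (Complex x t) \<partial>lborel) = (- \<i> * \<Gamma> (Complex x T)) - (- \<i> * \<Gamma> (Complex x (-T)))"
  proof (rule integral_FTC_atLeastAtMost)
   fix t
   have "((\<lambda>z. - \<i> * \<Gamma> (of_real x + \<i> * z)) has_field_derivative - \<i> * (g (of_real x + \<i> * of_real t) * \<i>)) (at (of_real t))"
    by (intro DERIV_cmult DERIV_chain2[OF \<Gamma>]) (use x in \<open>auto intro!: derivative_eq_intros\<close>)
   then have "((\<lambda>t. - \<i> * \<Gamma> (of_real x + \<i> * of_real t)) has_vector_derivative - \<i> * (g (of_real x + \<i> * of_real t) * \<i>)) (at t within {-T..T})"
    by (rule has_vector_derivative_real_field)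
   moreover have "- \<i> * (w * \<i>) = w" for w by (simp add: complex_eq_iff)
   ultimately show "((\<lambda>t. - \<i> * \<Gamma> (Complex x t)) has_vector_derivative g (Complex x t)) (at t within {-T..T})"
    by (simp only: Complex_eq)
  qed (use x continuous_on_subset[OF cont[OF x(1)]] in auto)
  then show ?thesis by (simp add: algebra_simps)
 qed
 have hor: "norm (\<Gamma> (Complex a T) - \<Gamma> (Complex b T)) \<le> B / (1 + T^2) * (b - a)" for T
 proof -
  have "norm (\<Gamma> (Complex a T) - \<Gamma> (Complex b T)) \<le> B / (1 + T^2) * norm (Complex a T - Complex b T)"
  proof (rule field_differentiable_bound[where S = "closed_segment (Complex a T) (Complex b T)" and f' = g])
   fix z assume "z \<in> closed_segment (Complex a T) (Complex b T)"
   then obtain u where u: "0 \<le> u" "u \<le> 1" "z = (1 - u) *\<^sub>R Complex a T + u *\<^sub>R Complex b T"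
    by (auto simp: closed_segment_def)
   define x where "x = a + u * (b - a)"
   have z: "z = Complex x T" by (simp add: u(3) complex_eq_iff x_def algebra_simps)
   have x: "a \<le> x" "x \<le> b" using u ab mult_left_le_one_le[of "b - a" u] by (auto simp: x_def)
   show "norm (g z) \<le> B / (1 + T^2)" unfolding z by (rule bd[OF x])
   show "(\<Gamma> has_field_derivative g z) (at z within closed_segment (Complex a T) (Complex b T))"
    by (rule has_field_derivative_at_within[OF \<Gamma>]) (use x ab z in auto)
  qed auto
  also have "Complex a T - Complex b T = of_real (a - b)" by (simp add: complex_eq_iff)
  finally show ?thesis using ab by (simp only: norm_of_real) simp
 qed
 have lim: "((\<lambda>T. \<integral>t. indicator {-T..T} t *\<^sub>R g (Complex x t) \<partial>lborel) \<longlongrightarrow> (\<integral>t. g (Complex x t) \<partial>lborel)) at_top"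
  if x: "a \<le> x" "x \<le> b" for x
 proof (rule tendsto_at_topI_sequentially)
  fix X :: "nat \<Rightarrow> real" assume X: "filterlim X at_top sequentially"
  show "(\<lambda>n. \<integral>t. indicator {- X n..X n} t *\<^sub>R g (Complex x t) \<partial>lborel) \<longlonglongrightarrow> (\<integral>t. g (Complex x t) \<partial>lborel)"
  proof (rule integral_dominated_convergence[OF _ _ integrable_norm[OF int[OF x]]])
   show "AE t in lborel. (\<lambda>n. indicator {- X n..X n} t *\<^sub>R g (Complex x t)) \<longlonglongrightarrow> g (Complex x t)"
   proof (rule AE_I2, rule tendsto_eventually)
    fix t
    have "\<forall>\<^sub>F n in sequentially. \<bar>t\<bar> \<le> X n" using X by (simp add: filterlim_at_top)
    then show "\<forall>\<^sub>F n in sequentially. indicator {- X n..X n} t *\<^sub>R g (Complex x t) = g (Complex x t)"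
     by eventually_elim (auto simp: abs_le_iff)
   qed
  qed (use int[OF x] in \<open>auto split: split_indicator\<close>)
 qed
 have "((\<lambda>T. (\<integral>t. indicator {-T..T} t *\<^sub>R g (Complex a t) \<partial>lborel) - (\<integral>t. indicator {-T..T} t *\<^sub>R g (Complex b t) \<partial>lborel)) \<longlongrightarrow> 0) at_top"
 proof (rule Lim_null_comparison)
  show "((\<lambda>T. 2 * B * (b - a) / (1 + T^2)) \<longlongrightarrow> 0) at_top" by real_asymp
  show "\<forall>\<^sub>F T in at_top. norm ((\<integral>t. indicator {-T..T} t *\<^sub>R g (Complex a t) \<partial>lborel) - (\<integral>t. indicator {-T..T} t *\<^sub>R g (Complex b t) \<partial>lborel)) \<le> 2 * B * (b - a) / (1 + T^2)"
  proof (rule eventually_at_top_linorderI[of 0])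
   fix T :: real assume T: "0 \<le> T"
   have "(\<integral>t. indicator {-T..T} t *\<^sub>R g (Complex a t) \<partial>lborel) - (\<integral>t. indicator {-T..T} t *\<^sub>R g (Complex b t) \<partial>lborel)
    = - \<i> * ((\<Gamma> (Complex a T) - \<Gamma> (Complex b T)) - (\<Gamma> (Complex a (-T)) - \<Gamma> (Complex b (-T))))"
    unfolding seg[OF ab(1) T] seg[OF less_le_trans[OF ab] T] by (simp add: algebra_simps)
   also have "norm \<dots> \<le> norm (\<Gamma> (Complex a T) - \<Gamma> (Complex b T)) + norm (\<Gamma> (Complex a (-T)) - \<Gamma> (Complex b (-T)))"
    by (simp add: norm_mult norm_triangle_ineq4)
   also have "\<dots> \<le> B / (1 + T^2) * (b - a) + B / (1 + (-T)^2) * (b - a)" by (intro add_mono hor)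
   finally show "norm ((\<integral>t. indicator {-T..T} t *\<^sub>R g (Complex a t) \<partial>lborel) - (\<integral>t. indicator {-T..T} t *\<^sub>R g (Complex b t) \<partial>lborel)) \<le> 2 * B * (b - a) / (1 + T^2)"
    by simp
  qed
 qed
 moreover have "((\<lambda>T. (\<integral>t. indicator {-T..T} t *\<^sub>R g (Complex a t) \<partial>lborel) - (\<integral>t. indicator {-T..T} t *\<^sub>R g (Complex b t) \<partial>lborel))
  \<longlongrightarrow> (\<integral>t. g (Complex a t) \<partial>lborel) - (\<integral>t. g (Complex b t) \<partial>lborel)) at_top"
  by (intro tendsto_diff lim) (use ab in auto)
 ultimately have "(\<integral>t. g (Complex a t) \<partial>lborel) - (\<integral>t. g (Complex b t) \<partial>lborel) = 0"
  using tendsto_unique[OF trivial_limit_at_top_linorder] by blast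
 then show ?thesis by simp
qed

text \<open>One factor \<open>1 + t^2\<close> is the growth allowed for the transform, the other is
  traded for the integrable \<open>1 / (1 + t^2)\<close>. The source is
  \<open>z^2 / 2 \<le> exp z\<close> at \<open>z = (d * t)^2 / 2\<close>.\<close>

lemma power4_le_gaussian:
 fixes d t :: real
 assumes "d > 0"
 shows "(1 + t^2)^2 * exp (- (d * t)\<^sup>2 / 2) \<le> 2 + 16 / d ^ 4"
proof -
 define z where "z = (d * t)^2 / 2"
 have z: "z \<ge> 0" by (simp add: z_def)
 have e: "z^2 / 2 \<le> exp z" using exp_lower_Taylor_quadratic[OF z] z by linarith
 have "t ^ 4 = 4 * z^2 / d ^ 4" using assms by (simp add: z_def power2_eq_square power4_eq_xxxx field_simps)
 also have "\<dots> = 8 / d ^ 4 * (z^2 / 2)" by simp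
 also have "\<dots> \<le> 8 / d ^ 4 * exp z" using e assms by (intro mult_left_mono) auto
 finally have t4: "t ^ 4 \<le> 8 / d ^ 4 * exp z" .
 have "(1 + t^2)^2 \<le> 2 + 2 * t ^ 4"
  using sum_squares_bound[of 1 "t^2"] by (simp add: power2_eq_square power4_eq_xxxx algebra_simps)
 also have "\<dots> \<le> 2 * exp z + 16 / d ^ 4 * exp z" using t4 z by (intro add_mono) simp_all
 also have "\<dots> = (2 + 16 / d ^ 4) * exp z" by (simp only: distrib_right)
 finally have "(1 + t^2)^2 * exp (- z) \<le> (2 + 16 / d ^ 4) * exp z * exp (- z)" by (intro mult_right_mono) auto
 then show ?thesis by (simp add: z_def mult.assoc flip: exp_add)
qed

text \<open>The inversion formula on a line \<open>Re s = a\<close> to which the Laplace transform has been continued.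
 The Gaussian factor makes every integral absolutely convergent.\<close>

lemma Laplace_inversion_shifted:
 fixes A :: "real \<Rightarrow> complex" and f :: "complex \<Rightarrow> complex"
 assumes A: "A \<in> borel_measurable borel" "integrable lborel (\<lambda>v. A v * of_real (exp (- b * v)))"
  and f: "f holomorphic_on {s. Re s > 0}" "\<And>s. Re s = b \<Longrightarrow> f s = (\<integral>v. A v * exp (- s * of_real v) \<partial>lborel)"
  and ab: "0 < a" "a \<le> b" and bd: "\<And>x t. a \<le> x \<Longrightarrow> x \<le> b \<Longrightarrow> norm (f (Complex x t)) \<le> C * (1 + t^2)"
  and d: "d > 0"
 shows "of_real (2 * pi) * (\<integral>v. A v * of_real (normal_density 0 d (y - v)) \<partial>lborel)
  = (\<integral>t. f (Complex a t) * exp (Complex a t * of_real y + of_real (d^2 / 2) * (Complex a t)^2) \<partial>lborel)"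
proof -
 define g where "g s = f s * exp (s * of_real y + of_real (d^2 / 2) * s^2)" for s
 have C: "C \<ge> 0" using order_trans[OF norm_ge_zero bd[of a 0]] ab by simp
 define k where "k = exp (b * \<bar>y\<bar> + d^2 / 2 * b^2)"
 have "(\<integral>t. g (Complex a t) \<partial>lborel) = (\<integral>t. g (Complex b t) \<partial>lborel)"
 proof (rule vertical_line_shift[OF _ ab])
  show "g holomorphic_on {s. Re s > 0}" unfolding g_def by (intro holomorphic_intros f)
  fix x t assume x: "a \<le> x" "x \<le> b"
  have x0: "x > 0" using x ab by simp
  have "norm (exp (Complex x t * of_real y + of_real (d^2 / 2) * (Complex x t)^2)) = exp (x * y + d^2 / 2 * x^2 + - (d * t)\<^sup>2 / 2)"
   unfolding norm_exp_eq_Re by (simp add: power2_eq_square field_simps)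
  also have "\<dots> = exp (x * y + d^2 / 2 * x^2) * exp (- (d * t)\<^sup>2 / 2)" by (simp only: exp_add)
  also have "\<dots> \<le> k * exp (- (d * t)\<^sup>2 / 2)"
  proof (rule mult_right_mono)
   have "x * y \<le> x * \<bar>y\<bar>" "x * \<bar>y\<bar> \<le> b * \<bar>y\<bar>"
    using x x0 by (auto intro: mult_left_mono mult_right_mono)
   moreover have "d^2 / 2 * x^2 \<le> d^2 / 2 * b^2" using x x0 by (intro mult_left_mono power_mono) auto
   ultimately show "exp (x * y + d^2 / 2 * x^2) \<le> k" unfolding k_def exp_le_cancel_iff by linarith
  qed simp
  finally have n: "norm (exp (Complex x t * of_real y + of_real (d^2 / 2) * (Complex x t)^2)) \<le> k * exp (- (d * t)\<^sup>2 / 2)" .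
  have "norm (g (Complex x t)) \<le> (C * (1 + t^2)) * (k * exp (- (d * t)\<^sup>2 / 2))"
   unfolding g_def norm_mult using bd[OF x] n C by (intro mult_mono) auto
  also have "\<dots> = C * k * ((1 + t^2)^2 * exp (- (d * t)\<^sup>2 / 2)) / (1 + t^2)"
   by (simp add: power2_eq_square add_nonneg_eq_0_iff)
  also have "\<dots> \<le> C * k * (2 + 16 / d ^ 4) / (1 + t^2)"
   using power4_le_gaussian[OF d, of t] C by (intro divide_right_mono mult_left_mono) (auto simp: k_def)
  finally show "norm (g (Complex x t)) \<le> C * k * (2 + 16 / d ^ 4) / (1 + t^2)" .
 qed
 also have "\<dots> = of_real (2 * pi) * (\<integral>v. A v * of_real (normal_density 0 d (y - v)) \<partial>lborel)"
  unfolding g_def Laplace_inversion_smoothed[OF A d, symmetric] by (simp add: f(2))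
 finally show ?thesis unfolding g_def by simp
qed

section \<open>Kernels, windows and mean squares\<close>

abbreviation window_integral :: "(real \<Rightarrow> real) \<Rightarrow> real \<Rightarrow> ennreal" where
 "window_integral f x \<equiv> \<integral>\<^sup>+t\<in>{x - 1/2..x + 1/2}. ennreal (f t) \<partial>lborel"

text \<open>The kernel is the modulus of the Fourier transform of
  \<open>exp (- \<bar>v - Y\<bar> / H)\<close> at the frequency \<open>t - s\<close>. It has width
  of order \<open>1 / H\<close> and integral \<open>2 * pi\<close> for every
  \<open>H\<close>.\<close>

abbreviation kernel_form :: "real \<Rightarrow> (real \<Rightarrow> complex) \<Rightarrow> ennreal" where
 "kernel_form H F \<equiv> \<integral>\<^sup>+s. \<integral>\<^sup>+t. ennreal (norm (F t) * norm (F s) * (2 * H / (1 + H^2 * (t - s)^2))) \<partial>lborel \<partial>lborel"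

abbreviation mean_square :: "(real \<Rightarrow> real) \<Rightarrow> (real \<Rightarrow> complex) \<Rightarrow> real \<Rightarrow> ennreal" where
 "mean_square w E Y \<equiv> \<integral>\<^sup>+y\<in>{0..Y}. ennreal (w y * (norm (E y))^2) \<partial>lborel"

text \<open>Normal densities of width \<open>1 / Suc n\<close> form an approximate identity. After
  rescaling, the Gaussian absorbs the growth \<open>exp (2 * \<bar>v\<bar>)\<close> of
  \<open>A\<close>, and dominated convergence applies.\<close>

lemma smoothing_limit:
 fixes A :: "real \<Rightarrow> complex"
 assumes A: "A \<in> borel_measurable borel" "\<And>v. norm (A v) \<le> C * exp (2 * \<bar>v\<bar>)" and cont: "isCont A y"
 shows "(\<lambda>n. \<integral>v. A v * of_real (normal_density 0 (1 / Suc n) (y - v)) \<partial>lborel) \<longlonglongrightarrow> A y"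
proof -
 let ?n = "std_normal_density"
 have C: "C \<ge> 0" using order_trans[OF norm_ge_zero A(2)[of 0]] by simp
 define d where "d n = 1 / real (Suc n)" for n
 have d: "d n > 0" "d n \<le> 1" for n by (auto simp: d_def)
 have eq: "(\<integral>v. A v * of_real (normal_density 0 (d n) (y - v)) \<partial>lborel) = (\<integral>u. A (y + - d n * u) * of_real (?n u) \<partial>lborel)" for n
 proof -
  have "d n * normal_density 0 (d n) (d n * u) = ?n u" for u
   using d[of n] by (simp add: normal_density_def real_sqrt_mult power_mult_distrib)
  then have "d n *\<^sub>R (A (y + - d n * u) * of_real (normal_density 0 (d n) (y - (y + - d n * u)))) = A (y + - d n * u) * of_real (?n u)" for u
   by (simp add: scaleR_conv_of_real mult.left_commute flip: of_real_mult)
  moreover have "(\<integral>v. A v * of_real (normal_density 0 (d n) (y - v)) \<partial>lborel)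
   = \<bar>- d n\<bar> *\<^sub>R (\<integral>u. A (y + - d n * u) * of_real (normal_density 0 (d n) (y - (y + - d n * u))) \<partial>lborel)"
   by (rule lborel_integral_real_affine) (use d[of n] in auto)
  ultimately show ?thesis using d[of n] by (simp flip: integral_scaleR_right)
 qed
 have "(\<lambda>n. \<integral>u. A (y + - d n * u) * of_real (?n u) \<partial>lborel) \<longlonglongrightarrow> (\<integral>u. A y * of_real (?n u) \<partial>lborel)"
 proof (rule integral_dominated_convergence)
  show "integrable lborel (\<lambda>u. C * exp (2 * \<bar>y\<bar>) * exp 4 * sqrt 2 * normal_density 0 (sqrt 2) u)"
   by (intro integrable_mult_right integrable_normal_density) simp
  show "(\<lambda>u. A y * of_real (?n u)) \<in> borel_measurable lborel" by measurable
  show "(\<lambda>u. A (y + - d n * u) * of_real (?n u)) \<in> borel_measurable lborel" for n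
   using A(1) by measurable
  show "AE u in lborel. (\<lambda>n. A (y + - d n * u) * of_real (?n u)) \<longlonglongrightarrow> A y * of_real (?n u)"
  proof (rule AE_I2)
   fix u
   have "(\<lambda>n. y + - d n * u) \<longlonglongrightarrow> y" unfolding d_def by real_asymp
   then have "(\<lambda>n. A (y + - d n * u)) \<longlonglongrightarrow> A y" by (rule isCont_tendsto_compose[OF cont])
   then show "(\<lambda>n. A (y + - d n * u) * of_real (?n u)) \<longlonglongrightarrow> A y * of_real (?n u)" by (intro tendsto_intros)
  qed
  show "AE u in lborel. norm (A (y + - d n * u) * of_real (?n u)) \<le> C * exp (2 * \<bar>y\<bar>) * exp 4 * sqrt 2 * normal_density 0 (sqrt 2) u" for n
  proof (rule AE_I2)
   fix u
   have "\<bar>d n * u\<bar> \<le> \<bar>u\<bar>" using d[of n] by (simp add: abs_mult mult_left_le_one_le)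
   then have "\<bar>y + - d n * u\<bar> \<le> \<bar>y\<bar> + \<bar>u\<bar>" using abs_triangle_ineq[of y "- d n * u"] by simp
   then have 1: "norm (A (y + - d n * u)) \<le> C * exp (2 * \<bar>y\<bar> + 2 * \<bar>u\<bar>)"
    using C by (intro order_trans[OF A(2)] mult_left_mono) auto
   \<comment> \<open>This gives \<open>2 * \<bar>u\<bar> - u^2 / 2 \<le> 4 - u^2 / 4\<close>: the
     growth costs a factor \<open>exp 4\<close> and doubles the variance, whence
     \<open>sqrt 2\<close> in the majorant.\<close>
   have "0 \<le> (\<bar>u\<bar> / 2 - 2)^2" by simp
   then have "2 * \<bar>u\<bar> - u\<^sup>2 / 2 \<le> 4 - u^2 / 4" by (simp add: power2_eq_square algebra_simps)
   then have "exp (2 * \<bar>u\<bar>) * exp (- u\<^sup>2 / 2) \<le> exp 4 * exp (- u\<^sup>2 / 4)" by (simp flip: exp_add)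
   moreover have "normal_density 0 (sqrt 2) u = exp (- u\<^sup>2 / 4) / (sqrt 2 * sqrt (2 * pi))"
    by (simp add: normal_density_def real_sqrt_mult)
   then have "sqrt 2 * normal_density 0 (sqrt 2) u = exp (- u\<^sup>2 / 4) / sqrt (2 * pi)" by simp
   moreover have "?n u = exp (- u\<^sup>2 / 2) / sqrt (2 * pi)"
    by (simp add: normal_density_def)
   ultimately have 2: "exp (2 * \<bar>u\<bar>) * ?n u \<le> exp 4 * (sqrt 2 * normal_density 0 (sqrt 2) u)"
    by (simp add: divide_right_mono)
   have "norm (A (y + - d n * u) * of_real (?n u)) = norm (A (y + - d n * u)) * ?n u"
    by (simp add: norm_mult)
   also have "\<dots> \<le> C * exp (2 * \<bar>y\<bar> + 2 * \<bar>u\<bar>) * ?n u"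
    using 1 by (rule mult_right_mono) simp
   also have "\<dots> = C * exp (2 * \<bar>y\<bar>) * (exp (2 * \<bar>u\<bar>) * ?n u)" by (simp add: exp_add mult_ac)
   also have "\<dots> \<le> C * exp (2 * \<bar>y\<bar>) * (exp 4 * (sqrt 2 * normal_density 0 (sqrt 2) u))"
    using 2 C by (intro mult_left_mono) auto
   finally show "norm (A (y + - d n * u) * of_real (?n u)) \<le> C * exp (2 * \<bar>y\<bar>) * exp 4 * sqrt 2 * normal_density 0 (sqrt 2) u"
    by (simp add: mult_ac)
  qed
 qed
 moreover have "(\<integral>u. A y * of_real (?n u) \<partial>lborel) = A y"
  by (simp add: integral_mult_right_zero)
 ultimately have "(\<lambda>n. \<integral>v. A v * of_real (normal_density 0 (d n) (y - v)) \<partial>lborel) \<longlonglongrightarrow> A y"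
  unfolding eq by (simp only:)
 then show ?thesis by (simp only: d_def)
qed

lemma two_sided_exp_Fourier:
 fixes H u :: real
 assumes "H > 0"
 shows "integrable lborel (\<lambda>v. exp (- \<bar>v - Y\<bar> / H))"
  "norm (\<integral>v. of_real (exp (- \<bar>v - Y\<bar> / H)) * exp (\<i> * of_real (u * v)) \<partial>lborel) = 2 * H / (1 + H^2 * u^2)"
proof -
 define f where "f = (\<lambda>v. of_real (exp (- \<bar>v\<bar> / H)) * exp (\<i> * of_real (u * v)) :: complex)"
 define w where "w s = Complex (1 / H) (- s)" for s :: real
 have Rw: "Re (w s) > 0" for s using assms by (simp add: w_def)
 define g where "g s = (\<lambda>v. indicator {0..} v *\<^sub>R exp (- w s * of_real v))" for s
 have g: "integrable lborel (g s)" "integral\<^sup>L lborel (g s) = 1 / w s" for s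
  using exp_decay_integral[OF Rw[of s], of 0] by (simp_all add: g_def)
 have g': "integrable lborel (\<lambda>v. g s (0 + (-1) * v))" for s
  by (rule lborel_integrable_real_affine[OF g(1)]) simp
 have ig': "(\<integral>v. g s (0 + (-1) * v) \<partial>lborel) = 1 / w s" for s
  using lborel_integral_real_affine[of "-1" "g s" 0] g(2)[of s] by simp
 have ae: "AE v in lborel. f v = g u v + g (- u) (0 + (-1) * v)"
 proof (rule AE_mp[OF AE_lborel_singleton[of 0] AE_I2], rule impI)
  fix v :: real assume "v \<noteq> 0"
  have e: "- w s * of_real v = of_real (- v / H) + \<i> * of_real (s * v)" for s v
   by (simp add: w_def complex_eq_iff)
  show "f v = g u v + g (- u) (0 + (-1) * v)"
   unfolding f_def g_def e exp_add exp_of_real using \<open>v \<noteq> 0\<close> by (cases "v > 0") auto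
 qed
 have fm[measurable]: "f \<in> borel_measurable borel" unfolding f_def by measurable
 have fi: "integrable lborel f"
  using integrable_cong_AE[OF _ _ ae] g(1)[of u] g'[of "- u"] borel_measurable_integrable[OF g'[of "-u"]]
   borel_measurable_integrable[OF g(1)[of u]] by (simp add: Bochner_Integration.integrable_add)
 have "integral\<^sup>L lborel f = (\<integral>v. g u v + g (- u) (0 + (-1) * v) \<partial>lborel)"
  by (rule integral_cong_AE[OF _ _ ae])
   (use borel_measurable_integrable[OF g'[of "-u"]] borel_measurable_integrable[OF g(1)[of u]] in simp_all)
 also have "\<dots> = 1 / w u + 1 / w (- u)"
  using g(1)[of u] g'[of "- u"] by (simp only: Bochner_Integration.integral_add g(2) ig')
 also have "\<dots> = of_real (2 * H / (1 + H^2 * u^2))"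
 proof -
  have "w u + w (- u) = of_real (2 / H)" "w u * w (- u) = of_real (1 / H^2 + u^2)"
   by (simp_all add: w_def complex_eq_iff power2_eq_square)
  moreover have "w u \<noteq> 0" "w (- u) \<noteq> 0" using Rw[of u] Rw[of "- u"] by auto
  moreover from this have "1 / w u + 1 / w (- u) = (w u + w (- u)) / (w u * w (- u))"
   by (simp add: add_divide_distrib)
  ultimately have "1 / w u + 1 / w (- u) = of_real (2 / H) / of_real (1 / H^2 + u^2)" by simp
  also have "\<dots> = of_real (2 / H / (1 / H^2 + u^2))" by simp
  also have "2 / H / (1 / H^2 + u^2) = 2 * H / (1 + H^2 * u^2)"
   using assms by (simp add: power2_eq_square divide_simps mult_ac)
  finally show ?thesis .
 qed
 finally have val: "integral\<^sup>L lborel f = of_real (2 * H / (1 + H^2 * u^2))" .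
 have "integrable lborel (\<lambda>v. norm (f (- Y + 1 * v)))"
  by (intro integrable_norm lborel_integrable_real_affine[OF fi]) simp
 then show "integrable lborel (\<lambda>v. exp (- \<bar>v - Y\<bar> / H))"
  by (simp add: f_def norm_mult)
 have "integral\<^sup>L lborel f = \<bar>1\<bar> *\<^sub>R (\<integral>v. f (- Y + 1 * v) \<partial>lborel)"
  by (rule lborel_integral_real_affine) simp
 also have "\<dots> = (\<integral>v. exp (- \<i> * of_real (u * Y)) * (of_real (exp (- \<bar>v - Y\<bar> / H)) * exp (\<i> * of_real (u * v))) \<partial>lborel)"
  unfolding f_def by (simp add: exp_add[symmetric] exp_diff[symmetric] algebra_simps exp_of_real[symmetric])
 also have "\<dots> = exp (- \<i> * of_real (u * Y)) * (\<integral>v. of_real (exp (- \<bar>v - Y\<bar> / H)) * exp (\<i> * of_real (u * v)) \<partial>lborel)"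
  by (rule integral_mult_right_zero)
 finally have "norm (integral\<^sup>L lborel f) = norm (\<integral>v. of_real (exp (- \<bar>v - Y\<bar> / H)) * exp (\<i> * of_real (u * v)) \<partial>lborel)"
  by (simp add: norm_mult)
 then show "norm (\<integral>v. of_real (exp (- \<bar>v - Y\<bar> / H)) * exp (\<i> * of_real (u * v)) \<partial>lborel) = 2 * H / (1 + H^2 * u^2)"
  unfolding val norm_of_real using assms by (simp add: add_nonneg_nonneg)
qed

text \<open>Expand the square of the Fourier integral and integrate over \<open>y\<close> first: the
  weight turns the oscillation of frequency \<open>t - s\<close> into the kernel. Absolute values
  are taken inside, so afterwards only the size of \<open>F\<close> counts.\<close>

lemma mean_square_Fourier:
 fixes F :: "real \<Rightarrow> complex"
 assumes F: "integrable lborel F" and H: "H > 0"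
 shows "(\<integral>\<^sup>+y. ennreal (exp (- \<bar>y - Y\<bar> / H) * (norm (\<integral>t. F t * exp (\<i> * of_real (t * y)) \<partial>lborel))^2) \<partial>lborel)
  \<le> kernel_form H F"
proof -
 have Fm[measurable]: "F \<in> borel_measurable borel" using borel_measurable_integrable[OF F] by simp
 have Fcm[measurable]: "(\<lambda>s. cnj (F s)) \<in> borel_measurable borel"
  by (rule measurable_compose[OF Fm borel_measurable_continuous_onI]) (intro continuous_intros)
 define w where "w y = exp (- \<bar>y - Y\<bar> / H)" for y
 have wi: "integrable lborel w" unfolding w_def by (rule two_sided_exp_Fourier(1)[OF H])
 have w0: "w y > 0" for y by (simp add: w_def)
 have wm[measurable]: "w \<in> borel_measurable borel" unfolding w_def by measurable
 define K where "K y = (\<integral>t. F t * exp (\<i> * of_real (t * y)) \<partial>lborel)" for y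
 have Km[measurable]: "K \<in> borel_measurable borel" unfolding K_def by measurable
 define I where "I = (\<integral>t. norm (F t) \<partial>lborel)"
 have KI: "norm (K y) \<le> I" for y
 proof -
  have "norm (K y) \<le> (\<integral>t. norm (F t * exp (\<i> * of_real (t * y))) \<partial>lborel)"
   unfolding K_def by (rule integral_norm_bound)
  then show ?thesis by (simp add: I_def norm_mult)
 qed
 have I0: "I \<ge> 0" unfolding I_def by simp
 define X where "X s = (\<integral>y. of_real (w y) * K y * exp (\<i> * of_real (- (s * y))) \<partial>lborel)" for s
 have nF: "integrable lborel (\<lambda>t. norm (F t))" by (rule integrable_norm[OF F])
 have bw: "integrable lborel (\<lambda>y. I * w y)" by (intro integrable_mult_right wi)
 define h where "h s y = of_real (w y) * K y * cnj (F s) * exp (\<i> * of_real (- (s * y)))" for s y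
 have hm: "case_prod h \<in> borel_measurable (lborel \<Otimes>\<^sub>M lborel)" unfolding h_def by measurable
 have hb: "norm (h s y) \<le> norm (F s) * (I * w y)" for s y
 proof -
  have "norm (h s y) = (w y * norm (F s)) * norm (K y)"
   unfolding h_def norm_mult using w0[of y] by simp
  also have "\<dots> \<le> (w y * norm (F s)) * I"
   using KI[of y] w0[of y] by (intro mult_left_mono) auto
  finally show ?thesis by (simp only: mult_ac)
 qed
 have hX: "(\<integral>y. h s y \<partial>lborel) = cnj (F s) * X s" for s
  unfolding h_def X_def by (subst integral_mult_right_zero[symmetric]) (simp add: mult_ac)
 have hK: "(\<integral>s. h s y \<partial>lborel) = of_real (w y * (norm (K y))^2)" for y
 proof -
  have "(\<integral>s. h s y \<partial>lborel) = of_real (w y) * K y * (\<integral>s. cnj (F s * exp (\<i> * of_real (s * y))) \<partial>lborel)"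
   unfolding h_def by (subst integral_mult_right_zero[symmetric]) (simp add: mult_ac exp_cnj)
  also have "(\<integral>s. cnj (F s * exp (\<i> * of_real (s * y))) \<partial>lborel) = cnj (K y)"
   unfolding K_def by (rule Bochner_Integration.integral_cnj)
  finally show ?thesis using complex_norm_square[of "K y"] by (simp add: mult.assoc)
 qed
 have wK: "integrable lborel (\<lambda>y. w y * (norm (K y))^2)"
 proof (rule Bochner_Integration.integrable_bound)
  show "integrable lborel (\<lambda>y. I^2 * w y)" by (intro integrable_mult_right wi)
  show "AE y in lborel. norm (w y * (norm (K y))^2) \<le> norm (I^2 * w y)"
   using KI w0 by (intro AE_I2) (simp add: abs_mult mult.commute less_imp_le mult_left_mono power_mono)
 qed measurable
 have "(\<integral>\<^sup>+y. ennreal (w y * (norm (K y))^2) \<partial>lborel) = ennreal (\<integral>y. w y * (norm (K y))^2 \<partial>lborel)"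
  by (rule nn_integral_eq_integral[OF wK]) (intro AE_I2 mult_nonneg_nonneg less_imp_le[OF w0] zero_le_power2)
 also have "(\<integral>y. w y * (norm (K y))^2 \<partial>lborel) \<le> norm (complex_of_real (\<integral>y. w y * (norm (K y))^2 \<partial>lborel))" by simp
 also have "complex_of_real (\<integral>y. w y * (norm (K y))^2 \<partial>lborel) = (\<integral>y. \<integral>s. h s y \<partial>lborel \<partial>lborel)"
  unfolding hK by (rule integral_complex_of_real[symmetric])
 also have "\<dots> = (\<integral>s. \<integral>y. h s y \<partial>lborel \<partial>lborel)"
  by (rule Fubini_dominated(1)[OF hm nF bw hb])
 also have "ennreal (norm (\<integral>s. \<integral>y. h s y \<partial>lborel \<partial>lborel)) \<le> (\<integral>\<^sup>+s. norm (\<integral>y. h s y \<partial>lborel) \<partial>lborel)"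
  by (rule integral_norm_bound_ennreal[OF Fubini_dominated(2)[OF hm nF bw hb]])
 also have "\<dots> \<le> kernel_form H F"
 proof (rule nn_integral_mono)
  fix s
  define k where "k t y = F t * (of_real (w y) * exp (\<i> * of_real ((t - s) * y)))" for t y
  have km: "case_prod k \<in> borel_measurable (lborel \<Otimes>\<^sub>M lborel)" unfolding k_def by measurable
  have kb: "norm (k t y) \<le> norm (F t) * w y" for t y
   unfolding k_def norm_mult using w0[of y] by simp
  have "X s = (\<integral>y. \<integral>t. k t y \<partial>lborel \<partial>lborel)"
  proof -
   have "of_real (w y) * K y * exp (\<i> * of_real (- (s * y))) = (\<integral>t. k t y \<partial>lborel)" for y
   proof -
    have "of_real (w y) * K y * exp (\<i> * of_real (- (s * y))) = (of_real (w y) * exp (\<i> * of_real (- (s * y)))) * K y" by simp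
    also have "\<dots> = (\<integral>t. (of_real (w y) * exp (\<i> * of_real (- (s * y)))) * (F t * exp (\<i> * of_real (t * y))) \<partial>lborel)"
     unfolding K_def by (rule integral_mult_right_zero[symmetric])
    also have "\<dots> = (\<integral>t. k t y \<partial>lborel)"
    proof (rule Bochner_Integration.integral_cong[OF refl])
     fix t
     have "exp (\<i> * of_real (- (s * y))) * exp (\<i> * of_real (t * y)) = exp (\<i> * of_real ((t - s) * y))"
      by (simp add: exp_add[symmetric] algebra_simps)
     then show "(of_real (w y) * exp (\<i> * of_real (- (s * y)))) * (F t * exp (\<i> * of_real (t * y))) = k t y"
      unfolding k_def by (metis mult.assoc mult.left_commute)
    qed
    finally show ?thesis .
   qed
   then show ?thesis unfolding X_def by simp
  qed
  also have "\<dots> = (\<integral>t. \<integral>y. k t y \<partial>lborel \<partial>lborel)"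
   by (rule Fubini_dominated(1)[OF km nF wi kb])
  finally have Xs: "X s = (\<integral>t. \<integral>y. k t y \<partial>lborel \<partial>lborel)" .
  have kn: "norm (\<integral>y. k t y \<partial>lborel) = norm (F t) * (2 * H / (1 + H^2 * (t - s)^2))" for t
  proof -
   have "(\<integral>y. k t y \<partial>lborel) = F t * (\<integral>y. of_real (w y) * exp (\<i> * of_real ((t - s) * y)) \<partial>lborel)"
    unfolding k_def by (rule integral_mult_right_zero)
   then show ?thesis using two_sided_exp_Fourier(2)[OF H, of Y "t - s"] by (simp add: norm_mult w_def)
  qed
  have "ennreal (norm (\<integral>y. h s y \<partial>lborel)) = ennreal (norm (F s)) * ennreal (norm (X s))"
   unfolding hX by (simp add: norm_mult ennreal_mult)
  also have "ennreal (norm (X s)) \<le> (\<integral>\<^sup>+t. norm (\<integral>y. k t y \<partial>lborel) \<partial>lborel)"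
   unfolding Xs by (rule integral_norm_bound_ennreal[OF Fubini_dominated(2)[OF km nF wi kb]])
  also have "ennreal (norm (F s)) * \<dots> = (\<integral>\<^sup>+t. ennreal (norm (F s)) * norm (\<integral>y. k t y \<partial>lborel) \<partial>lborel)"
   unfolding kn by (rule nn_integral_cmult[symmetric]) measurable
  also have "\<dots> = (\<integral>\<^sup>+t. ennreal (norm (F t) * norm (F s) * (2 * H / (1 + H^2 * (t - s)^2))) \<partial>lborel)"
   unfolding kn by (intro nn_integral_cong) (simp add: ennreal_mult'[symmetric] mult_ac)
  finally show "ennreal (norm (\<integral>y. h s y \<partial>lborel)) \<le> (\<integral>\<^sup>+t. ennreal (norm (F t) * norm (F s) * (2 * H / (1 + H^2 * (t - s)^2))) \<partial>lborel)"
   by (simp add: mult_left_mono)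
 qed
 finally show ?thesis unfolding w_def K_def by (simp add: ennreal_leI)
qed

text \<open>Average over the \<open>x\<close> within distance 1/2 of \<open>t\<close>, replace
  \<open>W t\<close> by \<open>k * W x\<close> and interchange the integrals. A bound for
  \<open>P\<close> on unit windows then acts like a pointwise bound.\<close>

lemma slowly_varying_integral:
 fixes P W :: "real \<Rightarrow> ennreal"
 assumes [measurable]: "P \<in> borel_measurable borel" "W \<in> borel_measurable borel"
  and P: "\<And>x. (\<integral>\<^sup>+t\<in>{x - 1/2..x + 1/2}. P t \<partial>lborel) \<le> B"
  and W: "\<And>t x. \<bar>t - x\<bar> \<le> 1/2 \<Longrightarrow> W t \<le> k * W x"
 shows "(\<integral>\<^sup>+t. P t * W t \<partial>lborel) \<le> k * B * (\<integral>\<^sup>+x. W x \<partial>lborel)"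
proof -
 define U where "U t x = (if \<bar>t - x\<bar> \<le> 1/2 then 1 else 0 :: ennreal)" for t x :: real
 have [measurable]: "(\<lambda>p. U (fst p) (snd p)) \<in> borel_measurable (lborel \<Otimes>\<^sub>M lborel)" unfolding U_def by measurable
 have [measurable]: "(\<lambda>p. U (snd p) (fst p)) \<in> borel_measurable (lborel \<Otimes>\<^sub>M lborel)" unfolding U_def by measurable
 have [measurable]: "(\<lambda>x. U t x) \<in> borel_measurable borel" "(\<lambda>t. U t x) \<in> borel_measurable borel" for t x unfolding U_def by measurable
 have U1: "U t x = indicator {t - 1/2..t + 1/2} x" for t x
  by (simp only: U_def indicator_def abs_minus_commute[of t] abs_diff_le_iff atLeastAtMost_iff of_bool_def)
 have U2: "U t x = indicator {x - 1/2..x + 1/2} t" for t x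
  by (simp only: U_def indicator_def abs_diff_le_iff atLeastAtMost_iff of_bool_def)
 have one: "(\<integral>\<^sup>+x. U t x \<partial>lborel) = 1" for t
  unfolding U1 by simp
 have "(\<integral>\<^sup>+t. P t * W t \<partial>lborel) = (\<integral>\<^sup>+t. \<integral>\<^sup>+x. P t * W t * U t x \<partial>lborel \<partial>lborel)"
  by (simp add: nn_integral_cmult one)
 also have "\<dots> \<le> (\<integral>\<^sup>+t. \<integral>\<^sup>+x. P t * (k * W x) * U t x \<partial>lborel \<partial>lborel)"
  using W by (intro nn_integral_mono) (auto simp: U_def mult_left_mono)
 also have "\<dots> = (\<integral>\<^sup>+x. \<integral>\<^sup>+t. P t * (k * W x) * U t x \<partial>lborel \<partial>lborel)"
  by (rule lborel_pair.Fubini') measurable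
 also have "\<dots> = (\<integral>\<^sup>+x. (k * W x) * (\<integral>\<^sup>+t\<in>{x - 1/2..x + 1/2}. P t \<partial>lborel) \<partial>lborel)"
 proof (rule nn_integral_cong)
  fix x
  have "(\<integral>\<^sup>+t. P t * (k * W x) * U t x \<partial>lborel) = (\<integral>\<^sup>+t. (k * W x) * (P t * indicator {x - 1/2..x + 1/2} t) \<partial>lborel)"
   unfolding U2 by (intro nn_integral_cong) (simp only: mult_ac)
  then show "(\<integral>\<^sup>+t. P t * (k * W x) * U t x \<partial>lborel) = (k * W x) * (\<integral>\<^sup>+t\<in>{x - 1/2..x + 1/2}. P t \<partial>lborel)"
   by (simp add: nn_integral_cmult)
 qed
 also have "\<dots> \<le> (\<integral>\<^sup>+x. (k * W x) * B \<partial>lborel)"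
  by (intro nn_integral_mono mult_left_mono P) simp
 also have "\<dots> = k * B * (\<integral>\<^sup>+x. W x \<partial>lborel)"
  by (simp add: nn_integral_cmult nn_integral_multc mult_ac)
 finally show ?thesis .
qed

text \<open>The primitive \<open>- 2 * (1 + x) powr (-1/2)\<close> gives 2 on each half-line. Within
  distance 1/2 the weight changes by a factor of at most \<open>(3/2) powr (3/2)\<close>, which is
  below 2.\<close>

lemma weight_three_halves:
 shows "(\<integral>\<^sup>+x. ennreal ((1 + \<bar>x\<bar>) powr (-3/2)) \<partial>lborel) \<le> 4"
  and "\<bar>t - x\<bar> \<le> 1/2 \<Longrightarrow> ennreal ((1 + \<bar>t\<bar>) powr (-3/2)) \<le> 2 * ennreal ((1 + \<bar>x\<bar>) powr (-3/2))"
proof -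
 let ?f = "\<lambda>x::real. (1 + \<bar>x\<bar>) powr (-3/2)"
 have half: "(\<integral>\<^sup>+x\<in>{0..}. ennreal (?f x) \<partial>lborel) = 2"
 proof -
  have "(\<integral>\<^sup>+x\<in>{0..}. ennreal (?f x) \<partial>lborel) = ennreal (0 - (- 2 * (1 + 0) powr (-1/2)))"
  proof (rule nn_integral_FTC_atLeast[where F = "\<lambda>x. - 2 * (1 + x) powr (-1/2)"])
   fix x :: real assume "0 \<le> x"
   then show "((\<lambda>x. - 2 * (1 + x) powr (-1/2)) has_real_derivative (1 + \<bar>x\<bar>) powr (-3/2)) (at x)"
    by (auto intro!: derivative_eq_intros)
  next
   show "((\<lambda>x::real. - 2 * (1 + x) powr (-1/2)) \<longlongrightarrow> 0) at_top" by real_asymp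
  qed auto
  also have "\<dots> = 2" by simp
  finally show ?thesis .
 qed
 have half': "(\<integral>\<^sup>+x\<in>{..0}. ennreal (?f x) \<partial>lborel) = 2"
 proof -
  have "(\<integral>\<^sup>+x\<in>{..0}. ennreal (?f x) \<partial>lborel)
   = ennreal \<bar>-1\<bar> * (\<integral>\<^sup>+x. ennreal (?f (0 + (-1) * x)) * indicator {..0} (0 + (-1) * x) \<partial>lborel)"
   by (rule nn_integral_real_affine) (auto intro!: measurable)
  also have "\<dots> = (\<integral>\<^sup>+x\<in>{0..}. ennreal (?f x) \<partial>lborel)"
   by (simp add: indicator_def)
  finally show ?thesis using half by simp
 qed
 have "(\<integral>\<^sup>+x. ennreal (?f x) \<partial>lborel) \<le> (\<integral>\<^sup>+x. ennreal (?f x) * indicator {0..} x + ennreal (?f x) * indicator {..0} x \<partial>lborel)"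
  by (intro nn_integral_mono) (auto simp: indicator_def)
 also have "\<dots> = (\<integral>\<^sup>+x\<in>{0..}. ennreal (?f x) \<partial>lborel) + (\<integral>\<^sup>+x\<in>{..0}. ennreal (?f x) \<partial>lborel)"
  by (rule nn_integral_add) measurable
 finally show "(\<integral>\<^sup>+x. ennreal (?f x) \<partial>lborel) \<le> 4" unfolding half half' by simp
 assume tx: "\<bar>t - x\<bar> \<le> 1/2"
 have "\<bar>x\<bar> \<le> \<bar>t\<bar> + 1/2" using abs_triangle_ineq4[of t "t - x"] tx by simp
 then have "1 + \<bar>x\<bar> \<le> 3/2 * (1 + \<bar>t\<bar>)" using abs_ge_zero[of t] by (simp add: field_simps)
 then have "(3/2 * (1 + \<bar>t\<bar>)) powr (-3/2) \<le> (1 + \<bar>x\<bar>) powr (-3/2)" by (intro powr_mono2') auto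
 moreover have "(3/2 * (1 + \<bar>t\<bar>)) powr (-3/2) = (3/2) powr (-3/2) * ?f t"
  by (subst powr_mult) auto
 ultimately have le: "(3/2) powr (-3/2) * ?f t \<le> ?f x" by linarith
 have "1/2 \<le> (3/2::real) powr (-3/2)"
 proof -
  have "((3/2::real) powr (-3/2))^2 = (3/2) powr (-3)" by (simp add: power2_eq_square flip: powr_add)
  also have "\<dots> = (2/3)^3" by (simp add: powr_minus power3_eq_cube powr_numeral)
  finally have "(1/2)^2 \<le> ((3/2::real) powr (-3/2))^2" by (simp add: power2_eq_square power3_eq_cube)
  then show ?thesis by (rule power2_le_imp_le) simp
 qed
 then have "1/2 * ?f t \<le> (3/2) powr (-3/2) * ?f t" by (rule mult_right_mono) simp
 with le have "?f t \<le> 2 * ?f x" by linarith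
 then have "ennreal (?f t) \<le> ennreal (2 * ?f x)" by (rule ennreal_leI)
 then show "ennreal (?f t) \<le> 2 * ennreal (?f x)" by (simp add: ennreal_mult')
qed

lemma Cauchy_kernel_integral:
 fixes H s :: real
 assumes "H > 0"
 shows "(\<integral>\<^sup>+t. ennreal (2 * H / (1 + H^2 * (t - s)^2)) \<partial>lborel) = ennreal (2 * pi)"
proof -
 have "(\<integral>\<^sup>+t. ennreal (2 * H / (1 + H^2 * (t - s)^2)) \<partial>lborel)
  = \<bar>1 / H\<bar> * (\<integral>\<^sup>+t. ennreal (2 * H / (1 + H^2 * ((s + 1 / H * t) - s)^2)) \<partial>lborel)"
  by (rule nn_integral_real_affine) (use assms in \<open>auto intro!: measurable\<close>)
 also have "\<dots> = (\<integral>\<^sup>+t. ennreal \<bar>1 / H\<bar> * ennreal (2 * H / (1 + H^2 * ((s + 1 / H * t) - s)^2)) \<partial>lborel)"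
  by (rule nn_integral_cmult[symmetric]) measurable
 also have "\<dots> = (\<integral>\<^sup>+t. ennreal (2 * (1 / (1 + t^2))) \<partial>lborel)"
 proof (rule nn_integral_cong)
  fix t
  have "\<bar>1 / H\<bar> * (2 * H / (1 + H^2 * ((s + 1 / H * t) - s)^2)) = 2 * (1 / (1 + t^2))"
   using assms by (simp add: power_divide)
  then show "ennreal \<bar>1 / H\<bar> * ennreal (2 * H / (1 + H^2 * ((s + 1 / H * t) - s)^2)) = ennreal (2 * (1 / (1 + t^2)))"
   by (simp only: ennreal_mult'[symmetric] abs_ge_zero)
 qed
 also have "\<dots> = ennreal (integral\<^sup>L lborel (\<lambda>t::real. 2 * (1 / (1 + t^2))))"
  by (intro nn_integral_eq_integral integrable_mult_right integrable_inverse_1_plus_square') simp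
 also have "integral\<^sup>L lborel (\<lambda>t::real. 2 * (1 / (1 + t^2))) = 2 * pi"
  using integral_inverse_1_plus_square' by (simp only: integral_mult_right_zero)
 finally show ?thesis .
qed

text \<open>For large \<open>H\<close> the kernel is much narrower than a unit window; at scale 1 it
  varies slowly, so that window bounds can be integrated against it.\<close>

lemma Cauchy_kernel_slowly_varying:
 fixes t x s :: real
 assumes "\<bar>t - x\<bar> \<le> 1/2"
 shows "ennreal (2 * 1 / (1 + 1^2 * (t - s)^2)) \<le> 2 * ennreal (2 * 1 / (1 + 1^2 * (x - s)^2))"
proof -
 have "\<bar>x - s\<bar> \<le> \<bar>t - s\<bar> + 1/2" using assms by linarith
 then have "(x - s)^2 \<le> (\<bar>t - s\<bar> + 1/2)^2" by (metis abs_ge_zero power2_abs power_mono)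
 also have "\<dots> \<le> 2 * (t - s)^2 + 1"
  using zero_le_power2[of "\<bar>t - s\<bar> - 1/2"] by (simp add: power2_eq_square algebra_simps)
 finally have le: "1 + (x - s)^2 \<le> 2 * (1 + (t - s)^2)" by simp
 define a b where "a = 1 + (t - s)^2" and "b = 1 + (x - s)^2"
 have pos: "0 < a" "0 < b" by (simp_all add: a_def b_def add_pos_nonneg)
 have "2 / a = 4 / (2 * a)" by simp
 also have "\<dots> \<le> 4 / b"
  by (rule divide_left_mono) (use pos le in \<open>auto simp: a_def b_def\<close>)
 also have "\<dots> = 2 * (2 / b)" by simp
 finally have "ennreal (2 * 1 / (1 + 1^2 * (t - s)^2)) \<le> ennreal (2 * (2 / b))"
  unfolding a_def by (intro ennreal_leI) simp
 also have "\<dots> = 2 * ennreal (2 / b)" using ennreal_mult'[of 2 "2 / b"] by simp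
 finally show ?thesis by (simp add: b_def)
qed

lemma double_integral_symmetrize:
 fixes k :: "real \<Rightarrow> real \<Rightarrow> ennreal"
 assumes [measurable]: "case_prod k \<in> borel_measurable (borel \<Otimes>\<^sub>M borel)" and le: "\<And>s t. G s t \<le> k s t + k t s"
  and B: "(\<integral>\<^sup>+s. \<integral>\<^sup>+t. k s t \<partial>lborel \<partial>lborel) \<le> B"
 shows "(\<integral>\<^sup>+s. \<integral>\<^sup>+t. G s t \<partial>lborel \<partial>lborel) \<le> 2 * B"
proof -
 have [measurable]: "k s \<in> borel_measurable borel" "(\<lambda>s. k s t) \<in> borel_measurable borel" for s t by measurable
 have "(\<integral>\<^sup>+s. \<integral>\<^sup>+t. G s t \<partial>lborel \<partial>lborel) \<le> (\<integral>\<^sup>+s. \<integral>\<^sup>+t. k s t + k t s \<partial>lborel \<partial>lborel)"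
  by (intro nn_integral_mono le)
 also have "\<dots> = (\<integral>\<^sup>+s. \<integral>\<^sup>+t. k s t \<partial>lborel \<partial>lborel) + (\<integral>\<^sup>+s. \<integral>\<^sup>+t. k t s \<partial>lborel \<partial>lborel)"
  by (subst nn_integral_add[symmetric]) (auto intro!: nn_integral_cong nn_integral_add simp: measurable)
 also have "(\<integral>\<^sup>+s. \<integral>\<^sup>+t. k t s \<partial>lborel \<partial>lborel) = (\<integral>\<^sup>+t. \<integral>\<^sup>+s. k t s \<partial>lborel \<partial>lborel)"
  by (rule lborel_pair.Fubini') measurable
 finally show ?thesis using add_mono[OF B B] by (simp add: mult_2)
qed

text \<open>\<open>norm (F t) = \<rho> t * P t\<close> with an integrable
  \<open>(\<rho> t)^2\<close>. For the first bound,
  \<open>\<rho> s * \<rho> t \<le> (\<rho> s)^2 + (\<rho> t)^2\<close> moves the weight to one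
  variable; the window bound is then used in \<open>t\<close> against the kernel and in
  \<open>s\<close> against the weight, whence \<open>B * B\<close>. For the second,
  \<open>norm (F t) * norm (F s)\<close> is split into squares and the kernel is integrated out,
  which works at every scale \<open>H\<close>.\<close>

lemma weighted_kernel_bounds:
 fixes F :: "real \<Rightarrow> complex"
 defines "P \<equiv> \<lambda>t. (1 + \<bar>t\<bar>) powr (3/4) * norm (F t)"
 assumes [measurable]: "F \<in> borel_measurable borel"
 shows "(\<And>x. window_integral P x \<le> B) \<Longrightarrow> kernel_form 1 F \<le> ennreal (64 * pi) * B * B"
  "(\<And>x. window_integral (\<lambda>t. (P t)^2) x \<le> B) \<Longrightarrow> H > 0 \<Longrightarrow> kernel_form H F \<le> ennreal (32 * pi) * B"
  "(\<And>x. window_integral P x \<le> B) \<Longrightarrow> (\<integral>\<^sup>+t. ennreal (P t * (1 + \<bar>t\<bar>) powr (-3/2)) \<partial>lborel) \<le> 8 * B"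
proof -
 define \<rho> where "\<rho> t = (1 + \<bar>t\<bar>) powr (-3/4)" for t :: real
 have Pm[measurable]: "P \<in> borel_measurable borel" unfolding P_def by measurable
 have \<rho>m[measurable]: "\<rho> \<in> borel_measurable borel" unfolding \<rho>_def by measurable
 have P0: "P t \<ge> 0" for t by (simp add: P_def)
 have \<rho>0: "\<rho> t \<ge> 0" for t by (simp add: \<rho>_def)
 have \<rho>2: "(\<rho> t)^2 = (1 + \<bar>t\<bar>) powr (-3/2)" for t
  by (simp add: \<rho>_def power2_eq_square flip: powr_add)
 have FP: "norm (F t) = \<rho> t * P t" for t
  by (simp add: \<rho>_def P_def mult.assoc[symmetric] flip: powr_add)
 have outer: "(\<integral>\<^sup>+t. ennreal (Q t) * ennreal ((\<rho> t)^2) \<partial>lborel) \<le> 8 * B"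
  if [measurable]: "Q \<in> borel_measurable borel" and Q: "\<And>x. window_integral Q x \<le> B" for Q B
 proof -
  have "(\<integral>\<^sup>+t. ennreal (Q t) * ennreal ((\<rho> t)^2) \<partial>lborel) \<le> 2 * B * (\<integral>\<^sup>+t. ennreal ((\<rho> t)^2) \<partial>lborel)"
   by (rule slowly_varying_integral[OF _ _ Q]) (use weight_three_halves(2) in \<open>auto simp: \<rho>2\<close>)
  also have "\<dots> \<le> 2 * B * 4" unfolding \<rho>2 by (intro mult_left_mono weight_three_halves(1)) simp
  finally show ?thesis by (simp add: mult_ac)
 qed
 show "(\<integral>\<^sup>+t. ennreal (P t * (1 + \<bar>t\<bar>) powr (-3/2)) \<partial>lborel) \<le> 8 * B" if "\<And>x. window_integral P x \<le> B"
  using outer[OF Pm that] P0 by (simp add: \<rho>2 ennreal_mult)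
 have sq: "x * y \<le> x^2 + y^2" if "x \<ge> 0" "y \<ge> 0" for x y :: real
  using sum_squares_bound[of x y] that mult_nonneg_nonneg[OF that] by linarith
 define W where "W H t s = 2 * H / (1 + H^2 * (t - s)^2)" for H t s :: real
 have W0: "H > 0 \<Longrightarrow> W H t s \<ge> 0" for H t s by (simp add: W_def)
 have Wsym: "W H t s = W H s t" for H t s by (simp add: W_def power2_commute)
 have Wm[measurable]: "case_prod (W H) \<in> borel_measurable (borel \<Otimes>\<^sub>M borel)" for H unfolding W_def by measurable
 have Wm1[measurable]: "(\<lambda>t. W H t s) \<in> borel_measurable borel" "(\<lambda>s. W H t s) \<in> borel_measurable borel" for H s t
  unfolding W_def by measurable
 have Wi: "(\<integral>\<^sup>+t. ennreal (W H t s) \<partial>lborel) = ennreal (2 * pi)" if "H > 0" for H s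
  unfolding W_def by (rule Cauchy_kernel_integral[OF that])
 have two: "2 * (ennreal c * X) = ennreal (2 * c) * X" for c X
  using ennreal_mult'[of 2 c] by (simp add: mult.assoc)
 show "kernel_form 1 F \<le> ennreal (64 * pi) * B * B" if B: "\<And>x. window_integral P x \<le> B"
 proof -
  have PW: "(\<integral>\<^sup>+t. ennreal (P t) * ennreal (W 1 t s) \<partial>lborel) \<le> ennreal (4 * pi) * B" for s
  proof -
   have "(\<integral>\<^sup>+t. ennreal (P t) * ennreal (W 1 t s) \<partial>lborel) \<le> 2 * B * (\<integral>\<^sup>+t. ennreal (W 1 t s) \<partial>lborel)"
    unfolding W_def by (rule slowly_varying_integral[OF _ _ B Cauchy_kernel_slowly_varying]) auto
   then show ?thesis using two[of "2 * pi" B] by (simp only: Wi[OF zero_less_one] mult_ac) simp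
  qed
  have "(\<integral>\<^sup>+s. \<integral>\<^sup>+t. ennreal (P s * (\<rho> s)^2) * (ennreal (P t) * ennreal (W 1 t s)) \<partial>lborel \<partial>lborel)
   = (\<integral>\<^sup>+s. ennreal (P s * (\<rho> s)^2) * (\<integral>\<^sup>+t. (ennreal (P t) * ennreal (W 1 t s)) \<partial>lborel) \<partial>lborel)"
   by (intro nn_integral_cong nn_integral_cmult) measurable
  also have "\<dots> \<le> (\<integral>\<^sup>+s. ennreal (P s * (\<rho> s)^2) * (ennreal (4 * pi) * B) \<partial>lborel)"
   by (intro nn_integral_mono mult_left_mono PW) simp
  also have "\<dots> = (\<integral>\<^sup>+s. ennreal (P s) * ennreal ((\<rho> s)^2) \<partial>lborel) * (ennreal (4 * pi) * B)"
   using P0 by (simp add: nn_integral_multc ennreal_mult)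
  also have "\<dots> \<le> (8 * B) * (ennreal (4 * pi) * B)" by (intro mult_right_mono outer[OF Pm B]) simp
  also have "\<dots> = (8 * ennreal (4 * pi)) * B * B" by (simp only: mult_ac)
  also have "8 * ennreal (4 * pi) = ennreal (32 * pi)" using ennreal_mult'[of 8 "4 * pi"] by simp
  finally have J: "(\<integral>\<^sup>+s. \<integral>\<^sup>+t. ennreal (P s * (\<rho> s)^2) * (ennreal (P t) * ennreal (W 1 t s)) \<partial>lborel \<partial>lborel) \<le> ennreal (32 * pi) * B * B" .
  have le: "ennreal (norm (F t) * norm (F s) * W 1 t s)
   \<le> ennreal (P s * (\<rho> s)^2) * (ennreal (P t) * ennreal (W 1 t s)) + ennreal (P t * (\<rho> t)^2) * (ennreal (P s) * ennreal (W 1 s t))" for s t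
  proof -
   have "norm (F t) * norm (F s) * W 1 t s = (\<rho> s * \<rho> t) * (P s * P t * W 1 t s)" by (simp add: FP)
   also have "\<dots> \<le> ((\<rho> s)^2 + (\<rho> t)^2) * (P s * P t * W 1 t s)"
    using sq[OF \<rho>0 \<rho>0] P0 W0 by (intro mult_right_mono) auto
   also have "\<dots> = (P s * (\<rho> s)^2) * (P t * W 1 t s) + (P t * (\<rho> t)^2) * (P s * W 1 s t)"
    by (simp add: Wsym[of 1 s t] algebra_simps)
   finally show ?thesis
    using P0 W0 by (simp add: ennreal_mult[symmetric] ennreal_plus[symmetric] ennreal_leI del: ennreal_plus)
  qed
  have "kernel_form 1 F \<le> 2 * (ennreal (32 * pi) * B * B)"
   unfolding W_def[symmetric] by (rule double_integral_symmetrize[OF _ le J]) measurable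
  then show ?thesis using two[of "32 * pi" "B * B"] by (simp add: mult.assoc)
 qed
 show "kernel_form H F \<le> ennreal (32 * pi) * B" if B: "\<And>x. window_integral (\<lambda>t. (P t)^2) x \<le> B" and H: "H > 0"
 proof -
  have "(\<integral>\<^sup>+s. \<integral>\<^sup>+t. ennreal ((norm (F s))^2) * ennreal (W H t s) \<partial>lborel \<partial>lborel)
   = (\<integral>\<^sup>+s. ennreal ((norm (F s))^2) * (\<integral>\<^sup>+t. ennreal (W H t s) \<partial>lborel) \<partial>lborel)"
   by (intro nn_integral_cong nn_integral_cmult) measurable
  also have "\<dots> = (\<integral>\<^sup>+s. ennreal ((norm (F s))^2) \<partial>lborel) * ennreal (2 * pi)"
   unfolding Wi[OF H] by (rule nn_integral_multc) measurable
  also have "(\<integral>\<^sup>+s. ennreal ((norm (F s))^2) \<partial>lborel) = (\<integral>\<^sup>+s. ennreal ((P s)^2) * ennreal ((\<rho> s)^2) \<partial>lborel)"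
   by (intro nn_integral_cong) (simp add: FP power_mult_distrib ennreal_mult mult.commute)
  also have "\<dots> * ennreal (2 * pi) \<le> (8 * B) * ennreal (2 * pi)"
   by (intro mult_right_mono outer B) auto
  also have "\<dots> = (8 * ennreal (2 * pi)) * B" by (simp only: mult_ac)
  also have "8 * ennreal (2 * pi) = ennreal (16 * pi)" using ennreal_mult'[of 8 "2 * pi"] by simp
  finally have J: "(\<integral>\<^sup>+s. \<integral>\<^sup>+t. ennreal ((norm (F s))^2) * ennreal (W H t s) \<partial>lborel \<partial>lborel) \<le> ennreal (16 * pi) * B" .
  have le: "ennreal (norm (F t) * norm (F s) * W H t s) \<le> ennreal ((norm (F s))^2) * ennreal (W H t s) + ennreal ((norm (F t))^2) * ennreal (W H s t)" for s t
  proof -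
   have "norm (F t) * norm (F s) * W H t s \<le> ((norm (F t))^2 + (norm (F s))^2) * W H t s"
    using sq[of "norm (F t)" "norm (F s)"] W0[OF H] by (intro mult_right_mono) auto
   also have "\<dots> = (norm (F s))^2 * W H t s + (norm (F t))^2 * W H s t" by (simp add: Wsym[of H s t] algebra_simps)
   finally show ?thesis
    using W0[OF H] by (simp add: ennreal_mult[symmetric] ennreal_plus[symmetric] ennreal_leI del: ennreal_plus)
  qed
  have "kernel_form H F \<le> 2 * (ennreal (16 * pi) * B)"
   unfolding W_def[symmetric] by (rule double_integral_symmetrize[OF _ le J]) measurable
  then show ?thesis using two[of "16 * pi" B] by simp
 qed
qed

text \<open>Bounds for \<open>A\<close> from its Laplace transform \<open>f\<close> on the line \<open>Re s = a\<close>, by letting the Gaussian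
 smoothing in the inversion formula tend to zero.\<close>

locale smoothed_inversion =
 fixes A :: "real \<Rightarrow> complex" and f :: "complex \<Rightarrow> complex" and a C C' :: real
 assumes A: "A \<in> borel_measurable borel" "\<And>v. norm (A v) \<le> C * exp (2 * \<bar>v\<bar>)"
  and inv: "\<And>d y. d > 0 \<Longrightarrow> of_real (2 * pi) * (\<integral>v. A v * of_real (normal_density 0 d (y - v)) \<partial>lborel)
   = (\<integral>t. f (Complex a t) * exp (Complex a t * of_real y + of_real (d^2 / 2) * (Complex a t)^2) \<partial>lborel)"
  and f: "(\<lambda>t. f (Complex a t)) \<in> borel_measurable borel" "\<And>t. norm (f (Complex a t)) \<le> C' * (1 + t^2)"
begin

text \<open>The Gaussian is attached to the transform, while the factor depending on
  \<open>y\<close> is kept apart, so that inversion becomes a Fourier integral in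
  \<open>t\<close>.\<close>

definition smoothed :: "nat \<Rightarrow> real \<Rightarrow> complex" where
 "smoothed n t = f (Complex a t) * exp (of_real ((1 / Suc n)^2 / 2) * (Complex a t)^2)"

lemma norm_smoothed: "norm (smoothed n t) = norm (f (Complex a t)) * (exp ((1 / Suc n)^2 / 2 * a^2) * exp (- (1 / Suc n * t)\<^sup>2 / 2))"
proof -
 have "Re (of_real r * w) = r * Re w" for r w by simp
 then have "Re (of_real ((1 / Suc n)^2 / 2) * (Complex a t)^2) = (1 / Suc n)^2 / 2 * Re ((Complex a t)^2)" .
 also have "\<dots> = (1 / Suc n)^2 / 2 * a^2 + - (1 / Suc n * t)\<^sup>2 / 2"
  by (simp add: Re_power2 power_mult_distrib power_divide right_diff_distrib del: of_nat_Suc)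
 finally show ?thesis unfolding smoothed_def norm_mult norm_exp_eq_Re by (simp only: exp_add)
qed

lemma norm_smoothed_le: "norm (smoothed n t) \<le> exp (a^2 / 2) * norm (f (Complex a t))"
proof -
 have "(1 / real (Suc n))^2 \<le> 1^2" by (intro power_mono) auto
 then have "(1 / Suc n)^2 / 2 * a^2 + - (1 / Suc n * t)\<^sup>2 / 2 \<le> 1 / 2 * a^2 + 0"
  by (intro add_mono mult_right_mono) auto
 then have "exp ((1 / Suc n)^2 / 2 * a^2) * exp (- (1 / Suc n * t)\<^sup>2 / 2) \<le> exp (a^2 / 2)"
  by (simp only: exp_add[symmetric]) simp
 from mult_left_mono[OF this norm_ge_zero[of "f (Complex a t)"]]
 show ?thesis by (simp only: norm_smoothed mult.commute[of "exp (a^2 / 2)"])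
qed

lemma smoothed_measurable [measurable]: "smoothed n \<in> borel_measurable borel"
proof -
 have [measurable]: "(\<lambda>t. Complex a t) \<in> borel_measurable borel" by (simp add: Complex_eq)
 show ?thesis unfolding smoothed_def using f(1) by measurable
qed

lemma smoothed_integrable: "integrable lborel (smoothed n)"
proof (rule Bochner_Integration.integrable_bound)
 define d where "d = 1 / real (Suc n)"
 have d: "d > 0" by (simp add: d_def)
 have C': "C' \<ge> 0" using order_trans[OF norm_ge_zero f(2)[of 0]] by simp
 let ?k = "C' * exp (d^2 / 2 * a^2) * (2 + 16 / d ^ 4)"
 show "integrable lborel (\<lambda>t. ?k * (1 / (1 + t^2)))"
  by (intro integrable_mult_right integrable_inverse_1_plus_square')
 show "AE t in lborel. norm (smoothed n t) \<le> norm (?k * (1 / (1 + t^2)))"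
 proof (rule AE_I2)
  fix t
  have "norm (smoothed n t) \<le> C' * (1 + t^2) * (exp (d^2 / 2 * a^2) * exp (- (d * t)\<^sup>2 / 2))"
   unfolding norm_smoothed d_def[symmetric] using f(2)[of t] by (rule mult_right_mono) simp
  also have "\<dots> = C' * exp (d^2 / 2 * a^2) * ((1 + t^2)^2 * exp (- (d * t)\<^sup>2 / 2)) * (1 / (1 + t^2))"
   by (simp add: power2_eq_square add_nonneg_eq_0_iff)
  also have "\<dots> \<le> ?k * (1 / (1 + t^2))"
   using power4_le_gaussian[OF d, of t] C' by (intro mult_right_mono mult_left_mono) auto
  finally show "norm (smoothed n t) \<le> norm (?k * (1 / (1 + t^2)))"
   unfolding real_norm_def by (rule order_trans) (rule abs_ge_self)
 qed
qed simp

definition approx :: "nat \<Rightarrow> real \<Rightarrow> complex" where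
 "approx n y = (\<integral>v. A v * of_real (normal_density 0 (1 / Suc n) (y - v)) \<partial>lborel)"

lemma approx_eq: "of_real (2 * pi) * approx n y = of_real (exp (a * y)) * (\<integral>t. smoothed n t * exp (\<i> * of_real (t * y)) \<partial>lborel)"
proof -
 have "of_real (2 * pi) * approx n y
  = (\<integral>t. f (Complex a t) * exp (Complex a t * of_real y + of_real ((1 / Suc n)^2 / 2) * (Complex a t)^2) \<partial>lborel)"
  unfolding approx_def by (rule inv) simp
 also have "\<dots> = (\<integral>t. of_real (exp (a * y)) * (smoothed n t * exp (\<i> * of_real (t * y))) \<partial>lborel)"
 proof (rule Bochner_Integration.integral_cong[OF refl])
  fix t
  have "Complex a t * of_real y = of_real (a * y) + \<i> * of_real (t * y)" by (simp add: complex_eq_iff)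
  then show "f (Complex a t) * exp (Complex a t * of_real y + of_real ((1 / Suc n)^2 / 2) * (Complex a t)^2)
   = of_real (exp (a * y)) * (smoothed n t * exp (\<i> * of_real (t * y)))"
   unfolding smoothed_def by (simp only: exp_add exp_of_real mult_ac)
 qed
 also have "\<dots> = of_real (exp (a * y)) * (\<integral>t. smoothed n t * exp (\<i> * of_real (t * y)) \<partial>lborel)"
  by (rule integral_mult_right_zero)
 finally show ?thesis .
qed

lemma approx_tendsto: "isCont A y \<Longrightarrow> (\<lambda>n. approx n y) \<longlonglongrightarrow> A y"
 unfolding approx_def by (rule smoothing_limit[OF A])

lemma norm_approx: "norm (approx n y) = exp (a * y) / (2 * pi) * norm (\<integral>t. smoothed n t * exp (\<i> * of_real (t * y)) \<partial>lborel)"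
 using arg_cong[OF approx_eq[of n y], of norm] by (simp add: norm_mult field_simps)

text \<open>Absolute values inside the inversion integral. This is of use when the transform is
  integrable on the line, as it is for the primitive of the error term.\<close>

lemma pointwise_bound:
 assumes "isCont A y"
 shows "ennreal (norm (A y)) \<le> ennreal (exp (a * y + a^2 / 2)) * (\<integral>\<^sup>+t. norm (f (Complex a t)) \<partial>lborel)"
proof -
 have lim: "(\<lambda>n. ennreal (norm (approx n y))) \<longlonglongrightarrow> ennreal (norm (A y))"
  by (intro tendsto_ennrealI tendsto_norm approx_tendsto assms)
 have bd: "ennreal (norm (approx n y)) \<le> ennreal (exp (a * y + a^2 / 2)) * (\<integral>\<^sup>+t. norm (f (Complex a t)) \<partial>lborel)" for n
 proof -
  have i: "integrable lborel (\<lambda>t. smoothed n t * exp (\<i> * of_real (t * y)))"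
   by (rule Bochner_Integration.integrable_bound[OF smoothed_integrable[of n]]) (auto simp: norm_mult)
  have "norm (approx n y) \<le> exp (a * y) * norm (\<integral>t. smoothed n t * exp (\<i> * of_real (t * y)) \<partial>lborel)"
   unfolding norm_approx using pi_gt3 by (intro mult_right_mono) (auto simp: divide_simps)
  then have "ennreal (norm (approx n y)) \<le> ennreal (exp (a * y)) * ennreal (norm (\<integral>t. smoothed n t * exp (\<i> * of_real (t * y)) \<partial>lborel))"
   by (simp add: ennreal_mult[symmetric] ennreal_leI)
  also have "ennreal (norm (\<integral>t. smoothed n t * exp (\<i> * of_real (t * y)) \<partial>lborel)) \<le> (\<integral>\<^sup>+t. norm (smoothed n t * exp (\<i> * of_real (t * y))) \<partial>lborel)"
   by (rule integral_norm_bound_ennreal[OF i])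
  also have "\<dots> \<le> (\<integral>\<^sup>+t. ennreal (exp (a^2 / 2)) * ennreal (norm (f (Complex a t))) \<partial>lborel)"
   using norm_smoothed_le by (intro nn_integral_mono) (simp add: norm_mult ennreal_mult[symmetric] ennreal_leI)
  also have "\<dots> = ennreal (exp (a^2 / 2)) * (\<integral>\<^sup>+t. norm (f (Complex a t)) \<partial>lborel)"
   using f(1) by (intro nn_integral_cmult) measurable
  also have "ennreal (exp (a * y)) * \<dots> = ennreal (exp (a * y + a^2 / 2)) * (\<integral>\<^sup>+t. norm (f (Complex a t)) \<partial>lborel)"
   by (simp add: exp_add ennreal_mult mult.assoc)
  finally show ?thesis by (simp add: mult_left_mono)
 qed
 show ?thesis by (rule LIMSEQ_le_const2[OF lim]) (use bd in auto)
qed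

text \<open>The bound \<open>mean_square_Fourier\<close> for the smoothed functions is uniform in
  \<open>n\<close>, and Fatou's lemma carries it to the limit. Continuity almost everywhere is the
  right hypothesis, because the error term has jumps at logarithms of integers.\<close>

lemma mean_square_bound:
 assumes cont: "AE y in lborel. isCont A y" and H: "H > 0"
 shows "(\<integral>\<^sup>+y. ennreal (exp (- \<bar>y - Y\<bar> / H) * exp (- 2 * a * y) * (norm (A y))^2) \<partial>lborel)
  \<le> ennreal (exp (a^2)) * kernel_form H (\<lambda>t. f (Complex a t))"
  (is "_ \<le> ennreal (exp (a^2)) * ?J")
proof -
 have fm[measurable]: "(\<lambda>t. f (Complex a t)) \<in> borel_measurable borel" by (rule f(1))
 define u where "u n y = ennreal (exp (- \<bar>y - Y\<bar> / H) * exp (- 2 * a * y) * (norm (approx n y))^2)" for n y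
 have appm[measurable]: "(\<lambda>y. norm (approx n y)) \<in> borel_measurable borel" for n
  unfolding norm_approx by measurable
 have um[measurable]: "u n \<in> borel_measurable lborel" for n unfolding u_def by measurable
 have ub: "(\<integral>\<^sup>+y. u n y \<partial>lborel) \<le> ennreal (exp (a^2)) * ?J" for n
 proof -
  have "(\<integral>\<^sup>+y. u n y \<partial>lborel) \<le> (\<integral>\<^sup>+y. ennreal (exp (- \<bar>y - Y\<bar> / H) * (norm (\<integral>t. smoothed n t * exp (\<i> * of_real (t * y)) \<partial>lborel))^2) \<partial>lborel)"
  proof (rule nn_integral_mono)
   fix y
   define N where "N = norm (\<integral>t. smoothed n t * exp (\<i> * of_real (t * y)) \<partial>lborel)"
   have "norm (approx n y) \<le> exp (a * y) * N"
    unfolding norm_approx N_def[symmetric] using pi_gt3 by (intro mult_right_mono) (auto simp: divide_simps N_def)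
   then have "(norm (approx n y))^2 \<le> (exp (a * y) * N)^2" by (intro power_mono) auto
   also have "\<dots> = exp (2 * a * y) * N^2" by (simp add: power_mult_distrib mult.assoc flip: exp_double)
   finally have "exp (- 2 * a * y) * (norm (approx n y))^2 \<le> exp (- 2 * a * y) * (exp (2 * a * y) * N^2)"
    by (intro mult_left_mono) auto
   also have "\<dots> = N^2" by (simp add: mult.assoc[symmetric] flip: exp_add)
   finally show "u n y \<le> ennreal (exp (- \<bar>y - Y\<bar> / H) * N^2)"
    unfolding u_def mult.assoc by (intro ennreal_leI mult_left_mono) auto
  qed
  also have "\<dots> \<le> (\<integral>\<^sup>+s. \<integral>\<^sup>+t. ennreal (norm (smoothed n t) * norm (smoothed n s) * (2 * H / (1 + H^2 * (t - s)^2))) \<partial>lborel \<partial>lborel)"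
   by (rule mean_square_Fourier[OF smoothed_integrable H])
  also have "\<dots> \<le> (\<integral>\<^sup>+s. \<integral>\<^sup>+t. ennreal (exp (a^2)) * ennreal (norm (f (Complex a t)) * norm (f (Complex a s)) * (2 * H / (1 + H^2 * (t - s)^2))) \<partial>lborel \<partial>lborel)"
  proof (intro nn_integral_mono)
   fix s t
   have "norm (smoothed n t) * norm (smoothed n s) \<le> (exp (a^2 / 2) * norm (f (Complex a t))) * (exp (a^2 / 2) * norm (f (Complex a s)))"
    by (intro mult_mono norm_smoothed_le) auto
   also have "\<dots> = exp (a^2) * (norm (f (Complex a t)) * norm (f (Complex a s)))"
   proof -
    have "exp (a^2 / 2) * exp (a^2 / 2) = exp (a^2)" by (simp flip: exp_add)
    then show ?thesis by (metis mult.assoc mult.left_commute)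
   qed
   finally have "norm (smoothed n t) * norm (smoothed n s) * (2 * H / (1 + H^2 * (t - s)^2))
    \<le> exp (a^2) * (norm (f (Complex a t)) * norm (f (Complex a s))) * (2 * H / (1 + H^2 * (t - s)^2))"
    using H by (intro mult_right_mono) auto
   then show "ennreal (norm (smoothed n t) * norm (smoothed n s) * (2 * H / (1 + H^2 * (t - s)^2)))
    \<le> ennreal (exp (a^2)) * ennreal (norm (f (Complex a t)) * norm (f (Complex a s)) * (2 * H / (1 + H^2 * (t - s)^2)))"
    using H by (subst ennreal_mult[symmetric]) (auto simp: mult.assoc intro!: ennreal_leI)
  qed
  also have "\<dots> = ennreal (exp (a^2)) * ?J"
   by (simp add: nn_integral_cmult)
  finally show ?thesis .
 qed
 have "(\<integral>\<^sup>+y. ennreal (exp (- \<bar>y - Y\<bar> / H) * exp (- 2 * a * y) * (norm (A y))^2) \<partial>lborel) = (\<integral>\<^sup>+y. liminf (\<lambda>n. u n y) \<partial>lborel)"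
 proof (rule nn_integral_cong_AE, use cont in eventually_elim)
  fix y assume "isCont A y"
  then have "(\<lambda>n. u n y) \<longlonglongrightarrow> ennreal (exp (- \<bar>y - Y\<bar> / H) * exp (- 2 * a * y) * (norm (A y))^2)"
   unfolding u_def by (intro tendsto_ennrealI tendsto_intros approx_tendsto)
  then show "ennreal (exp (- \<bar>y - Y\<bar> / H) * exp (- 2 * a * y) * (norm (A y))^2) = liminf (\<lambda>n. u n y)"
   by (intro lim_imp_Liminf[symmetric]) auto
 qed
 also have "\<dots> \<le> liminf (\<lambda>n. \<integral>\<^sup>+y. u n y \<partial>lborel)" by (rule nn_integral_liminf) measurable
 also have "\<dots> \<le> ennreal (exp (a^2)) * ?J" by (rule Liminf_le) (use ub in auto)
 finally show ?thesis .
qed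

end

subsection \<open>The logarithmic derivative under GRH\<close>

lemma inverse_abs_integral:
 fixes \<sigma> g :: real
 assumes "0 < \<sigma>" "\<sigma> \<le> 1/2"
 shows "(\<integral>\<^sup>+t\<in>{g - 1..g + 1}. ennreal (2 / (\<sigma> + \<bar>t - g\<bar>)) \<partial>lborel) \<le> ennreal (8 * ln (1 / \<sigma>))"
proof -
 let ?f = "\<lambda>x::real. 2 / (\<sigma> + x)"
 have half: "(\<integral>\<^sup>+x\<in>{0..1}. ennreal (?f x) \<partial>lborel) = ennreal (2 * ln (1 + 1 / \<sigma>))"
 proof -
  have "(\<integral>\<^sup>+x\<in>{0..1}. ennreal (?f x) \<partial>lborel) = ennreal (2 * ln (\<sigma> + 1) - 2 * ln (\<sigma> + 0))"
   by (rule nn_integral_FTC_Icc) (use assms in \<open>auto intro!: derivative_eq_intros\<close>)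
  also have "2 * ln (\<sigma> + 1) - 2 * ln (\<sigma> + 0) = 2 * ln (1 + 1 / \<sigma>)"
  proof -
   have "1 + 1 / \<sigma> = (\<sigma> + 1) / \<sigma>" using assms by (simp add: field_simps)
   then have "ln (1 + 1 / \<sigma>) = ln (\<sigma> + 1) - ln \<sigma>" using assms by (simp only: ln_divide_pos)
   then show ?thesis by simp
  qed
  finally show ?thesis .
 qed
 have "(\<integral>\<^sup>+t\<in>{g - 1..g + 1}. ennreal (2 / (\<sigma> + \<bar>t - g\<bar>)) \<partial>lborel)
   \<le> (\<integral>\<^sup>+t. ennreal (?f (t - g)) * indicator {0..1} (t - g) + ennreal (?f (g - t)) * indicator {0..1} (g - t) \<partial>lborel)"
  by (intro nn_integral_mono) (auto simp: indicator_def abs_if)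
 also have "\<dots> = (\<integral>\<^sup>+t. ennreal (?f (t - g)) * indicator {0..1} (t - g) \<partial>lborel) + (\<integral>\<^sup>+t. ennreal (?f (g - t)) * indicator {0..1} (g - t) \<partial>lborel)"
  by (rule nn_integral_add) measurable
 also have "(\<integral>\<^sup>+t. ennreal (?f (t - g)) * indicator {0..1} (t - g) \<partial>lborel) = (\<integral>\<^sup>+x\<in>{0..1}. ennreal (?f x) \<partial>lborel)"
  using nn_integral_real_affine[of "\<lambda>x. ennreal (?f x) * indicator {0..1} x" 1 "- g"] by simp
 also have "(\<integral>\<^sup>+t. ennreal (?f (g - t)) * indicator {0..1} (g - t) \<partial>lborel) = (\<integral>\<^sup>+x\<in>{0..1}. ennreal (?f x) \<partial>lborel)"
  using nn_integral_real_affine[of "\<lambda>x. ennreal (?f x) * indicator {0..1} x" "-1" g] by simp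
 also have "(\<integral>\<^sup>+x\<in>{0..1}. ennreal (?f x) \<partial>lborel) + (\<integral>\<^sup>+x\<in>{0..1}. ennreal (?f x) \<partial>lborel)
   = ennreal (4 * ln (1 + 1 / \<sigma>))"
  unfolding half using assms by (subst ennreal_plus[symmetric]) auto
 also have "\<dots> \<le> ennreal (8 * ln (1 / \<sigma>))"
 proof (rule ennreal_leI)
  \<comment> \<open>For \<open>\<sigma> \<le> 1/2\<close> this yields
    \<open>1 + 1 / \<sigma> \<le> (1 / \<sigma>)^2\<close>; taking logarithms doubles the constant 4
    to 8.\<close>
  have "\<sigma> * \<sigma> + \<sigma> \<le> 1/2 * (1/2) + 1/2" using assms by (intro add_mono mult_mono) auto
  then have "1 + 1 / \<sigma> \<le> (1 / \<sigma>)^2"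
  proof -
   assume *: "\<sigma> * \<sigma> + \<sigma> \<le> 1/2 * (1/2) + 1/2"
   have "1 + 1 / \<sigma> = (\<sigma> * \<sigma> + \<sigma>) * (1 / \<sigma>)^2" using assms by (simp add: add_divide_distrib power2_eq_square)
   also have "\<dots> \<le> 1 * (1 / \<sigma>)^2" using * by (intro mult_right_mono) auto
   finally show ?thesis by simp
  qed
  then have "ln (1 + 1 / \<sigma>) \<le> ln ((1 / \<sigma>)^2)" using assms by (subst ln_le_cancel_iff) (auto intro: add_pos_pos)
  also have "\<dots> = 2 * ln (1 / \<sigma>)" using assms by (subst ln_realpow) auto
  finally show "4 * ln (1 + 1 / \<sigma>) \<le> 8 * ln (1 / \<sigma>)" by simp
 qed
 finally show ?thesis .
qed

text \<open>From \<open>exp 1 \<le> 4\<close>. It lets additive constants be absorbed into multiples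
  of \<open>ln (1 / \<sigma>)\<close>.\<close>

lemma ln_ge_half: "0 < \<sigma> \<Longrightarrow> \<sigma> \<le> 1/2 \<Longrightarrow> 1/2 \<le> ln (1 / \<sigma> :: real)"
proof -
 assume \<sigma>: "0 < \<sigma>" "\<sigma> \<le> 1/2"
 have "exp 1 \<le> (2::real)^2" using exp_le by simp
 then have "1 \<le> ln ((2::real)^2)" by (subst ln_ge_iff) auto
 then have "1/2 \<le> ln (2::real)" by (subst (asm) ln_realpow) auto
 also have "\<dots> \<le> ln (1 / \<sigma>)" using \<sigma> by (simp add: field_simps)
 finally show ?thesis .
qed

lemma inverse_sqrt_le:
 fixes \<sigma> u :: real
 assumes "\<sigma> > 0"
 shows "1 / sqrt (\<sigma>^2 + u^2) \<le> 2 / (\<sigma> + \<bar>u\<bar>)"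
proof -
 have "(\<sigma> + \<bar>u\<bar>)^2 \<le> 4 * (\<sigma>^2 + u^2)"
  using sum_squares_bound[of \<sigma> "\<bar>u\<bar>"] by (simp add: power2_sum) (use zero_le_power2[of \<sigma>] zero_le_power2[of u] in linarith)
 then have "\<sigma> + \<bar>u\<bar> \<le> sqrt (4 * (\<sigma>^2 + u^2))" by (rule real_le_rsqrt)
 then have "\<sigma> + \<bar>u\<bar> \<le> 2 * sqrt (\<sigma>^2 + u^2)" by (subst (asm) real_sqrt_mult) simp
 moreover have "sqrt (\<sigma>^2 + u^2) > 0" using assms by (simp add: add_pos_nonneg)
 moreover have "\<sigma> + \<bar>u\<bar> > 0" using assms by simp
 ultimately show ?thesis by (simp add: field_simps)
qed

text \<open>The contribution of one zero at height \<open>g\<close>, seen from a line at distance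
  \<open>\<sigma>\<close>: logarithmic in mean over a unit window, and
  \<open>O(1 / \<sigma>)\<close> in mean square. At distance 1 or more from \<open>g\<close> the
  first integrand is at most 1.\<close>

lemma window_integral_bounds:
 fixes \<sigma> g :: real
 assumes \<sigma>: "0 < \<sigma>" "\<sigma> \<le> 1/2"
 shows "window_integral (\<lambda>t. 1 / sqrt (\<sigma>^2 + (t - g)^2)) x \<le> ennreal (10 * ln (1 / \<sigma>))"
  "window_integral (\<lambda>t. 1 / (\<sigma>^2 + (t - g)^2)) x \<le> ennreal (4 / \<sigma>)"
proof -
 have "window_integral (\<lambda>t. 1 / sqrt (\<sigma>^2 + (t - g)^2)) x
  \<le> (\<integral>\<^sup>+t. indicator {x - 1/2..x + 1/2} t + ennreal (2 / (\<sigma> + \<bar>t - g\<bar>)) * indicator {g - 1..g + 1} t \<partial>lborel)"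
 proof (rule nn_integral_mono)
  fix t
  have le: "1 / sqrt (\<sigma>^2 + (t - g)^2) \<le> 2 / (\<sigma> + \<bar>t - g\<bar>)" by (rule inverse_sqrt_le[OF \<sigma>(1)])
  show "ennreal (1 / sqrt (\<sigma>^2 + (t - g)^2)) * indicator {x - 1/2..x + 1/2} t
   \<le> indicator {x - 1/2..x + 1/2} t + ennreal (2 / (\<sigma> + \<bar>t - g\<bar>)) * indicator {g - 1..g + 1} t"
  proof (cases "t \<in> {g - 1..g + 1}")
   case True
   have "ennreal (1 / sqrt (\<sigma>^2 + (t - g)^2)) \<le> ennreal (2 / (\<sigma> + \<bar>t - g\<bar>))" by (rule ennreal_leI[OF le])
   then show ?thesis using True by (auto simp: indicator_def intro: add_increasing)
  next
   case False
   then have "1 \<le> \<bar>t - g\<bar>" by auto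
   then have "1^2 \<le> \<bar>t - g\<bar>\<^sup>2" by (intro power_mono) auto
   then have "1 \<le> \<sigma>^2 + (t - g)^2" using zero_le_power2[of \<sigma>] unfolding power2_abs one_power2 by linarith
   then have "1 / sqrt (\<sigma>^2 + (t - g)^2) \<le> 1" by (simp add: divide_le_eq)
   then have "ennreal (1 / sqrt (\<sigma>^2 + (t - g)^2)) \<le> ennreal 1" by (rule ennreal_leI)
   then show ?thesis using False by (auto simp: indicator_def)
  qed
 qed
 also have "\<dots> = (\<integral>\<^sup>+t. indicator {x - 1/2..x + 1/2} t \<partial>lborel) + (\<integral>\<^sup>+t\<in>{g - 1..g + 1}. ennreal (2 / (\<sigma> + \<bar>t - g\<bar>)) \<partial>lborel)"
  by (rule nn_integral_add) measurable
 also have "\<dots> \<le> ennreal (2 * ln (1 / \<sigma>)) + ennreal (8 * ln (1 / \<sigma>))"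
 proof (intro add_mono inverse_abs_integral[OF \<sigma>])
  have "ennreal 1 \<le> ennreal (2 * ln (1 / \<sigma>))" using ln_ge_half[OF \<sigma>] by (intro ennreal_leI) simp
  then show "(\<integral>\<^sup>+t. indicator {x - 1/2..x + 1/2} t \<partial>lborel) \<le> ennreal (2 * ln (1 / \<sigma>))" by simp
 qed
 also have "\<dots> = ennreal (10 * ln (1 / \<sigma>))"
  using ln_ge_half[OF \<sigma>] by (subst ennreal_plus[symmetric]) auto
 finally show "window_integral (\<lambda>t. 1 / sqrt (\<sigma>^2 + (t - g)^2)) x \<le> ennreal (10 * ln (1 / \<sigma>))" .
 have "window_integral (\<lambda>t. 1 / (\<sigma>^2 + (t - g)^2)) x
  \<le> (\<integral>\<^sup>+t. ennreal (1 / (2 * \<sigma>)) * ennreal (2 * (1 / \<sigma>) / (1 + (1 / \<sigma>)^2 * (t - g)^2)) \<partial>lborel)"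
 proof (rule nn_integral_mono)
  fix t
  have "1 / (2 * \<sigma>) * (2 * (1 / \<sigma>) / (1 + (1 / \<sigma>)^2 * (t - g)^2)) = 1 / (\<sigma>^2 + (t - g)^2)"
  proof -
   have "\<sigma>^2 * (1 + (1 / \<sigma>)^2 * (t - g)^2) = \<sigma>^2 + (t - g)^2" using \<sigma>(1) by (simp add: distrib_left power_divide)
   then have "1 / (\<sigma>^2 + (t - g)^2) = 1 / (\<sigma>^2 * (1 + (1 / \<sigma>)^2 * (t - g)^2))" by (simp only:)
   then show ?thesis using \<sigma>(1) by (simp add: power2_eq_square)
  qed
  then show "ennreal (1 / (\<sigma>^2 + (t - g)^2)) * indicator {x - 1/2..x + 1/2} t
   \<le> ennreal (1 / (2 * \<sigma>)) * ennreal (2 * (1 / \<sigma>) / (1 + (1 / \<sigma>)^2 * (t - g)^2))"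
   using \<sigma>(1) by (subst ennreal_mult'[symmetric]) (auto simp: indicator_def)
 qed
 also have "\<dots> = ennreal (1 / (2 * \<sigma>)) * (\<integral>\<^sup>+t. ennreal (2 * (1 / \<sigma>) / (1 + (1 / \<sigma>)^2 * (t - g)^2)) \<partial>lborel)"
  by (rule nn_integral_cmult) measurable
 also have "\<dots> = ennreal (1 / (2 * \<sigma>)) * ennreal (2 * pi)"
  using \<sigma>(1) by (subst Cauchy_kernel_integral) auto
 also have "\<dots> = ennreal (pi / \<sigma>)" using \<sigma>(1) by (subst ennreal_mult'[symmetric]) auto
 also have "\<dots> \<le> ennreal (4 / \<sigma>)" using \<sigma>(1) pi_less_4 by (intro ennreal_leI divide_right_mono) auto
 finally show "window_integral (\<lambda>t. 1 / (\<sigma>^2 + (t - g)^2)) x \<le> ennreal (4 / \<sigma>)" .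
qed

lemma nn_integral_sum_list_le:
 fixes k :: "real \<Rightarrow> real \<Rightarrow> real"
 assumes "\<And>g. (\<lambda>t. k g t) \<in> borel_measurable borel" "\<And>g t. k g t \<ge> 0"
  and "\<And>g. (\<integral>\<^sup>+t\<in>S. ennreal (k g t) \<partial>lborel) \<le> B" and [measurable]: "S \<in> sets borel"
 shows "(\<integral>\<^sup>+t\<in>S. ennreal (\<Sum>g\<leftarrow>gs. k g t) \<partial>lborel) \<le> of_nat (length gs) * B"
proof (induction gs)
 case (Cons g gs)
 have [measurable]: "(\<lambda>t. k g t) \<in> borel_measurable borel" for g by (rule assms)
 have [measurable]: "(\<lambda>t. \<Sum>g\<leftarrow>gs. k g t) \<in> borel_measurable borel" by (induction gs) simp_all
 have nn: "(\<Sum>g\<leftarrow>gs. k g t) \<ge> 0" for t by (rule sum_list_nonneg) (use assms(2) in auto)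
 have "(\<integral>\<^sup>+t\<in>S. ennreal (\<Sum>g\<leftarrow>g # gs. k g t) \<partial>lborel)
  = (\<integral>\<^sup>+t. ennreal (k g t) * indicator S t + ennreal (\<Sum>g\<leftarrow>gs. k g t) * indicator S t \<partial>lborel)"
  using nn assms(2) by (intro nn_integral_cong) (simp add: distrib_right)
 also have "\<dots> = (\<integral>\<^sup>+t\<in>S. ennreal (k g t) \<partial>lborel) + (\<integral>\<^sup>+t\<in>S. ennreal (\<Sum>g\<leftarrow>gs. k g t) \<partial>lborel)"
  by (rule nn_integral_add) measurable
 also have "\<dots> \<le> B + of_nat (length gs) * B" by (intro add_mono assms(3) Cons)
 finally show ?case by (simp add: distrib_right)
qed simp

text \<open>Adds up the zeros that matter for one window: \<open>L\<close> bounds their number and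
  \<open>W\<close> the contribution of each.\<close>

lemma window_integral_le:
 fixes k :: "real \<Rightarrow> real \<Rightarrow> real"
 assumes k: "\<And>g. (\<lambda>t. k g t) \<in> borel_measurable borel" "\<And>g t. k g t \<ge> 0" "\<And>g. window_integral (k g) x \<le> ennreal W"
  and F: "\<And>t. t \<in> {x - 1/2..x + 1/2} \<Longrightarrow> F t \<le> a + b * (\<Sum>g\<leftarrow>gs. k g t)" and gs: "real (length gs) \<le> L"
  and ab: "a \<ge> 0" "b \<ge> 0" "W \<ge> 0"
 shows "window_integral F x \<le> ennreal (a + b * (L * W))"
proof -
 let ?I = "{x - 1/2..x + 1/2}" and ?S = "\<lambda>t. \<Sum>g\<leftarrow>gs. k g t"
 have [measurable]: "?S \<in> borel_measurable borel" using k(1) by (induction gs) simp_all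
 have S0: "?S t \<ge> 0" for t by (rule sum_list_nonneg) (use k(2) in auto)
 have "window_integral F x \<le> (\<integral>\<^sup>+t. ennreal a * indicator ?I t + ennreal b * (ennreal (?S t) * indicator ?I t) \<partial>lborel)"
 proof (rule nn_integral_mono)
  fix t
  show "ennreal (F t) * indicator ?I t \<le> ennreal a * indicator ?I t + ennreal b * (ennreal (?S t) * indicator ?I t)"
  proof (cases "t \<in> ?I")
   case True
   have "ennreal (F t) \<le> ennreal (a + b * ?S t)" by (rule ennreal_leI[OF F[OF True]])
   also have "\<dots> = ennreal a + ennreal b * ennreal (?S t)"
    using ab S0[of t] by (simp add: ennreal_mult'[symmetric] ennreal_plus)
   finally show ?thesis using True by simp
  qed simp
 qed
 also have "\<dots> = ennreal a * (\<integral>\<^sup>+t. indicator ?I t \<partial>lborel) + ennreal b * window_integral ?S x"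
  by (subst nn_integral_add) (auto simp: nn_integral_cmult)
 also have "\<dots> \<le> ennreal a * 1 + ennreal b * (of_nat (length gs) * ennreal W)"
  by (intro add_mono mult_left_mono nn_integral_sum_list_le k) auto
 also have "of_nat (length gs) * ennreal W = ennreal (real (length gs) * W)"
  by (subst ennreal_mult') (simp_all add: ennreal_of_nat_eq_real_of_nat)
 also have "ennreal a * 1 + ennreal b * \<dots> = ennreal (a + b * (real (length gs) * W))"
  using ab by (simp add: ennreal_mult'[symmetric] ennreal_plus)
 also have "\<dots> \<le> ennreal (a + b * (L * W))" using gs ab by (intro ennreal_leI add_left_mono mult_left_mono mult_right_mono)
 finally show ?thesis .
qed

lemma sum_list_power2_le:
 fixes f :: "'a \<Rightarrow> real"
 shows "(\<Sum>x\<leftarrow>xs. f x)^2 \<le> real (length xs) * (\<Sum>x\<leftarrow>xs. (f x)^2)"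
proof -
 have "(\<Sum>x\<leftarrow>xs. f x)^2 = (\<Sum>i<length xs. f (xs ! i) * 1)^2"
  by (simp add: sum_list_sum_nth atLeast0LessThan)
 also have "\<dots> \<le> (\<Sum>i<length xs. (f (xs ! i))^2) * (\<Sum>i<length xs. 1^2)"
  by (rule Cauchy_Schwarz_ineq_sum)
 finally show ?thesis by (simp add: sum_list_sum_nth atLeast0LessThan mult.commute)
qed

locale GRH_character =
 fixes q :: nat and chi :: "nat \<Rightarrow> complex"
 assumes q: "q > 1" and chi: "dirichlet_char q chi" "chi \<noteq> principal_char q" and GRH: "GRH_for chi"
begin

abbreviation "L \<equiv> Lfun chi"

definition m :: real where "m = of_int (m_char chi)"

definition h :: "complex \<Rightarrow> complex" where "h s = deriv L (1/2 + s) / L (1/2 + s)"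

text \<open>The continuation of the Laplace transform of the error term \<open>E1\<close>, as
  \<open>E1_Laplace\<close> shows. At 0 the first summand behaves like \<open>- 2 * m / s\<close>,
  and the second cancels this pole.\<close>

definition f1 :: "complex \<Rightarrow> complex" where "f1 s = - h s / (1/2 + s) + 2 * of_real m / s"

lemma L_holomorphic: "L holomorphic_on {s. Re s > 0}"
 by (rule Lfun_char_holomorphic[OF chi q])

text \<open>\<open>GRH_for\<close> covers the open strip; on its right edge and beyond there are no
  zeros at all.\<close>

lemma L_zero: "L s = 0 \<Longrightarrow> Re s > 0 \<Longrightarrow> Re s = 1/2"
 using GRH Lfun_nonzero_Re_eq_1[OF chi q, of s] unfolding GRH_for_def by force

text \<open>The shift 4 keeps the logarithm above 1, so that constants can be absorbed in it. The
  power 1/4 is the slack left by the exponent 3/4 in \<open>P\<close>.\<close>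

lemma log_bounds:
 fixes x :: real
 shows "1 \<le> ln (\<bar>x\<bar> + 4)" "ln (\<bar>x\<bar> + 4) \<le> 6 * (1 + \<bar>x\<bar>) powr (1/4)"
proof -
 have "exp 1 \<le> \<bar>x\<bar> + 4" using exp_le by linarith
 then show "1 \<le> ln (\<bar>x\<bar> + 4)" by (subst ln_ge_iff) auto
 have l4: "ln 4 \<le> (2::real)"
 proof -
  have "ln (4::real) = 2 * ln 2" using ln_realpow[of 2 2] by simp
  then show ?thesis using ln_less_self[of "2::real"] ln_le_minus_one[of "2::real"] by simp
 qed
 have one: "1 \<le> (1 + \<bar>x\<bar>) powr (1/4)" by (intro ge_one_powr_ge_zero) auto
 have "ln (\<bar>x\<bar> + 4) \<le> ln (4 * (1 + \<bar>x\<bar>))" by (subst ln_le_cancel_iff) auto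
 also have "\<dots> = ln 4 + ln (1 + \<bar>x\<bar>)" by (rule ln_mult_pos) auto
 also have "\<dots> \<le> 2 * (1 + \<bar>x\<bar>) powr (1/4) + ((1 + \<bar>x\<bar>) powr (1/4)) / (1/4)"
  using l4 one ln_powr_bound[of "1 + \<bar>x\<bar>" "1/4"] by (intro add_mono) auto
 finally show "ln (\<bar>x\<bar> + 4) \<le> 6 * (1 + \<bar>x\<bar>) powr (1/4)" by simp
qed

text \<open>Landau's lemma on discs about \<open>2 + \<i> \<tau>\<close>. The radii meet two
  demands: the points \<open>1/2 + x + \<i> t\<close> in question lie within
  \<open>sqrt (5/2) < 16/10\<close> of the centre, and the largest disc, of radius 19/10, stays in
  \<open>Re s \<ge> 1/10\<close>. Under GRH every zero found has real part 1/2, so its distance from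
  such a point is \<open>sqrt (x^2 + (t - g)^2)\<close>.\<close>

lemma h_local_bound:
 "\<exists>C>0. \<forall>\<tau>. \<exists>gs. real (length gs) \<le> C * ln (\<bar>\<tau>\<bar> + 4) \<and>
  (\<forall>x t. 0 < x \<longrightarrow> x \<le> 2 \<longrightarrow> \<bar>t - \<tau>\<bar> \<le> 1/2 \<longrightarrow>
   norm (h (Complex x t)) \<le> C * ln (\<bar>\<tau>\<bar> + 4) + (\<Sum>g\<leftarrow>gs. 1 / sqrt (x^2 + (t - g)^2)))"
proof -
 obtain C where C: "C > 0" "\<And>s. Re s \<ge> 1/10 \<Longrightarrow> norm (L s) \<le> C * norm s"
  using Lfun_bound[OF dirichlet_char_partial_sums[OF chi q], of "1/10"] by auto
 obtain K where K: "K > 0" "\<And>f M. f holomorphic_on ball 0 (19/10) \<Longrightarrow> f 0 \<noteq> 0 \<Longrightarrow> (\<forall>z. norm z \<le> 18/10 \<longrightarrow> norm (f z) \<le> M) \<Longrightarrow>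
  (\<exists>as. real (length as) \<le> K * (ln (M / norm (f 0)) + 1) \<and> (\<forall>a\<in>set as. norm a \<le> 17/10 \<and> f a = 0) \<and>
   (\<forall>z. norm z \<le> 16/10 \<longrightarrow> f z \<noteq> 0 \<longrightarrow>
    norm (deriv f z / f z) \<le> K * (ln (M / norm (f 0)) + 1) + (\<Sum>a\<leftarrow>as. 1 / norm (z - a))))"
  using logderiv_near_zeros[of "16/10" "17/10" "18/10" "19/10"] by (auto simp: power2_eq_square)
 define C1 where "C1 = K * (\<bar>ln (4 * C)\<bar> + 2)"
 have C1: "C1 > 0" using K(1) by (simp add: C1_def)
 show ?thesis
 proof (intro exI[of _ C1] conjI allI)
  fix \<tau> :: real
  define c where "c = Complex 2 \<tau>"
  define f where "f z = L (c + z)" for z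
  define M where "M = C * (\<bar>\<tau>\<bar> + 4)"
  have M0: "M > 0" using C(1) by (simp add: M_def add_nonneg_pos)
  have Re_c: "Re (c + z) \<ge> 1/10" if "norm z < 19/10" for z
   using abs_Re_le_cmod[of z] that by (simp add: c_def)
  have "(L \<circ> (\<lambda>z. c + z)) holomorphic_on ball 0 (19/10)"
   by (rule holomorphic_on_compose_gen[OF _ L_holomorphic])
    (use Re_c in \<open>force intro!: holomorphic_intros\<close>)+
  then have fh: "f holomorphic_on ball 0 (19/10)" by (simp add: f_def[abs_def] o_def)
  have f0: "norm (f 0) \<ge> 1/4" unfolding f_def
   by (rule Lfun_lower_bound) (use norm_dirichlet_char_le[OF chi(1)] dirichlet_charD(1)[OF chi(1)] q in \<open>auto simp: c_def\<close>)
  have fM: "norm (f z) \<le> M" if "norm z \<le> 18/10" for z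
  proof -
   have "norm (f z) \<le> C * norm (c + z)" unfolding f_def by (rule C(2)[OF Re_c]) (use that in simp)
   also have "norm (c + z) \<le> \<bar>\<tau>\<bar> + 4"
    using norm_triangle_ineq[of c z] cmod_le[of c] that by (simp add: c_def)
   finally show ?thesis using C(1) by (simp add: M_def mult_left_mono)
  qed
  obtain as where as: "real (length as) \<le> K * (ln (M / norm (f 0)) + 1)" "\<And>a. a \<in> set as \<Longrightarrow> norm a \<le> 17/10 \<and> f a = 0"
   "\<And>z. norm z \<le> 16/10 \<Longrightarrow> f z \<noteq> 0 \<Longrightarrow> norm (deriv f z / f z) \<le> K * (ln (M / norm (f 0)) + 1) + (\<Sum>a\<leftarrow>as. 1 / norm (z - a))"
   using K(2)[OF fh, of M] f0 fM by force
  have lnb: "K * (ln (M / norm (f 0)) + 1) \<le> C1 * ln (\<bar>\<tau>\<bar> + 4)"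
  proof -
   have "M / norm (f 0) \<le> M / (1/4)" using f0 M0 by (intro divide_left_mono) auto
   moreover have "M / norm (f 0) > 0" using f0 M0 by (intro divide_pos_pos) linarith+
   moreover have "M / (1/4) = 4 * C * (\<bar>\<tau>\<bar> + 4)" by (simp add: M_def)
   ultimately have "ln (M / norm (f 0)) \<le> ln (4 * C * (\<bar>\<tau>\<bar> + 4))"
    by (metis ln_mono)
   also have "\<dots> = ln (4 * C) + ln (\<bar>\<tau>\<bar> + 4)" using C(1) by (intro ln_mult_pos) auto
   finally have "ln (M / norm (f 0)) + 1 \<le> \<bar>ln (4 * C)\<bar> * 1 + ln (\<bar>\<tau>\<bar> + 4) + 1" by linarith
   also have "\<dots> \<le> \<bar>ln (4 * C)\<bar> * ln (\<bar>\<tau>\<bar> + 4) + ln (\<bar>\<tau>\<bar> + 4) + ln (\<bar>\<tau>\<bar> + 4)"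
    using log_bounds(1)[of \<tau>] by (intro add_mono mult_left_mono) auto
   also have "\<dots> = (\<bar>ln (4 * C)\<bar> + 2) * ln (\<bar>\<tau>\<bar> + 4)" by (simp add: algebra_simps)
   finally show ?thesis using K(1) by (simp add: C1_def mult.assoc mult_left_mono)
  qed
  define gs where "gs = map (\<lambda>a. \<tau> + Im a) as"
  have "norm (h (Complex x t)) \<le> C1 * ln (\<bar>\<tau>\<bar> + 4) + (\<Sum>g\<leftarrow>gs. 1 / sqrt (x^2 + (t - g)^2))"
   if x: "0 < x" "x \<le> 2" and t: "\<bar>t - \<tau>\<bar> \<le> 1/2" for x t
  proof -
   define z where "z = Complex (x - 3/2) (t - \<tau>)"
   have cz: "c + z = 1/2 + Complex x t" by (simp add: c_def z_def complex_eq_iff)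
   have "norm z \<le> 16/10"
   proof -
    have "\<bar>x - 3/2\<bar> \<le> 3/2" using x by (intro abs_leI) linarith+
    then have "(x - 3/2)^2 \<le> (3/2)^2" by (metis abs_le_square_iff abs_of_nonneg zero_le_divide_iff zero_le_numeral)
    moreover have "(t - \<tau>)^2 \<le> (1/2)^2" using t by (metis abs_le_square_iff abs_of_nonneg zero_le_divide_1_iff zero_le_numeral)
    ultimately have "(norm z)^2 \<le> (16/10)^2" by (simp add: z_def cmod_power2) (simp add: power2_eq_square)
    then show ?thesis by (rule power2_le_imp_le) simp
   qed
   moreover have "f z \<noteq> 0" using L_zero[of "c + z"] x unfolding f_def cz by auto
   ultimately have "norm (deriv f z / f z) \<le> K * (ln (M / norm (f 0)) + 1) + (\<Sum>a\<leftarrow>as. 1 / norm (z - a))"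
    by (rule as(3))
   moreover have "deriv f z = deriv L (c + z)"
   proof -
    have "(L has_field_derivative deriv L (c + z)) (at (c + z))"
     by (rule holomorphic_derivI[OF L_holomorphic open_halfspace_Re_gt]) (use x in \<open>simp add: cz\<close>)
    then have "((\<lambda>z. L (c + z)) has_field_derivative deriv L (c + z) * 1) (at z)"
     by (rule DERIV_chain2) (auto intro!: derivative_eq_intros)
    then show ?thesis unfolding f_def by (simp add: DERIV_imp_deriv)
   qed
   moreover have "(\<Sum>a\<leftarrow>as. 1 / norm (z - a)) = (\<Sum>g\<leftarrow>gs. 1 / sqrt (x^2 + (t - g)^2))"
   proof -
    have "1 / norm (z - a) = 1 / sqrt (x^2 + (t - (\<tau> + Im a))^2)" if "a \<in> set as" for a
    proof -
     have a: "norm a \<le> 17/10" "L (c + a) = 0" using as(2)[OF that] by (auto simp: f_def)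
     have "Re (c + a) = 1/2" by (rule L_zero[OF a(2)]) (use Re_c[of a] a(1) in simp)
     then have "Re a = - 3/2" by (simp add: c_def)
     then show ?thesis by (simp add: z_def cmod_def algebra_simps)
    qed
    then have "(\<Sum>a\<leftarrow>as. 1 / norm (z - a)) = (\<Sum>a\<leftarrow>as. 1 / sqrt (x^2 + (t - (\<tau> + Im a))^2))"
     by (intro arg_cong[where f = sum_list] map_cong) auto
    then show ?thesis by (simp add: gs_def o_def)
   qed
   ultimately show ?thesis using lnb unfolding h_def f_def cz by simp
  qed
  moreover have "real (length gs) \<le> C1 * ln (\<bar>\<tau>\<bar> + 4)" using as(1) lnb by (simp add: gs_def)
  ultimately show "\<exists>gs. real (length gs) \<le> C1 * ln (\<bar>\<tau>\<bar> + 4) \<and>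
  (\<forall>x t. 0 < x \<longrightarrow> x \<le> 2 \<longrightarrow> \<bar>t - \<tau>\<bar> \<le> 1/2 \<longrightarrow>
   norm (h (Complex x t)) \<le> C1 * ln (\<bar>\<tau>\<bar> + 4) + (\<Sum>g\<leftarrow>gs. 1 / sqrt (x^2 + (t - g)^2)))"
   by (intro exI[of _ gs]) auto
 qed (rule C1)
qed

lemma h_near_0: "\<exists>r C. 0 < r \<and> r \<le> 1/4 \<and> (\<forall>s. s \<noteq> 0 \<longrightarrow> norm s \<le> r \<longrightarrow> norm (h s - of_real m / s) \<le> C)" and m_nonneg: "m \<ge> 0"
proof -
 have ex: "\<exists>w\<in>{s. Re s > 0}. L w \<noteq> 0"
  using Lfun_char_Re_gt_1(1)[OF chi(1) q, of 2] by (intro bexI[of _ 2]) auto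
 have half: "(1/2::complex) \<in> {s. Re s > 0}" by simp
 obtain r C where r: "r > 0" "zorder L (1/2) \<ge> 0"
  "\<And>s. s \<noteq> 0 \<Longrightarrow> norm s \<le> r \<Longrightarrow> norm (deriv L (1/2 + s) / L (1/2 + s) - of_int (zorder L (1/2)) / s) \<le> C"
  using logderiv_near_point[OF L_holomorphic open_halfspace_Re_gt convex_connected[OF convex_halfspace_Re_gt] half ex] by blast
 show "m \<ge> 0" using r(2) by (simp add: m_def m_char_def)
 show "\<exists>r C. 0 < r \<and> r \<le> 1/4 \<and> (\<forall>s. s \<noteq> 0 \<longrightarrow> norm s \<le> r \<longrightarrow> norm (h s - of_real m / s) \<le> C)"
  using r(1,3) by - (rule exI[of _ "min r (1/4)"], rule exI[of _ C], auto simp: h_def m_def m_char_def)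
qed

lemma f1_holomorphic: "f1 holomorphic_on {s. Re s > 0}"
proof -
 have "deriv L holomorphic_on {s. Re s > 0}"
  by (rule holomorphic_deriv[OF L_holomorphic open_halfspace_Re_gt])
 then have "(deriv L \<circ> (\<lambda>s. 1/2 + s)) holomorphic_on {s. Re s > 0}" "(L \<circ> (\<lambda>s. 1/2 + s)) holomorphic_on {s. Re s > 0}"
  using L_holomorphic by (auto intro!: holomorphic_on_compose_gen[where t = "{s. Re s > 0}"] holomorphic_intros)
 then show ?thesis unfolding f1_def h_def o_def
 proof (intro holomorphic_intros)
  fix z assume z: "z \<in> {s. Re s > 0}"
  show "L (1/2 + z) \<noteq> 0" using L_zero[of "1/2 + z"] z by auto
  have "Re (1/2 + z) \<noteq> 0" using z by simp
  then show "1/2 + z \<noteq> 0" by (metis zero_complex.sel(1))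
  show "z \<noteq> 0" using z by auto
 qed
qed

lemma f1_near_0: "\<exists>r C. 0 < r \<and> r \<le> 1/4 \<and> C \<ge> 0 \<and> (\<forall>s. Re s > 0 \<longrightarrow> norm s \<le> r \<longrightarrow> norm (f1 s) \<le> C)"
proof -
 obtain r C where r: "0 < r" "r \<le> 1/4" "\<And>s. s \<noteq> 0 \<Longrightarrow> norm s \<le> r \<Longrightarrow> norm (h s - of_real m / s) \<le> C"
  using h_near_0 by blast
 have C: "C \<ge> 0" using order_trans[OF norm_ge_zero r(3)[of "of_real r"]] r(1) by simp
 have "norm (f1 s) \<le> 4 * m + 2 * C" if s: "Re s > 0" "norm s \<le> r" for s
 proof -
  have s0: "s \<noteq> 0" "1/2 + s \<noteq> 0" using s by (auto simp: complex_eq_iff)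
  have nrm: "norm (1/2 + s) \<ge> 1/2" using abs_Re_le_cmod[of "1/2 + s"] s by simp
  \<comment> \<open>The pole of \<open>h\<close> at 0 and the summand \<open>2 * m / s\<close>
    combine to the constant \<open>2 * m\<close> in the numerator.\<close>
  have "f1 s = (2 * of_real m - (h s - of_real m / s)) / (1/2 + s)"
   using s0 by (simp add: f1_def divide_simps) (simp add: algebra_simps)
  then have "norm (f1 s) \<le> (norm (2 * of_real m - (h s - of_real m / s))) / (1/2)"
   using nrm by (simp only: norm_divide) (intro divide_left_mono, auto)
  also have "norm (2 * of_real m - (h s - of_real m / s)) \<le> 2 * m + C"
   using norm_triangle_ineq4[of "2 * of_real m" "h s - of_real m / s"] r(3)[OF s0(1) s(2)] m_nonneg
   by (simp add: norm_mult)
  finally show ?thesis by simp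
 qed
 then show ?thesis using r C m_nonneg by (intro exI[of _ r] exI[of _ "4 * m + 2 * C"]) auto
qed

text \<open>Away from 0 both denominators in \<open>f1\<close> are at least a constant times
  \<open>1 + \<bar>t\<bar>\<close>; near 0 the poles cancel and \<open>f1_near_0\<close> takes over.
  The constant is uniform as \<open>x\<close> tends to 0.\<close>

lemma f1_bound: "\<exists>C>0. \<forall>x t. 0 < x \<longrightarrow> x \<le> 2 \<longrightarrow> norm (f1 (Complex x t)) \<le> C * (1 + norm (h (Complex x t))) / (1 + \<bar>t\<bar>)"
proof -
 obtain r C where r: "0 < r" "r \<le> 1/4" "C \<ge> 0" "\<And>s. Re s > 0 \<Longrightarrow> norm s \<le> r \<Longrightarrow> norm (f1 s) \<le> C"
  using f1_near_0 by blast
 define K where "K = 2 * C + 3 + 2 * m * (1 + 1 / r)"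
 have K0: "K > 0" using r m_nonneg by (simp add: K_def add_nonneg_pos add_pos_nonneg)
 have "norm (f1 (Complex x t)) \<le> K * (1 + norm (h (Complex x t))) / (1 + \<bar>t\<bar>)" if x: "0 < x" "x \<le> 2" for x t
 proof -
  define s where "s = Complex x t"
  have ts: "\<bar>t\<bar> \<le> norm s" using abs_Im_le_cmod[of s] by (simp add: s_def)
  have "(1 + \<bar>t\<bar>) * norm (f1 s) \<le> K * (1 + norm (h s))"
  proof (cases "norm s \<le> r")
   case True
   then have "norm (f1 s) \<le> C" using r(4)[of s] x by (simp add: s_def)
   moreover have "1 + \<bar>t\<bar> \<le> 2" using ts True r by simp
   ultimately have "(1 + \<bar>t\<bar>) * norm (f1 s) \<le> 2 * C" using r(3) by (intro mult_mono) auto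
   also have "\<dots> \<le> K * 1" using r m_nonneg by (simp add: K_def)
   also have "\<dots> \<le> K * (1 + norm (h s))" using K0 by (intro mult_left_mono) auto
   finally show ?thesis .
  next
   case False
   have n1: "1 + \<bar>t\<bar> \<le> 3 * norm (1/2 + s)"
   proof -
    have "1/2 \<le> norm (1/2 + s)" "\<bar>t\<bar> \<le> norm (1/2 + s)"
     using abs_Re_le_cmod[of "1/2 + s"] abs_Im_le_cmod[of "1/2 + s"] x by (auto simp: s_def)
    then show ?thesis by simp
   qed
   have "1 \<le> norm s / r" using False r(1) by simp
   then have n2: "1 + \<bar>t\<bar> \<le> (1 + 1 / r) * norm s" using ts by (simp add: distrib_right)
   have s0: "norm s > 0" "norm (1/2 + s) > 0" using x abs_Re_le_cmod[of s] abs_Re_le_cmod[of "1/2 + s"] by (auto simp: s_def)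
   have "norm (f1 s) \<le> norm (h s) / norm (1/2 + s) + 2 * m / norm s"
    unfolding f1_def using norm_triangle_ineq[of "- h s / (1/2 + s)" "2 * of_real m / s"] m_nonneg
    by (simp add: norm_divide norm_mult)
   then have "(1 + \<bar>t\<bar>) * norm (f1 s) \<le> (1 + \<bar>t\<bar>) * (norm (h s) / norm (1/2 + s)) + (1 + \<bar>t\<bar>) * (2 * m / norm s)"
    unfolding distrib_left[symmetric] by (intro mult_left_mono) auto
   also have "\<dots> \<le> (3 * norm (1/2 + s)) * (norm (h s) / norm (1/2 + s)) + ((1 + 1 / r) * norm s) * (2 * m / norm s)"
    using n1 n2 m_nonneg by (intro add_mono mult_right_mono) auto
   also have "\<dots> = 3 * norm (h s) + 2 * m * (1 + 1 / r)" using s0 by simp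
   also have "\<dots> \<le> K * norm (h s) + K * 1"
    using r m_nonneg by (intro add_mono mult_right_mono) (auto simp: K_def)
   finally show ?thesis by (simp add: distrib_left)
  qed
  then show ?thesis unfolding s_def by (simp add: pos_le_divide_eq mult.commute)
 qed
 then show ?thesis using K0 by blast
qed

text \<open>Apart from nearby zeros \<open>f1\<close> decays like
  \<open>log \<bar>t\<bar> / \<bar>t\<bar>\<close>. The exponent 3/4 leaves
  \<open>(1 + \<bar>t\<bar>) powr (-1/4)\<close> to absorb the logarithms, while the inverse of the
  extracted factor is still square integrable.\<close>

definition P :: "real \<Rightarrow> real \<Rightarrow> real" where
 "P \<sigma> t = (1 + \<bar>t\<bar>) powr (3/4) * norm (f1 (Complex \<sigma> t))"

text \<open>The number of relevant zeros is at most a constant times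
  \<open>(1 + \<bar>\<tau>\<bar>) powr (1/4)\<close>, and each enters with the reciprocal of this
  power. The powers cancel, which makes the window bounds independent of the window.\<close>

lemma P_pointwise:
 "\<exists>C>0. \<forall>\<sigma> \<tau>. 0 < \<sigma> \<longrightarrow> \<sigma> \<le> 2 \<longrightarrow> (\<exists>gs. real (length gs) \<le> C * (1 + \<bar>\<tau>\<bar>) powr (1/4) \<and>
  (\<forall>t. \<bar>t - \<tau>\<bar> \<le> 1/2 \<longrightarrow> P \<sigma> t \<le> C + C * (1 + \<bar>\<tau>\<bar>) powr (-1/4) * (\<Sum>g\<leftarrow>gs. 1 / sqrt (\<sigma>^2 + (t - g)^2))))"
proof -
 obtain C where C: "C > 0" "\<And>\<tau>. \<exists>gs. real (length gs) \<le> C * ln (\<bar>\<tau>\<bar> + 4) \<and>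
  (\<forall>x t. 0 < x \<longrightarrow> x \<le> 2 \<longrightarrow> \<bar>t - \<tau>\<bar> \<le> 1/2 \<longrightarrow>
   norm (h (Complex x t)) \<le> C * ln (\<bar>\<tau>\<bar> + 4) + (\<Sum>g\<leftarrow>gs. 1 / sqrt (x^2 + (t - g)^2)))"
  using h_local_bound by blast
 obtain D where D: "D > 0" "\<And>x t. 0 < x \<Longrightarrow> x \<le> 2 \<Longrightarrow> norm (f1 (Complex x t)) \<le> D * (1 + norm (h (Complex x t))) / (1 + \<bar>t\<bar>)"
  using f1_bound by blast
 define K where "K = 6 * C + 2 * D * (1 + 6 * C) + 2 * D"
 have K0: "K > 0" using C D by (simp add: K_def add_pos_pos)
 show ?thesis
 proof (intro exI[of _ K] conjI allI impI K0)
  fix \<sigma> \<tau> :: real assume \<sigma>: "0 < \<sigma>" "\<sigma> \<le> 2"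
  obtain gs where gs: "real (length gs) \<le> C * ln (\<bar>\<tau>\<bar> + 4)"
   "\<And>t. \<bar>t - \<tau>\<bar> \<le> 1/2 \<Longrightarrow> norm (h (Complex \<sigma> t)) \<le> C * ln (\<bar>\<tau>\<bar> + 4) + (\<Sum>g\<leftarrow>gs. 1 / sqrt (\<sigma>^2 + (t - g)^2))"
   using C(2)[of \<tau>] \<sigma> by auto
  define v where "v = (1 + \<bar>\<tau>\<bar>) powr (1/4)"
  have v1: "v \<ge> 1" unfolding v_def by (intro ge_one_powr_ge_zero) auto
  have vinv: "(1 + \<bar>\<tau>\<bar>) powr (-1/4) = 1 / v" by (simp add: v_def powr_minus_divide[symmetric])
  have lnv: "ln (\<bar>\<tau>\<bar> + 4) \<le> 6 * v" unfolding v_def by (rule log_bounds(2))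
  have "real (length gs) \<le> C * (6 * v)" using gs(1) lnv C(1) by (meson mult_left_mono order_trans less_imp_le)
  also have "\<dots> \<le> K * v" using v1 C D by (simp add: K_def)
  finally have len: "real (length gs) \<le> K * v" .
  have "P \<sigma> t \<le> K + K * (1 / v) * (\<Sum>g\<leftarrow>gs. 1 / sqrt (\<sigma>^2 + (t - g)^2))" if t: "\<bar>t - \<tau>\<bar> \<le> 1/2" for t
  proof -
   define S where "S = (\<Sum>g\<leftarrow>gs. 1 / sqrt (\<sigma>^2 + (t - g)^2))"
   have S0: "S \<ge> 0" unfolding S_def by (rule sum_list_nonneg) auto
   have w: "(1 + \<bar>t\<bar>) powr (3/4) * (1 / (1 + \<bar>t\<bar>)) \<le> 2 / v"
   proof -
    have "(1 + \<bar>t\<bar>) powr (3/4) * (1 / (1 + \<bar>t\<bar>)) = (1 + \<bar>t\<bar>) powr (-1/4)"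
    proof -
     have "(1 + \<bar>t\<bar>) powr (3/4) * (1 / (1 + \<bar>t\<bar>)) = (1 + \<bar>t\<bar>) powr (3/4) * (1 + \<bar>t\<bar>) powr (-1)"
      by (simp add: powr_minus_divide)
     also have "\<dots> = (1 + \<bar>t\<bar>) powr (3/4 + -1)" by (rule powr_add[symmetric])
     finally show ?thesis by simp
    qed
    also have "\<dots> \<le> ((1 + \<bar>\<tau>\<bar>) / 2) powr (-1/4)"
    proof (rule powr_mono2')
     have "\<bar>\<tau>\<bar> \<le> \<bar>t\<bar> + 1/2" using abs_triangle_ineq4[of t "t - \<tau>"] t by simp
     then show "(1 + \<bar>\<tau>\<bar>) / 2 \<le> 1 + \<bar>t\<bar>" by simp
    qed auto
    also have "\<dots> = (1 + \<bar>\<tau>\<bar>) powr (-1/4) * 2 powr (1/4)"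
     by (simp add: powr_divide powr_minus_divide)
    also have "\<dots> \<le> (1 + \<bar>\<tau>\<bar>) powr (-1/4) * 2"
     using powr_mono[of "1/4" 1 "2::real"] by (intro mult_left_mono) auto
    finally show ?thesis unfolding vinv using v1 by (simp add: mult_left_mono divide_right_mono)
   qed
   have "P \<sigma> t \<le> (1 + \<bar>t\<bar>) powr (3/4) * (D * (1 + norm (h (Complex \<sigma> t))) / (1 + \<bar>t\<bar>))"
    unfolding P_def using D(2)[OF \<sigma>] by (intro mult_left_mono) auto
   also have "\<dots> = ((1 + \<bar>t\<bar>) powr (3/4) * (1 / (1 + \<bar>t\<bar>))) * (D * (1 + norm (h (Complex \<sigma> t))))" by simp
   also have "\<dots> \<le> 2 / v * (D * (1 + norm (h (Complex \<sigma> t))))"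
    using w D by (intro mult_right_mono) auto
   also have "\<dots> \<le> 2 / v * (D * (v + (C * (6 * v) + S)))"
   proof (intro mult_left_mono add_mono)
    show "norm (h (Complex \<sigma> t)) \<le> C * (6 * v) + S"
     using gs(2)[OF t] mult_left_mono[OF lnv, of C] C(1) unfolding S_def by linarith
   qed (use v1 D in auto)
   also have "\<dots> = 2 * D * (1 + 6 * C) + 2 * D * (1 / v) * S" using v1 by (simp add: field_simps)
   also have "\<dots> \<le> K + K * (1 / v) * S"
    using v1 C D S0 by (intro add_mono mult_right_mono) (auto simp: K_def)
   finally show ?thesis unfolding S_def .
  qed
  then show "\<exists>gs. real (length gs) \<le> K * (1 + \<bar>\<tau>\<bar>) powr (1/4) \<and>
   (\<forall>t. \<bar>t - \<tau>\<bar> \<le> 1/2 \<longrightarrow> P \<sigma> t \<le> K + K * (1 + \<bar>\<tau>\<bar>) powr (-1/4) * (\<Sum>g\<leftarrow>gs. 1 / sqrt (\<sigma>^2 + (t - g)^2)))"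
   using len unfolding vinv v_def[symmetric] by blast
 qed
qed

text \<open>Each zero contributes at most \<open>1 / a\<close>. The constant depends on
  \<open>a\<close>, which is harmless: the bound serves to justify the inversion formula, and the
  final estimates do not contain it.\<close>

lemma f1_polynomial_bound:
 assumes a: "0 < a"
 shows "\<exists>C. \<forall>x t. a \<le> x \<longrightarrow> x \<le> 2 \<longrightarrow> norm (f1 (Complex x t)) \<le> C * (1 + t^2)"
proof -
 obtain C where C: "C > 0" "\<And>\<sigma> \<tau>. 0 < \<sigma> \<Longrightarrow> \<sigma> \<le> 2 \<Longrightarrow> (\<exists>gs. real (length gs) \<le> C * (1 + \<bar>\<tau>\<bar>) powr (1/4) \<and>
  (\<forall>t. \<bar>t - \<tau>\<bar> \<le> 1/2 \<longrightarrow> P \<sigma> t \<le> C + C * (1 + \<bar>\<tau>\<bar>) powr (-1/4) * (\<Sum>g\<leftarrow>gs. 1 / sqrt (\<sigma>^2 + (t - g)^2))))"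
  using P_pointwise by blast
 define K where "K = C + C * (C / a)"
 have K: "K \<ge> 0" using C(1) a by (simp add: K_def)
 have "norm (f1 (Complex x t)) \<le> K * (1 + t^2)" if x: "a \<le> x" "x \<le> 2" for x t
 proof -
  define w where "w = (1 + \<bar>t\<bar>) powr (-1/4)"
  obtain gs where gs: "real (length gs) \<le> C * (1 + \<bar>t\<bar>) powr (1/4)" "P x t \<le> C + C * w * (\<Sum>g\<leftarrow>gs. 1 / sqrt (x^2 + (t - g)^2))"
   using C(2)[of x t] x a unfolding w_def by auto
  have "(\<Sum>g\<leftarrow>gs. 1 / sqrt (x^2 + (t - g)^2)) \<le> (\<Sum>g\<leftarrow>gs. 1 / a)"
  proof (rule sum_list_mono)
   fix g
   have "a \<le> sqrt (x^2 + (t - g)^2)"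
    using x a power_mono[of a x 2] by (intro real_le_rsqrt) (auto intro: add_increasing2)
   then show "1 / sqrt (x^2 + (t - g)^2) \<le> 1 / a" using a by (intro divide_left_mono mult_pos_pos) linarith+
  qed
  also have "\<dots> = real (length gs) / a" by (simp add: sum_list_triv)
  also have "\<dots> \<le> C * (1 + \<bar>t\<bar>) powr (1/4) / a" using gs(1) a by (intro divide_right_mono) auto
  finally have "C * w * (\<Sum>g\<leftarrow>gs. 1 / sqrt (x^2 + (t - g)^2)) \<le> C * w * (C * (1 + \<bar>t\<bar>) powr (1/4) / a)"
   using C(1) by (intro mult_left_mono) (auto simp: w_def)
  also have "\<dots> = C * (C / a) * (w * (1 + \<bar>t\<bar>) powr (1/4))" by simp
  also have "w * (1 + \<bar>t\<bar>) powr (1/4) = 1" unfolding w_def by (simp flip: powr_add)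
  finally have "P x t \<le> K" using gs(2) by (simp add: K_def)
  moreover have "1 * norm (f1 (Complex x t)) \<le> P x t"
   unfolding P_def by (intro mult_right_mono ge_one_powr_ge_zero) auto
  moreover have "K * 1 \<le> K * (1 + t^2)" using K by (intro mult_left_mono) auto
  ultimately show ?thesis by linarith
 qed
 then show ?thesis by blast
qed

lemma P_window:
 "\<exists>C>0. \<forall>\<sigma> x. 0 < \<sigma> \<longrightarrow> \<sigma> \<le> 1/2 \<longrightarrow>
  window_integral (P \<sigma>) x \<le> ennreal (C * ln (1 / \<sigma>)) \<and> window_integral (\<lambda>t. (P \<sigma> t)^2) x \<le> ennreal (C / \<sigma>)"
proof -
 obtain C where C: "C > 0" "\<And>\<sigma> \<tau>. 0 < \<sigma> \<Longrightarrow> \<sigma> \<le> 2 \<Longrightarrow> (\<exists>gs. real (length gs) \<le> C * (1 + \<bar>\<tau>\<bar>) powr (1/4) \<and>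
  (\<forall>t. \<bar>t - \<tau>\<bar> \<le> 1/2 \<longrightarrow> P \<sigma> t \<le> C + C * (1 + \<bar>\<tau>\<bar>) powr (-1/4) * (\<Sum>g\<leftarrow>gs. 1 / sqrt (\<sigma>^2 + (t - g)^2))))"
  using P_pointwise by blast
 define K where "K = 2 * C + 10 * C^2 + 2 * C^2 + 8 * C ^ 4"
 have K0: "K > 0" using C by (simp add: K_def add_pos_nonneg)
 show ?thesis
 proof (intro exI[of _ K] conjI allI impI K0)
  fix \<sigma> x :: real assume \<sigma>: "0 < \<sigma>" "\<sigma> \<le> 1/2"
  obtain gs where gs: "real (length gs) \<le> C * (1 + \<bar>x\<bar>) powr (1/4)"
   "\<And>t. \<bar>t - x\<bar> \<le> 1/2 \<Longrightarrow> P \<sigma> t \<le> C + C * (1 + \<bar>x\<bar>) powr (-1/4) * (\<Sum>g\<leftarrow>gs. 1 / sqrt (\<sigma>^2 + (t - g)^2))"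
   using C(2)[of \<sigma> x] \<sigma> by force
  define v where "v = (1 + \<bar>x\<bar>) powr (1/4)"
  have v1: "v \<ge> 1" unfolding v_def by (intro ge_one_powr_ge_zero) auto
  have vinv: "(1 + \<bar>x\<bar>) powr (-1/4) = 1 / v" by (simp add: v_def powr_minus_divide[symmetric])
  have tI: "t \<in> {x - 1/2..x + 1/2} \<longleftrightarrow> \<bar>t - x\<bar> \<le> 1/2" for t unfolding abs_diff_le_iff by simp
  define S where "S t = (\<Sum>g\<leftarrow>gs. 1 / sqrt (\<sigma>^2 + (t - g)^2))" for t
  define S2 where "S2 t = (\<Sum>g\<leftarrow>gs. 1 / (\<sigma>^2 + (t - g)^2))" for t
  have Pb: "P \<sigma> t \<le> C + C / v * S t" if "t \<in> {x - 1/2..x + 1/2}" for t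
   using gs(2)[of t] that unfolding tI vinv S_def by simp
  have "window_integral (P \<sigma>) x \<le> ennreal (C + C / v * (C * v * (10 * ln (1 / \<sigma>))))"
   by (rule window_integral_le[OF _ _ window_integral_bounds(1)[OF \<sigma>] Pb[unfolded S_def] gs(1)[folded v_def]])
    (use C(1) v1 ln_ge_half[OF \<sigma>] in auto)
  also have "C + C / v * (C * v * (10 * ln (1 / \<sigma>))) = C * 1 + 10 * C^2 * ln (1 / \<sigma>)"
   using v1 by (simp add: power2_eq_square)
  also have "\<dots> \<le> C * (2 * ln (1 / \<sigma>)) + 10 * C^2 * ln (1 / \<sigma>)"
   using C(1) ln_ge_half[OF \<sigma>] by (intro add_mono mult_left_mono) auto
  also have "\<dots> = (2 * C + 10 * C^2) * ln (1 / \<sigma>)" by (simp add: algebra_simps)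
  also have "\<dots> \<le> K * ln (1 / \<sigma>)"
   using C(1) ln_ge_half[OF \<sigma>] by (intro mult_right_mono) (auto simp: K_def)
  finally show "window_integral (P \<sigma>) x \<le> ennreal (K * ln (1 / \<sigma>))" by (simp add: ennreal_leI)
  have P2b: "(P \<sigma> t)^2 \<le> 2 * C^2 + 2 * C ^ 3 / v * S2 t" if "t \<in> {x - 1/2..x + 1/2}" for t
  proof -
   have sq: "1 / (\<sigma>^2 + (t - g)^2) = (1 / sqrt (\<sigma>^2 + (t - g)^2))^2" for g by (simp add: power_divide)
   \<comment> \<open>Cauchy-Schwarz over the list of zeros removes the cross terms at the cost of a
     factor, the number of zeros; \<open>(C / v)^2\<close> compensates both this factor and the
     summation over the zeros.\<close>
   have "(S t)^2 \<le> real (length gs) * S2 t"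
    unfolding S_def S2_def sq by (rule sum_list_power2_le)
   also have "\<dots> \<le> C * v * S2 t" using gs(1) unfolding v_def S2_def by (intro mult_right_mono sum_list_nonneg) auto
   finally have S2: "(S t)^2 \<le> C * v * S2 t" .
   have "(P \<sigma> t)^2 \<le> (C + C / v * S t)^2" using Pb[OF that] by (intro power_mono) (auto simp: P_def)
   also have "\<dots> \<le> 2 * C^2 + 2 * (C / v * S t)^2"
    using sum_squares_bound[of C "C / v * S t"] by (simp add: power2_sum)
   also have "(C / v * S t)^2 = (C / v)^2 * (S t)^2" by (rule power_mult_distrib)
   also have "2 * ((C / v)^2 * (S t)^2) \<le> 2 * ((C / v)^2 * (C * v * S2 t))"
    using S2 by (intro mult_left_mono) auto
   also have "2 * ((C / v)^2 * (C * v * S2 t)) = 2 * C ^ 3 / v * S2 t"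
    using v1 by (simp add: power2_eq_square power3_eq_cube)
   finally show ?thesis by simp
  qed
  have "window_integral (\<lambda>t. (P \<sigma> t)^2) x \<le> ennreal (2 * C^2 + 2 * C ^ 3 / v * (C * v * (4 / \<sigma>)))"
   by (rule window_integral_le[OF _ _ window_integral_bounds(2)[OF \<sigma>] P2b[unfolded S2_def] gs(1)[folded v_def]])
    (use C(1) v1 \<sigma> in auto)
  also have "2 * C^2 + 2 * C ^ 3 / v * (C * v * (4 / \<sigma>)) = 2 * C^2 * 1 + 8 * C ^ 4 / \<sigma>"
   using v1 \<sigma> by (simp add: power2_eq_square power3_eq_cube power4_eq_xxxx)
  also have "\<dots> \<le> 2 * C^2 * (1 / \<sigma>) + 8 * C ^ 4 / \<sigma>"
   using C(1) \<sigma> by (intro add_mono mult_left_mono) auto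
  also have "\<dots> = (2 * C^2 + 8 * C ^ 4) / \<sigma>" by (simp add: add_divide_distrib)
  also have "\<dots> \<le> K / \<sigma>" using C(1) \<sigma> by (intro divide_right_mono) (auto simp: K_def)
  finally show "window_integral (\<lambda>t. (P \<sigma> t)^2) x \<le> ennreal (K / \<sigma>)" by (simp add: ennreal_leI)
 qed
qed

end

subsection \<open>Mean squares of the prime number error term\<close>

lemma exp_decay_norm_integral:
 fixes w :: complex
 assumes "Re w > 0"
 shows "(\<integral>v. norm (indicator {a..} v *\<^sub>R exp (- w * of_real v)) \<partial>lborel) = exp (- Re w * a) / Re w"
proof -
 have "complex_of_real (\<integral>v. norm (indicator {a..} v *\<^sub>R exp (- w * of_real v)) \<partial>lborel)
   = (\<integral>v. complex_of_real (norm (indicator {a..} v *\<^sub>R exp (- w * of_real v))) \<partial>lborel)"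
  by (rule integral_complex_of_real[symmetric])
 also have "\<dots> = (\<integral>v. indicator {a..} v *\<^sub>R exp (- complex_of_real (Re w) * of_real v) \<partial>lborel)"
 proof (rule Bochner_Integration.integral_cong[OF refl])
  fix v
  have "complex_of_real (norm (exp (- w * of_real v))) = exp (- complex_of_real (Re w) * of_real v)"
   by (simp add: norm_exp_eq_Re exp_of_real[symmetric])
  then show "complex_of_real (norm (indicator {a..} v *\<^sub>R exp (- w * of_real v)))
    = indicator {a..} v *\<^sub>R exp (- complex_of_real (Re w) * of_real v)"
   by (simp add: indicator_def)
 qed
 also have "\<dots> = exp (- complex_of_real (Re w) * of_real a) / of_real (Re w)"
  using assms by (intro exp_decay_integral(2)) simp
 also have "\<dots> = complex_of_real (exp (- Re w * a) / Re w)" by (simp add: exp_of_real[symmetric])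
 finally show ?thesis unfolding of_real_eq_iff .
qed

lemma of_nat_powr_minus_exp: "n > 0 \<Longrightarrow> exp (- w * of_real (ln (real n))) = (of_nat n powr (- w) :: complex)"
 by (simp add: powr_def Ln_of_nat mult.commute)

context GRH_character
begin

definition psi :: "nat \<Rightarrow> complex" where "psi N = (\<Sum>n\<in>{0<..N}. mangoldt n * chi n)"

text \<open>The cut-off at 0 makes the constant \<open>2 * m\<close> contribute
  \<open>2 * m / s\<close> to the Laplace transform, the second summand of \<open>f1\<close>. The
  factor \<open>exp (-v/2)\<close> moves the point 1/2 to 0.\<close>

definition E1 :: "real \<Rightarrow> complex" where
 "E1 v = (if v < 0 then 0 else of_real (exp (-v/2)) * psi (nat \<lfloor>exp v\<rfloor>) + 2 * of_real m)"

lemma norm_coeff_le: "norm (mangoldt n * chi n) \<le> ln (real n)" if "n > 0" for n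
 using mult_mono[OF mangoldt_le[of n] norm_dirichlet_char_le[OF chi(1), of n]] q that by (simp add: norm_mult)

lemma norm_psi_le: "norm (psi N) \<le> real N * ln (real N)"
proof -
 have "norm (psi N) \<le> (\<Sum>n\<in>{0<..N}. ln (real N))" unfolding psi_def
  by (intro sum_norm_le order_trans[OF norm_coeff_le]) auto
 then show ?thesis by simp
qed

text \<open>From \<open>mangoldt n \<le> ln n\<close> alone: \<open>psi\<close> is at most
  \<open>exp (2 * v)\<close>, and the factor \<open>exp (-v/2)\<close> leaves the exponent 3/2. All
  that is asked for is convergence of the Laplace transform on \<open>Re s = 2\<close>.\<close>

lemma norm_E1_le: "norm (E1 v) \<le> (1 + 2 * m) * exp (3/2 * \<bar>v\<bar>)"
proof (cases "v < 0")
 case True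
 then show ?thesis using m_nonneg by (simp add: E1_def)
next
 case False
 define N where "N = nat \<lfloor>exp v\<rfloor>"
 have N: "1 \<le> N" "real N \<le> exp v" using False by (auto simp: N_def le_nat_iff le_floor_iff)
 have "ln (real N) \<le> ln (exp v)" using N by (intro ln_mono) auto
 then have lnN: "ln (real N) \<le> exp v" using exp_ge_add_one_self[of v] unfolding ln_exp by linarith
 have "norm (psi N) \<le> exp v * exp v"
  by (rule order_trans[OF norm_psi_le]) (use N lnN in \<open>intro mult_mono; simp\<close>)
 then have "exp (-v/2) * norm (psi N) \<le> exp (-v/2) * (exp v * exp v)" by (intro mult_left_mono) auto
 also have "\<dots> = exp (3/2 * v)" by (simp add: exp_add[symmetric])
 finally have "norm (E1 v) \<le> exp (3/2 * v) + 2 * m * 1"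
  using False m_nonneg norm_triangle_ineq[of "of_real (exp (-v/2)) * psi N" "2 * of_real m"]
  by (simp add: E1_def N_def[symmetric] norm_mult)
 also have "\<dots> \<le> exp (3/2 * v) + 2 * m * exp (3/2 * v)"
  using False m_nonneg by (intro add_mono mult_left_mono) auto
 finally show ?thesis using False by (simp add: distrib_right)
qed

lemma E1_measurable [measurable]: "E1 \<in> borel_measurable borel"
proof -
 have "(\<lambda>v. psi (nat \<lfloor>exp v\<rfloor>)) \<in> borel_measurable (borel :: real measure)"
  by (rule measurable_compose[where N = "count_space UNIV"]) measurable
 then show ?thesis unfolding E1_def by measurable
qed

lemma isCont_E1:
 assumes "v \<noteq> 0" "v \<notin> (\<lambda>n. ln (real n)) ` UNIV"
 shows "isCont E1 v"
proof (cases "v < 0")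
 case True
 have "\<forall>\<^sub>F u in nhds v. u \<in> {..<0}" using True by (intro eventually_nhds_in_open) auto
 then have "\<forall>\<^sub>F u in nhds v. E1 u = 0" by eventually_elim (simp add: E1_def)
 then show ?thesis using isCont_cong[of E1 "\<lambda>_. 0" v] by simp
next
 case False
 have "exp v \<notin> \<int>"
 proof
  assume "exp v \<in> \<int>"
  then obtain k where k: "exp v = of_int k" by (auto elim: Ints_cases)
  have "k > 0" using exp_gt_zero[of v] unfolding k by simp
  then have "v = ln (real (nat k))" using k by (metis ln_exp of_nat_nat less_imp_le of_int_of_nat_eq)
  then show False using assms(2) by blast
 qed
 then have fl: "\<forall>\<^sub>F u in at v. \<lfloor>exp u\<rfloor> = \<lfloor>exp v\<rfloor>"
  by (intro eventually_floor_eq) (auto intro!: tendsto_intros)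
 then have fl: "\<forall>\<^sub>F u in nhds v. \<lfloor>exp u\<rfloor> = \<lfloor>exp v\<rfloor>" by (auto simp: eventually_nhds_conv_at)
 have "\<forall>\<^sub>F u in nhds v. u \<in> {0<..}" using False assms(1) by (intro eventually_nhds_in_open) auto
 then have eq: "\<forall>\<^sub>F u in nhds v. E1 u = of_real (exp (-u/2)) * psi (nat \<lfloor>exp v\<rfloor>) + 2 * of_real m"
  using fl by eventually_elim (simp add: E1_def)
 have "isCont (\<lambda>u. complex_of_real (exp (-u/2)) * psi (nat \<lfloor>exp v\<rfloor>) + 2 * of_real m) v"
  by (intro continuous_intros) auto
 then show ?thesis unfolding isCont_cong[OF eq] .
qed

lemma AE_isCont_E1: "AE v in lborel. isCont E1 v"
proof -
 have "countable (insert 0 ((\<lambda>n. ln (real n)) ` UNIV))" by simp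
 then have "AE v in lborel. v \<notin> insert 0 ((\<lambda>n. ln (real n)) ` UNIV)"
  by (intro AE_not_in countable_imp_null_set_lborel)
 then show ?thesis by eventually_elim (auto intro: isCont_E1)
qed

lemma floor_exp_less_iff: "nat \<lfloor>exp v\<rfloor> < n \<longleftrightarrow> v < ln (real n)" if "n > 0" for v :: real
proof -
 have "nat \<lfloor>exp v\<rfloor> < n \<longleftrightarrow> exp v < real n"
  using that by (simp add: nat_less_iff floor_less_iff)
 also have "\<dots> \<longleftrightarrow> v < ln (real n)" using that by (metis exp_less_cancel_iff exp_ln of_nat_0_less_iff)
 finally show ?thesis .
qed

text \<open>\<open>psi\<close> as a series of step functions in \<open>v\<close>, so that its
  Laplace transform can be computed term by term.\<close>

lemma psi_exp_eq: "psi (nat \<lfloor>exp v\<rfloor>) = (\<Sum>n. mangoldt (Suc n) * chi (Suc n) * indicator {ln (real (Suc n))..} v)"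
 and summable_psi_exp: "summable (\<lambda>n. norm (mangoldt (Suc n) * chi (Suc n) * indicator {ln (real (Suc n))..} v * z))"
proof -
 let ?N = "nat \<lfloor>exp v\<rfloor>"
 have zero: "indicator {ln (real (Suc n))..} v = (0::complex)" if "n \<notin> {..<?N}" for n
  using that floor_exp_less_iff[of "Suc n" v] by (simp add: indicator_def not_le del: of_nat_Suc)
 have one: "indicator {ln (real (Suc n))..} v = (1::complex)" if "n \<in> {..<?N}" for n
  using that floor_exp_less_iff[of "Suc n" v] by (simp add: indicator_def not_less del: of_nat_Suc)
 have "(\<Sum>n. mangoldt (Suc n) * chi (Suc n) * indicator {ln (real (Suc n))..} v) = (\<Sum>n<?N. mangoldt (Suc n) * chi (Suc n) * indicator {ln (real (Suc n))..} v)"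
  by (rule suminf_finite) (use zero in auto)
 also have "\<dots> = (\<Sum>n<?N. mangoldt (Suc n) * chi (Suc n))" using one by (intro sum.cong) auto
 also have "\<dots> = psi ?N" unfolding psi_def
  by (rule sum.reindex_bij_witness[of _ "\<lambda>n. n - 1" Suc]) auto
 finally show "psi ?N = (\<Sum>n. mangoldt (Suc n) * chi (Suc n) * indicator {ln (real (Suc n))..} v)" ..
 show "summable (\<lambda>n. norm (mangoldt (Suc n) * chi (Suc n) * indicator {ln (real (Suc n))..} v * z))"
  by (rule summable_finite[of "{..<?N}"]) (use zero in auto)
qed

text \<open>Term by term integration at \<open>w = 1/2 + s\<close> with real part 5/2, where already
  the crude bound \<open>mangoldt n \<le> n\<close> gives absolute convergence. The series at
  \<open>w\<close> is the negative of the logarithmic derivative of \<open>L\<close>.\<close>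

lemma E1_Laplace:
 assumes s: "Re s = 2"
 shows "f1 s = (\<integral>v. E1 v * exp (- s * of_real v) \<partial>lborel)"
proof -
 define w where "w = 1/2 + s"
 have w: "Re w = 5/2" using s by (simp add: w_def)
 define c where "c n = mangoldt (Suc n) * chi (Suc n)" for n
 define g where "g n v = c n * (indicator {ln (real (Suc n))..} v *\<^sub>R exp (- w * of_real v))" for n v
 have int_g: "integrable lborel (g n)" for n unfolding g_def
  by (rule integrable_mult_right) (rule exp_decay_integral(1), use w in simp)
 have val_g: "(\<integral>v. g n v \<partial>lborel) = c n / of_nat (Suc n) powr w / w" for n
 proof -
  have "(\<integral>v. g n v \<partial>lborel) = c n * (exp (- w * of_real (ln (real (Suc n)))) / w)"
   unfolding g_def by (subst integral_mult_right_zero, subst exp_decay_integral(2)) (use w in simp_all)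
  also have "exp (- w * of_real (ln (real (Suc n)))) = 1 / of_nat (Suc n) powr w"
   by (subst of_nat_powr_minus_exp) (simp_all add: powr_minus divide_inverse del: of_nat_Suc)
  finally show ?thesis by simp
 qed
 have cb: "norm (mangoldt n * chi n) \<le> 1 * real n powr 1" if "n > 0" for n
  using norm_coeff_le[OF that] ln_bound[of "real n"] that by simp
 have "Re w > 1 + 1" using w by simp
 note Lf = Lfun_abs_convergent[OF cb this]
 have sm: "summable (\<lambda>n. \<integral>v. norm (g n v) \<partial>lborel)"
 proof -
  have "(\<integral>v. norm (g n v) \<partial>lborel) = norm (c n / of_nat (Suc n) powr w) * (1 / Re w)" for n
  proof -
   have "(\<integral>v. norm (g n v) \<partial>lborel) = norm (c n) * (exp (- Re w * ln (real (Suc n))) / Re w)"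
    unfolding g_def norm_mult by (subst integral_mult_right_zero, subst exp_decay_norm_integral) (use w in simp_all)
   also have "exp (- Re w * ln (real (Suc n))) = real (Suc n) powr (- Re w)" by (simp add: powr_def)
   finally show ?thesis by (simp add: norm_divide powr_minus inverse_eq_divide del: of_nat_Suc)
  qed
  then show ?thesis using summable_mult2[OF Lf(1), of "1 / Re w"] unfolding c_def by simp
 qed
 have gs: "(\<Sum>n. g n v) = psi (nat \<lfloor>exp v\<rfloor>) * exp (- w * of_real v)" and smg: "summable (\<lambda>n. norm (g n v))" for v
 proof -
  have eq: "g n v = mangoldt (Suc n) * chi (Suc n) * indicator {ln (real (Suc n))..} v * exp (- w * of_real v)" for n
   by (simp add: g_def c_def indicator_def)
  show "summable (\<lambda>n. norm (g n v))" unfolding eq by (rule summable_psi_exp)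
  have "summable (\<lambda>n. mangoldt (Suc n) * chi (Suc n) * indicator {ln (real (Suc n))..} v)"
   using summable_norm_cancel[OF summable_psi_exp[of v 1]] by simp
  then show "(\<Sum>n. g n v) = psi (nat \<lfloor>exp v\<rfloor>) * exp (- w * of_real v)"
   unfolding eq psi_exp_eq by (rule suminf_mult2[symmetric])
 qed
 have S: "(\<lambda>n. \<integral>v. g n v \<partial>lborel) sums (\<integral>v. (\<Sum>n. g n v) \<partial>lborel)" "integrable lborel (\<lambda>v. \<Sum>n. g n v)"
  using smg by (auto intro!: sums_integral integrable_suminf int_g sm)
 have "(\<lambda>n. c n / of_nat (Suc n) powr w / w) sums (Lfun (\<lambda>n. mangoldt n * chi n) w / w)"
  using sums_divide[OF Lf(2), of w] unfolding c_def .
 then have psi_int: "(\<integral>v. (\<Sum>n. g n v) \<partial>lborel) = Lfun (\<lambda>n. mangoldt n * chi n) w / w"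
  using S(1) unfolding val_g by (metis sums_unique2)
 have E: "E1 v * exp (- s * of_real v) = (\<Sum>n. g n v) + 2 * of_real m * (indicator {0..} v *\<^sub>R exp (- s * of_real v))" for v
 proof (cases "v < 0")
  case True
  then have "nat \<lfloor>exp v\<rfloor> = 0" by (simp add: floor_le_zero)
  then show ?thesis using True unfolding gs by (simp add: E1_def psi_def)
 next
  case False
  have "exp (- w * of_real v) = complex_of_real (exp (-v/2)) * exp (- s * of_real v)"
   by (simp add: w_def exp_of_real[symmetric] exp_add[symmetric] algebra_simps)
  then show ?thesis using False unfolding gs by (simp add: E1_def algebra_simps)
 qed
 have "(\<integral>v. E1 v * exp (- s * of_real v) \<partial>lborel)
   = (\<integral>v. (\<Sum>n. g n v) \<partial>lborel) + (\<integral>v. 2 * of_real m * (indicator {0..} v *\<^sub>R exp (- s * of_real v)) \<partial>lborel)"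
  unfolding E by (intro Bochner_Integration.integral_add S(2) integrable_mult_right exp_decay_integral(1)) (use s in simp)
 also have "(\<integral>v. 2 * of_real m * (indicator {0..} v *\<^sub>R exp (- s * of_real v)) \<partial>lborel) = 2 * of_real m * (exp (- s * of_real 0) / s)"
  by (subst integral_mult_right_zero, subst exp_decay_integral(2)) (use s in simp_all)
 finally have I: "(\<integral>v. E1 v * exp (- s * of_real v) \<partial>lborel) = Lfun (\<lambda>n. mangoldt n * chi n) w / w + 2 * of_real m / s"
  by (simp add: psi_int)
 have "h s = - Lfun (\<lambda>n. mangoldt n * chi n) w"
  using Lfun_char_Re_gt_1[OF chi(1) q, of w] w unfolding h_def w_def[symmetric] by simp
 then show ?thesis unfolding I by (simp add: f1_def w_def)
qed

definition G1 :: "real \<Rightarrow> complex" where "G1 y = (\<integral>v. (if v \<le> y then E1 v else 0) \<partial>lborel)"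

lemma G1_measurable [measurable]: "G1 \<in> borel_measurable borel"
 unfolding G1_def by measurable

text \<open>The exponent 7/4 exceeds 3/2 by 1/4, and this quarter pays for the factor
  \<open>exp (- v / 4)\<close>, which is integrable over \<open>v \<ge> 0\<close>. It stays below 2,
  as inversion from \<open>Re s = 2\<close> demands.\<close>

lemma norm_E1_cutoff_le:
 "norm (if v \<le> y then E1 v else 0) \<le> (if y < 0 then 0 else (1 + 2 * m) * exp (7/4 * \<bar>y\<bar>)) * norm (indicator {0..} v *\<^sub>R exp (- (1/4) * of_real v :: complex))"
proof (cases "0 \<le> v \<and> v \<le> y")
 case True
 have "norm (E1 v) \<le> (1 + 2 * m) * exp (3/2 * \<bar>v\<bar>)" by (rule norm_E1_le)
 also have "\<dots> \<le> (1 + 2 * m) * exp (7/4 * \<bar>y\<bar> + - (1/4) * v)"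
  using True m_nonneg by (intro mult_left_mono) auto
 finally show ?thesis using True unfolding exp_add by (simp add: norm_exp_eq_Re mult.assoc)
qed (use m_nonneg in \<open>auto simp: E1_def\<close>)

lemma exp_decay_real: "r > 0 \<Longrightarrow> integrable lborel (\<lambda>v. norm (indicator {0..} v *\<^sub>R exp (- of_real r * of_real v :: complex)))"
 by (intro integrable_norm exp_decay_integral(1)) simp

lemma E1_cutoff_integrable: "integrable lborel (\<lambda>v. if v \<le> y then E1 v else 0)"
proof (rule Bochner_Integration.integrable_bound)
 let ?g = "\<lambda>v. (if y < 0 then 0 else (1 + 2 * m) * exp (7/4 * \<bar>y\<bar>)) * norm (indicator {0..} v *\<^sub>R exp (- of_real (1/4) * of_real v :: complex))"
 show "integrable lborel ?g" by (intro integrable_mult_right exp_decay_real) simp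
 show "AE v in lborel. norm (if v \<le> y then E1 v else 0) \<le> norm (?g v)"
  unfolding real_norm_def by (intro AE_I2 order_trans[OF norm_E1_cutoff_le] order_trans[OF _ abs_ge_self]) simp
qed simp

lemma norm_G1_le: "norm (G1 y) \<le> 4 * (1 + 2 * m) * exp (7/4 * \<bar>y\<bar>)" and G1_negative: "y < 0 \<Longrightarrow> G1 y = 0"
proof -
 let ?c = "if y < 0 then 0 else (1 + 2 * m) * exp (7/4 * \<bar>y\<bar>)"
 have "norm (G1 y) \<le> (\<integral>v. ?c * norm (indicator {0..} v *\<^sub>R exp (- (1/4) * of_real v :: complex)) \<partial>lborel)"
  unfolding G1_def by (rule Bochner_Integration.integral_norm_bound_integral[OF E1_cutoff_integrable integrable_mult_right norm_E1_cutoff_le])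
   (use exp_decay_real[of "1/4"] in simp)
 also have "\<dots> = ?c * (exp (- Re (1/4) * 0) / Re (1/4))"
  by (subst integral_mult_right_zero, subst exp_decay_norm_integral) simp_all
 finally have *: "norm (G1 y) \<le> ?c * 4" by simp
 then show "y < 0 \<Longrightarrow> G1 y = 0" by simp
 show "norm (G1 y) \<le> 4 * (1 + 2 * m) * exp (7/4 * \<bar>y\<bar>)"
  by (rule order_trans[OF *]) (use m_nonneg in auto)
qed

text \<open>Interchange the integrals: for fixed \<open>v\<close>, integration over
  \<open>y \<ge> v\<close> produces \<open>exp (- s * v) / s\<close>, so passing to the primitive
  divides the transform by \<open>s\<close>.\<close>

lemma G1_Laplace:
 assumes s: "Re s = 2"
 shows "f1 s / s = (\<integral>y. G1 y * exp (- s * of_real y) \<partial>lborel)"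
proof -
 define k where "k y v = (if v \<le> y then E1 v * exp (- s * of_real y) else 0)" for y v
 let ?e = "\<lambda>y. norm (indicator {0..} y *\<^sub>R exp (- of_real (1/4) * of_real y :: complex))"
 have "(\<integral>v. \<integral>y. k y v \<partial>lborel \<partial>lborel) = (\<integral>y. \<integral>v. k y v \<partial>lborel \<partial>lborel)"
 proof (rule Fubini_dominated(1))
  show "case_prod k \<in> borel_measurable (lborel \<Otimes>\<^sub>M lborel)" unfolding k_def by measurable
  show "integrable lborel (\<lambda>y. (1 + 2 * m) * ?e y)" by (intro integrable_mult_right exp_decay_real) simp
  show "integrable lborel ?e" by (intro exp_decay_real) simp
  show "norm (k y v) \<le> (1 + 2 * m) * ?e y * ?e v" for y v
  proof (cases "0 \<le> v \<and> v \<le> y")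
   case True
   have "norm (k y v) \<le> (1 + 2 * m) * exp (3/2 * \<bar>v\<bar>) * exp (- 2 * y)"
    using norm_E1_le[of v] s True unfolding k_def by (auto simp: norm_mult norm_exp_eq_Re intro!: mult_mono)
   also have "\<dots> = (1 + 2 * m) * exp (3/2 * v - 2 * y)" using True by (simp add: mult.assoc exp_add[symmetric])
   also have "\<dots> \<le> (1 + 2 * m) * exp (- (1/4) * y + - (1/4) * v)"
    using True m_nonneg by (intro mult_left_mono) auto
   finally show ?thesis using True by (simp add: norm_exp_eq_Re exp_add[symmetric] mult.assoc)
  qed (use m_nonneg in \<open>auto simp: k_def E1_def\<close>)
 qed
 moreover have "(\<integral>y. k y v \<partial>lborel) = E1 v * exp (- s * of_real v) / s" for v
 proof -
  have "(\<integral>y. k y v \<partial>lborel) = (\<integral>y. E1 v * (indicator {v..} y *\<^sub>R exp (- s * of_real y)) \<partial>lborel)"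
   by (rule Bochner_Integration.integral_cong) (auto simp: k_def)
  also have "\<dots> = E1 v * (exp (- s * of_real v) / s)"
   by (subst integral_mult_right_zero, subst exp_decay_integral(2)) (use s in simp_all)
  finally show ?thesis by simp
 qed
 moreover have "(\<integral>v. k y v \<partial>lborel) = G1 y * exp (- s * of_real y)" for y
 proof -
  have "(\<integral>v. k y v \<partial>lborel) = (\<integral>v. (if v \<le> y then E1 v else 0) * exp (- s * of_real y) \<partial>lborel)"
   by (rule Bochner_Integration.integral_cong) (auto simp: k_def)
  then show ?thesis by (simp add: G1_def)
 qed
 ultimately show ?thesis using E1_Laplace[OF s] by simp
qed

lemma smoothed_inversionI:
 assumes A: "A \<in> borel_measurable borel" "\<And>v. v < 0 \<Longrightarrow> A v = 0" "\<And>v. norm (A v) \<le> K * exp (7/4 * \<bar>v\<bar>)"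
  and F: "F holomorphic_on {s. Re s > 0}" "\<And>s. Re s = 2 \<Longrightarrow> F s = (\<integral>v. A v * exp (- s * of_real v) \<partial>lborel)"
  and a: "0 < a" "a \<le> 2" and bd: "\<And>x t. a \<le> x \<Longrightarrow> x \<le> 2 \<Longrightarrow> norm (F (Complex x t)) \<le> C * (1 + t^2)"
 shows "smoothed_inversion A F a K C"
proof
 note [measurable] = A(1)
 have K: "K \<ge> 0" using order_trans[OF norm_ge_zero A(3)[of 0]] by simp
 show "norm (A v) \<le> K * exp (2 * \<bar>v\<bar>)" for v
  by (rule order_trans[OF A(3)]) (use K in \<open>intro mult_left_mono; simp\<close>)
 have i: "integrable lborel (\<lambda>v. A v * of_real (exp (- 2 * v)))"
 proof (rule Bochner_Integration.integrable_bound[OF integrable_mult_right[OF exp_decay_real[of "1/4"]]])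
  show "AE v in lborel. norm (A v * of_real (exp (- 2 * v))) \<le> norm (K * norm (indicator {0..} v *\<^sub>R exp (- of_real (1/4) * of_real v :: complex)))"
  proof (rule AE_I2)
   fix v
   show "norm (A v * of_real (exp (- 2 * v))) \<le> norm (K * norm (indicator {0..} v *\<^sub>R exp (- of_real (1/4) * of_real v :: complex)))"
   proof (cases "v < 0")
    case False
    have "norm (A v * of_real (exp (- 2 * v))) \<le> K * exp (7/4 * \<bar>v\<bar>) * exp (- 2 * v)"
     using A(3)[of v] K unfolding norm_mult by (intro mult_mono) auto
    also have "\<dots> = K * exp (- (1/4) * v)" using False by (simp add: mult.assoc exp_add[symmetric])
    finally show ?thesis using False K by (simp add: norm_exp_eq_Re abs_mult)
   qed (simp add: A(2))
  qed
 qed auto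
 show "of_real (2 * pi) * (\<integral>v. A v * of_real (normal_density 0 d (y - v)) \<partial>lborel)
   = (\<integral>t. F (Complex a t) * exp (Complex a t * of_real y + of_real (d^2 / 2) * (Complex a t)^2) \<partial>lborel)" if "d > 0" for d y
  by (rule Laplace_inversion_shifted[OF A(1) i F a bd that])
 have "continuous_on UNIV (\<lambda>t. F (Complex a t))"
  by (rule continuous_on_compose2[OF holomorphic_on_imp_continuous_on[OF F(1)]]) (use a in \<open>auto intro!: continuous_intros simp: Complex_eq\<close>)
 then show "(\<lambda>t. F (Complex a t)) \<in> borel_measurable borel" by (rule borel_measurable_continuous_onI)
 show "norm (F (Complex a t)) \<le> C * (1 + t^2)" for t using bd[of a t] a by simp
qed (rule A(1))

lemma f1_line_measurable: "0 < a \<Longrightarrow> (\<lambda>t. f1 (Complex a t)) \<in> borel_measurable borel"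
 by (intro borel_measurable_continuous_onI continuous_on_compose2[OF holomorphic_on_imp_continuous_on[OF f1_holomorphic]])
  (auto intro!: continuous_intros simp: Complex_eq)

text \<open>Work on the line \<open>Re s = 1/Y\<close>. The scale \<open>H = 1\<close> localises
  near \<open>Y\<close>, and the window bound \<open>O(ln Y)\<close> enters squared; the scale
  \<open>H = Y\<close> weighs all of \<open>{0..Y}\<close> comparably and uses the bound
  \<open>O(Y)\<close> for windows of the square.\<close>

lemma E1_mean_square:
 "\<exists>C>0. \<forall>Y\<ge>2. mean_square (\<lambda>y. exp (y - Y)) E1 Y \<le> ennreal (C * (ln Y)^2) \<and> mean_square (\<lambda>_. 1) E1 Y \<le> ennreal (C * Y)"
proof -
 obtain K where K: "K > 0" "\<And>\<sigma> x. 0 < \<sigma> \<Longrightarrow> \<sigma> \<le> 1/2 \<Longrightarrow>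
  window_integral (P \<sigma>) x \<le> ennreal (K * ln (1 / \<sigma>)) \<and>
  window_integral (\<lambda>t. (P \<sigma> t)^2) x \<le> ennreal (K / \<sigma>)"
  using P_window by blast
 define C where "C = exp 4 * (64 * pi * K^2) + exp 4 * (32 * pi * K)"
 have C0: "C > 0" unfolding C_def using K by (intro add_pos_pos mult_pos_pos) auto
 show ?thesis
 proof (intro exI[of _ C] conjI allI impI C0)
  fix Y :: real assume Y: "Y \<ge> 2"
  define a where "a = 1 / Y"
  have a: "0 < a" "a \<le> 1/2" "1 / a = Y" "a * Y = 1" using Y by (auto simp: a_def field_simps)
  obtain C' where C': "\<And>x t. a \<le> x \<Longrightarrow> x \<le> 2 \<Longrightarrow> norm (f1 (Complex x t)) \<le> C' * (1 + t^2)"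
   using f1_polynomial_bound[OF a(1)] by blast
  interpret smoothed_inversion E1 f1 a "1 + 2 * m" C'
  proof (rule smoothed_inversionI)
   show "norm (E1 v) \<le> (1 + 2 * m) * exp (7/4 * \<bar>v\<bar>)" for v
    by (rule order_trans[OF norm_E1_le]) (use m_nonneg in \<open>intro mult_left_mono; simp\<close>)
  qed (use E1_Laplace f1_holomorphic a C' in \<open>auto simp: E1_def\<close>)
  let ?J = "\<lambda>H. kernel_form H (\<lambda>t. f1 (Complex a t))"
  have J1: "?J 1 \<le> ennreal (64 * pi * K^2 * (ln Y)^2)"
  proof -
   have "?J 1 \<le> ennreal (64 * pi) * ennreal (K * ln Y) * ennreal (K * ln Y)"
    by (rule weighted_kernel_bounds(1)[OF f1_line_measurable[OF a(1)]])
     (use K(2)[OF a(1,2)] in \<open>simp add: P_def a(3)\<close>)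
   also have "\<dots> = ennreal (64 * pi * (K * ln Y) * (K * ln Y))"
    using K(1) Y by (simp add: ennreal_mult[symmetric])
   finally show ?thesis by (simp add: power2_eq_square mult_ac)
  qed
  have J2: "?J Y \<le> ennreal (32 * pi * K * Y)"
  proof -
   have "?J Y \<le> ennreal (32 * pi) * ennreal (K / a)"
    by (rule weighted_kernel_bounds(2)[OF f1_line_measurable[OF a(1)]])
     (use K(2)[OF a(1,2)] Y in \<open>auto simp add: P_def\<close>)
   also have "K / a = K * Y" by (simp add: a_def)
   also have "ennreal (32 * pi) * ennreal (K * Y) = ennreal (32 * pi * (K * Y))"
    using K(1) Y by (simp add: ennreal_mult[symmetric])
   finally show ?thesis by (simp add: mult_ac)
  qed
  \<comment> \<open>On \<open>{0..Y}\<close> the damping \<open>exp (- 2 * a * y)\<close> is at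
    least \<open>exp (-2)\<close>, because \<open>a * Y = 1\<close>. The constant
    \<open>exp 3\<close> combines this loss with \<open>exp (a^2) \<le> exp 1\<close>.\<close>
  have main: "mean_square (\<lambda>y. exp ((y - Y) / H)) E1 Y \<le> ennreal (exp 3) * ?J H" if H: "H > 0" for H
  proof -
   have "mean_square (\<lambda>y. exp ((y - Y) / H)) E1 Y
     \<le> (\<integral>\<^sup>+y. ennreal (exp 2) * ennreal (exp (- \<bar>y - Y\<bar> / H) * exp (- 2 * a * y) * (norm (E1 y))^2) \<partial>lborel)"
   proof (rule nn_integral_mono)
    fix y
    show "ennreal (exp ((y - Y) / H) * (norm (E1 y))^2) * indicator {0..Y} y
     \<le> ennreal (exp 2) * ennreal (exp (- \<bar>y - Y\<bar> / H) * exp (- 2 * a * y) * (norm (E1 y))^2)"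
    proof (cases "y \<in> {0..Y}")
     case True
     have "a * y \<le> a * Y" using True a by (intro mult_left_mono) auto
     then have "1 \<le> exp 2 * exp (- 2 * a * y)" using a(4) by (simp add: exp_add[symmetric])
     then have "exp ((y - Y) / H) * (norm (E1 y))^2 * 1 \<le> exp ((y - Y) / H) * (norm (E1 y))^2 * (exp 2 * exp (- 2 * a * y))"
      by (intro mult_left_mono) auto
     also have "\<dots> = exp 2 * (exp (- \<bar>y - Y\<bar> / H) * exp (- 2 * a * y) * (norm (E1 y))^2)" using True by simp
     finally have "ennreal (exp ((y - Y) / H) * (norm (E1 y))^2) \<le> ennreal (exp 2 * (exp (- \<bar>y - Y\<bar> / H) * exp (- 2 * a * y) * (norm (E1 y))^2))"
      unfolding mult_1_right by (rule ennreal_leI)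
     also have "\<dots> = ennreal (exp 2) * ennreal (exp (- \<bar>y - Y\<bar> / H) * exp (- 2 * a * y) * (norm (E1 y))^2)"
      by (rule ennreal_mult) auto
     finally show ?thesis by (simp only: indicator_simps(1)[OF True] mult_1_right)
    qed simp
   qed
   also have "\<dots> = ennreal (exp 2) * (\<integral>\<^sup>+y. ennreal (exp (- \<bar>y - Y\<bar> / H) * exp (- 2 * a * y) * (norm (E1 y))^2) \<partial>lborel)"
    by (rule nn_integral_cmult) measurable
   also have "\<dots> \<le> ennreal (exp 2) * (ennreal (exp (a^2)) * ?J H)"
    by (intro mult_left_mono mean_square_bound AE_isCont_E1 H) simp
   also have "\<dots> \<le> ennreal (exp 2) * (ennreal (exp 1) * ?J H)"
   proof -
    have "a^2 \<le> 1" using a by (simp add: abs_square_le_1)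
    then show ?thesis by (intro mult_left_mono mult_right_mono ennreal_leI) auto
   qed
   also have "\<dots> = ennreal (exp 3) * ?J H"
    by (simp add: mult.assoc[symmetric] ennreal_mult[symmetric] exp_add[symmetric])
   finally show ?thesis .
  qed
  have "mean_square (\<lambda>y. exp (y - Y)) E1 Y \<le> ennreal (exp 3) * ennreal (64 * pi * K^2 * (ln Y)^2)"
   using order_trans[OF main[of 1] mult_left_mono[OF J1]] by simp
  also have "\<dots> = ennreal (exp 3 * (64 * pi * K^2 * (ln Y)^2))" by (simp add: ennreal_mult[symmetric])
  also have "\<dots> \<le> ennreal (C * (ln Y)^2)"
  proof (rule ennreal_leI)
   have "exp 3 * (64 * pi * K^2) \<le> exp 4 * (64 * pi * K^2)" by (intro mult_right_mono) auto
   also have "\<dots> \<le> C" using K by (simp add: C_def)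
   finally show "exp 3 * (64 * pi * K^2 * (ln Y)^2) \<le> C * (ln Y)^2"
    by (simp only: mult.assoc[symmetric]) (intro mult_right_mono, auto)
  qed
  finally show "mean_square (\<lambda>y. exp (y - Y)) E1 Y \<le> ennreal (C * (ln Y)^2)" .
  have "mean_square (\<lambda>_. 1) E1 Y
    \<le> (\<integral>\<^sup>+y. ennreal (exp 1) * (ennreal (exp ((y - Y) / Y) * (norm (E1 y))^2) * indicator {0..Y} y) \<partial>lborel)"
  proof (rule nn_integral_mono)
   fix y
   show "ennreal (1 * (norm (E1 y))^2) * indicator {0..Y} y \<le> ennreal (exp 1) * (ennreal (exp ((y - Y) / Y) * (norm (E1 y))^2) * indicator {0..Y} y)"
   proof (cases "y \<in> {0..Y}")
    case True
    have "1 \<le> exp 1 * exp ((y - Y) / Y)" using True Y by (simp add: exp_add[symmetric] diff_divide_distrib)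
    then have "1 * (norm (E1 y))^2 \<le> exp 1 * exp ((y - Y) / Y) * (norm (E1 y))^2" by (intro mult_right_mono) auto
    then show ?thesis using True by (simp add: ennreal_mult[symmetric] mult.assoc ennreal_leI)
   qed simp
  qed
  also have "\<dots> = ennreal (exp 1) * mean_square (\<lambda>y. exp ((y - Y) / Y)) E1 Y"
   by (rule nn_integral_cmult) measurable
  also have "\<dots> \<le> ennreal (exp 1) * (ennreal (exp 3) * ennreal (32 * pi * K * Y))"
   by (intro mult_left_mono order_trans[OF main] J2) (use Y in auto)
  also have "\<dots> = ennreal (exp 4 * (32 * pi * K * Y))"
   using K Y by (simp add: mult.assoc[symmetric] ennreal_mult[symmetric] exp_add[symmetric])
  also have "\<dots> \<le> ennreal (C * Y)"
  proof (rule ennreal_leI)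
   have "exp 4 * (32 * pi * K) \<le> C" using K by (simp add: C_def)
   then show "exp 4 * (32 * pi * K * Y) \<le> C * Y" using Y
    by (simp only: mult.assoc[symmetric]) (intro mult_right_mono, auto)
  qed
  finally show "mean_square (\<lambda>_. 1) E1 Y \<le> ennreal (C * Y)" .
 qed
qed

end

section \<open>The primitive of the error term and partial summation\<close>

text \<open>The limit \<open>c\<close> is found along the integers, and the rate for differences
  passes to it.\<close>

lemma Cauchy_tail_limit:
 fixes f :: "real \<Rightarrow> complex"
 assumes bd: "\<And>a b. x0 \<le> a \<Longrightarrow> a \<le> b \<Longrightarrow> norm (f b - f a) \<le> \<eta> a" and \<eta>: "(\<eta> \<longlongrightarrow> 0) at_top"
 shows "\<exists>c. \<forall>a\<ge>x0. norm (f a - c) \<le> \<eta> a"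
proof -
 have seq: "(\<lambda>n. \<eta> (real n)) \<longlonglongrightarrow> 0" by (rule filterlim_compose[OF \<eta> filterlim_real_sequentially])
 have "Cauchy (\<lambda>n. f (real n))"
 proof (rule metric_CauchyI)
  fix e :: real assume "e > 0"
  then have "\<forall>\<^sub>F n in sequentially. \<eta> (real n) < e / 2 \<and> real n \<ge> x0"
   using order_tendstoD(2)[OF seq, of "e/2"] filterlim_real_sequentially[unfolded filterlim_at_top]
   by (auto intro: eventually_conj)
  then obtain N where N: "\<eta> (real N) < e / 2" "real N \<ge> x0" unfolding eventually_sequentially by blast
  have "norm (f (real n) - f (real N)) < e / 2" if "n \<ge> N" for n
   using bd[OF N(2), of "real n"] N(1) that by simp
  then have "dist (f (real k)) (f (real n)) < e" if "k \<ge> N" "n \<ge> N" for k n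
   using that dist_triangle_half_l[of "f (real k)" "f (real N)" e "f (real n)"] by (simp add: dist_norm)
  then show "\<exists>M. \<forall>k\<ge>M. \<forall>n\<ge>M. dist (f (real k)) (f (real n)) < e" by blast
 qed
 then obtain c where c: "(\<lambda>n. f (real n)) \<longlonglongrightarrow> c" using Cauchy_convergent convergentD by blast
 have "norm (f a - c) \<le> \<eta> a" if a: "a \<ge> x0" for a
 proof (rule tendsto_upperbound[of "\<lambda>n. norm (f a - f (real n))" _ sequentially])
  show "(\<lambda>n. norm (f a - f (real n))) \<longlonglongrightarrow> norm (f a - c)" by (intro tendsto_intros c)
  show "\<forall>\<^sub>F n in sequentially. norm (f a - f (real n)) \<le> \<eta> a"
   using eventually_ge_at_top[of "nat \<lceil>a\<rceil>"]
  proof eventually_elim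
   case (elim n)
   then show ?case using bd[OF a, of "real n"] by (simp add: norm_minus_commute nat_ceiling_le_eq)
  qed
 qed simp
 then show ?thesis by blast
qed

context GRH_character
begin

lemma G1_eq_integral: "0 \<le> y \<Longrightarrow> G1 y = integral {0..y} E1" and E1_integrable_on: "E1 integrable_on {0..y}"
proof -
 have eq: "indicator {0..y} v *\<^sub>R E1 v = (if v \<le> y then E1 v else 0)" for v y by (auto simp: E1_def)
 then have int: "set_integrable lborel {0..y} E1" for y
  unfolding set_integrable_def using E1_cutoff_integrable by simp
 show "E1 integrable_on {0..y}" by (rule set_borel_integral_eq_integral(1)[OF int])
 show "G1 y = integral {0..y} E1"
  using set_borel_integral_eq_integral(2)[OF int] unfolding set_lebesgue_integral_def eq G1_def .
qed

lemma G1_continuous_on: "continuous_on {0..} G1"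
proof -
 have "continuous_on {0..<b} G1" for b
 proof -
  have "continuous_on {0..b} (\<lambda>x. integral {0..x} E1)"
   by (rule indefinite_integral_continuous_1[OF E1_integrable_on])
  then have "continuous_on {0..<b} (\<lambda>x. integral {0..x} E1)" by (rule continuous_on_subset) auto
  then show ?thesis by (rule continuous_on_eq) (simp add: G1_eq_integral)
 qed
 \<comment> \<open>Extending \<open>G1\<close> evenly removes the boundary point 0, so that
   continuity on half-open intervals becomes continuity at every point.\<close>
 then have "isCont (\<lambda>x. G1 \<bar>x\<bar>) y" for y
 proof -
  have "continuous_on {- (\<bar>y\<bar> + 1)<..<\<bar>y\<bar> + 1} (\<lambda>x. G1 \<bar>x\<bar>)"
   by (rule continuous_on_compose2[OF \<open>\<And>b. continuous_on {0..<b} G1\<close>[of "\<bar>y\<bar> + 1"]]) (auto intro!: continuous_intros)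
  moreover have "y \<in> {- (\<bar>y\<bar> + 1)<..<\<bar>y\<bar> + 1}" by auto
  ultimately show ?thesis by (simp only: continuous_on_eq_continuous_at[OF open_greaterThanLessThan])
 qed
 then have "continuous_on {0..} (\<lambda>x. G1 \<bar>x\<bar>)" by (simp add: continuous_at_imp_continuous_on)
 then show ?thesis by (rule continuous_on_eq) simp
qed

lemma G1_has_derivative:
 assumes "v > 0" "isCont E1 v"
 shows "(G1 has_vector_derivative E1 v) (at v)"
proof -
 have "((\<lambda>u. integral {0..u} E1) has_vector_derivative E1 v) (at v within ({0..v + 1} - {}))"
  by (rule integral_has_vector_derivative_continuous_at[OF E1_integrable_on])
   (use assms in \<open>auto intro: continuous_at_imp_continuous_at_within\<close>)
 then have "((\<lambda>u. integral {0..u} E1) has_vector_derivative E1 v) (at v within {0<..<v + 1})"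
  by (rule has_vector_derivative_within_subset) auto
 then have "((\<lambda>u. integral {0..u} E1) has_vector_derivative E1 v) (at v)"
  using assms(1) by (simp add: at_within_open[of v "{0<..<v + 1}"])
 then show ?thesis
  by (rule has_vector_derivative_transform_within_open[of _ _ _ "{0<..}"])
   (use assms(1) in \<open>auto simp: G1_eq_integral\<close>)
qed

text \<open>The transform \<open>f1 s / s\<close> of \<open>G1\<close> is absolutely integrable on
  \<open>Re s = 1/Y\<close>. Near 0 \<open>f1\<close> is bounded and \<open>1 / s\<close> integrates
  to \<open>O(ln Y)\<close>; further out \<open>1 / s\<close> adds the decay that turns the window
  bound for \<open>P\<close> into another \<open>O(ln Y)\<close>.\<close>

lemma G1_bound: "\<exists>C>0. \<forall>Y\<ge>2. norm (G1 Y) \<le> C * ln Y"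
proof -
 obtain K where K: "K > 0" "\<And>\<sigma> x. 0 < \<sigma> \<Longrightarrow> \<sigma> \<le> 1/2 \<Longrightarrow>
  window_integral (P \<sigma>) x \<le> ennreal (K * ln (1 / \<sigma>))"
  using P_window by blast
 obtain r D where r: "0 < r" "r \<le> 1/4" "D \<ge> 0" "\<And>s. Re s > 0 \<Longrightarrow> norm s \<le> r \<Longrightarrow> norm (f1 s) \<le> D"
  using f1_near_0 by blast
 define R where "R = 1 + 1 / r"
 have R: "R > 0" using r by (simp add: R_def add_pos_pos)
 define C where "C = exp 2 * (D * 8 + R * (8 * K))"
 have C0: "C > 0" unfolding C_def using K R r by (intro mult_pos_pos add_nonneg_pos) auto
 have "norm (G1 Y) \<le> C * ln Y" if Y: "Y \<ge> 2" for Y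
 proof -
  define a where "a = 1 / Y"
  have a: "0 < a" "a \<le> 1/2" "1 / a = Y" "a * Y = 1" using Y by (auto simp: a_def field_simps)
  obtain C' where C': "\<And>x t. a \<le> x \<Longrightarrow> x \<le> 2 \<Longrightarrow> norm (f1 (Complex x t)) \<le> C' * (1 + t^2)"
   using f1_polynomial_bound[OF a(1)] by blast
  have C'0: "C' \<ge> 0" using order_trans[OF norm_ge_zero C'[of a 0]] a by simp
  interpret smoothed_inversion G1 "\<lambda>s. f1 s / s" a "4 * (1 + 2 * m)" "C' / a"
  proof (rule smoothed_inversionI)
   show "(\<lambda>s. f1 s / s) holomorphic_on {s. Re s > 0}" by (intro holomorphic_intros f1_holomorphic) auto
   fix x t assume x: "a \<le> x" "x \<le> 2"
   have "a \<le> norm (Complex x t)" using x a abs_Re_le_cmod[of "Complex x t"] by simp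
   then have "norm (f1 (Complex x t) / Complex x t) \<le> (C' * (1 + t^2)) / a"
    using C'[OF x] C'0 a unfolding norm_divide by (intro frac_le) auto
   then show "norm (f1 (Complex x t) / Complex x t) \<le> C' / a * (1 + t^2)" by simp
  qed (rule G1_measurable G1_negative norm_G1_le G1_Laplace order_trans[OF a(2)] a(1) | assumption | simp)+
  have "isCont G1 Y"
  proof -
   have "continuous_on {0<..} G1" by (rule continuous_on_subset[OF G1_continuous_on]) auto
   then show ?thesis using Y by (simp add: continuous_on_eq_continuous_at)
  qed
  then have "ennreal (norm (G1 Y)) \<le> ennreal (exp (a * Y + a^2 / 2)) * (\<integral>\<^sup>+t. norm (f1 (Complex a t) / Complex a t) \<partial>lborel)"
   by (rule pointwise_bound)
  also have "\<dots> \<le> ennreal (exp 2) * (\<integral>\<^sup>+t. ennreal D * (ennreal (2 / (a + \<bar>t - 0\<bar>)) * indicator {0 - 1..0 + 1} t)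
    + ennreal R * ennreal (P a t * (1 + \<bar>t\<bar>) powr (-3/2)) \<partial>lborel)"
  proof (intro mult_mono nn_integral_mono ennreal_leI)
   have "a^2 \<le> 1" using a by (simp add: abs_square_le_1)
   then show "exp (a * Y + a^2 / 2) \<le> exp 2" using a(4) by simp
   fix t
   define s where "s = Complex a t"
   have ns: "norm s = sqrt (a^2 + t^2)" by (simp add: s_def cmod_def)
   have inv: "1 / norm s \<le> 2 / (a + \<bar>t\<bar>)" using inverse_sqrt_le[OF a(1), of t] unfolding ns .
   have ts: "\<bar>t\<bar> \<le> norm s" "norm s > 0" using abs_Im_le_cmod[of s] abs_Re_le_cmod[of s] a by (auto simp: s_def)
   show "ennreal (norm (f1 (Complex a t) / Complex a t)) \<le> ennreal D * (ennreal (2 / (a + \<bar>t - 0\<bar>)) * indicator {0 - 1..0 + 1} t)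
     + ennreal R * ennreal (P a t * (1 + \<bar>t\<bar>) powr (-3/2))"
   proof (cases "norm s \<le> r")
    case True
    have "norm (f1 s / s) = norm (f1 s) * (1 / norm s)" by (simp add: norm_divide)
    also have "\<dots> \<le> D * (2 / (a + \<bar>t\<bar>))" using r(4)[of s] True a inv r(3) by (intro mult_mono) (auto simp: s_def)
    finally have "ennreal (norm (f1 s / s)) \<le> ennreal (D * (2 / (a + \<bar>t\<bar>)))" by (rule ennreal_leI)
    also have "\<dots> = ennreal D * ennreal (2 / (a + \<bar>t - 0\<bar>))" using a r(3) by (simp add: ennreal_mult[symmetric])
    finally have *: "ennreal (norm (f1 s / s)) \<le> ennreal D * ennreal (2 / (a + \<bar>t - 0\<bar>))" .
    have "t \<in> {0 - 1..0 + 1}" using ts True r(2) by auto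
    then show ?thesis using * unfolding s_def by (simp add: add_increasing2)
   next
    case False
    have "1 \<le> norm s / r" using False r(1) by simp
    then have "1 + \<bar>t\<bar> \<le> R * norm s" using ts by (simp add: distrib_right R_def)
    then have i: "1 / norm s \<le> R / (1 + \<bar>t\<bar>)" using ts by (simp add: field_simps)
    have "norm (f1 s / s) = norm (f1 s) * (1 / norm s)" by (simp add: norm_divide)
    also have "\<dots> \<le> norm (f1 s) * (R / (1 + \<bar>t\<bar>))" by (intro mult_left_mono i) simp
    also have "\<dots> \<le> R * (P a t * (1 + \<bar>t\<bar>) powr (-3/2))"
    proof -
     \<comment> \<open>By \<open>-1 \<le> 3/4 - 3/2\<close>: the exponent 3/4 completes
       \<open>f1\<close> to \<open>P\<close>, and -3/2 is the integrable weight.\<close>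
     have "1 / (1 + \<bar>t\<bar>) = (1 + \<bar>t\<bar>) powr (-1)" by (simp add: powr_minus_divide)
     also have "\<dots> \<le> (1 + \<bar>t\<bar>) powr (3/4 + -3/2)" by (intro powr_mono) auto
     also have "\<dots> = (1 + \<bar>t\<bar>) powr (3/4) * (1 + \<bar>t\<bar>) powr (-3/2)" by (rule powr_add)
     finally have "R * norm (f1 s) * (1 / (1 + \<bar>t\<bar>)) \<le> R * norm (f1 s) * ((1 + \<bar>t\<bar>) powr (3/4) * (1 + \<bar>t\<bar>) powr (-3/2))"
      using R by (intro mult_left_mono) auto
     then show ?thesis by (simp add: P_def s_def mult_ac)
    qed
    finally have "ennreal (norm (f1 s / s)) \<le> ennreal (R * (P a t * (1 + \<bar>t\<bar>) powr (-3/2)))" by (rule ennreal_leI)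
    also have "\<dots> = ennreal R * ennreal (P a t * (1 + \<bar>t\<bar>) powr (-3/2))"
     using R by (intro ennreal_mult) (auto simp: P_def)
    finally show ?thesis unfolding s_def by (simp add: add_increasing)
   qed
  qed auto
  also have "\<dots> = ennreal (exp 2) * (ennreal D * (\<integral>\<^sup>+t\<in>{0 - 1..0 + 1}. ennreal (2 / (a + \<bar>t - 0\<bar>)) \<partial>lborel)
    + ennreal R * (\<integral>\<^sup>+t. ennreal (P a t * (1 + \<bar>t\<bar>) powr (-3/2)) \<partial>lborel))"
  proof -
   have [measurable]: "P a \<in> borel_measurable borel" unfolding P_def using f1_line_measurable[OF a(1)] by measurable
   show ?thesis by (subst nn_integral_add) (auto simp: nn_integral_cmult)
  qed
  also have "\<dots> \<le> ennreal (exp 2) * (ennreal D * ennreal (8 * ln (1 / a)) + ennreal R * (8 * ennreal (K * ln (1 / a))))"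
  proof (intro mult_left_mono add_mono inverse_abs_integral a)
   show "(\<integral>\<^sup>+t. ennreal (P a t * (1 + \<bar>t\<bar>) powr (-3/2)) \<partial>lborel) \<le> 8 * ennreal (K * ln (1 / a))"
    unfolding P_def by (rule weighted_kernel_bounds(3)[OF f1_line_measurable[OF a(1)]]) (use K(2)[OF a(1,2)] in \<open>simp add: P_def\<close>)
  qed auto
  also have "\<dots> = ennreal (exp 2 * (D * (8 * ln Y) + R * (8 * (K * ln Y))))"
  proof -
   have "8 * ennreal (K * ln Y) = ennreal (8 * (K * ln Y))" by (simp add: ennreal_mult'[of 8 "K * ln Y"])
   then show ?thesis using K R r Y unfolding a(3) by (simp add: ennreal_mult ennreal_plus)
  qed
  also have "exp 2 * (D * (8 * ln Y) + R * (8 * (K * ln Y))) = C * ln Y" by (simp add: C_def algebra_simps)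
  finally show ?thesis using C0 Y by (simp add: ennreal_le_iff)
 qed
 then show ?thesis using C0 by blast
qed

definition W :: "nat \<Rightarrow> complex" where
 "W N = (\<Sum>n\<in>{2..N}. mangoldt n * chi n / of_real (sqrt (real n) * ln (real n)))"

text \<open>Partial summation: up to elementary terms the weighted sum is an antiderivative of \<open>k * E1\<close>
 with \<open>k v = 1/(2v) + 1/v^2\<close>, and one integration by parts replaces \<open>E1\<close> by its much smaller
 primitive \<open>G1\<close>.\<close>

lemma W_asymptotics:
 "\<exists>c C. \<forall>y\<ge>2. norm (W (nat \<lfloor>exp y\<rfloor>) + of_real (m * ln y) - c - E1 y / of_real y) \<le> C * (ln y / y)"
proof -
 obtain D where D: "D > 0" "\<And>Y. Y \<ge> 2 \<Longrightarrow> norm (G1 Y) \<le> D * ln Y" using G1_bound by blast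
 \<comment> \<open>Chosen so that \<open>k v * exp (-v/2)\<close> is minus the derivative of
   \<open>exp (-v/2) / v\<close>, which is the weight \<open>1 / (sqrt n * ln n)\<close> at
   \<open>n = exp v\<close>.\<close>
 define k where "k v = 1 / (2 * v) + 1 / v^2" for v :: real
 define k' where "k' v = - 1 / (2 * v^2) - 2 / v ^ 3" for v :: real
 have dk: "(k has_real_derivative k' v) (at v)" if "v > 0" for v
  unfolding k_def k'_def using that
  by (auto intro!: derivative_eq_intros) (simp add: field_simps power2_eq_square power3_eq_cube power4_eq_xxxx)
 define g where "g v = exp (-v/2) / v" for v :: real
 have dg: "(g has_real_derivative - (k v * exp (-v/2))) (at v)" if "v > 0" for v
  unfolding g_def k_def using that
  by (auto intro!: derivative_eq_intros) (simp add: field_simps power2_eq_square)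
 \<comment> \<open>Arranged so that the derivative is \<open>- k' v * G1 v\<close>:
   \<open>E1 v / v\<close> contains the boundary term of the partial summation, and
   \<open>k v * G1 v\<close> is that of the integration by parts.\<close>
 define \<Phi> where "\<Phi> v = W (nat \<lfloor>exp v\<rfloor>) - E1 v / of_real v + of_real (m * ln v) - of_real (k v) * G1 v" for v
 have main: "norm (\<Phi> b - \<Phi> a) \<le> 2 * D * ((ln a + 1) / a)" if ab: "2 \<le> a" "a \<le> b" for a b
 proof -
  define M where "M = nat \<lfloor>exp b\<rfloor>"
  \<comment> \<open>Equal to \<open>W N - psi N * g v\<close> with \<open>N\<close> the integer part
    of \<open>exp v\<close>. Both terms jump at logarithms of integers; \<open>min\<close> keeps the
    summand of \<open>n\<close> at 0 until \<open>v\<close> reaches \<open>ln n\<close>, which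
    exhibits the continuity of the difference.\<close>
  define D1 where "D1 v = (\<Sum>n\<in>{2..M}. (mangoldt n * chi n) * of_real (g (min (ln (real n)) v) - g v))" for v
  define S where "S = (\<lambda>n. ln (real n)) ` {0..M}"
  have \<Phi>: "\<Phi> v = D1 v - 2 * of_real m / of_real v + of_real (m * ln v) - of_real (k v) * G1 v" if v: "a \<le> v" "v \<le> b" for v
  proof -
   define N where "N = nat \<lfloor>exp v\<rfloor>"
   have NM: "N \<le> M" unfolding N_def M_def using v by (intro nat_mono floor_mono) auto
   have gN: "g (min (ln (real n)) v) - g v = (if n \<le> N then 1 / (sqrt (real n) * ln (real n)) - g v else 0)" if n: "n \<ge> 2" for n
   proof (cases "n \<le> N")
    case True
    then have "ln (real n) \<le> v" using floor_exp_less_iff[of n v] n unfolding N_def by linarith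
    moreover have "exp (- ln (real n) / 2) = 1 / sqrt (real n)"
    proof -
     have "exp (- ln (real n) / 2) = real n powr (- (1/2))" using n by (simp add: powr_def)
     then show ?thesis using n by (simp add: powr_minus_divide powr_half_sqrt)
    qed
    ultimately show ?thesis using True by (simp add: g_def)
   next
    case False
    then have "v < ln (real n)" using floor_exp_less_iff[of n v] n unfolding N_def by linarith
    then show ?thesis using False by simp
   qed
   have "D1 v = (\<Sum>n\<in>{2..M}. if n \<in> {2..N} then mangoldt n * chi n / of_real (sqrt (real n) * ln (real n)) - mangoldt n * chi n * of_real (g v) else 0)"
    unfolding D1_def by (intro sum.cong refl) (auto simp: gN right_diff_distrib)
   also have "\<dots> = (\<Sum>n\<in>{2..N}. mangoldt n * chi n / of_real (sqrt (real n) * ln (real n)) - mangoldt n * chi n * of_real (g v))"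
    using NM by (subst sum.inter_restrict[symmetric]) (auto intro!: sum.cong)
   also have "\<dots> = W N - (\<Sum>n\<in>{2..N}. mangoldt n * chi n) * of_real (g v)"
    by (simp add: W_def sum_subtractf sum_distrib_right)
   also have "(\<Sum>n\<in>{2..N}. mangoldt n * chi n) = psi N"
    unfolding psi_def by (rule sum.mono_neutral_left) (auto simp: not_le less_2_cases_iff)
   finally have "D1 v = W N - psi N * of_real (g v)" .
   moreover have "E1 v / of_real v = psi N * of_real (g v) + 2 * of_real m / of_real v"
    using v ab by (simp add: E1_def N_def[symmetric] g_def add_divide_distrib)
   ultimately show ?thesis by (simp add: \<Phi>_def N_def[symmetric])
  qed
  have der: "((\<lambda>v. D1 v - 2 * of_real m / of_real v + of_real (m * ln v) - of_real (k v) * G1 v) has_vector_derivative - of_real (k' v) * G1 v) (at v)"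
   if v: "v \<in> {a<..<b} - S" for v
  proof -
   have v0: "v > 0" "a < v" "v < b" using v ab by auto
   define N where "N = nat \<lfloor>exp v\<rfloor>"
   have NM: "N \<le> M" unfolding N_def M_def using v by (intro nat_mono floor_mono) auto
   have "v \<notin> (\<lambda>n. ln (real n)) ` UNIV"
   proof
    assume "v \<in> (\<lambda>n. ln (real n)) ` UNIV"
    then obtain n where n: "v = ln (real n)" by blast
    have "n > 0" using n v0 by (cases "n = 0") auto
    then have "\<not> n > M" using floor_exp_less_iff[of n b] n v0 unfolding M_def by auto
    then show False using n v unfolding S_def by auto
   qed
   then have "isCont E1 v" using v0 by (intro isCont_E1) auto
   then have dG: "(G1 has_vector_derivative E1 v) (at v)" using v0 by (intro G1_has_derivative)
   have dmin: "((\<lambda>v. g (min (ln (real n)) v) - g v) has_real_derivative (if n \<le> N then k v * exp (-v/2) else 0)) (at v)"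
    if n: "n \<in> {2..M}" for n
   proof (cases "n \<le> N")
    case True
    then have "ln (real n) \<le> v" using floor_exp_less_iff[of n v] n unfolding N_def by auto
    moreover have "ln (real n) \<noteq> v" using v n unfolding S_def by auto
    ultimately have l: "v \<in> {ln (real n)<..}" by simp
    have "((\<lambda>v. g (ln (real n)) - g v) has_real_derivative 0 - - (k v * exp (-v/2))) (at v)"
     by (intro DERIV_diff DERIV_const dg v0)
    then have "((\<lambda>v. g (min (ln (real n)) v) - g v) has_real_derivative 0 - - (k v * exp (-v/2))) (at v)"
     by (rule has_field_derivative_transform_within_open[OF _ open_greaterThan l]) auto
    then show ?thesis using True by simp
   next
    case False
    then have l: "v \<in> {..<ln (real n)}" using floor_exp_less_iff[of n v] n unfolding N_def by auto
    have "((\<lambda>v. g (min (ln (real n)) v) - g v) has_real_derivative 0) (at v)"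
     by (rule has_field_derivative_transform_within_open[OF DERIV_const[of 0] open_lessThan l]) auto
    then show ?thesis using False by simp
   qed
   have ofr: "((\<lambda>x. complex_of_real (f x)) has_vector_derivative of_real f') (at v)" if "(f has_real_derivative f') (at v)" for f f'
    using that by (intro has_vector_derivative_of_real) (simp add: has_real_derivative_iff_has_vector_derivative)
   have dD: "(D1 has_vector_derivative (\<Sum>n\<in>{2..M}. (mangoldt n * chi n) * of_real (if n \<le> N then k v * exp (-v/2) else 0))) (at v)"
    unfolding D1_def by (intro has_vector_derivative_sum has_vector_derivative_mult_right ofr dmin)
   have "(\<Sum>n\<in>{2..M}. (mangoldt n * chi n) * of_real (if n \<le> N then k v * exp (-v/2) else 0)) = (\<Sum>n\<in>{2..M}. if n \<in> {0<..N} then mangoldt n * chi n * of_real (k v * exp (-v/2)) else 0)"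
    by (intro sum.cong) auto
   also have "\<dots> = (\<Sum>n\<in>{2..M} \<inter> {0<..N}. mangoldt n * chi n * of_real (k v * exp (-v/2)))"
    by (rule sum.inter_restrict[symmetric]) simp
   also have "\<dots> = (\<Sum>n\<in>{0<..N}. mangoldt n * chi n * of_real (k v * exp (-v/2)))"
   proof (rule sum.mono_neutral_left)
    show "\<forall>i\<in>{0<..N} - {2..M} \<inter> {0<..N}. mangoldt i * chi i * of_real (k v * exp (-v/2)) = 0"
    proof
     fix i assume "i \<in> {0<..N} - {2..M} \<inter> {0<..N}"
     then have "i = 1" using NM by auto
     then show "mangoldt i * chi i * of_real (k v * exp (-v/2)) = 0" by simp
    qed
   qed auto
   also have "\<dots> = psi N * of_real (k v * exp (-v/2))" by (simp add: psi_def sum_distrib_right)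
   also have "\<dots> = of_real (k v) * (E1 v - 2 * of_real m)" using v0 by (simp add: E1_def N_def[symmetric])
   finally have dD: "(D1 has_vector_derivative of_real (k v) * (E1 v - 2 * of_real m)) (at v)" using dD by simp
   have d2: "((\<lambda>v. complex_of_real (- 2 * m / v + m * ln v)) has_vector_derivative of_real (2 * m * k v)) (at v)"
    by (rule ofr) (use v0 in \<open>auto intro!: derivative_eq_intros\<close>, simp add: k_def field_simps power2_eq_square)
   have d3: "((\<lambda>v. of_real (k v) * G1 v) has_vector_derivative of_real (k v) * E1 v + of_real (k' v) * G1 v) (at v)"
    by (rule has_vector_derivative_mult[OF ofr[OF dk[OF v0(1)]] dG])
   have "((\<lambda>v. D1 v + complex_of_real (- 2 * m / v + m * ln v) - of_real (k v) * G1 v) has_vector_derivative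
     of_real (k v) * (E1 v - 2 * of_real m) + of_real (2 * m * k v) - (of_real (k v) * E1 v + of_real (k' v) * G1 v)) (at v)"
    by (intro has_vector_derivative_diff has_vector_derivative_add dD d2 d3)
   moreover have "of_real (k v) * (E1 v - 2 * of_real m) + of_real (2 * m * k v) - (of_real (k v) * E1 v + of_real (k' v) * G1 v) = - of_real (k' v) * G1 v"
    by (simp add: algebra_simps)
   moreover have "D1 v + complex_of_real (- 2 * m / v + m * ln v) - of_real (k v) * G1 v
     = D1 v - 2 * of_real m / of_real v + of_real (m * ln v) - of_real (k v) * G1 v" for v
    by simp
   ultimately show ?thesis by (simp only:)
  qed
  have ab0: "x > 0" if "x \<in> {a..b}" for x using that ab by auto
  have cont: "continuous_on {a..b} (\<lambda>v. D1 v - 2 * of_real m / of_real v + of_real (m * ln v) - of_real (k v) * G1 v)"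
  proof -
   have cg: "continuous_on {0<..} g" unfolding g_def by (intro continuous_intros) auto
   have "continuous_on {a..b} D1" unfolding D1_def
   proof (intro continuous_intros)
    fix n assume n: "n \<in> {2..M}"
    show "continuous_on {a..b} (\<lambda>v. g (min (ln (real n)) v))"
     by (rule continuous_on_compose2[OF cg]) (use n ab in \<open>auto intro!: continuous_intros\<close>)
    show "continuous_on {a..b} g" by (rule continuous_on_subset[OF cg]) (use ab in auto)
   qed
   moreover have "continuous_on {a..b} G1" by (rule continuous_on_subset[OF G1_continuous_on]) (use ab in auto)
   moreover have "continuous_on {a..b} k" unfolding k_def by (intro continuous_intros) (use ab in auto)
   ultimately show ?thesis by (intro continuous_intros) (use ab in auto)
  qed
  have "((\<lambda>v. - of_real (k' v) * G1 v) has_integral (\<Phi> b - \<Phi> a)) {a..b}"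
   unfolding \<Phi>[OF ab(2) order_refl] \<Phi>[OF order_refl ab(2)]
  proof (rule fundamental_theorem_of_calculus_interior_strong[where S = S and f = "\<lambda>v. D1 v - 2 * of_real m / of_real v + of_real (m * ln v) - of_real (k v) * G1 v"])
   show "finite S" by (simp add: S_def)
  qed (fact ab(2) der cont)+
  \<comment> \<open>The majorant \<open>2 * D * ln v / v^2\<close> of the integrand has the
    primitive \<open>- 2 * D * (ln v + 1) / v\<close>, whence the rate in
    \<open>main\<close>.\<close>
  moreover have i2: "((\<lambda>v. 2 * D * (ln v / v^2)) has_integral (- (2 * D * ((ln b + 1) / b)) - - (2 * D * ((ln a + 1) / a)))) {a..b}"
  proof (rule fundamental_theorem_of_calculus[OF ab(2), where f = "\<lambda>x. - (2 * D * ((ln x + 1) / x))"])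
   fix x assume "x \<in> {a..b}"
   then have x: "x > 0" by (rule ab0)
   have "((\<lambda>x. - (2 * D * ((ln x + 1) / x))) has_real_derivative 2 * D * (ln x / x^2)) (at x)"
    using x by (auto intro!: derivative_eq_intros) (simp add: field_simps power2_eq_square)
   then show "((\<lambda>x. - (2 * D * ((ln x + 1) / x))) has_vector_derivative 2 * D * (ln x / x^2)) (at x within {a..b})"
    unfolding has_real_derivative_iff_has_vector_derivative by (rule has_vector_derivative_at_within)
  qed
  moreover have "norm (- of_real (k' v) * G1 v) \<le> 2 * D * (ln v / v^2)" if "v \<in> {a..b}" for v
  proof -
   have v: "v \<ge> 2" using that ab by auto
   have "2 / v ^ 3 \<le> 1 / v^2" using v by (simp add: power2_eq_square power3_eq_cube divide_simps)
   moreover have "2 / v ^ 3 \<ge> 0" "1 / (2 * v^2) \<le> 1 / v^2" "1 / (2 * v^2) \<ge> 0" using v by (auto simp: divide_simps)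
   moreover have "k' v = - (1 / (2 * v^2)) - 2 / v ^ 3" "2 / v^2 = 1 / v^2 + 1 / v^2" by (simp_all add: k'_def)
   ultimately have "\<bar>k' v\<bar> \<le> 2 / v^2" by linarith
   then have "norm (- of_real (k' v) * G1 v) \<le> 2 / v^2 * (D * ln v)"
    unfolding norm_mult norm_minus_cancel norm_of_real using D(2)[OF v] by (intro mult_mono) auto
   then show ?thesis by (simp add: field_simps)
  qed
  ultimately have "norm (\<Phi> b - \<Phi> a) \<le> - (2 * D * ((ln b + 1) / b)) - - (2 * D * ((ln a + 1) / a))"
   by (metis (no_types, lifting) Henstock_Kurzweil_Integration.integral_norm_bound_integral has_integral_integrable_integral)
  moreover have "2 * D * ((ln b + 1) / b) \<ge> 0" using D(1) ab by (auto intro!: mult_nonneg_nonneg divide_nonneg_nonneg)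
  ultimately show ?thesis by simp
 qed
 have "((\<lambda>a. 2 * D * ((ln a + 1) / a)) \<longlongrightarrow> 0) at_top" by real_asymp
 from Cauchy_tail_limit[OF main this] obtain c where c: "\<And>y. y \<ge> 2 \<Longrightarrow> norm (\<Phi> y - c) \<le> 2 * D * ((ln y + 1) / y)" by blast
 \<comment> \<open>Of the constant 7, six parts come from \<open>ln y + 1 \<le> 3 * ln y\<close>,
   valid since \<open>1 \<le> 2 * ln y\<close>, and one from \<open>k y * G1 y\<close> with
   \<open>k y \<le> 1 / y\<close>.\<close>
 have "norm (W (nat \<lfloor>exp y\<rfloor>) + of_real (m * ln y) - c - E1 y / of_real y) \<le> 7 * D * (ln y / y)" if y: "y \<ge> 2" for y
 proof -
  have "exp 1 \<le> (2::real)^2" using exp_le by simp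
  then have "1 \<le> ln ((2::real)^2)" by (subst ln_ge_iff) auto
  then have "1/2 \<le> ln (2::real)" by (subst (asm) ln_realpow) auto
  also have "\<dots> \<le> ln y" using y by simp
  finally have ly: "1 \<le> 2 * ln y" by simp
  have "W (nat \<lfloor>exp y\<rfloor>) + of_real (m * ln y) - c - E1 y / of_real y = (\<Phi> y - c) + of_real (k y) * G1 y" by (simp add: \<Phi>_def)
  also have "norm \<dots> \<le> 2 * D * ((ln y + 1) / y) + (1 / y) * (D * ln y)"
  proof (intro order_trans[OF norm_triangle_ineq] add_mono c y)
   have "1 / y^2 \<le> 1 / (2 * y)" using y by (simp add: power2_eq_square divide_simps)
   then have "\<bar>k y\<bar> \<le> 1 / y" using y unfolding k_def by (simp add: abs_of_nonneg)
   then show "norm (of_real (k y) * G1 y) \<le> (1 / y) * (D * ln y)"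
    unfolding norm_mult norm_of_real using D(2)[OF y] y by (intro mult_mono) auto
  qed
  also have "2 * D * ((ln y + 1) / y) \<le> 2 * D * ((ln y + 2 * ln y) / y)"
   using D(1) y ly by (intro mult_left_mono divide_right_mono) auto
  finally show ?thesis by (simp add: field_simps)
 qed
 then show ?thesis by blast
qed

end

subsection \<open>Mertens-type estimates\<close>

lemma norm_sum_by_parts_Icc:
 fixes g :: "nat \<Rightarrow> 'a::real_normed_vector"
 assumes "\<And>N. N \<ge> M \<Longrightarrow> norm (\<Sum>n\<in>{M<..N}. g n) \<le> B" "\<And>n. n > M \<Longrightarrow> b (Suc n) \<le> b n" "\<And>n. n > M \<Longrightarrow> 0 \<le> (b n :: real)"
 shows "norm (\<Sum>n\<in>{M<..N}. b n *\<^sub>R g n) \<le> B * b (Suc M)"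
proof -
 have shift: "(\<Sum>n\<in>{M<..M + K}. f n) = (\<Sum>k<K. f (Suc M + k))" for f :: "nat \<Rightarrow> 'a" and K
  by (rule sum.reindex_bij_witness[of _ "\<lambda>k. Suc M + k" "\<lambda>n. n - Suc M"]) auto
 show ?thesis
 proof (cases "N \<ge> M")
  case True
  then obtain K where K: "N = M + K" using le_Suc_ex by blast
  have "norm (\<Sum>k<K. b (Suc M + k) *\<^sub>R g (Suc M + k)) \<le> B * b (Suc M + 0)"
  proof (rule norm_sum_by_parts_decreasing)
   show "norm (\<Sum>i<n. g (Suc M + i)) \<le> B" for n using assms(1)[of "M + n"] unfolding shift by simp
  qed (use assms(2,3) in auto)
  then show ?thesis unfolding K shift by simp
 next
  case False
  have "B \<ge> 0" using order_trans[OF norm_ge_zero assms(1)[of M]] by simp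
  then show ?thesis using False assms(3)[of "Suc M"] by simp
 qed
qed

text \<open>The divisor sum of \<open>mangoldt\<close>, twisted by a completely multiplicative
  \<open>f\<close> and summed up to \<open>N\<close>. The arguments of Chebyshev and Mertens both
  start from it.\<close>

lemma sum_ln_mangoldt:
 fixes f :: "nat \<Rightarrow> 'a::real_normed_field"
 assumes "\<And>m n. f (m * n) = f m * f n"
 shows "(\<Sum>n\<in>{1..N}. of_real (ln (real n)) * f n) = (\<Sum>d\<in>{1..N}. mangoldt d * f d * (\<Sum>m\<in>{1..N div d}. f m))"
proof -
 have "(\<Sum>n\<in>{1..N}. of_real (ln (real n)) * f n) = (\<Sum>n\<in>{1..N}. \<Sum>d | d dvd n. mangoldt d * f d * f (n div d))"
 proof (rule sum.cong[OF refl])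
  fix n assume "n \<in> {1..N}"
  then have n: "n > 0" by simp
  have "of_real (ln (real n)) * f n = (\<Sum>d | d dvd n. mangoldt d * f n)"
   using mangoldt_sum[of n, where ?'a = 'a] n by (simp add: sum_distrib_right[symmetric])
  also have "\<dots> = (\<Sum>d | d dvd n. mangoldt d * f d * f (n div d))"
   by (intro sum.cong refl) (simp add: mult.assoc flip: assms)
  finally show "of_real (ln (real n)) * f n = (\<Sum>d | d dvd n. mangoldt d * f d * f (n div d))" .
 qed
 also have "\<dots> = (\<Sum>d\<in>{1..N}. \<Sum>m\<in>{1..N div d}. mangoldt d * f d * f m)"
  by (rule sum_divisors_swap)
 finally show ?thesis by (simp add: sum_distrib_left)
qed

text \<open>The logarithm of \<open>2n choose n\<close>, at most \<open>2 * n * ln 2\<close>, is a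
  sum of \<open>mangoldt d\<close> times \<open>floor (2n/d) - 2 * floor (n/d)\<close>, a factor
  that is 1 for \<open>n < d \<le> 2n\<close> and never negative. Doubling costs
  \<open>2 * n\<close>; the constant 4 leaves room for it and for an odd last term.\<close>

lemma Chebyshev_upper: "(\<Sum>n\<in>{1..N}. mangoldt n) \<le> 4 * real N"
proof -
 define T where "T N = (\<Sum>n\<in>{1..N}. ln (real n))" for N
 have T: "T N = (\<Sum>d\<in>{1..N}. mangoldt d * real (N div d))" for N
  using sum_ln_mangoldt[of "\<lambda>_. 1 :: real" N] by (simp add: T_def)
 have T_fact: "T N = ln (fact N)" for N unfolding T_def
  by (induction N) (simp_all add: ln_mult del: of_nat_Suc)
 have step: "(\<Sum>n\<in>{1..2*n}. mangoldt n) \<le> (\<Sum>n\<in>{1..n}. mangoldt n) + 2 * real n" for n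
 proof -
  have "(\<Sum>d\<in>{n<..2*n}. mangoldt d) = (\<Sum>d\<in>{n<..2*n}. mangoldt d * (real ((2*n) div d) - 2 * real (n div d)))"
  proof (rule sum.cong[OF refl])
   fix d assume d: "d \<in> {n<..2*n}"
   then have "n div d = 0" "(2*n) div d = 1" by (auto simp: div_eq_dividend_iff intro: div_nat_eqI)
   then show "mangoldt d = mangoldt d * (real ((2*n) div d) - 2 * real (n div d))" by simp
  qed
  also have "\<dots> \<le> (\<Sum>d\<in>{1..2*n}. mangoldt d * (real ((2*n) div d) - 2 * real (n div d)))"
  proof (rule sum_mono2)
   fix d
   have "2 * (n div d) \<le> (2*n) div d"
    by (metis div_mult2_eq div_le_mono div_times_less_eq_dividend div_mult_self1_is_m mult.assoc mult.commute nat_0_less_mult_iff div_by_0 less_eq_div_iff_mult_less_eq mult_le_mono2 mult_0_right le_refl not_gr_zero)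
   then show "0 \<le> mangoldt d * (real ((2*n) div d) - 2 * real (n div d))"
    by (intro mult_nonneg_nonneg mangoldt_nonneg) linarith
  qed auto
  also have "\<dots> = T (2*n) - 2 * (\<Sum>d\<in>{1..2*n}. mangoldt d * real (n div d))"
   by (simp add: T right_diff_distrib sum_subtractf sum_distrib_left mult_ac)
  also have "(\<Sum>d\<in>{1..2*n}. mangoldt d * real (n div d)) = T n"
   unfolding T by (rule sum.mono_neutral_right) auto
  also have "T (2*n) - 2 * T n = ln (real ((2*n) choose n))"
  proof -
   have "real ((2*n) choose n) = fact (2*n) / (fact n * fact n)"
    using binomial_fact[of n "2*n"] by simp
   then show ?thesis by (simp add: T_fact ln_div ln_mult)
  qed
  also have "\<dots> \<le> ln (2 ^ (2*n))"
  proof (rule ln_mono)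
   show "real ((2*n) choose n) \<le> 2 ^ (2*n)" using binomial_le_pow2[of "2*n" n] by (metis of_nat_le_iff of_nat_numeral of_nat_power)
   show "0 < real ((2*n) choose n)" by simp
  qed
  also have "\<dots> = 2 * real n * ln 2" by (simp add: ln_realpow)
  also have "\<dots> \<le> 2 * real n * 1" using ln_le_minus_one[of "2::real"] by (intro mult_left_mono) auto
  finally have "(\<Sum>d\<in>{n<..2*n}. mangoldt d) \<le> 2 * real n" by simp
  moreover have "{1..2*n} = {1..n} \<union> {n<..2*n}" by auto
  ultimately show ?thesis by (simp add: sum.union_disjoint ivl_disj_int)
 qed
 show ?thesis
 proof (induction N rule: less_induct)
  case (less N)
  show ?case
  proof (cases "N \<le> 1")
   case True
   then have "N = 0 \<or> N = 1" by auto
   then show ?thesis by auto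
  next
   case False
   define n where "n = N div 2"
   have n: "n < N" "n \<ge> 1" using False by (auto simp: n_def)
   have "(\<Sum>n\<in>{1..2*n}. mangoldt n) \<le> 4 * real n + 2 * real n"
    using step[of n] less[OF n(1)] by linarith
   moreover have "N = 2*n \<or> N = Suc (2*n)" by (auto simp: n_def)
   moreover have "(\<Sum>n\<in>{1..Suc (2*n)}. mangoldt n) \<le> (\<Sum>n\<in>{1..2*n}. mangoldt n) + 2 * real n"
    using mangoldt_le[of "Suc (2*n)"] ln_le_minus_one[of "real (Suc (2*n))"] by simp
   ultimately show ?thesis using n(2) by auto
  qed
 qed
qed

lemma ln_Suc_diff_le: "n \<ge> 1 \<Longrightarrow> ln (real (Suc n)) - ln (real n) \<le> 1 / real n"
proof -
 assume n: "n \<ge> 1"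
 have "ln (real (Suc n)) - ln (real n) = ln (real (Suc n) / real n)" using n by (simp only: ln_divide_pos of_nat_0_less_iff)
 also have "\<dots> \<le> real (Suc n) / real n - 1" using n by (intro ln_le_minus_one) auto
 also have "\<dots> = 1 / real n" using n by (simp add: add_divide_distrib)
 finally show ?thesis .
qed

text \<open>The logarithm of \<open>N!\<close> is \<open>N * ln N + O(N)\<close> and also the sum of
  \<open>mangoldt d\<close> times the integer part of \<open>N / d\<close>. Dropping the integer
  part costs at most what \<open>Chebyshev_upper\<close> allows, whence the constant 4.\<close>

lemma Mertens_all: "N \<ge> 1 \<Longrightarrow> \<bar>(\<Sum>n\<in>{1..N}. mangoldt n / real n) - ln (real N)\<bar> \<le> 4"
proof -
 assume N: "N \<ge> 1"
 define T where "T N = (\<Sum>n\<in>{1..N}. ln (real n))" for N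
 have T: "T N = (\<Sum>d\<in>{1..N}. mangoldt d * real (N div d))"
  using sum_ln_mangoldt[of "\<lambda>_. 1 :: real" N] by (simp add: T_def)
 have T_upper: "T N \<le> real N * ln (real N)"
 proof -
  have "T N \<le> (\<Sum>n\<in>{1..N}. ln (real N))" unfolding T_def by (intro sum_mono ln_mono) auto
  then show ?thesis by simp
 qed
 have T_lower: "real N * ln (real N) - real N \<le> T N" using N
 proof (induction N rule: nat_induct_at_least)
  case (Suc n)
  have "ln (real (Suc n)) - ln (real n) \<le> 1 / real n" using Suc.hyps by (rule ln_Suc_diff_le)
  then have "real n * (ln (real (Suc n)) - ln (real n)) \<le> real n * (1 / real n)" by (intro mult_left_mono) auto
  also have "\<dots> = 1" using Suc.hyps by simp
  finally have "real (Suc n) * ln (real (Suc n)) - real (Suc n) \<le> real n * ln (real n) - real n + ln (real (Suc n))"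
   by (simp add: algebra_simps)
  then show ?case using Suc.IH by (simp add: T_def)
 qed (simp add: T_def)
 define S where "S = (\<Sum>n\<in>{1..N}. mangoldt n / real n)"
 have "T N \<le> (\<Sum>d\<in>{1..N}. mangoldt d * (real N / real d))" unfolding T
  by (intro sum_mono mult_left_mono of_nat_div_le_of_nat mangoldt_nonneg)
 then have TS: "T N \<le> real N * S" by (simp add: S_def sum_distrib_left mult_ac)
 have "real N * S - (\<Sum>d\<in>{1..N}. mangoldt d) = (\<Sum>d\<in>{1..N}. mangoldt d * (real N / real d - 1))"
  by (simp add: S_def sum_distrib_left sum_subtractf[symmetric] right_diff_distrib mult_ac)
 also have "\<dots> \<le> T N" unfolding T
 proof (intro sum_mono mult_left_mono mangoldt_nonneg)
  fix d assume d: "d \<in> {1..N}"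
  have "N < d * Suc (N div d)" using d dividend_less_times_div[of d N] by simp
  then have "real N \<le> real d * (real (N div d) + 1)" by (metis less_imp_le of_nat_le_iff of_nat_mult of_nat_Suc add.commute)
  then show "real N / real d - 1 \<le> real (N div d)" using d by (simp add: field_simps)
 qed
 finally have ST: "real N * S \<le> T N + 4 * real N" using Chebyshev_upper[of N] by linarith
 have "real N * (S - ln (real N)) \<le> real N * 4" using ST T_upper by (simp add: right_diff_distrib)
 moreover have "real N * (ln (real N) - S) \<le> real N * 4" using TS T_lower N by (simp add: right_diff_distrib)
 ultimately show ?thesis using N unfolding S_def[symmetric] by (simp add: abs_le_iff)
qed

text \<open>Summation by parts against the weights \<open>1 / n\<close> and \<open>ln n / n\<close>.
  The latter decreases from \<open>n = 3\<close> on, hence the sum over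
  \<open>n > 2\<close>.\<close>

lemma norm_sum_ln_over_n_le:
 fixes f :: "nat \<Rightarrow> complex"
 assumes "\<And>M N. norm (\<Sum>n\<in>{M<..N}. f n) \<le> B"
 shows "norm (\<Sum>n\<in>{M<..N}. f n / of_nat n) \<le> B / real (Suc M)"
  "norm (\<Sum>n\<in>{2<..N}. of_real (ln (real n)) * (f n / of_nat n)) \<le> B"
proof -
 have "norm (\<Sum>n\<in>{M<..N}. (1 / real n) *\<^sub>R f n) \<le> B * (1 / real (Suc M))"
  by (rule norm_sum_by_parts_Icc) (use assms in \<open>auto intro!: divide_left_mono\<close>)
 then show "norm (\<Sum>n\<in>{M<..N}. f n / of_nat n) \<le> B / real (Suc M)"
  by (simp add: scaleR_conv_of_real del: of_nat_Suc)
 have B: "B \<ge> 0" using order_trans[OF norm_ge_zero assms] by blast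
 have "norm (\<Sum>n\<in>{2<..N}. (ln (real n) / real n) *\<^sub>R f n) \<le> B * (ln (real (Suc 2)) / real (Suc 2))"
 proof (rule norm_sum_by_parts_Icc)
  show "ln (real (Suc n)) / real (Suc n) \<le> ln (real n) / real n" if "n > 2" for n
  proof -
   have n: "3 \<le> real n" using that by simp
   have "ln (real (Suc n)) - ln (real n) \<le> 1 / real n" using that by (intro ln_Suc_diff_le) simp
   then have "real n * (ln (real (Suc n)) - ln (real n)) \<le> real n * (1 / real n)" by (intro mult_left_mono) auto
   also have "\<dots> = 1" using that by simp
   also have "1 \<le> ln (real n)" using n exp_le by (subst ln_ge_iff) auto
   finally have "real n * ln (real (Suc n)) \<le> (real n + 1) * ln (real n)" by (simp add: algebra_simps)
   then show ?thesis using that by (simp add: field_simps)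
  qed
 qed (use assms in auto)
 also have "\<dots> \<le> B * 1" using ln_bound[of "real (Suc 2)"] B by (intro mult_left_mono) auto
 finally show "norm (\<Sum>n\<in>{2<..N}. of_real (ln (real n)) * (f n / of_nat n)) \<le> B"
  by (simp add: scaleR_conv_of_real)
qed

text \<open>In \<open>sum_ln_mangoldt\<close> with \<open>f n = \<psi> n / n\<close> the left side
  is bounded, and the inner sums are \<open>L(1, \<psi>)\<close> up to \<open>O(d / N)\<close>.
  Chebyshev's bound controls the accumulated error, and \<open>L(1, \<psi>) \<noteq> 0\<close>
  permits the division.\<close>

lemma Mertens_nonprincipal:
 assumes "dirichlet_char q \<psi>" "\<psi> \<noteq> principal_char q" "q > 1"
 shows "\<exists>C. \<forall>N. norm (\<Sum>n\<in>{1..N}. mangoldt n * \<psi> n / of_nat n) \<le> C"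
proof -
 define f where "f n = \<psi> n / of_nat n" for n
 have f_mult: "f (m * n) = f m * f n" for m n using dirichlet_charD(3)[OF assms(1)] by (simp add: f_def)
 have pb: "norm (\<Sum>n\<in>{M<..N}. \<psi> n) \<le> 2 * real q" for M N
 proof -
  have s: "norm (\<Sum>n\<in>{0<..N}. \<psi> n) \<le> real q" for N
  proof -
   have "(\<Sum>n\<in>{0<..N}. \<psi> n) = (\<Sum>i<N. \<psi> (Suc i))"
    by (rule sum.reindex_bij_witness[of _ Suc "\<lambda>n. n - 1"]) auto
   then show ?thesis using dirichlet_char_partial_sums[OF assms] by simp
  qed
  show ?thesis
  proof (cases "M \<le> N")
   case True
   have "{0<..N} = {0<..M} \<union> {M<..N}" using True by auto
   then have "(\<Sum>n\<in>{M<..N}. \<psi> n) = (\<Sum>n\<in>{0<..N}. \<psi> n) - (\<Sum>n\<in>{0<..M}. \<psi> n)"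
    by (simp add: sum.union_disjoint)
   then show ?thesis using norm_triangle_ineq4[of "\<Sum>n\<in>{0<..N}. \<psi> n" "\<Sum>n\<in>{0<..M}. \<psi> n"] s[of N] s[of M] by simp
  qed simp
 qed
 have L1: "Lfun \<psi> 1 \<noteq> 0" by (rule Lfun_nonzero_Re_eq_1[OF assms]) simp
 have sums: "(\<lambda>n. f (Suc n)) sums Lfun \<psi> 1"
 proof -
  have "(\<lambda>k. \<psi> (Suc k) / of_nat (Suc k) powr 1) sums Lfun \<psi> 1"
   using Lfun_Abel(2)[OF dirichlet_char_partial_sums[OF assms], of 1]
    Lfun_eq_Abel[OF dirichlet_char_partial_sums[OF assms], of 1] by simp
  then show ?thesis by (simp add: f_def del: of_nat_Suc)
 qed
 have part: "(\<Sum>n\<in>{1..M}. f n) = (\<Sum>i<M. f (Suc i))" for M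
  by (rule sum.reindex_bij_witness[of _ Suc "\<lambda>n. n - 1"]) auto
 have tail: "norm ((\<Sum>n\<in>{1..M}. f n) - Lfun \<psi> 1) \<le> 2 * real q / real (Suc M)" for M
 proof (rule tendsto_upperbound[of "\<lambda>N. norm ((\<Sum>n\<in>{1..M}. f n) - (\<Sum>n\<in>{1..N}. f n))" _ sequentially])
  show "(\<lambda>N. norm ((\<Sum>n\<in>{1..M}. f n) - (\<Sum>n\<in>{1..N}. f n))) \<longlonglongrightarrow> norm ((\<Sum>n\<in>{1..M}. f n) - Lfun \<psi> 1)"
   unfolding part using sums[unfolded sums_def] by (intro tendsto_intros)
  show "\<forall>\<^sub>F N in sequentially. norm ((\<Sum>n\<in>{1..M}. f n) - (\<Sum>n\<in>{1..N}. f n)) \<le> 2 * real q / real (Suc M)"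
   using eventually_ge_at_top[of M]
  proof eventually_elim
   case (elim N)
   have "{1..N} = {1..M} \<union> {M<..N}" using elim by auto
   then have "(\<Sum>n\<in>{1..M}. f n) - (\<Sum>n\<in>{1..N}. f n) = - (\<Sum>n\<in>{M<..N}. f n)"
    by (simp add: sum.union_disjoint ivl_disj_int)
   then show ?case using norm_sum_ln_over_n_le(1)[OF pb, of M N] by (simp add: f_def)
  qed
 qed simp
 define C where "C = (2 * real q + 1) + 8 * real q"
 have "norm (\<Sum>n\<in>{1..N}. mangoldt n * \<psi> n / of_nat n) \<le> C / norm (Lfun \<psi> 1)" if N: "N \<ge> 2" for N
 proof -
  have "(\<Sum>n\<in>{1..N}. of_real (ln (real n)) * f n) = (\<Sum>d\<in>{1..N}. mangoldt d * f d * (\<Sum>m\<in>{1..N div d}. f m))"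
   by (rule sum_ln_mangoldt[OF f_mult])
  also have "\<dots> = (\<Sum>d\<in>{1..N}. mangoldt d * f d) * Lfun \<psi> 1 + (\<Sum>d\<in>{1..N}. mangoldt d * f d * ((\<Sum>m\<in>{1..N div d}. f m) - Lfun \<psi> 1))"
   by (simp only: sum_distrib_right sum.distrib[symmetric]) (simp add: algebra_simps)
  finally have eq: "(\<Sum>d\<in>{1..N}. mangoldt d * f d) * Lfun \<psi> 1 = (\<Sum>n\<in>{1..N}. of_real (ln (real n)) * f n)
    - (\<Sum>d\<in>{1..N}. mangoldt d * f d * ((\<Sum>m\<in>{1..N div d}. f m) - Lfun \<psi> 1))" by simp
  have n\<psi>: "norm (\<psi> n) \<le> 1" for n using norm_dirichlet_char_le[OF assms(1)] assms(3) by simp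
  have b1: "norm (\<Sum>n\<in>{1..N}. of_real (ln (real n)) * f n) \<le> 2 * real q + 1"
  proof -
   have "{1..N} = {1,2} \<union> {2<..N}" using N by auto
   then have "(\<Sum>n\<in>{1..N}. of_real (ln (real n)) * f n) = of_real (ln 2) * f 2 + (\<Sum>n\<in>{2<..N}. of_real (ln (real n)) * f n)"
    by (simp add: sum.union_disjoint)
   also have "norm \<dots> \<le> 1 + 2 * real q"
   proof (intro order_trans[OF norm_triangle_ineq] add_mono)
    have "norm (f 2) \<le> 1" using n\<psi>[of 2] by (simp add: f_def norm_divide)
    then have "\<bar>ln 2\<bar> * norm (f 2) \<le> 1 * 1" using ln_le_minus_one[of "2::real"] by (intro mult_mono) auto
    then show "norm (of_real (ln 2) * f 2) \<le> 1" by (simp add: norm_mult)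
    show "norm (\<Sum>n\<in>{2<..N}. of_real (ln (real n)) * f n) \<le> 2 * real q"
     unfolding f_def by (rule norm_sum_ln_over_n_le(2)[OF pb])
   qed
   finally show ?thesis by simp
  qed
  have b2: "norm (\<Sum>d\<in>{1..N}. mangoldt d * f d * ((\<Sum>m\<in>{1..N div d}. f m) - Lfun \<psi> 1)) \<le> 8 * real q"
  proof -
   have "norm (\<Sum>d\<in>{1..N}. mangoldt d * f d * ((\<Sum>m\<in>{1..N div d}. f m) - Lfun \<psi> 1)) \<le> (\<Sum>d\<in>{1..N}. mangoldt d * (2 * real q / real N))"
   proof (rule sum_norm_le)
    fix d assume d: "d \<in> {1..N}"
    have "N < d * Suc (N div d)" using d dividend_less_times_div[of d N] by simp
    then have Nd: "real N \<le> real d * real (Suc (N div d))" by (metis less_imp_le of_nat_le_iff of_nat_mult)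
    have "norm (f d) \<le> 1 / real d" using n\<psi>[of d] d by (simp add: f_def norm_divide divide_right_mono)
    then have "norm (f d) * norm ((\<Sum>m\<in>{1..N div d}. f m) - Lfun \<psi> 1) \<le> 1 / real d * (2 * real q / real (Suc (N div d)))"
     using tail[of "N div d"] by (intro mult_mono) auto
    also have "\<dots> = 2 * real q / (real d * real (Suc (N div d)))" by simp
    also have "\<dots> \<le> 2 * real q / real N" using Nd d by (intro divide_left_mono) auto
    finally show "norm (mangoldt d * f d * ((\<Sum>m\<in>{1..N div d}. f m) - Lfun \<psi> 1)) \<le> mangoldt d * (2 * real q / real N)"
     unfolding norm_mult norm_mangoldt mult.assoc by (rule mult_left_mono[OF _ mangoldt_nonneg])
   qed
   also have "\<dots> = (\<Sum>d\<in>{1..N}. mangoldt d) * (2 * real q / real N)" by (rule sum_distrib_right[symmetric])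
   also have "\<dots> \<le> 4 * real N * (2 * real q / real N)" by (intro mult_right_mono Chebyshev_upper) auto
   also have "\<dots> = 8 * real q" using N by simp
   finally show ?thesis .
  qed
  have "norm ((\<Sum>d\<in>{1..N}. mangoldt d * f d) * Lfun \<psi> 1) \<le> C"
   unfolding eq C_def by (intro order_trans[OF norm_triangle_ineq4] add_mono b1 b2)
  then have "norm (\<Sum>d\<in>{1..N}. mangoldt d * f d) * norm (Lfun \<psi> 1) \<le> C" by (simp only: norm_mult)
  then show ?thesis using L1 by (simp add: f_def field_simps)
 qed
 moreover have "norm (\<Sum>n\<in>{1..N}. mangoldt n * \<psi> n / of_nat n) \<le> C / norm (Lfun \<psi> 1)" if "N < 2" for N
 proof -
  have "N = 0 \<or> N = 1" using that by auto
  then show ?thesis by (auto simp: C_def)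
 qed
 ultimately show ?thesis by (metis linorder_not_le)
qed

lemma Cauchy_tail_limit_log:
 fixes f :: "nat \<Rightarrow> complex"
 assumes bd: "\<And>M N. 2 \<le> M \<Longrightarrow> M \<le> N \<Longrightarrow> norm (f N - f M) \<le> C / ln (real M)"
 shows "\<exists>c. \<forall>N\<ge>2. norm (f N - c) \<le> C / ln (real N)"
proof -
 have "\<exists>c. \<forall>a\<ge>(2::real). norm (f (nat \<lfloor>a\<rfloor>) - c) \<le> C / ln (real (nat \<lfloor>a\<rfloor>))"
 proof (rule Cauchy_tail_limit)
  fix a b :: real assume "2 \<le> a" "a \<le> b"
  then show "norm (f (nat \<lfloor>b\<rfloor>) - f (nat \<lfloor>a\<rfloor>)) \<le> C / ln (real (nat \<lfloor>a\<rfloor>))"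
   by (intro bd nat_mono floor_mono) (simp_all add: le_nat_iff le_floor_iff)
 next
  have "((\<lambda>n. C / ln (real n)) \<longlongrightarrow> 0) sequentially" by real_asymp
  then show "((\<lambda>a. C / ln (real (nat \<lfloor>a\<rfloor>))) \<longlongrightarrow> 0) at_top"
   by (rule filterlim_compose) (rule filterlim_compose[OF filterlim_nat_sequentially filterlim_floor_sequentially])
 qed
 then obtain c where c: "\<And>a::real. a \<ge> 2 \<Longrightarrow> norm (f (nat \<lfloor>a\<rfloor>) - c) \<le> C / ln (real (nat \<lfloor>a\<rfloor>))" by blast
 have "norm (f N - c) \<le> C / ln (real N)" if "N \<ge> 2" for N using c[of "real N"] that by simp
 then show ?thesis by blast
qed

lemma ln_ln_Suc_bounds:
 assumes "n \<ge> 2"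
 shows "(ln (real (Suc n)) - ln (real n)) / ln (real (Suc n)) \<le> ln (ln (real (Suc n))) - ln (ln (real n))"
  "ln (ln (real (Suc n))) - ln (ln (real n)) \<le> (ln (real (Suc n)) - ln (real n)) / ln (real n)"
proof -
 define a b where "a = ln (real n)" and "b = ln (real (Suc n))"
 have ab: "a > 0" "b > 0" using assms by (auto simp: a_def b_def)
 have "ln (b / a) \<le> b / a - 1" "ln (a / b) \<le> a / b - 1" using ab by (intro ln_le_minus_one; simp)+
 then have "ln b - ln a \<le> b / a - 1" "ln a - ln b \<le> a / b - 1" using ab by (simp_all add: ln_divide_pos)
 moreover have "b / a - 1 = (b - a) / a" "a / b - 1 = - ((b - a) / b)" using ab by (simp_all add: field_simps)
 ultimately show "(ln (real (Suc n)) - ln (real n)) / ln (real (Suc n)) \<le> ln (ln (real (Suc n))) - ln (ln (real n))"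
  "ln (ln (real (Suc n))) - ln (ln (real n)) \<le> (ln (real (Suc n)) - ln (real n)) / ln (real n)"
  unfolding a_def b_def by linarith+
qed

text \<open>Subtract from \<open>a n\<close> the multiple \<open>\<delta>\<close> of the increment
  of \<open>ln\<close>: the differences \<open>b n\<close> have bounded partial sums and can be
  summed against \<open>1 / ln n\<close>. The increments divided by \<open>ln n\<close> reproduce
  \<open>ln (ln N)\<close> with an error that telescopes.\<close>

lemma partial_summation_log:
 fixes a :: "nat \<Rightarrow> complex"
 assumes bd: "\<And>N. N \<ge> 2 \<Longrightarrow> norm ((\<Sum>n\<in>{2..N}. a n) - of_real (\<delta> * ln (real N))) \<le> B"
 shows "\<exists>c C. \<forall>N\<ge>2. norm ((\<Sum>n\<in>{2..N}. a n / of_real (ln (real n))) - of_real (\<delta> * ln (ln (real N))) - c) \<le> C / ln (real N)"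
proof -
 define \<Phi> where "\<Phi> N = (\<Sum>n\<in>{2..N}. a n / of_real (ln (real n))) - of_real (\<delta> * ln (ln (real N)))" for N
 define \<Delta> where "\<Delta> n = ln (real n) - ln (real (n - 1))" for n
 define b where "b n = a n - of_real (\<delta> * \<Delta> n)" for n
 have bound: "norm (\<Phi> N - \<Phi> M) \<le> (2 * B + \<bar>\<delta>\<bar>) / ln (real M)" if MN: "2 \<le> M" "M \<le> N" for M N
 proof -
  have split: "{2..K} = {2..M} \<union> {M<..K}" if "M \<le> K" for K using that MN by auto
  have tele: "(\<Sum>n\<in>{M<..K}. \<Delta> n) = ln (real K) - ln (real M)" if "M \<le> K" for K
   using that
  proof (induction K rule: dec_induct)
   case (step K)
   have "{M<..Suc K} = insert (Suc K) {M<..K}" using step by auto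
   then show ?case using step by (simp add: \<Delta>_def)
  qed simp
  have "norm (\<Sum>n\<in>{M<..K}. b n) \<le> 2 * B" if K: "M \<le> K" for K
  proof -
   have "(\<Sum>n\<in>{M<..K}. b n) = (\<Sum>n\<in>{M<..K}. a n) - of_real (\<delta> * (\<Sum>n\<in>{M<..K}. \<Delta> n))"
    by (simp add: b_def sum_subtractf sum_distrib_left)
   also have "(\<Sum>n\<in>{M<..K}. a n) = (\<Sum>n\<in>{2..K}. a n) - (\<Sum>n\<in>{2..M}. a n)"
    unfolding split[OF K] by (subst sum.union_disjoint) auto
   finally have "(\<Sum>n\<in>{M<..K}. b n) = ((\<Sum>n\<in>{2..K}. a n) - of_real (\<delta> * ln (real K))) - ((\<Sum>n\<in>{2..M}. a n) - of_real (\<delta> * ln (real M)))"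
    unfolding tele[OF K] by (simp add: algebra_simps)
   also have "norm \<dots> \<le> B + B" by (rule order_trans[OF norm_triangle_ineq4 add_mono[OF bd bd]]) (use MN K in auto)
   finally show ?thesis by simp
  qed
  then have "norm (\<Sum>n\<in>{M<..N}. (1 / ln (real n)) *\<^sub>R b n) \<le> 2 * B * (1 / ln (real (Suc M)))"
   by (rule norm_sum_by_parts_Icc) (use MN in \<open>auto intro!: divide_left_mono mult_pos_pos ln_gt_zero\<close>)
  also have "\<dots> \<le> 2 * B * (1 / ln (real M))"
  proof (intro mult_left_mono divide_left_mono)
   show "0 \<le> 2 * B" using order_trans[OF norm_ge_zero bd[of 2]] by simp
  qed (use MN in \<open>auto intro!: mult_pos_pos ln_gt_zero\<close>)
  finally have b: "norm (\<Sum>n\<in>{M<..N}. (1 / ln (real n)) *\<^sub>R b n) \<le> 2 * B / ln (real M)" by simp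
  define D where "D = (\<Sum>n\<in>{M<..N}. \<Delta> n / ln (real n))"
  have "0 \<le> ln (ln (real N)) - ln (ln (real M)) - D \<and> ln (ln (real N)) - ln (ln (real M)) - D \<le> 1 / ln (real M) - 1 / ln (real N)"
   unfolding D_def using MN(2)
  proof (induction N rule: dec_induct)
   case (step K)
   have K: "2 \<le> K" using step MN by simp
   have set: "{M<..Suc K} = insert (Suc K) {M<..K}" using step by auto
   have \<Delta>: "0 \<le> \<Delta> (Suc K)" "\<Delta> (Suc K) \<le> 1"
   proof -
    show "0 \<le> \<Delta> (Suc K)" using K by (simp add: \<Delta>_def)
    have "1 / real K \<le> 1" using K by simp
    then show "\<Delta> (Suc K) \<le> 1" using ln_Suc_diff_le[of K] K unfolding \<Delta>_def diff_Suc_1 by linarith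
   qed
   have inv: "1 / ln (real (Suc K)) \<le> 1 / ln (real K)" using K by (intro divide_left_mono mult_pos_pos ln_gt_zero) auto
   have "\<Delta> (Suc K) * (1 / ln (real K) - 1 / ln (real (Suc K))) \<le> 1 * (1 / ln (real K) - 1 / ln (real (Suc K)))"
    using \<Delta> inv by (intro mult_right_mono) auto
   then have "\<Delta> (Suc K) / ln (real K) - \<Delta> (Suc K) / ln (real (Suc K)) \<le> 1 / ln (real K) - 1 / ln (real (Suc K))"
    by (simp only: right_diff_distrib times_divide_eq_right mult_1_right mult_1_left)
   moreover have "(\<Sum>n\<in>{M<..Suc K}. \<Delta> n / ln (real n)) = \<Delta> (Suc K) / ln (real (Suc K)) + (\<Sum>n\<in>{M<..K}. \<Delta> n / ln (real n))"
    unfolding set by (subst sum.insert) auto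
   moreover have "ln (real (Suc K)) - ln (real K) = \<Delta> (Suc K)" by (simp add: \<Delta>_def)
   note bounds = ln_ln_Suc_bounds[OF K, unfolded this]
   ultimately show ?case using step.IH bounds by (intro conjI) linarith+
  qed simp
  moreover have "1 / ln (real N) \<ge> 0" using MN by simp
  ultimately have Db: "\<bar>D - (ln (ln (real N)) - ln (ln (real M)))\<bar> \<le> 1 / ln (real M)" by linarith
  have "(\<Sum>n\<in>{M<..N}. a n / of_real (ln (real n))) = (\<Sum>n\<in>{M<..N}. (1 / ln (real n)) *\<^sub>R b n) + of_real (\<delta> * D)"
   by (simp add: b_def D_def scaleR_conv_of_real sum_distrib_left sum.distrib[symmetric] algebra_simps diff_divide_distrib)
  moreover have "(\<Sum>n\<in>{2..N}. a n / of_real (ln (real n))) = (\<Sum>n\<in>{2..M}. a n / of_real (ln (real n))) + (\<Sum>n\<in>{M<..N}. a n / of_real (ln (real n)))"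
   unfolding split[OF MN(2)] by (rule sum.union_disjoint) auto
  ultimately have "\<Phi> N - \<Phi> M = (\<Sum>n\<in>{M<..N}. (1 / ln (real n)) *\<^sub>R b n) + of_real (\<delta> * (D - (ln (ln (real N)) - ln (ln (real M)))))"
   by (simp add: \<Phi>_def algebra_simps)
  also have "norm \<dots> \<le> 2 * B / ln (real M) + \<bar>\<delta>\<bar> * (1 / ln (real M))"
  proof (rule order_trans[OF norm_triangle_ineq add_mono[OF b]])
   show "norm (complex_of_real (\<delta> * (D - (ln (ln (real N)) - ln (ln (real M)))))) \<le> \<bar>\<delta>\<bar> * (1 / ln (real M))"
    unfolding norm_of_real abs_mult by (intro mult_left_mono Db) simp
  qed
  finally show ?thesis by (simp add: add_divide_distrib)
 qed
 from Cauchy_tail_limit_log[of \<Phi>, OF bound] show ?thesis unfolding \<Phi>_def by blast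
qed

section \<open>Primes, squares of primes and higher prime powers\<close>

definition prime_powers_from :: "nat \<Rightarrow> nat set" where
 "prime_powers_from k0 = {p ^ k | p k. prime p \<and> k0 \<le> k}"

text \<open>Each prime gives a geometric series in the exponent, of size
  \<open>ln p * p powr (- \<alpha> * k0)\<close>. Half of the excess of \<open>\<alpha> * k0\<close>
  over 1 absorbs the logarithm, the other half keeps the sum over primes convergent. The
  applications are \<open>k0 = 2\<close> with \<open>\<alpha> = 1\<close> and \<open>k0 = 3\<close>
  with \<open>\<alpha> = 1/2\<close>.\<close>

lemma prime_power_sum_bounded:
 fixes \<alpha> :: real
 assumes "1 \<le> k0" "\<alpha> * real k0 > 1"
 shows "\<exists>B\<ge>0. \<forall>N. (\<Sum>n\<in>{2..N} \<inter> prime_powers_from k0. mangoldt n * real n powr (- \<alpha>)) \<le> B"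
proof -
 have \<alpha>: "\<alpha> > 0" using assms by (smt (verit) mult_nonneg_nonneg mult_nonpos_nonneg of_nat_0_le_iff)
 define \<epsilon> where "\<epsilon> = (\<alpha> * real k0 - 1) / 2"
 have \<epsilon>: "\<epsilon> > 0" "\<alpha> * real k0 = 1 + 2 * \<epsilon>" using assms by (auto simp: \<epsilon>_def field_simps)
 define r0 where "r0 = (2::real) powr (- \<alpha>)"
 have r0: "0 < r0" "r0 < 1" using \<alpha> powr_less_mono[of "- \<alpha>" 0 2] by (auto simp: r0_def)
 define A where "A = 1 / (1 - r0) / \<epsilon>"
 have A: "A \<ge> 0" using r0 \<epsilon> by (simp add: A_def)
 have sm: "summable (\<lambda>n. real n powr (- (1 + \<epsilon>)))" using summable_real_powr_iff[of "- (1 + \<epsilon>)"] \<epsilon> by simp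
 define B where "B = A * (\<Sum>n. real n powr (- (1 + \<epsilon>)))"
 have B: "B \<ge> 0" unfolding B_def using A by (intro mult_nonneg_nonneg suminf_nonneg sm) auto
 have "(\<Sum>n\<in>{2..N} \<inter> prime_powers_from k0. mangoldt n * real n powr (- \<alpha>)) \<le> B" for N
 proof -
  define P where "P = {p. prime p \<and> p \<le> N}"
  have P: "finite P" unfolding P_def by (rule finite_subset[of _ "{..N}"]) auto
  define f :: "nat \<times> nat \<Rightarrow> nat" where "f = (\<lambda>(p, k). p ^ k)"
  have sub: "{2..N} \<inter> prime_powers_from k0 \<subseteq> f ` (P \<times> {k0..N})"
  proof
   fix n assume "n \<in> {2..N} \<inter> prime_powers_from k0"
   then obtain p k where n: "2 \<le> n" "n \<le> N" "n = p ^ k" "prime p" "k0 \<le> k" by (auto simp: prime_powers_from_def)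
   have k: "k > 0" using n assms by simp
   then have "p \<le> p ^ k" using n prime_gt_0_nat[of p] by (simp add: self_le_power)
   moreover have "k < p ^ k" using prime_gt_1_nat[OF n(4)] by (intro power_gt_expt) simp
   ultimately have "(p, k) \<in> P \<times> {k0..N}" using n by (auto simp: P_def)
   then show "n \<in> f ` (P \<times> {k0..N})" using n by (force simp: f_def)
  qed
  have "(\<Sum>n\<in>{2..N} \<inter> prime_powers_from k0. mangoldt n * real n powr (- \<alpha>)) \<le> (\<Sum>n\<in>f ` (P \<times> {k0..N}). mangoldt n * real n powr (- \<alpha>))"
   by (rule sum_mono2[OF _ sub]) (use P in \<open>auto intro!: mult_nonneg_nonneg mangoldt_nonneg\<close>)
  also have "\<dots> \<le> sum ((\<lambda>n. mangoldt n * real n powr (- \<alpha>)) \<circ> f) (P \<times> {k0..N})"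
   by (rule sum_image_le) (use P in \<open>auto intro!: mult_nonneg_nonneg mangoldt_nonneg\<close>)
  also have "\<dots> = (\<Sum>p\<in>P. \<Sum>k\<in>{k0..N}. mangoldt (p ^ k) * real (p ^ k) powr (- \<alpha>))"
   by (simp add: sum.cartesian_product f_def split_beta)
  also have "\<dots> \<le> (\<Sum>p\<in>P. A * real p powr (- (1 + \<epsilon>)))"
  proof (rule sum_mono)
   fix p assume "p \<in> P"
   then have p: "prime p" "p \<ge> 2" by (auto simp: P_def prime_ge_2_nat)
   define r where "r = real p powr (- \<alpha>)"
   have r: "0 < r" "r \<le> r0" using p \<alpha> by (auto simp: r_def r0_def intro!: powr_mono2')
   have "(\<Sum>k\<in>{k0..N}. mangoldt (p ^ k) * real (p ^ k) powr (- \<alpha>)) = (\<Sum>k\<in>{k0..N}. ln (real p) * r ^ k)"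
   proof (rule sum.cong[OF refl])
    fix k assume "k \<in> {k0..N}"
    then have "k > 0" using assms by simp
    moreover have "real (p ^ k) powr (- \<alpha>) = r ^ k" using p by (simp add: r_def powr_power powr_powr mult.commute flip: powr_realpow)
    ultimately show "mangoldt (p ^ k) * real (p ^ k) powr (- \<alpha>) = ln (real p) * r ^ k" using p by simp
   qed
   also have "\<dots> = ln (real p) * (\<Sum>k\<in>{k0..N}. r ^ k)" by (simp add: sum_distrib_left)
   also have "\<dots> \<le> real p powr \<epsilon> / \<epsilon> * (real p powr (- (1 + 2 * \<epsilon>)) / (1 - r0))"
   proof (rule mult_mono)
   have "(\<Sum>k\<in>{k0..N}. r ^ k) \<le> r ^ k0 / (1 - r)"
   proof (cases "k0 \<le> N")
    case True
    have "(\<Sum>k\<in>{k0..N}. r ^ k) = (r ^ k0 - r ^ Suc N) / (1 - r)"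
     using True r r0 by (simp add: sum_gp)
    also have "\<dots> \<le> r ^ k0 / (1 - r)" using r r0 by (intro divide_right_mono) auto
    finally show ?thesis .
   qed (use r r0 in auto)
   also have "\<dots> \<le> r ^ k0 / (1 - r0)" using r r0 by (intro divide_left_mono) auto
   also have "r ^ k0 = real p powr (- (1 + 2 * \<epsilon>))"
   proof -
    have "r ^ k0 = real p powr (- (\<alpha> * real k0))" using p by (simp add: r_def powr_power mult.commute)
    then show ?thesis unfolding \<epsilon>(2) .
   qed
   finally show "(\<Sum>k\<in>{k0..N}. r ^ k) \<le> real p powr (- (1 + 2 * \<epsilon>)) / (1 - r0)" .
   show "ln (real p) \<le> real p powr \<epsilon> / \<epsilon>" using p \<epsilon> by (intro ln_powr_bound) auto
   qed (use r \<epsilon> in \<open>auto intro!: sum_nonneg\<close>)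
   also have "\<dots> = A * (real p powr \<epsilon> * real p powr (- (1 + 2 * \<epsilon>)))" by (simp add: A_def)
   also have "real p powr \<epsilon> * real p powr (- (1 + 2 * \<epsilon>)) = real p powr (- (1 + \<epsilon>))"
   proof -
    have "\<epsilon> + - (1 + 2 * \<epsilon>) = - (1 + \<epsilon>)" by simp
    then show ?thesis using powr_add[of "real p" \<epsilon> "- (1 + 2 * \<epsilon>)"] by (simp only:)
   qed
   finally show "(\<Sum>k\<in>{k0..N}. mangoldt (p ^ k) * real (p ^ k) powr (- \<alpha>)) \<le> A * real p powr (- (1 + \<epsilon>))" .
  qed
  also have "\<dots> \<le> B" unfolding B_def sum_distrib_left[symmetric]
   by (intro mult_left_mono A sum_le_suminf sm P) auto
  finally show ?thesis .
 qed
 then show ?thesis using B by blast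
qed

text \<open>With the weight \<open>1 / sqrt n\<close> the squares of primes can still contribute to
  the main term, whereas cubes and higher powers converge; hence the separation into three
  groups.\<close>

lemma sum_prime_powers_split:
 fixes F :: "nat \<Rightarrow> 'a::comm_monoid_add"
 assumes "\<And>n. \<not> primepow n \<Longrightarrow> F n = 0"
 shows "(\<Sum>n\<in>{2..N}. F n) = (\<Sum>p | prime p \<and> p \<le> N. F p) + (\<Sum>n\<in>{2..N} \<inter> prime_powers_from 2. F n)"
  "(\<Sum>n\<in>{2..N} \<inter> prime_powers_from 2. F n) = (\<Sum>p | prime p \<and> p^2 \<le> N. F (p^2)) + (\<Sum>n\<in>{2..N} \<inter> prime_powers_from 3. F n)"
proof -
 define P where "P = {p. prime p \<and> p \<le> N}"
 have P: "finite P" unfolding P_def by (rule finite_subset[of _ "{..N}"]) auto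
 have "(\<Sum>n\<in>{2..N}. F n) = (\<Sum>n\<in>P \<union> {2..N} \<inter> prime_powers_from 2. F n)"
 proof (rule sum.mono_neutral_right)
  show "P \<union> {2..N} \<inter> prime_powers_from 2 \<subseteq> {2..N}" by (auto simp: P_def prime_ge_2_nat)
  show "\<forall>i\<in>{2..N} - (P \<union> {2..N} \<inter> prime_powers_from 2). F i = 0"
  proof
   fix n assume n: "n \<in> {2..N} - (P \<union> {2..N} \<inter> prime_powers_from 2)"
   have "\<not> primepow n"
   proof
    assume "primepow n"
    then obtain p k where pk: "prime p" "k > 0" "n = p ^ k" by (auto simp: primepow_def)
    show False
    proof (cases "k = 1")
     case False
     then have "k \<ge> 2" using pk by simp
     then show ?thesis using n pk by (auto simp: prime_powers_from_def)
    qed (use n pk in \<open>auto simp: P_def\<close>)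
   qed
   then show "F n = 0" by (rule assms)
  qed
 qed simp
 also have "\<dots> = (\<Sum>n\<in>P. F n) + (\<Sum>n\<in>{2..N} \<inter> prime_powers_from 2. F n)"
  by (rule sum.union_disjoint) (use P in \<open>auto simp: P_def prime_powers_from_def prime_power_iff\<close>)
 finally show "(\<Sum>n\<in>{2..N}. F n) = (\<Sum>p | prime p \<and> p \<le> N. F p) + (\<Sum>n\<in>{2..N} \<inter> prime_powers_from 2. F n)"
  unfolding P_def .
 define Q where "Q = {p. prime p \<and> p^2 \<le> N}"
 have "p \<le> p^2" for p :: nat by (simp add: power2_eq_square)
 then have "Q \<subseteq> {..N}" unfolding Q_def using order_trans by blast
 then have Q: "finite Q" by (rule finite_subset) simp
 have "{2..N} \<inter> prime_powers_from 2 = (\<lambda>p. p^2) ` Q \<union> {2..N} \<inter> prime_powers_from 3"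
 proof (intro equalityI subsetI)
  fix n assume "n \<in> {2..N} \<inter> prime_powers_from 2"
  then obtain p k where n: "2 \<le> n" "n \<le> N" "n = p ^ k" "prime p" "2 \<le> k" by (auto simp: prime_powers_from_def)
  show "n \<in> (\<lambda>p. p^2) ` Q \<union> {2..N} \<inter> prime_powers_from 3"
  proof (cases "k = 2")
   case False
   then have "3 \<le> k" using n by simp
   then show ?thesis using n by (auto simp: prime_powers_from_def)
  qed (use n in \<open>auto simp: Q_def\<close>)
 next
  fix n assume "n \<in> (\<lambda>p. p^2) ` Q \<union> {2..N} \<inter> prime_powers_from 3"
  then show "n \<in> {2..N} \<inter> prime_powers_from 2"
  proof
   assume "n \<in> (\<lambda>p. p^2) ` Q"
   then obtain p where p: "n = p^2" "prime p" "p^2 \<le> N" by (auto simp: Q_def)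
   then have "2 \<le> p^2" using prime_ge_2_nat[of p] \<open>\<And>p. p \<le> p^2\<close>[of p] by linarith
   then show ?thesis using p by (auto simp: prime_powers_from_def)
  next
   assume "n \<in> {2..N} \<inter> prime_powers_from 3"
   then obtain p k where p: "n \<in> {2..N}" "prime p" "3 \<le> k" "n = p ^ k" by (auto simp: prime_powers_from_def)
   have "2 \<le> k" using p(3) by simp
   then have "n \<in> prime_powers_from 2" using p(2,4) unfolding prime_powers_from_def by blast
   then show ?thesis using p(1) by blast
  qed
 qed
 moreover have "(\<lambda>p. p^2) ` Q \<inter> ({2..N} \<inter> prime_powers_from 3) = {}"
 proof -
  have False if "prime p" "prime r" "p^2 = r ^ k" "3 \<le> k" for p r :: nat and k
   using prime_power_inj'(2)[OF that(1,2,3)] that(4) by simp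
  then show ?thesis by (auto simp: Q_def prime_powers_from_def)
 qed
 ultimately have "(\<Sum>n\<in>{2..N} \<inter> prime_powers_from 2. F n) = (\<Sum>n\<in>(\<lambda>p. p^2) ` Q. F n) + (\<Sum>n\<in>{2..N} \<inter> prime_powers_from 3. F n)"
  using Q by (simp add: sum.union_disjoint)
 also have "(\<Sum>n\<in>(\<lambda>p. p^2) ` Q. F n) = (\<Sum>p\<in>Q. F (p^2))" by (subst sum.reindex) (auto intro!: inj_onI)
 finally show "(\<Sum>n\<in>{2..N} \<inter> prime_powers_from 2. F n) = (\<Sum>p | prime p \<and> p^2 \<le> N. F (p^2)) + (\<Sum>n\<in>{2..N} \<inter> prime_powers_from 3. F n)"
  unfolding Q_def .
qed

lemma mangoldt_eq_0: "\<not> primepow n \<Longrightarrow> mangoldt n = 0"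
 by (simp add: mangoldt_def)

text \<open>Passing from prime powers to primes costs a bounded sum over \<open>p^k\<close> with
  \<open>k \<ge> 2\<close>; in the principal case the primes dividing \<open>q\<close> are missing
  as well, at a cost of at most \<open>Q\<close>. Partial summation then replaces the weight
  \<open>ln p / p\<close> by \<open>1 / p\<close>.\<close>

lemma Mertens_primes_char:
 assumes \<psi>: "dirichlet_char q \<psi>" and q: "q > 1"
 shows "\<exists>c C. \<forall>N\<ge>2. norm ((\<Sum>p | prime p \<and> p \<le> N. \<psi> p / of_nat p) - of_real ((if \<psi> = principal_char q then 1 else 0) * ln (ln (real N))) - c) \<le> C / ln (real N)"
proof -
 define \<delta> :: real where "\<delta> = (if \<psi> = principal_char q then 1 else 0)"
 define a where "a n = (if prime n then of_real (ln (real n)) * \<psi> n / of_nat n else 0)" for n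
 have sum_primes: "(\<Sum>n\<in>{2..N}. if prime n then F n else 0) = (\<Sum>p | prime p \<and> p \<le> N. F p)" for F :: "nat \<Rightarrow> complex" and N
  by (subst sum.inter_filter[symmetric]) (auto intro!: sum.cong simp: prime_ge_2_nat)
 obtain B where B: "B \<ge> 0" "\<And>N. (\<Sum>n\<in>{2..N} \<inter> prime_powers_from 2. mangoldt n * real n powr (- 1)) \<le> B"
  using prime_power_sum_bounded[of 2 1] by auto
 have pp: "norm (\<Sum>n\<in>{2..N} \<inter> prime_powers_from 2. mangoldt n * f n / of_nat n) \<le> B"
  if "\<And>n. norm (f n) \<le> 1" for f :: "nat \<Rightarrow> complex" and N
 proof (rule order_trans[OF sum_norm_le B(2)])
  fix n
  show "norm (mangoldt n * f n / of_nat n) \<le> mangoldt n * real n powr (- 1)"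
   using mult_left_mono[OF that[of n] mangoldt_nonneg[of n]]
   by (simp add: norm_mult norm_divide powr_minus_divide divide_right_mono)
 qed
 have from1: "(\<Sum>n\<in>{1..N}. F n) = (\<Sum>n\<in>{2..N}. F n)" if "F 1 = 0" for F :: "nat \<Rightarrow> complex" and N
  by (rule sum.mono_neutral_right) (use that in \<open>auto simp: not_le less_2_cases_iff\<close>)
 have split: "(\<Sum>n\<in>{1..N}. mangoldt n * f n / of_nat n)
   = (\<Sum>n\<in>{2..N}. if prime n then of_real (ln (real n)) * f n / of_nat n else 0) + (\<Sum>n\<in>{2..N} \<inter> prime_powers_from 2. mangoldt n * f n / of_nat n)"
  for f :: "nat \<Rightarrow> complex" and N
 proof -
  have "(\<Sum>n\<in>{1..N}. mangoldt n * f n / of_nat n) = (\<Sum>n\<in>{2..N}. mangoldt n * f n / of_nat n)" by (rule from1) simp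
  also have "\<dots> = (\<Sum>p | prime p \<and> p \<le> N. mangoldt p * f p / of_nat p) + (\<Sum>n\<in>{2..N} \<inter> prime_powers_from 2. mangoldt n * f n / of_nat n)"
   by (rule sum_prime_powers_split(1)) (simp add: mangoldt_eq_0)
  also have "(\<Sum>p | prime p \<and> p \<le> N. mangoldt p * f p / of_nat p) = (\<Sum>p | prime p \<and> p \<le> N. of_real (ln (real p)) * f p / of_nat p)"
   by (intro sum.cong) auto
  finally show ?thesis unfolding sum_primes .
 qed
 have n\<psi>: "norm (\<psi> n) \<le> 1" for n using norm_dirichlet_char_le[OF \<psi>] q by simp
 have "\<exists>B'. \<forall>N\<ge>2. norm ((\<Sum>n\<in>{2..N}. a n) - of_real (\<delta> * ln (real N))) \<le> B'"
 proof (cases "\<psi> = principal_char q")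
  case False
  obtain C where C: "\<And>N. norm (\<Sum>n\<in>{1..N}. mangoldt n * \<psi> n / of_nat n) \<le> C"
   using Mertens_nonprincipal[OF \<psi> False q] by blast
  have "norm ((\<Sum>n\<in>{2..N}. a n) - of_real (\<delta> * ln (real N))) \<le> C + B" for N
  proof -
   have "(\<Sum>n\<in>{2..N}. a n) - of_real (\<delta> * ln (real N)) = (\<Sum>n\<in>{1..N}. mangoldt n * \<psi> n / of_nat n) - (\<Sum>n\<in>{2..N} \<inter> prime_powers_from 2. mangoldt n * \<psi> n / of_nat n)"
    using False unfolding split by (simp add: \<delta>_def a_def)
   also have "norm \<dots> \<le> C + B" by (rule order_trans[OF norm_triangle_ineq4 add_mono[OF C pp[OF n\<psi>]]])
   finally show ?thesis .
  qed
  then show ?thesis by blast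
 next
  case True
  define Q where "Q = (\<Sum>n\<in>{1..q}. ln (real n) / real n)"
  have "norm ((\<Sum>n\<in>{2..N}. a n) - of_real (\<delta> * ln (real N))) \<le> 4 + B + Q" if N: "N \<ge> 2" for N
  proof -
   define D where "D = (\<Sum>n\<in>{2..N}. if prime n then of_real (ln (real n)) * (1 - \<psi> n) / of_nat n else 0)"
   have "norm D \<le> (\<Sum>n\<in>{2..N}. if n dvd q then ln (real n) / real n else 0)" unfolding D_def
   proof (rule sum_norm_le)
    fix n assume n: "n \<in> {2..N}"
    show "norm (if prime n then of_real (ln (real n)) * (1 - \<psi> n) / of_nat n else 0) \<le> (if n dvd q then ln (real n) / real n else 0)"
    proof (cases "prime n \<and> \<not> n dvd q")
     case True
     then have "coprime n q" by (simp add: prime_imp_coprime)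
     then show ?thesis using True \<open>\<psi> = principal_char q\<close> by (simp add: principal_char_def)
    next
     case False
     have "norm (1 - \<psi> n) \<le> 1" using \<open>\<psi> = principal_char q\<close> by (simp add: principal_char_def)
     then have "\<bar>ln (real n)\<bar> * norm (1 - \<psi> n) \<le> ln (real n) * 1" using n by (intro mult_mono) auto
     then show ?thesis using False n by (auto simp: norm_mult norm_divide divide_right_mono)
    qed
   qed
   also have "\<dots> = (\<Sum>n\<in>{n\<in>{2..N}. n dvd q}. ln (real n) / real n)" by (subst sum.inter_filter) auto
   also have "\<dots> \<le> Q" unfolding Q_def
    by (rule sum_mono2) (use q in \<open>auto dest: dvd_imp_le\<close>)
   finally have D: "norm D \<le> Q" .
   have M: "norm ((\<Sum>n\<in>{1..N}. mangoldt n * 1 / of_nat n) - complex_of_real (ln (real N))) \<le> 4"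
   proof -
    have "(\<Sum>n\<in>{1..N}. mangoldt n * 1 / of_nat n) - complex_of_real (ln (real N)) = of_real ((\<Sum>n\<in>{1..N}. mangoldt n / real n) - ln (real N))"
     by simp
    then show ?thesis using Mertens_all[of N] N by (simp only: norm_of_real)
   qed
   have "(\<Sum>n\<in>{2..N}. a n) = (\<Sum>n\<in>{2..N}. if prime n then of_real (ln (real n)) * 1 / of_nat n else 0) - D"
    unfolding D_def a_def sum_subtractf[symmetric] by (intro sum.cong) (auto simp: algebra_simps diff_divide_distrib)
   then have "(\<Sum>n\<in>{2..N}. a n) - of_real (\<delta> * ln (real N))
     = ((\<Sum>n\<in>{1..N}. mangoldt n * 1 / of_nat n) - of_real (ln (real N))) - (\<Sum>n\<in>{2..N} \<inter> prime_powers_from 2. mangoldt n * 1 / of_nat n) - D"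
    unfolding split using True by (simp add: \<delta>_def)
   also have "norm \<dots> \<le> 4 + B + Q"
    by (rule order_trans[OF norm_triangle_ineq4 add_mono[OF order_trans[OF norm_triangle_ineq4 add_mono[OF M pp]] D]]) simp
   finally show ?thesis .
  qed
  then show ?thesis by blast
 qed
 then obtain B' where "\<And>N. N \<ge> 2 \<Longrightarrow> norm ((\<Sum>n\<in>{2..N}. a n) - of_real (\<delta> * ln (real N))) \<le> B'" by blast
 from partial_summation_log[OF this] obtain c C where
  c: "\<And>N. N \<ge> 2 \<Longrightarrow> norm ((\<Sum>n\<in>{2..N}. a n / of_real (ln (real n))) - of_real (\<delta> * ln (ln (real N))) - c) \<le> C / ln (real N)" by blast
 have "(\<Sum>n\<in>{2..N}. a n / of_real (ln (real n))) = (\<Sum>p | prime p \<and> p \<le> N. \<psi> p / of_nat p)" for N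
  unfolding sum_primes[symmetric] by (intro sum.cong) (auto simp: a_def)
 then show ?thesis using c unfolding \<delta>_def by (simp only:) blast
qed

text \<open>For using estimates at integers \<open>N\<close> with a real variable \<open>y\<close>:
  rounding \<open>exp y\<close> down changes its logarithm by at most 1/2 and the iterated logarithm
  by at most \<open>1 / ln N\<close>.\<close>

lemma floor_exp_bounds:
 fixes y :: real
 assumes "y \<ge> 1"
 defines "N \<equiv> nat \<lfloor>exp y\<rfloor>"
 shows "N \<ge> 2" "y / 4 \<le> ln (real N)" "0 \<le> ln y - ln (ln (real N))" "ln y - ln (ln (real N)) \<le> 1 / ln (real N)"
proof -
 have "2 \<le> exp y" using exp_ge_add_one_self[of y] assms by linarith
 then show N: "N \<ge> 2" by (simp add: N_def le_nat_iff le_floor_iff)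
 have "real N \<le> exp y" "exp y < real N + 1" unfolding N_def by (simp_all add: of_nat_nat)
 then have "ln (real N) \<le> ln (exp y)" "ln (exp y) \<le> ln (real (Suc N))" using N by (subst ln_le_cancel_iff; auto)+
 then have y: "ln (real N) \<le> y" "y \<le> ln (real (Suc N))" unfolding ln_exp .
 have "ln (real (Suc N)) - ln (real N) \<le> 1 / real N" using N by (intro ln_Suc_diff_le) auto
 also have "\<dots> \<le> 1 / 2" using N by (intro divide_left_mono) auto
 finally have d: "y - ln (real N) \<le> 1 / 2" using y by simp
 then show "y / 4 \<le> ln (real N)" using assms by simp
 have pos: "ln (real N) > 0" using N by simp
 then show "0 \<le> ln y - ln (ln (real N))" using y by simp
 have "ln (y / ln (real N)) \<le> y / ln (real N) - 1" using pos assms by (intro ln_le_minus_one) auto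
 also have "y / ln (real N) - 1 = (y - ln (real N)) / ln (real N)" using pos by (simp add: diff_divide_distrib)
 also have "\<dots> \<le> 1 / ln (real N)" using pos d by (intro divide_right_mono) auto
 finally show "ln y - ln (ln (real N)) \<le> 1 / ln (real N)" using pos assms by (simp add: ln_divide_pos)
qed

context GRH_character
begin

text \<open>\<open>W\<close> runs over prime powers. Cubes and higher powers converge with error
  \<open>O(1 / y)\<close>; the squares give half of Mertens' sum for \<open>chi^2\<close> up to
  \<open>exp (y / 2)\<close>, whose main term is \<open>ln (y / 2)\<close> when \<open>chi^2\<close>
  is principal. Moving it to the other side shifts \<open>m\<close> by 1/2.\<close>

lemma prime_sum_asymptotics:
 "\<exists>c C. \<forall>y\<ge>2. norm ((\<Sum>p | prime p \<and> real p \<le> exp y. chi p / of_real (sqrt (real p)))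
  + of_real ((m + (if (\<lambda>n. chi n ^ 2) = principal_char q then 1 else 0) / 2) * ln y) - c - E1 y / of_real y) \<le> C * (ln y / y)"
proof -
 define \<psi> where "\<psi> = (\<lambda>n. chi n ^ 2)"
 define \<delta> :: real where "\<delta> = (if \<psi> = principal_char q then 1 else 0)"
 have \<psi>: "dirichlet_char q \<psi>" using dirichlet_char_mult[OF chi(1) chi(1)] by (simp add: \<psi>_def power2_eq_square)
 define F where "F n = mangoldt n * chi n / of_real (sqrt (real n) * ln (real n))" for n
 define T3 where "T3 N = (\<Sum>n\<in>{2..N} \<inter> prime_powers_from 3. F n)" for N
 obtain B where B: "B \<ge> 0" "\<And>N. (\<Sum>n\<in>{2..N} \<inter> prime_powers_from 3. mangoldt n * real n powr (- (1/2))) \<le> B"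
  using prime_power_sum_bounded[of 3 "1/2"] by auto
 have "\<exists>c. \<forall>N\<ge>2. norm (T3 N - c) \<le> B / ln (real N)"
 proof (rule Cauchy_tail_limit_log)
  fix M N :: nat assume MN: "2 \<le> M" "M \<le> N"
  have "{2..N} \<inter> prime_powers_from 3 = {2..M} \<inter> prime_powers_from 3 \<union> {M<..N} \<inter> prime_powers_from 3" using MN by auto
  then have "T3 N = T3 M + (\<Sum>n\<in>{M<..N} \<inter> prime_powers_from 3. F n)"
   unfolding T3_def by (simp only:) (rule sum.union_disjoint, auto)
  then have "T3 N - T3 M = (\<Sum>n\<in>{M<..N} \<inter> prime_powers_from 3. F n)" by simp
  also have "norm \<dots> \<le> (\<Sum>n\<in>{M<..N} \<inter> prime_powers_from 3. mangoldt n * real n powr (- (1/2)) * (1 / ln (real M)))"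
  proof (rule sum_norm_le)
   fix n assume n: "n \<in> {M<..N} \<inter> prime_powers_from 3"
   have "norm (F n) = mangoldt n * norm (chi n) * (1 / sqrt (real n)) * (1 / ln (real n))"
    using n MN by (simp add: F_def norm_mult norm_divide)
   also have "\<dots> \<le> mangoldt n * 1 * (1 / sqrt (real n)) * (1 / ln (real M))"
    using n MN norm_dirichlet_char_le[OF chi(1), of n] q
    by (intro mult_mono divide_left_mono mult_nonneg_nonneg mangoldt_nonneg ln_mono mult_pos_pos ln_gt_zero) auto
   also have "1 / sqrt (real n) = real n powr (- (1/2))" by (simp add: powr_minus_divide powr_half_sqrt)
   finally show "norm (F n) \<le> mangoldt n * real n powr (- (1/2)) * (1 / ln (real M))" by simp
  qed
  also have "\<dots> = (\<Sum>n\<in>{M<..N} \<inter> prime_powers_from 3. mangoldt n * real n powr (- (1/2))) * (1 / ln (real M))"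
   by (rule sum_distrib_right[symmetric])
  also have "\<dots> \<le> B * (1 / ln (real M))"
  proof (rule mult_right_mono)
   have "(\<Sum>n\<in>{M<..N} \<inter> prime_powers_from 3. mangoldt n * real n powr (- (1/2))) \<le> (\<Sum>n\<in>{2..N} \<inter> prime_powers_from 3. mangoldt n * real n powr (- (1/2)))"
    by (rule sum_mono2) (use MN in \<open>auto intro!: mult_nonneg_nonneg mangoldt_nonneg\<close>)
   then show "(\<Sum>n\<in>{M<..N} \<inter> prime_powers_from 3. mangoldt n * real n powr (- (1/2))) \<le> B" using B(2)[of N] by linarith
  qed (use MN in auto)
  finally show "norm (T3 N - T3 M) \<le> B / ln (real M)" by simp
 qed
 then obtain c3 where c3: "\<And>N. N \<ge> 2 \<Longrightarrow> norm (T3 N - c3) \<le> B / ln (real N)" by blast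
 define M2 where "M2 N = (\<Sum>p | prime p \<and> p \<le> N. \<psi> p / of_nat p)" for N
 obtain c2 C2 where c2: "\<And>N. N \<ge> 2 \<Longrightarrow> norm (M2 N - of_real (\<delta> * ln (ln (real N))) - c2) \<le> C2 / ln (real N)"
  using Mertens_primes_char[OF \<psi> q] unfolding \<delta>_def M2_def by blast
 obtain c1 C1 where c1: "\<And>y. y \<ge> 2 \<Longrightarrow> norm (W (nat \<lfloor>exp y\<rfloor>) + of_real (m * ln y) - c1 - E1 y / of_real y) \<le> C1 * (ln y / y)"
  using W_asymptotics by blast
 have C2: "C2 \<ge> 0" using order_trans[OF norm_ge_zero c2[of 2]] by (simp add: zero_le_divide_iff)
 \<comment> \<open>The summand with \<open>ln 2\<close> comes from
   \<open>ln (y / 2) = ln y - ln 2\<close>.\<close>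
 define c where "c = c1 - (c2 - of_real (\<delta> * ln 2)) / 2 - c3"
 define S where "S y = (\<Sum>p | prime p \<and> real p \<le> exp y. chi p / of_real (sqrt (real p)))" for y
 define C where "C = C1 + 8 * C2 + 8 + 16 * B"
 have "norm (S y + of_real ((m + \<delta> / 2) * ln y) - c - E1 y / of_real y) \<le> C * (ln y / y)" if y: "y \<ge> 2" for y
 proof -
  define N where "N = nat \<lfloor>exp y\<rfloor>"
  define N' where "N' = nat \<lfloor>exp (y / 2)\<rfloor>"
  have Nle: "p \<le> N \<longleftrightarrow> real p \<le> exp y" "p \<le> N' \<longleftrightarrow> real p \<le> exp (y / 2)" for p
   unfolding N_def N'_def by (simp_all add: le_nat_iff le_floor_iff)
  have sq: "p^2 \<le> N \<longleftrightarrow> p \<le> N'" for p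
  proof -
   have "exp y = (exp (y / 2))^2" by (simp add: power2_eq_square exp_add[symmetric])
   then show ?thesis unfolding Nle by (simp add: power_mono_iff)
  qed
  have "W N = (\<Sum>n\<in>{2..N}. F n)" by (simp add: W_def F_def)
  also have "\<dots> = (\<Sum>p | prime p \<and> p \<le> N. F p) + ((\<Sum>p | prime p \<and> p^2 \<le> N. F (p^2)) + T3 N)"
   unfolding T3_def by (subst sum_prime_powers_split(1), simp add: F_def mangoldt_eq_0, subst sum_prime_powers_split(2)) (simp_all add: F_def mangoldt_eq_0)
  also have "(\<Sum>p | prime p \<and> p \<le> N. F p) = S y" unfolding S_def Nle
   by (intro sum.cong refl) (auto simp: F_def dest: prime_gt_1_nat)
  also have "(\<Sum>p | prime p \<and> p^2 \<le> N. F (p^2)) = M2 N' / 2" unfolding M2_def sq sum_divide_distrib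
  proof (intro sum.cong refl)
   fix p assume "p \<in> {p. prime p \<and> p \<le> N'}"
   then have p: "prime p" "p > 1" by (auto dest: prime_gt_1_nat)
   have "ln (real p) \<noteq> 0" using p by simp
   then show "F (p^2) = \<psi> p / of_nat p / 2"
    using p by (simp add: F_def \<psi>_def dirichlet_char_power[OF chi(1)] ln_realpow)
  qed
  finally have W: "W N = S y + (M2 N' / 2 + T3 N)" .
  have y2: "1 \<le> y / 2" "1 \<le> y" using y by auto
  note b = floor_exp_bounds[OF y2(2), folded N_def] and b' = floor_exp_bounds[OF y2(1), folded N'_def]
  have iN: "1 / ln (real N) \<le> 4 / y" "1 / ln (real N') \<le> 8 / y"
   using b(2) b'(2) y by (simp_all add: field_simps)
  have ly: "1 \<le> 2 * ln y"
   using ln_ge_half[of "1/y"] y by simp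
  have e1: "norm (W N + of_real (m * ln y) - c1 - E1 y / of_real y) \<le> C1 * (ln y / y)" unfolding N_def by (rule c1[OF y])
  have e2: "norm (M2 N' - of_real (\<delta> * ln (ln (real N'))) - c2) \<le> C2 * (8 / y)"
   using c2[OF b'(1)] mult_left_mono[OF iN(2) C2] by simp
  have e3: "norm (T3 N - c3) \<le> B * (8 / y)"
  proof -
   have "4 / y \<le> 8 / y" using y by (simp add: divide_right_mono)
   then show ?thesis using c3[OF b(1)] mult_left_mono[OF order_trans[OF iN(1)] B(1), of "8 / y"] by simp
  qed
  have e4: "norm (complex_of_real (\<delta> * (ln (y / 2) - ln (ln (real N'))))) \<le> 8 / y"
  proof -
   have "norm (complex_of_real (\<delta> * (ln (y / 2) - ln (ln (real N'))))) \<le> 1 * (1 / ln (real N'))"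
    unfolding norm_of_real abs_mult using b'(3,4) by (intro mult_mono) (auto simp: \<delta>_def)
   then show ?thesis using iN(2) by simp
  qed
  have lny: "ln (y / 2) = ln y - ln 2" using y by (simp add: ln_divide_pos)
  have "S y + of_real ((m + \<delta> / 2) * ln y) - c - E1 y / of_real y
    = (W N + of_real (m * ln y) - c1 - E1 y / of_real y) - (M2 N' - of_real (\<delta> * ln (ln (real N'))) - c2) / 2
     + of_real (\<delta> * (ln (y / 2) - ln (ln (real N')))) / 2 - (T3 N - c3)"
   unfolding W c_def lny by (simp add: algebra_simps add_divide_distrib diff_divide_distrib)
  also have "norm \<dots> \<le> C1 * (ln y / y) + C2 * (8 / y) / 2 + (8 / y) / 2 + B * (8 / y)"
  proof -
   have e2': "norm ((M2 N' - of_real (\<delta> * ln (ln (real N'))) - c2) / 2) \<le> C2 * (8 / y) / 2"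
    using e2 unfolding norm_divide norm_numeral by (rule divide_right_mono) simp
   have e4': "norm (complex_of_real (\<delta> * (ln (y / 2) - ln (ln (real N')))) / 2) \<le> (8 / y) / 2"
    using e4 unfolding norm_divide norm_numeral by (rule divide_right_mono) simp
   show ?thesis
    by (rule order_trans[OF norm_triangle_ineq4 add_mono[OF order_trans[OF norm_triangle_ineq
       add_mono[OF order_trans[OF norm_triangle_ineq4 add_mono[OF e1 e2']] e4']] e3]])
  qed
  also have "\<dots> = C1 * (ln y / y) + (4 * C2 + 4 + 8 * B) * (1 / y)" by (simp add: algebra_simps)
  also have "\<dots> \<le> C1 * (ln y / y) + (4 * C2 + 4 + 8 * B) * (2 * ln y / y)"
   using C2 B(1) ly y by (intro add_left_mono mult_left_mono divide_right_mono) auto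
  also have "\<dots> \<le> C1 * (ln y / y) + (8 * C2 + 8 + 16 * B) * (ln y / y)" by (simp add: algebra_simps)
  also have "\<dots> = C * (ln y / y)" by (simp add: C_def algebra_simps)
  finally show ?thesis .
 qed
 then show ?thesis unfolding S_def \<delta>_def \<psi>_def by blast
qed

end

subsection \<open>From mean squares to densities\<close>

text \<open>The shape that survives linear combinations: \<open>- a\<close> is the coefficient of
  \<open>ln y\<close>, and \<open>E\<close> is an error controlled in mean square only, at scale 1
  near \<open>Y\<close> and over all of \<open>{0..Y}\<close>. One constant \<open>K\<close> serves
  all bounds.\<close>

definition mean_square_expansion :: "(real \<Rightarrow> complex) \<Rightarrow> complex \<Rightarrow> bool" where
 "mean_square_expansion f a \<longleftrightarrow> (\<exists>c K E. K > 0 \<and> E \<in> borel_measurable borel \<and>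
  (\<forall>y\<ge>2. norm (f y + a * of_real (ln y) - c - E y / of_real y) \<le> K * (ln y / y)) \<and>
  (\<forall>Y\<ge>2. mean_square (\<lambda>y. exp (y - Y)) E Y \<le> ennreal (K * (ln Y)^2) \<and> mean_square (\<lambda>_. 1) E Y \<le> ennreal (K * Y)))"

lemma mean_square_expansion_0: "mean_square_expansion (\<lambda>_. 0) 0"
 unfolding mean_square_expansion_def by (rule exI[of _ 0], rule exI[of _ 1], rule exI[of _ "\<lambda>_. 0"]) simp

lemma mean_square_combination:
 assumes [measurable]: "E \<in> borel_measurable borel" "E' \<in> borel_measurable borel" "w \<in> borel_measurable borel"
  and w: "\<And>y. w y \<ge> 0" and bd: "mean_square w E Y \<le> ennreal A" "mean_square w E' Y \<le> ennreal A'" and A: "A \<ge> 0" "A' \<ge> 0"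
 shows "mean_square w (\<lambda>y. z * E y + E' y) Y \<le> ennreal (2 * (norm z)^2 * A + 2 * A')"
proof -
 let ?z = "2 * (norm z)^2"
 have "mean_square w (\<lambda>y. z * E y + E' y) Y
   \<le> (\<integral>\<^sup>+y. ennreal ?z * (ennreal (w y * (norm (E y))^2) * indicator {0..Y} y) + ennreal 2 * (ennreal (w y * (norm (E' y))^2) * indicator {0..Y} y) \<partial>lborel)"
 proof (rule nn_integral_mono)
  fix y
  have "(norm (z * E y + E' y))^2 \<le> (norm (z * E y) + norm (E' y))^2" by (intro power_mono norm_triangle_ineq) auto
  also have "\<dots> \<le> 2 * (norm (z * E y))^2 + 2 * (norm (E' y))^2"
   using sum_squares_bound[of "norm (z * E y)" "norm (E' y)"] by (simp add: power2_sum)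
  also have "\<dots> = ?z * (norm (E y))^2 + 2 * (norm (E' y))^2" by (simp add: norm_mult power_mult_distrib)
  finally have "w y * (norm (z * E y + E' y))^2 \<le> w y * (?z * (norm (E y))^2 + 2 * (norm (E' y))^2)"
   by (intro mult_left_mono w)
  then have "ennreal (w y * (norm (z * E y + E' y))^2) \<le> ennreal (?z * (w y * (norm (E y))^2) + 2 * (w y * (norm (E' y))^2))"
   by (intro ennreal_leI) (simp add: algebra_simps)
  also have "\<dots> = ennreal ?z * ennreal (w y * (norm (E y))^2) + ennreal 2 * ennreal (w y * (norm (E' y))^2)"
   using w[of y] by (subst ennreal_plus) (auto simp only: ennreal_mult' zero_le_numeral zero_le_power2 mult_nonneg_nonneg)
  finally show "ennreal (w y * (norm (z * E y + E' y))^2) * indicator {0..Y} y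
    \<le> ennreal ?z * (ennreal (w y * (norm (E y))^2) * indicator {0..Y} y) + ennreal 2 * (ennreal (w y * (norm (E' y))^2) * indicator {0..Y} y)"
   by (simp only: indicator_def split: if_split) simp
 qed
 also have "\<dots> = ennreal ?z * mean_square w E Y + ennreal 2 * mean_square w E' Y"
  by (subst nn_integral_add) (auto simp: nn_integral_cmult)
 also have "\<dots> \<le> ennreal ?z * ennreal A + ennreal 2 * ennreal A'" by (intro add_mono mult_left_mono bd) auto
 also have "\<dots> = ennreal (?z * A + 2 * A')"
  using A by (subst ennreal_plus) (auto simp only: ennreal_mult' zero_le_numeral zero_le_power2 mult_nonneg_nonneg)
 finally show ?thesis .
qed

lemma mean_square_expansion_combination:
 assumes "mean_square_expansion f a" "mean_square_expansion g b"
 shows "mean_square_expansion (\<lambda>y. z * f y + g y) (z * a + b)"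
proof -
 obtain c K E where 1: "K > 0" "E \<in> borel_measurable borel"
  "\<And>y. y \<ge> 2 \<Longrightarrow> norm (f y + a * of_real (ln y) - c - E y / of_real y) \<le> K * (ln y / y)"
  "\<And>Y. Y \<ge> 2 \<Longrightarrow> mean_square (\<lambda>y. exp (y - Y)) E Y \<le> ennreal (K * (ln Y)^2)"
  "\<And>Y. Y \<ge> 2 \<Longrightarrow> mean_square (\<lambda>_. 1) E Y \<le> ennreal (K * Y)"
  using assms(1) unfolding mean_square_expansion_def by blast
 obtain c' K' E' where 2: "K' > 0" "E' \<in> borel_measurable borel"
  "\<And>y. y \<ge> 2 \<Longrightarrow> norm (g y + b * of_real (ln y) - c' - E' y / of_real y) \<le> K' * (ln y / y)"
  "\<And>Y. Y \<ge> 2 \<Longrightarrow> mean_square (\<lambda>y. exp (y - Y)) E' Y \<le> ennreal (K' * (ln Y)^2)"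
  "\<And>Y. Y \<ge> 2 \<Longrightarrow> mean_square (\<lambda>_. 1) E' Y \<le> ennreal (K' * Y)"
  using assms(2) unfolding mean_square_expansion_def by blast
 define K2 where "K2 = 2 * (norm z)^2 * K + norm z * K + 2 * K'"
 have K2: "K2 > 0" "2 * (norm z)^2 * K + 2 * K' \<le> K2" "norm z * K + K' \<le> K2"
  using 1(1) 2(1) by (auto simp: K2_def add_nonneg_pos)
 have bd: "mean_square w (\<lambda>y. z * E y + E' y) Y \<le> ennreal (K2 * B)"
  if "w \<in> borel_measurable borel" "\<And>y. w y \<ge> 0" "B \<ge> 0" "mean_square w E Y \<le> ennreal (K * B)" "mean_square w E' Y \<le> ennreal (K' * B)" for w B Y
 proof -
  have "mean_square w (\<lambda>y. z * E y + E' y) Y \<le> ennreal (2 * (norm z)^2 * (K * B) + 2 * (K' * B))"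
   by (rule mean_square_combination[OF 1(2) 2(2) that(1,2,4,5)]) (use 1(1) 2(1) that(3) in auto)
  also have "\<dots> \<le> ennreal (K2 * B)"
   using mult_right_mono[OF K2(2) that(3)] by (intro ennreal_leI) (simp add: algebra_simps)
  finally show ?thesis .
 qed
 show ?thesis unfolding mean_square_expansion_def
 proof (intro exI[of _ "z * c + c'"] exI[of _ K2] exI[of _ "\<lambda>y. z * E y + E' y"] conjI allI impI K2(1))
  show "(\<lambda>y. z * E y + E' y) \<in> borel_measurable borel" using 1(2) 2(2) by measurable
  fix y :: real assume y: "y \<ge> 2"
  have "z * f y + g y + (z * a + b) * of_real (ln y) - (z * c + c') - (z * E y + E' y) / of_real y
    = z * (f y + a * of_real (ln y) - c - E y / of_real y) + (g y + b * of_real (ln y) - c' - E' y / of_real y)"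
   by (simp add: algebra_simps add_divide_distrib)
  also have "norm \<dots> \<le> norm z * (K * (ln y / y)) + K' * (ln y / y)"
   by (rule order_trans[OF norm_triangle_ineq]) (unfold norm_mult, intro add_mono mult_left_mono 1 2 y norm_ge_zero)
  also have "\<dots> = (norm z * K + K') * (ln y / y)" by (simp add: algebra_simps)
  also have "\<dots> \<le> K2 * (ln y / y)" using K2(3) y by (intro mult_right_mono) auto
  finally show "norm (z * f y + g y + (z * a + b) * of_real (ln y) - (z * c + c') - (z * E y + E' y) / of_real y) \<le> K2 * (ln y / y)" .
 next
  fix Y :: real assume Y: "Y \<ge> 2"
  show "mean_square (\<lambda>y. exp (y - Y)) (\<lambda>y. z * E y + E' y) Y \<le> ennreal (K2 * (ln Y)^2)"
   by (rule bd[OF _ _ _ 1(4)[OF Y] 2(4)[OF Y]]) auto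
  show "mean_square (\<lambda>_. 1) (\<lambda>y. z * E y + E' y) Y \<le> ennreal (K2 * Y)"
   by (rule bd[OF _ _ _ 1(5)[OF Y] 2(5)[OF Y]]) (use Y in auto)
 qed
qed

text \<open>Terms with coefficient 0 are passed over, because GRH is assumed just for the characters
  that occur in \<open>t\<close>.\<close>

lemma mean_square_expansion_sum:
 assumes "finite S" "\<And>i. i \<in> S \<Longrightarrow> z i \<noteq> 0 \<Longrightarrow> mean_square_expansion (f i) (a i)"
 shows "mean_square_expansion (\<lambda>y. \<Sum>i\<in>S. z i * f i y) (\<Sum>i\<in>S. z i * a i)"
 using assms
proof (induction S rule: finite_induct)
 case (insert i S)
 then show ?case by (cases "z i = 0") (auto intro: mean_square_expansion_combination)
qed (simp add: mean_square_expansion_0)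

lemma (in GRH_character) mean_square_expansion_char:
 "mean_square_expansion (\<lambda>y. \<Sum>p | prime p \<and> real p \<le> exp y. chi p / of_real (sqrt (real p)))
  (of_real (m + (if (\<lambda>n. chi n ^ 2) = principal_char q then 1 else 0) / 2))"
proof -
 obtain c C where 1: "\<And>y. y \<ge> 2 \<Longrightarrow> norm ((\<Sum>p | prime p \<and> real p \<le> exp y. chi p / of_real (sqrt (real p)))
  + of_real ((m + (if (\<lambda>n. chi n ^ 2) = principal_char q then 1 else 0) / 2) * ln y) - c - E1 y / of_real y) \<le> C * (ln y / y)"
  using prime_sum_asymptotics by blast
 obtain D where D: "D > 0" "\<And>Y. Y \<ge> 2 \<Longrightarrow> mean_square (\<lambda>y. exp (y - Y)) E1 Y \<le> ennreal (D * (ln Y)^2)"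
  "\<And>Y. Y \<ge> 2 \<Longrightarrow> mean_square (\<lambda>_. 1) E1 Y \<le> ennreal (D * Y)"
  using E1_mean_square by blast
 define K where "K = max C D"
 have K: "K > 0" "C \<le> K" "D \<le> K" using D(1) by (auto simp: K_def)
 show ?thesis unfolding mean_square_expansion_def
 proof (intro exI[of _ c] exI[of _ K] exI[of _ E1] conjI allI impI K(1) E1_measurable)
  fix y :: real assume y: "y \<ge> 2"
  have "C * (ln y / y) \<le> K * (ln y / y)" using K(2) y by (intro mult_right_mono) auto
  then show "norm ((\<Sum>p | prime p \<and> real p \<le> exp y. chi p / of_real (sqrt (real p)))
   + of_real (m + (if (\<lambda>n. chi n ^ 2) = principal_char q then 1 else 0) / 2) * of_real (ln y) - c - E1 y / of_real y) \<le> K * (ln y / y)"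
   using 1[OF y] unfolding of_real_mult by linarith
 next
  fix Y :: real assume Y: "Y \<ge> 2"
  show "mean_square (\<lambda>y. exp (y - Y)) E1 Y \<le> ennreal (K * (ln Y)^2)"
   by (rule order_trans[OF D(2)[OF Y]]) (use K in \<open>auto intro!: ennreal_leI mult_right_mono\<close>)
  show "mean_square (\<lambda>_. 1) E1 Y \<le> ennreal (K * Y)"
   by (rule order_trans[OF D(3)[OF Y]]) (use K Y in \<open>auto intro!: ennreal_leI mult_right_mono\<close>)
 qed
qed

text \<open>Characters vanish at the primes dividing \<open>q\<close>, so the condition on
  \<open>p\<close> disappears once \<open>t\<close> is expanded; the principal character is absent
  by hypothesis.\<close>

lemma pi_half_char_expansion:
 assumes q: "q > 1" and t0: "char_inner q t (principal_char q) = 0"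
 shows "pi_half q t x = (\<Sum>chi | dirichlet_char q chi \<and> chi \<noteq> principal_char q.
  char_inner q t chi * (\<Sum>p | prime p \<and> real p \<le> x. chi p / of_real (sqrt (real p))))"
proof -
 let ?X = "{chi. dirichlet_char q chi \<and> chi \<noteq> principal_char q}"
 have fin: "finite {chi. dirichlet_char q chi}" using q by (intro finite_dirichlet_chars) simp
 have finP: "finite {p. prime p \<and> real p \<le> x}"
  by (rule finite_subset[of _ "{..nat \<lfloor>x\<rfloor>}"]) (auto simp: le_nat_iff le_floor_iff)
 have "pi_half q t x = (\<Sum>p\<in>{p. prime p \<and> real p \<le> x \<and> \<not> p dvd q}. \<Sum>chi\<in>?X. char_inner q t chi * chi p / of_real (sqrt (real p)))"
  unfolding pi_half_def
 proof (rule sum.cong[OF refl])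
  fix p assume "p \<in> {p. prime p \<and> real p \<le> x \<and> \<not> p dvd q}"
  then have "coprime p q" by (simp add: prime_imp_coprime)
  then have "p mod q \<in> units_mod q" using q by (simp add: units_mod_def)
  then have "t (p mod q) = (\<Sum>chi | dirichlet_char q chi. char_inner q t chi * chi (p mod q))"
   by (rule char_expansion[OF _ q])
  also have "\<dots> = (\<Sum>chi\<in>?X. char_inner q t chi * chi (p mod q))"
   by (rule sum.mono_neutral_right[OF fin]) (use t0 in auto)
  also have "\<dots> = (\<Sum>chi\<in>?X. char_inner q t chi * chi p)"
   by (intro sum.cong refl) (auto simp: dirichlet_char_mod)
  finally show "t (p mod q) / of_real (sqrt (real p)) = (\<Sum>chi\<in>?X. char_inner q t chi * chi p / of_real (sqrt (real p)))"
   by (simp only: sum_divide_distrib)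
 qed
 also have "\<dots> = (\<Sum>p | prime p \<and> real p \<le> x. \<Sum>chi\<in>?X. char_inner q t chi * chi p / of_real (sqrt (real p)))"
 proof (rule sum.mono_neutral_left[OF finP])
  show "\<forall>p\<in>{p. prime p \<and> real p \<le> x} - {p. prime p \<and> real p \<le> x \<and> \<not> p dvd q}. (\<Sum>chi\<in>?X. char_inner q t chi * chi p / of_real (sqrt (real p))) = 0"
  proof
   fix p assume "p \<in> {p. prime p \<and> real p \<le> x} - {p. prime p \<and> real p \<le> x \<and> \<not> p dvd q}"
   then have "prime p" "p dvd q" by auto
   then have "\<not> coprime p q" using not_prime_unit by (auto simp: coprime_def)
   then have "chi p = 0" if "chi \<in> ?X" for chi using that dirichlet_charD(5)[of q chi] by simp
   then show "(\<Sum>chi\<in>?X. char_inner q t chi * chi p / of_real (sqrt (real p))) = 0" by (intro sum.neutral ballI) simp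
  qed
 qed auto
 also have "\<dots> = (\<Sum>chi\<in>?X. \<Sum>p | prime p \<and> real p \<le> x. char_inner q t chi * chi p / of_real (sqrt (real p)))"
  by (rule sum.swap)
 finally show ?thesis by (simp add: sum_distrib_left)
qed

lemma M_const_char_expansion:
 assumes q: "q > 1" and t0: "char_inner q t (principal_char q) = 0"
 shows "M_const q t = (\<Sum>chi | dirichlet_char q chi \<and> chi \<noteq> principal_char q.
  char_inner q t chi * of_real (of_int (m_char chi) + (if (\<lambda>n. chi n ^ 2) = principal_char q then 1 else 0) / 2))"
proof -
 let ?X = "{chi. dirichlet_char q chi \<and> chi \<noteq> principal_char q}"
 have fin: "finite {chi. dirichlet_char q chi}" using q by (intro finite_dirichlet_chars) simp
 have "char_inner q t (r_sq q) = (\<Sum>chi | dirichlet_char q chi. if (\<lambda>n. chi n ^ 2) = principal_char q then char_inner q t chi else 0)"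
  by (rule char_inner_r_sq[OF q])
 also have "\<dots> = (\<Sum>chi\<in>?X. if (\<lambda>n. chi n ^ 2) = principal_char q then char_inner q t chi else 0)"
  by (rule sum.mono_neutral_right[OF fin]) (use t0 in auto)
 finally show ?thesis unfolding M_const_def
  by (simp add: sum_divide_distrib sum_distrib_left sum.distrib[symmetric] add_divide_distrib)
   (intro sum.cong refl, simp add: algebra_simps)
qed

lemma mean_square_expansion_pi_half:
 assumes q: "q > 1" and t0: "char_inner q t (principal_char q) = 0"
  and GRH: "\<And>chi. dirichlet_char q chi \<Longrightarrow> char_inner q t chi \<noteq> 0 \<Longrightarrow> GRH_for chi"
 shows "mean_square_expansion (\<lambda>y. pi_half q t (exp y)) (M_const q t)"
 unfolding pi_half_char_expansion[OF q t0] M_const_char_expansion[OF q t0]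
proof (rule mean_square_expansion_sum)
 have "finite {chi. dirichlet_char q chi}" using q by (intro finite_dirichlet_chars) simp
 then show "finite {chi. dirichlet_char q chi \<and> chi \<noteq> principal_char q}" by (rule rev_finite_subset) auto
 fix chi assume "chi \<in> {chi. dirichlet_char q chi \<and> chi \<noteq> principal_char q}" "char_inner q t chi \<noteq> 0"
 then interpret GRH_character q chi by unfold_locales (use q GRH in auto)
 show "mean_square_expansion (\<lambda>y. \<Sum>p | prime p \<and> real p \<le> exp y. chi p / of_real (sqrt (real p)))
  (of_real (of_int (m_char chi) + (if (\<lambda>n. chi n ^ 2) = principal_char q then 1 else 0) / 2))"
  using mean_square_expansion_char by (simp only: m_def)
qed

section \<open>Chebyshev's inequality and densities\<close>

lemma exp_substitution:
 fixes u :: "real \<Rightarrow> real"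
 assumes [measurable]: "u \<in> borel_measurable borel" and Y: "Y \<ge> 0"
 shows "(\<integral>\<^sup>+x\<in>{1..exp Y}. ennreal (u x) \<partial>lborel) = (\<integral>\<^sup>+y\<in>{0..Y}. ennreal (u (exp y) * exp y) \<partial>lborel)"
 using nn_integral_substitution[of exp 0 Y u exp] Y
 by (simp add: set_borel_measurable_def continuous_on_exp nn_integral_set_ennreal)

text \<open>Chebyshev's inequality with the weight \<open>\<omega>\<close>, after the substitution
  \<open>x = exp y\<close>: the weight 1 serves natural density and \<open>1 / x\<close> logarithmic
  density. Points up to \<open>Z\<close> are given away, so that the threshold \<open>T\<close> is
  asked for only where \<open>ln x\<close> is large.\<close>

lemma deviation_bound:
 fixes E :: "real \<Rightarrow> complex" and S :: "real set"
 assumes [measurable]: "E \<in> borel_measurable borel" "S \<in> sets borel" "\<omega> \<in> borel_measurable borel"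
  and T: "T > 0" and X: "X \<ge> 1" and \<omega>: "\<And>x. x \<ge> 1 \<Longrightarrow> \<omega> x \<ge> 0"
  and S: "\<And>x. x \<in> S \<Longrightarrow> 1 \<le> x \<and> x \<le> X \<and> (x \<le> Z \<or> T \<le> norm (E (ln x)))"
  and A: "(\<integral>\<^sup>+x\<in>{1..Z}. ennreal (\<omega> x) \<partial>lborel) \<le> ennreal A" "A \<ge> 0"
  and B: "mean_square (\<lambda>y. \<omega> (exp y) * exp y) E (ln X) \<le> ennreal B" "B \<ge> 0"
 shows "(\<integral>\<^sup>+x\<in>S. ennreal (\<omega> x) \<partial>lborel) \<le> ennreal (A + B / T^2)"
proof -
 let ?F = "\<lambda>x. \<omega> x * (norm (E (ln x)))^2"
 have "(\<integral>\<^sup>+x\<in>S. ennreal (\<omega> x) \<partial>lborel)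
   \<le> (\<integral>\<^sup>+x. ennreal (\<omega> x) * indicator {1..Z} x + ennreal (1 / T^2) * (ennreal (?F x) * indicator {1..exp (ln X)} x) \<partial>lborel)"
 proof (rule nn_integral_mono)
  fix x
  show "ennreal (\<omega> x) * indicator S x \<le> ennreal (\<omega> x) * indicator {1..Z} x + ennreal (1 / T^2) * (ennreal (?F x) * indicator {1..exp (ln X)} x)"
  proof (cases "x \<in> S \<and> \<not> x \<le> Z")
   case True
   then have x: "1 \<le> x" "x \<le> X" "T \<le> norm (E (ln x))" using S[of x] by auto
   have "T^2 \<le> (norm (E (ln x)))^2" using x T by (intro power_mono) auto
   then have "\<omega> x * 1 \<le> \<omega> x * (1 / T^2 * (norm (E (ln x)))^2)" using T \<omega>[OF x(1)] by (intro mult_left_mono) auto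
   then have "ennreal (\<omega> x) \<le> ennreal (1 / T^2 * ?F x)" by (intro ennreal_leI) (simp add: mult_ac)
   also have "\<dots> = ennreal (1 / T^2) * ennreal (?F x)" using \<omega>[OF x(1)] by (intro ennreal_mult) auto
   finally show ?thesis using True x X by (simp add: add_increasing)
  qed (use S in \<open>auto simp: indicator_def add_increasing2\<close>)
 qed
 also have "\<dots> = (\<integral>\<^sup>+x\<in>{1..Z}. ennreal (\<omega> x) \<partial>lborel) + ennreal (1 / T^2) * (\<integral>\<^sup>+x\<in>{1..exp (ln X)}. ennreal (?F x) \<partial>lborel)"
  by (subst nn_integral_add) (auto simp: nn_integral_cmult)
 also have "(\<integral>\<^sup>+x\<in>{1..exp (ln X)}. ennreal (?F x) \<partial>lborel) = mean_square (\<lambda>y. \<omega> (exp y) * exp y) E (ln X)"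
  by (subst exp_substitution) (use X in \<open>auto simp: mult_ac\<close>)
 also have "(\<integral>\<^sup>+x\<in>{1..Z}. ennreal (\<omega> x) \<partial>lborel) + ennreal (1 / T^2) * mean_square (\<lambda>y. \<omega> (exp y) * exp y) E (ln X)
   \<le> ennreal A + ennreal (1 / T^2) * ennreal B"
  by (intro add_mono mult_left_mono A B) auto
 also have "ennreal (1 / T^2) * ennreal B = ennreal (1 / T^2 * B)" by (rule ennreal_mult[symmetric]) (use B in auto)
 also have "ennreal A + \<dots> = ennreal (A + 1 / T^2 * B)" using A B by (subst ennreal_plus) auto
 finally show ?thesis by simp
qed

lemma has_natural_density_oneI:
 assumes [measurable]: "A \<in> sets borel" and B: "(B \<longlongrightarrow> 0) at_top"
  and le: "\<forall>\<^sub>F X in at_top. measure lborel ({2..X} - A) / X \<le> B X"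
 shows "has_natural_density A 1"
 unfolding has_natural_density_def
proof
 have "\<forall>\<^sub>F X in at_top. measure lborel (A \<inter> {2..X}) / X = (X - 2) / X - measure lborel ({2..X} - A) / X"
  using eventually_ge_at_top[of 2]
 proof eventually_elim
  case (elim X)
  have "measure lborel ({2..X} - {2..X} \<inter> A) = measure lborel {2..X} - measure lborel ({2..X} \<inter> A)"
   by (rule measure_Diff) (use elim in auto)
  then show ?case using elim by (simp add: Diff_Int Int_commute diff_divide_distrib)
 qed
 moreover have "((\<lambda>X. (X - 2) / X - measure lborel ({2..X} - A) / X) \<longlongrightarrow> 1 - 0) at_top"
 proof (rule tendsto_diff)
  show "((\<lambda>X::real. (X - 2) / X) \<longlongrightarrow> 1) at_top" by real_asymp
  show "((\<lambda>X. measure lborel ({2..X} - A) / X) \<longlongrightarrow> 0) at_top"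
   by (rule tendsto_sandwich[OF _ le tendsto_const B]) (use eventually_ge_at_top[of 0] in eventually_elim, simp)
 qed
 ultimately show "((\<lambda>X. measure lborel (A \<inter> {2..X}) / X) \<longlongrightarrow> 1) at_top"
  by (simp add: tendsto_cong)
qed (use assms(1) in simp)

lemma has_log_density_oneI:
 assumes A[measurable]: "A \<in> sets borel" and B: "(B \<longlongrightarrow> 0) at_top" 
  and le: "\<forall>\<^sub>F X in at_top. 0 \<le> B X \<and> (\<integral>\<^sup>+x. ennreal (indicator ({2..X} - A) x / x) \<partial>lborel) \<le> ennreal (B X * ln X)"
 shows "has_log_density A 1"
 unfolding has_log_density_def
proof
 define J where "J S = (\<integral>u. indicator S u / u \<partial>lborel)" for S :: "real set"
 have int: "integrable lborel (\<lambda>u. indicator S u / u :: real)" if [measurable]: "S \<in> sets borel" and "S \<subseteq> {2..X}" for S X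
 proof (rule Bochner_Integration.integrable_bound)
  show "integrable lborel (indicator {2..X} :: real \<Rightarrow> real)" by (simp add: integrable_indicator_iff emeasure_lborel_Icc_eq)
  show "AE u in lborel. norm (indicator S u / u :: real) \<le> norm (indicator {2..X} u :: real)"
   using that(2) by (intro AE_I2) (auto simp: indicator_def divide_simps)
 qed measurable
 have nn: "ennreal (J S) = (\<integral>\<^sup>+u. ennreal (indicator S u / u) \<partial>lborel)" if "S \<in> sets borel" "S \<subseteq> {2..X}" for S X
  unfolding J_def
  by (rule nn_integral_eq_integral[symmetric, OF int[OF that]]) (use that(2) in \<open>auto intro!: AE_I2 simp: indicator_def\<close>)
 have J0: "J S \<ge> 0" if "S \<subseteq> {2..X}" for S X
  unfolding J_def by (rule Bochner_Integration.integral_nonneg) (use that in \<open>auto simp: indicator_def\<close>)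
 have full: "J {2..X} = ln X - ln 2" if X: "X \<ge> 2" for X
 proof -
  have "ennreal (J {2..X}) = (\<integral>\<^sup>+u\<in>{2..X}. ennreal (1 / u) \<partial>lborel)"
   unfolding nn[OF _ order_refl, simplified] by (intro nn_integral_cong) (auto simp: indicator_def)
  also have "\<dots> = ennreal (ln X - ln 2)"
   by (rule nn_integral_FTC_Icc) (use X in \<open>auto intro!: derivative_eq_intros\<close>)
  finally show ?thesis using J0[of "{2..X}" X] X by simp
 qed
 have "\<forall>\<^sub>F X in at_top. J (A \<inter> {2..X}) / ln X = (ln X - ln 2) / ln X - J ({2..X} - A) / ln X"
  using eventually_ge_at_top[of 2]
 proof eventually_elim
  case (elim X)
  have "J (A \<inter> {2..X}) + J ({2..X} - A) = (\<integral>u. indicator (A \<inter> {2..X}) u / u + indicator ({2..X} - A) u / u \<partial>lborel)"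
   unfolding J_def by (rule Bochner_Integration.integral_add[symmetric]) (rule int[of _ X], auto)+
  also have "\<dots> = J {2..X}" unfolding J_def by (rule Bochner_Integration.integral_cong) (auto simp: indicator_def)
  finally show ?case using full[OF elim] by (simp add: diff_divide_distrib[symmetric])
 qed
 moreover have "((\<lambda>X. (ln X - ln 2) / ln X - J ({2..X} - A) / ln X) \<longlongrightarrow> 1 - 0) at_top"
 proof (rule tendsto_diff)
  show "((\<lambda>X::real. (ln X - ln 2) / ln X) \<longlongrightarrow> 1) at_top" by real_asymp
  have "\<forall>\<^sub>F X in at_top. J ({2..X} - A) / ln X \<le> B X"
   using le eventually_ge_at_top[of 2]
  proof eventually_elim
   case (elim X)
   have "ennreal (J ({2..X} - A)) \<le> ennreal (B X * ln X)" using elim nn[of "{2..X} - A" X] by auto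
   then have "J ({2..X} - A) \<le> B X * ln X" using elim by (simp add: ennreal_le_iff)
   then show ?case using elim by (simp add: pos_divide_le_eq)
  qed
  note upper = this
  have lower: "\<forall>\<^sub>F X in at_top. 0 \<le> J ({2..X} - A) / ln X"
   using eventually_ge_at_top[of 2] by eventually_elim (auto intro!: divide_nonneg_nonneg J0)
  show "((\<lambda>X. J ({2..X} - A) / ln X) \<longlongrightarrow> 0) at_top"
   by (rule tendsto_sandwich[OF lower upper tendsto_const B])
 qed
 ultimately show "((\<lambda>X. (\<integral>u. indicator (A \<inter> {2..X}) u / u \<partial>lborel) / ln X) \<longlongrightarrow> 1) at_top"
  unfolding J_def by (simp add: tendsto_cong)
qed (use assms(1) in simp)

text \<open>Without a common point beyond \<open>X0\<close> the measures of the two sets in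
  \<open>{2..X}\<close> would add up to at most \<open>X\<close> plus a constant, whereas the
  densities require about \<open>2 * X\<close>.\<close>

lemma natural_density_one_common_point:
 assumes "has_natural_density A 1" "has_natural_density B 1"
 shows "\<exists>x\<ge>X0. x \<in> A \<and> x \<in> B"
proof (rule ccontr)
 assume none: "\<not> (\<exists>x\<ge>X0. x \<in> A \<and> x \<in> B)"
 define X1 where "X1 = max X0 2"
 have [measurable]: "A \<in> sets borel" "B \<in> sets borel" using assms by (auto simp: has_natural_density_def)
 have lim: "((\<lambda>X. measure lborel (A \<inter> {2..X}) / X + measure lborel (B \<inter> {2..X}) / X) \<longlongrightarrow> 1 + 1) at_top"
  using assms by (intro tendsto_add) (auto simp: has_natural_density_def)
 have "\<forall>\<^sub>F X in at_top. measure lborel (A \<inter> {2..X}) / X + measure lborel (B \<inter> {2..X}) / X \<le> (X + X1) / X"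
  using eventually_ge_at_top[of 2]
 proof eventually_elim
  case (elim X)
  have fm: "S \<inter> {2..X} \<in> fmeasurable lborel" if "S \<in> sets borel" for S
   by (rule fmeasurableI2[of "{2..X}"]) (use that in \<open>auto simp: fmeasurable_def emeasure_lborel_Icc_eq\<close>)
  have "measure lborel (A \<inter> {2..X} \<union> B \<inter> {2..X}) = measure lborel (A \<inter> {2..X}) + measure lborel (B \<inter> {2..X}) - measure lborel ((A \<inter> {2..X}) \<inter> (B \<inter> {2..X}))"
   by (rule measure_Un3) (use fm in auto)
  moreover have fX: "{2..b} \<in> fmeasurable lborel" for b :: real
   by (simp add: fmeasurable_def emeasure_lborel_Icc_eq)
  have "measure lborel (A \<inter> {2..X} \<union> B \<inter> {2..X}) \<le> measure lborel {2..X}"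
   by (rule measure_mono_fmeasurable[OF _ _ fX]) auto
  moreover have "measure lborel ((A \<inter> {2..X}) \<inter> (B \<inter> {2..X})) \<le> measure lborel {2..X1}"
   by (rule measure_mono_fmeasurable[OF _ _ fX]) (use none in \<open>auto simp: X1_def not_le le_max_iff_disj intro: less_imp_le\<close>)
  ultimately have "measure lborel (A \<inter> {2..X}) + measure lborel (B \<inter> {2..X}) \<le> X + X1"
   using elim by (simp add: X1_def)
  then show ?case using elim by (simp add: add_divide_distrib[symmetric] divide_right_mono)
 qed
 moreover have "((\<lambda>X. (X + X1) / X) \<longlongrightarrow> 1) at_top" by real_asymp
 ultimately have "(1 + 1 :: real) \<le> 1" by (intro tendsto_le[OF _ _ lim]) auto
 then show False by simp
qed

text \<open>With \<open>y = ln x\<close> the deviation times \<open>y\<close> is at most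
  \<open>norm (E y) + K * ln y\<close>. For natural density the mean square at scale 1 is
  \<open>O((ln Y)^2)\<close>, so that the set where \<open>norm (E y)\<close> exceeds
  \<open>(ln y)^2\<close> is negligible; an exponent above 3 dominates this threshold together with
  \<open>K * ln y\<close>. For logarithmic density the mean square over \<open>{0..Y}\<close> is
  \<open>O(Y)\<close>, the threshold \<open>ln y\<close> is enough, and \<open>K + 1\<close>
  results.\<close>

lemma mean_square_expansion_densities:
 fixes g :: "real \<Rightarrow> complex"
 assumes [measurable]: "g \<in> borel_measurable borel" and "mean_square_expansion (\<lambda>y. g (exp y)) a"
 shows "\<exists>C. (\<forall>\<epsilon>>0. has_natural_density {x. x \<ge> 2 \<and> cmod (g x + a * of_real (ln (ln x)) - C) \<le> (ln (ln x)) powr (3 + \<epsilon>) / ln x} 1)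
  \<and> (\<exists>K>1. has_log_density {x. x \<ge> 2 \<and> cmod (g x + a * of_real (ln (ln x)) - C) \<le> K * ln (ln x) / ln x} 1)"
proof -
 obtain c K E where K: "K > 0" and Em[measurable]: "E \<in> borel_measurable borel"
  and ex: "\<And>y. y \<ge> 2 \<Longrightarrow> norm (g (exp y) + a * of_real (ln y) - c - E y / of_real y) \<le> K * (ln y / y)"
  and ms: "\<And>Y. Y \<ge> 2 \<Longrightarrow> mean_square (\<lambda>y. exp (y - Y)) E Y \<le> ennreal (K * (ln Y)^2)"
   "\<And>Y. Y \<ge> 2 \<Longrightarrow> mean_square (\<lambda>_. 1) E Y \<le> ennreal (K * Y)"
  using assms(2) unfolding mean_square_expansion_def by blast
 define D where "D x = cmod (g x + a * of_real (ln (ln x)) - c)" for x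
 have Dm[measurable]: "D \<in> borel_measurable borel" unfolding D_def by measurable
 have D: "D x * ln x \<le> norm (E (ln x)) + K * ln (ln x)" if "x > 0" "ln x \<ge> 2" for x
 proof -
  define y where "y = ln x"
  have y: "y \<ge> 2" "x = exp y" using that by (auto simp: y_def)
  have "D x \<le> norm (g (exp y) + a * of_real (ln y) - c - E y / of_real y) + norm (E y / of_real y)"
   unfolding D_def y_def[symmetric] y(2)[symmetric] using norm_triangle_sub[of "g x + a * of_real (ln y) - c" "E y / of_real y"] by simp
  also have "\<dots> \<le> K * (ln y / y) + norm (E y) / y" using ex[OF y(1)] y(1) by (simp add: norm_divide)
  finally have "D x * y \<le> (K * (ln y / y) + norm (E y) / y) * y" using y by (intro mult_right_mono) auto
  then show ?thesis using y(1) unfolding y_def[symmetric] by (simp add: distrib_right)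
 qed
 have nat: "has_natural_density {x. x \<ge> 2 \<and> D x \<le> (ln (ln x)) powr (3 + \<epsilon>) / ln x} 1" if \<epsilon>: "\<epsilon> > 0" for \<epsilon>
 proof (rule has_natural_density_oneI)
  let ?A = "{x. x \<ge> 2 \<and> D x \<le> (ln (ln x)) powr (3 + \<epsilon>) / ln x}"
  show Am[measurable]: "?A \<in> sets borel" by measurable
  \<comment> \<open>Points below \<open>sqrt X\<close> are discarded; beyond them
    \<open>y \<ge> ln X / 2\<close>, where the threshold is evaluated.\<close>
  show "((\<lambda>X. (sqrt X + X * (K * (ln (ln X))^2) / ((ln (ln X / 2))^2)^2) / X) \<longlongrightarrow> 0) at_top" by real_asymp
  have "\<forall>\<^sub>F y in at_top. ln y ^ 3 > K * ln y + (ln y)^2 \<and> ln y > 1" by (intro eventually_conj; real_asymp)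
  then obtain y0 where y0: "\<And>y. y \<ge> y0 \<Longrightarrow> ln y ^ 3 > K * ln y + (ln y)^2 \<and> ln y > 1"
   unfolding eventually_at_top_linorder by blast
  have "\<forall>\<^sub>F X::real in at_top. ln X \<ge> 2 * y0 \<and> ln X \<ge> 4 \<and> X \<ge> 2" by (intro eventually_conj; real_asymp)
  then show "\<forall>\<^sub>F X in at_top. measure lborel ({2..X} - ?A) / X \<le> (sqrt X + X * (K * (ln (ln X))^2) / ((ln (ln X / 2))^2)^2) / X"
  proof eventually_elim
   case (elim X)
   have l2: "ln (ln X / 2) > 0" using elim by simp
   have "(\<integral>\<^sup>+x\<in>{2..X} - ?A. ennreal 1 \<partial>lborel) \<le> ennreal (sqrt X + X * (K * (ln (ln X))^2) / ((ln (ln X / 2))^2)^2)"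
   proof (rule deviation_bound[OF Em])
    have "1 * exp y * (norm (E y))^2 = X * (exp (y - ln X) * (norm (E y))^2)" for y
     using elim by (simp add: exp_diff)
    then have "ennreal (1 * exp y * (norm (E y))^2) = ennreal X * ennreal (exp (y - ln X) * (norm (E y))^2)" for y
     using elim by (simp only:) (rule ennreal_mult, auto)
    then have "mean_square (\<lambda>y. 1 * exp y) E (ln X) = ennreal X * mean_square (\<lambda>y. exp (y - ln X)) E (ln X)"
     by (simp only: mult.assoc) (rule nn_integral_cmult, measurable)
    also have "\<dots> \<le> ennreal X * ennreal (K * (ln (ln X))^2)" by (intro mult_left_mono ms(1)) (use elim in auto)
    also have "\<dots> = ennreal (X * (K * (ln (ln X))^2))" by (rule ennreal_mult[symmetric]) (use elim K in auto)
    finally show "mean_square (\<lambda>y. 1 * exp y) E (ln X) \<le> ennreal (X * (K * (ln (ln X))^2))" .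
    show "(\<integral>\<^sup>+x\<in>{1..sqrt X}. ennreal 1 \<partial>lborel) \<le> ennreal (sqrt X)"
     using elim by (auto simp: emeasure_lborel_Icc_eq intro!: ennreal_leI)
    fix x assume x: "x \<in> {2..X} - ?A"
    have "(ln (ln X / 2))^2 \<le> norm (E (ln x))" if sx: "sqrt X \<le> x"
    proof -
     define y where "y = ln x"
     have "ln (sqrt X) \<le> ln x" using sx elim x by (subst ln_le_cancel_iff) auto
     then have yX: "ln X / 2 \<le> y" using elim by (simp add: y_def ln_sqrt)
     then have y: "y \<ge> 2" "y \<ge> y0" using elim by auto
     have ly: "ln y ^ 3 > K * ln y + (ln y)^2" "ln y > 1" using y0[OF y(2)] by auto
     have "ln y ^ 3 = ln y powr 3" using ly(2) by (simp add: powr_numeral)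
     also have "\<dots> \<le> ln y powr (3 + \<epsilon>)" using ly(2) \<epsilon> by (intro powr_mono) auto
     also have "\<dots> < D x * y" using x y unfolding y_def by (auto simp: divide_less_eq not_le pos_divide_less_eq)
     also have "\<dots> \<le> norm (E y) + K * ln y" using D[of x] x y unfolding y_def by auto
     finally have "(ln y)^2 \<le> norm (E y)" using ly(1) by linarith
     moreover have "(ln (ln X / 2))^2 \<le> (ln y)^2" using l2 yX elim by (intro power_mono ln_mono) auto
     ultimately show ?thesis unfolding y_def by linarith
    qed
    then show "1 \<le> x \<and> x \<le> X \<and> (x \<le> sqrt X \<or> (ln (ln X / 2))^2 \<le> norm (E (ln x)))" using x by force
   qed (use elim K l2 in auto)
   then have "measure lborel ({2..X} - ?A) \<le> sqrt X + X * (K * (ln (ln X))^2) / ((ln (ln X / 2))^2)^2"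
    unfolding measure_def by (intro enn2real_leI) (use elim K in auto)
   then show ?case using elim by (intro divide_right_mono) auto
  qed
 qed
 have "has_log_density {x. x \<ge> 2 \<and> D x \<le> (K + 1) * ln (ln x) / ln x} 1"
 proof (rule has_log_density_oneI)
  let ?A = "{x. x \<ge> 2 \<and> D x \<le> (K + 1) * ln (ln x) / ln x}"
  \<comment> \<open>Discarding \<open>x \<le> exp (sqrt (ln X))\<close> costs
    \<open>sqrt (ln X)\<close> in logarithmic measure; beyond this point
    \<open>ln y \<ge> ln (sqrt (ln X))\<close>, which tends to infinity.\<close>
  let ?B = "\<lambda>X. (sqrt (ln X) + K * ln X / (ln (sqrt (ln X)))^2) / ln X"
  show Am[measurable]: "?A \<in> sets borel" by measurable
  show "(?B \<longlongrightarrow> 0) at_top" by real_asymp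
  have "\<forall>\<^sub>F X::real in at_top. sqrt (ln X) \<ge> 2 \<and> ln X \<ge> 4 \<and> X \<ge> 2" by (intro eventually_conj; real_asymp)
  then show "\<forall>\<^sub>F X in at_top. 0 \<le> ?B X \<and> (\<integral>\<^sup>+x. ennreal (indicator ({2..X} - ?A) x / x) \<partial>lborel) \<le> ennreal (?B X * ln X)"
  proof eventually_elim
   case (elim X)
   have l2: "ln (sqrt (ln X)) > 0" using elim by simp
   have inv: "(\<integral>\<^sup>+x\<in>{1..exp (sqrt (ln X))}. ennreal (inverse x) \<partial>lborel) = ennreal (sqrt (ln X))"
    by (subst exp_substitution) (use elim in \<open>auto simp: emeasure_lborel_Icc_eq\<close>)
   have "(\<integral>\<^sup>+x. ennreal (indicator ({2..X} - ?A) x / x) \<partial>lborel) = (\<integral>\<^sup>+x\<in>{2..X} - ?A. ennreal (inverse x) \<partial>lborel)"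
    by (intro nn_integral_cong) (auto simp: indicator_def inverse_eq_divide)
   also have "\<dots> \<le> ennreal (sqrt (ln X) + K * ln X / (ln (sqrt (ln X)))^2)"
   proof (rule deviation_bound[OF Em _ _ l2])
    show "mean_square (\<lambda>y. inverse (exp y) * exp y) E (ln X) \<le> ennreal (K * ln X)" using ms(2)[of "ln X"] elim by simp
    fix x assume x: "x \<in> {2..X} - ?A"
    have "ln (sqrt (ln X)) \<le> norm (E (ln x))" if sx: "sqrt (ln X) \<le> ln x"
    proof -
     define y where "y = ln x"
     have y: "y \<ge> 2" using sx elim by (simp add: y_def)
     have "(K + 1) * ln y < D x * y" using x y unfolding y_def by (auto simp: not_le pos_divide_less_eq)
     also have "\<dots> \<le> norm (E y) + K * ln y" using D[of x] x y unfolding y_def by auto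
     finally have "ln y \<le> norm (E y)" by (simp add: distrib_right)
     moreover have "ln (sqrt (ln X)) \<le> ln y" using sx elim unfolding y_def by (intro ln_mono) auto
     ultimately show ?thesis unfolding y_def by linarith
    qed
    moreover have "x \<le> exp (sqrt (ln X)) \<or> sqrt (ln X) \<le> ln x" using x by (auto simp: ln_ge_iff)
    ultimately show "1 \<le> x \<and> x \<le> X \<and> (x \<le> exp (sqrt (ln X)) \<or> ln (sqrt (ln X)) \<le> norm (E (ln x)))" using x by auto
   qed (use elim K inv in auto)
   finally have "(\<integral>\<^sup>+x. ennreal (indicator ({2..X} - ?A) x / x) \<partial>lborel) \<le> ennreal (sqrt (ln X) + K * ln X / (ln (sqrt (ln X)))^2)" .
   moreover have "sqrt (ln X) + K * ln X / (ln (sqrt (ln X)))^2 = ?B X * ln X" using elim by simp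
   moreover have "0 \<le> ?B X" using elim K by (intro divide_nonneg_nonneg add_nonneg_nonneg mult_nonneg_nonneg) auto
   ultimately show ?case by (simp only:)
  qed
 qed
 moreover have "K + 1 > 1" using K by simp
 ultimately show ?thesis using nat unfolding D_def by blast
qed

text \<open>The sum depends on the integer part of \<open>x\<close> only, so it factors through a
  discrete space.\<close>

lemma pi_half_measurable [measurable]: "pi_half q t \<in> borel_measurable borel"
proof -
 have "real p \<le> x \<longleftrightarrow> p \<le> nat \<lfloor>x\<rfloor>" if "prime p" for p and x :: real
 proof -
  have "p > 0" using that by (rule prime_gt_0_nat)
  then have "p \<le> nat \<lfloor>x\<rfloor> \<longleftrightarrow> int p \<le> \<lfloor>x\<rfloor>" by linarith
  then show ?thesis by (simp add: le_floor_iff)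
 qed
 then have "pi_half q t = (\<lambda>x. (\<Sum>p\<in>{p. prime p \<and> p \<le> nat \<lfloor>x\<rfloor> \<and> \<not> p dvd q}. t (p mod q) / of_real (sqrt (real p))))"
  unfolding pi_half_def by (intro ext sum.cong) auto
 moreover have "(\<lambda>x::real. (\<Sum>p\<in>{p. prime p \<and> p \<le> nat \<lfloor>x\<rfloor> \<and> \<not> p dvd q}. t (p mod q) / of_real (sqrt (real p)))) \<in> borel_measurable borel"
  by (rule measurable_compose[where N = "count_space UNIV" and f = "\<lambda>x. nat \<lfloor>x\<rfloor>" and g = "\<lambda>n. \<Sum>p\<in>{p. prime p \<and> p \<le> n \<and> \<not> p dvd q}. t (p mod q) / of_real (sqrt (real p))"]) measurable
 ultimately show ?thesis by simp
qed

text \<open>Two sets of density 1 meet at arbitrarily large \<open>x\<close>, and there the two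
  bounds bring \<open>C\<close> and \<open>C'\<close> arbitrarily close. The exponent 4 is
  \<open>3 + \<epsilon>\<close> at \<open>\<epsilon> = 1\<close>.\<close>

lemma natural_density_constant_unique:
 fixes f :: "real \<Rightarrow> complex"
 assumes "has_natural_density {x. x \<ge> 2 \<and> cmod (f x - C) \<le> (ln (ln x)) powr 4 / ln x} 1"
  "has_natural_density {x. x \<ge> 2 \<and> cmod (f x - C') \<le> (ln (ln x)) powr 4 / ln x} 1"
 shows "C' = C"
proof (rule ccontr)
 assume "C' \<noteq> C"
 then have "cmod (C' - C) > 0" by simp
 moreover have "((\<lambda>x::real. 2 * ((ln (ln x)) powr 4 / ln x)) \<longlongrightarrow> 0) at_top" by real_asymp
 ultimately have "\<forall>\<^sub>F x in at_top. 2 * ((ln (ln x)) powr 4 / ln x) < cmod (C' - C)" by (intro order_tendstoD(2))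
 then obtain X0 where X0: "\<And>x. x \<ge> X0 \<Longrightarrow> 2 * ((ln (ln x)) powr 4 / ln x) < cmod (C' - C)"
  unfolding eventually_at_top_linorder by blast
 obtain x where x: "x \<ge> X0" "cmod (f x - C) \<le> (ln (ln x)) powr 4 / ln x" "cmod (f x - C') \<le> (ln (ln x)) powr 4 / ln x"
  using natural_density_one_common_point[OF assms, of X0] by auto
 have "cmod (C' - C) \<le> cmod (f x - C) + cmod (f x - C')"
  using norm_triangle_ineq4[of "f x - C" "f x - C'"] by simp
 then show False using X0[OF x(1)] x(2,3) by linarith
qed

theorem theorem3p1:
  fixes q :: nat and t :: "nat \<Rightarrow> complex"
  assumes "q \<ge> 3"
    and "\<exists>a\<in>units_mod q. t a \<noteq> 0"
    and "char_inner q t (principal_char q) = 0"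
    and "\<And>chi. dirichlet_char q chi \<Longrightarrow> char_inner q t chi \<noteq> 0 \<Longrightarrow> GRH_for chi"
  shows "\<exists>C::complex.
    (\<forall>\<epsilon>>0. has_natural_density
       {x. x \<ge> 2 \<and> cmod (pi_half q t x + M_const q t * of_real (ln (ln x)) - C)
                      \<le> (ln (ln x)) powr (3 + \<epsilon>) / ln x} 1)
    \<and> (\<forall>C'::complex. (\<forall>\<epsilon>>0. has_natural_density
       {x. x \<ge> 2 \<and> cmod (pi_half q t x + M_const q t * of_real (ln (ln x)) - C')
                      \<le> (ln (ln x)) powr (3 + \<epsilon>) / ln x} 1) \<longrightarrow> C' = C)
    \<and> (\<exists>K>1. has_log_density
       {x. x \<ge> 2 \<and> cmod (pi_half q t x + M_const q t * of_real (ln (ln x)) - C)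
                      \<le> K * ln (ln x) / ln x} 1)"
proof -
  have q: "q > 1" using assms(1) by simp
  obtain C K where C: "\<And>\<epsilon>. \<epsilon> > 0 \<Longrightarrow> has_natural_density {x. x \<ge> 2 \<and> cmod (pi_half q t x + M_const q t * of_real (ln (ln x)) - C)
      \<le> (ln (ln x)) powr (3 + \<epsilon>) / ln x} 1"
    and K: "K > 1" "has_log_density {x. x \<ge> 2 \<and> cmod (pi_half q t x + M_const q t * of_real (ln (ln x)) - C)
      \<le> K * ln (ln x) / ln x} 1"
    using mean_square_expansion_densities[OF pi_half_measurable mean_square_expansion_pi_half[OF q assms(3,4)]] by blast
  show ?thesis
  proof (intro exI[of _ C] conjI allI impI)
    fix C' assume C': "\<forall>\<epsilon>>0. has_natural_density {x. x \<ge> 2 \<and> cmod (pi_half q t x + M_const q t * of_real (ln (ln x)) - C')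
      \<le> (ln (ln x)) powr (3 + \<epsilon>) / ln x} 1"
    show "C' = C"
      by (rule natural_density_constant_unique[of "\<lambda>x. pi_half q t x + M_const q t * of_real (ln (ln x))"])
        (use C[of 1] C'[rule_format, of 1] in simp_all)
  next
    show "\<exists>K>1. has_log_density {x. x \<ge> 2 \<and> cmod (pi_half q t x + M_const q t * of_real (ln (ln x)) - C)
      \<le> K * ln (ln x) / ln x} 1"
      using K by blast
  qed (rule C)
qed

end
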